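(* Let $\boldsymbol{\varepsilon}=(\epsilon_1^+,\epsilon_2^+,\epsilon_3^+,\epsilon_1^-,\epsilon_2^-,\epsilon_3^-)\in\{\pm1\}^6$ with $\prod_{\sigma=\pm}\prod_{i=1}^3\epsilon_i^\sigma=1$ and let $M$ be a nonnegative integer such that the boundary parameters satisfy $$\sum_{\sigma=\pm}\sum_{i=1}^3\epsilon_i^\sigma\alpha_i^\sigma=(N-2M-1)\eta .$$ Let $\{q_1,\dots,q_M\}$, with $2q_j\neq 0$ and $q_j\neq\pm q_k$ modulo $(\pi,\pi\omega)$ for $j\ne k$, be a solution of the Bethe equations $$\mathbf{A}_{\boldsymbol{\varepsilon}}(q_j)\,Q(q_j-\eta)+\mathbf{A}_{\boldsymbol{\varepsilon}}(-q_j)\,Q(q_j+\eta)=0,\qquad 1\le j\le M,\qquad Q(\lambda)=\prod_{n=1}^M\theta_{\mathrm s}(\lambda,q_n),$$ implying that $Q$ is a solution of the homogeneous $TQ$-equation $\tau_Q(\lambda)Q(\lambda)=\mathbf{A}_{\boldsymbol{\varepsilon}}(\lambda)Q(\lambda-\eta)+\mathbf{A}_{\boldsymbol{\varepsilon}}(-\lambda)Q(\lambda+\eta)$ with $\tau_Q$ entire, and that the associated separate states $|Q\rangle_{\boldsymbol{\varepsilon}}$ and ${}_{\boldsymbol{\varepsilon}}\langle Q|$ are right and left eigenstates of the transfer matrix $\mathcal T(\lambda)$ with eigenvalue $\tau_Q(\lambda)$. Let $\{p_1,\dots,p_M\}$ be arbitrary complex parameters and let $P(\lambda)=\prod_{j=1}^M\theta_{\mathrm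 s}(\lambda,p_j)$, with associated separate states ${}_{\boldsymbol{\varepsilon}}\langle P|$ and $|P\rangle_{\boldsymbol{\varepsilon}}$. Then $$\frac{{}_{\boldsymbol{\varepsilon}}\langle P|Q\rangle_{\boldsymbol{\varepsilon}}}{{}_{\boldsymbol{\varepsilon}}\langle Q|Q\rangle_{\boldsymbol{\varepsilon}}}=\frac{{}_{\boldsymbol{\varepsilon}}\langle Q|P\rangle_{\boldsymbol{\varepsilon}}}{{}_{\boldsymbol{\varepsilon}}\langle Q|Q\rangle_{\boldsymbol{\varepsilon}}}=\frac{V(q_1,\dots,q_M)}{V(p_1,\dots,p_M)}\prod_{j=1}^M\frac{\theta_{\mathrm s}(2q_j,\eta)}{\theta_{\mathrm s}(2p_j,\eta)}\;\frac{\det_M[\mathcal S_Q(\mathbf p,\mathbf q)]}{\det_M[\mathcal S_Q(\mathbf q,\mathbf q)]},$$ where the $M\times M$ matrix $\mathcal S_Q(\mathbf p,\mathbf q)$, $\mathbf p=(p_1,\dots,p_M)$, $\mathbf q=(q_1,\dots,q_M)$, has elements $$[\mathcal S_Q(\mathbf p,\mathbf q)]_{i,j}=Q(p_i)\frac{\partial\tau_Q(p_i)}{\partial q_j} =\mathbf{A}_{\boldsymbol{\varepsilon}}(p_i)Q(p_i-\eta)\big[t(p_i+q_j-\tfrac\eta2)-t(p_i-q_j-\tfrac\eta2)\big]-\mathbf{A}_{\boldsymbol{\varepsilon}}(-p_i)Q(p_i+\eta)\big[t(p_i+q_j+\tfrac\eta2)-t(p_i-q_j+\tfrac\eta2)\big],$$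 with $t(\lambda)=\frac{\theta'(\lambda-\eta/2)}{\theta(\lambda-\eta/2)}-\frac{\theta'(\lambda+\eta/2)}{\theta(\lambda+\eta/2)}$. In the limit $p_i\to q_i$, $1\le i\le M$, the matrix elements become $$[\mathcal S_Q(\mathbf q,\mathbf q)]_{i,j}=\mathbf{A}_{\boldsymbol{\varepsilon}}(-q_i)Q(q_i+\eta)\bigg[-\delta_{i,j}\frac{\partial}{\partial\mu}\Big(\log\frac{\mathbf{A}_{\boldsymbol{\varepsilon}}(\mu)Q(\mu-\eta)}{\mathbf{A}_{\boldsymbol{\varepsilon}}(-\mu)Q(\mu+\eta)}\Big)_{\mu=q_i}+\mathsf K(q_i-q_j)-\mathsf K(q_i+q_j)\bigg],$$ with $\mathsf K(\lambda)=t(\lambda+\tfrac\eta2)+t(\lambda-\tfrac\eta2)=\frac{\theta'(\lambda-\eta)}{\theta(\lambda-\eta)}-\frac{\theta'(\lambda+\eta)}{\theta(\lambda+\eta)}$.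
   Context: **Theta functions.** Fix $\omega$ with $\Im\omega>0$. For $\tau\in\{\omega,2\omega\}$ and $q=e^{i\pi\tau}$, with $q^{s}:=e^{i\pi\tau s}$: $\theta_1(\lambda|\tau)=2\sum_{n\ge0}(-1)^nq^{(n+1/2)^2}\sin((2n+1)\lambda)$, $\theta_2(\lambda|\tau)=2\sum_{n\ge0}q^{(n+1/2)^2}\cos((2n+1)\lambda)$, $\theta_3(\lambda|\tau)=1+2\sum_{n\ge1}q^{n^2}\cos(2n\lambda)$, $\theta_4(\lambda|\tau)=1+2\sum_{n\ge1}(-1)^nq^{n^2}\cos(2n\lambda)$. Write $\theta_j(\lambda)=\theta_j(\lambda|\omega)$, $\vartheta_j(\lambda)=\theta_j(\lambda|2\omega)$, $\theta=\theta_1$ and $\theta_{\mathrm s}(\lambda,\mu)=\theta(\lambda-\mu)\theta(\lambda+\mu)$. "Modulo $(\pi,\pi\omega)$" means modulo $\mathbb Z\pi+\mathbb Z\pi\omega$. The crossing parameter $\eta\in\mathbb C$ is generic: $n\eta\notin\mathbb Z\pi+\mathbb Z\pi\omega$ for every nonzero integer $n$. $V(\zeta_1,\dots,\zeta_n)=\prod_{1\le i<j\le n}\theta_{\mathrm s}(\zeta_j,\zeta_i)$. **Model.** The R-matrix on $\mathbb C^2\otimes\mathbb C^2$ (in the ordered standard basis) is $$R(\lambda)=\begin{pmatrix}\mathrm a&0&0&\mathrm d\\0&\mathrm b&\mathrm c&0\\0&\mathrm c&\mathrm b&0\\\mathrm d&0&0&\mathrm a\end{pmatrix}(\lambda),$$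 with $\mathrm a(\lambda)=\frac{2\vartheta_4(\eta)\vartheta_1(\lambda+\eta)\vartheta_4(\lambda)}{\theta_2(0)\vartheta_4(0)}$, $\mathrm b(\lambda)=\frac{2\vartheta_4(\eta)\vartheta_1(\lambda)\vartheta_4(\lambda+\eta)}{\theta_2(0)\vartheta_4(0)}$, $\mathrm c(\lambda)=\frac{2\vartheta_1(\eta)\vartheta_4(\lambda)\vartheta_4(\lambda+\eta)}{\theta_2(0)\vartheta_4(0)}$, $\mathrm d(\lambda)=\frac{2\vartheta_1(\eta)\vartheta_1(\lambda+\eta)\vartheta_1(\lambda)}{\theta_2(0)\vartheta_4(0)}$. The boundary matrix is $$K(\lambda;\alpha_1,\alpha_2,\alpha_3)=\frac{\theta_1(2\lambda)}{2\theta_1(\lambda)}\Big[\mathbb I+c^x\frac{\theta_1(\lambda)}{\theta_4(\lambda)}\sigma^x+ic^y\frac{\theta_1(\lambda)}{\theta_3(\lambda)}\sigma^y+c^z\frac{\theta_1(\lambda)}{\theta_2(\lambda)}\sigma^z\Big],$$ $c^x=\prod_{\ell=1}^3\frac{\theta_4(\alpha_\ell)}{\theta_1(\alpha_\ell)}$, $c^y=-\prod_{\ell=1}^3\frac{\theta_3(\alpha_\ell)}{\theta_1(\alpha_\ell)}$, $c^z=\prod_{\ell=1}^3\frac{\theta_2(\alpha_\ell)}{\theta_1(\alpha_\ell)}$. With six boundary parameters $\alpha_i^\pm$ ($i=1,2,3$), $K_-(\lambda)=K(\lambda-\eta/2;\alpha_1^-,\alpha_2^-,\alpha_3^-)$ and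 $K_+(\lambda)=K(\lambda+\eta/2;\alpha_1^+,\alpha_2^+,\alpha_3^+)$. With inhomogeneities $\xi_1,\dots,\xi_N\in\mathbb C$, on $\mathcal H_0\otimes\mathcal H$, $\mathcal H_0=\mathbb C^2$, $\mathcal H=(\mathbb C^2)^{\otimes N}$: $T(\lambda)=R_{01}(\lambda-\xi_1-\eta/2)\cdots R_{0N}(\lambda-\xi_N-\eta/2)$, $\hat T(\lambda)=R_{0N}(\lambda+\xi_N-\eta/2)\cdots R_{01}(\lambda+\xi_1-\eta/2)$. The transfer matrix $\mathcal T(\lambda)=\mathrm{tr}_0[K_+(\lambda)T(\lambda)K_-(\lambda)\hat T(\lambda)]$ is a commuting family of operators on $\mathcal H$. **Notation.** $\xi_n^{(h)}=\xi_n+\eta/2-h\eta$ for $h\in\{0,1\}$, $1\le n\le N$; $\xi_0^{(0)}=\frac\eta2$, $\xi_{-1}^{(0)}=\frac\eta2+\frac\pi2$, $\xi_{-2}^{(0)}=\frac\eta2+\frac{\pi\omega}2$, $\xi_{-3}^{(0)}=\frac\eta2+\frac{\pi+\pi\omega}2$. $a(\lambda)=\prod_{n=1}^N\theta(\lambda-\xi_n+\eta/2)$, $d(\lambda)=a(\lambda-\eta)$. For $\boldsymbol\varepsilon\in\{\pm1\}^6$, $$\mathsf a_{\boldsymbol\varepsilon}(\lambda)=\prod_{\sigma=\pm}\prod_{i=1}^3\frac{\theta(\lambda-\frac\eta2-\epsilon_i^\sigma\alpha_i^\sigma)}{\theta(-\epsilon_i^\sigma\alpha_i^\sigma)},\qquad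 \mathbf A_{\boldsymbol\varepsilon}(\lambda)=(-1)^N\frac{\theta(2\lambda+\eta)}{\theta(2\lambda)}\mathsf a_{\boldsymbol\varepsilon}(\lambda)a(\lambda)d(-\lambda).$$ **Standing assumptions.** The inhomogeneities are generic; in particular the points $\epsilon\,\xi_n^{(h)}$ ($1\le n\le N$, $h\in\{0,1\}$, $\epsilon=\pm1$) and $\epsilon\,\xi_{-j}^{(0)}$ ($0\le j\le3$, $\epsilon=\pm1$) are pairwise distinct modulo $(\pi,\pi\omega)$, and all $\theta(\alpha_i^\sigma)$ and $\mathbf A_{\boldsymbol\varepsilon}(\frac\eta2-\xi_n)$ are nonzero. $K_+(\lambda)$ and $K_-(\lambda)$ are not both proportional to the identity. **SoV bases.** Fix a covector $\langle S|\in\mathcal H^*$ such that the covectors, $\mathbf h=(h_1,\dots,h_N)\in\{0,1\}^N$, $${}_{\boldsymbol\varepsilon}\langle\mathbf h|=\langle S|\prod_{n=1}^N\Big(\frac{\mathcal T(\xi_n-\frac\eta2)}{\mathbf A_{\boldsymbol\varepsilon}(\frac\eta2-\xi_n)}\Big)^{1-h_n}$$ form a basis of $\mathcal H^*$ (true for almost any $\langle S|$ and inhomogeneities). Fix a constant $\mathcal N_0\ne0$ and let $|R\rangle\in\mathcal H$ be the unique vector with ${}_{\boldsymbol\varepsilon}\langle\mathbf h|R\rangle=\delta_{\mathbf h,\mathbf 0}\,\mathcal N_0/[V(\xi_1^{(0)},\dots,\xi_N^{(0)})V(\xi_1,\dots,\xi_N)]$. Set $$|\mathbf h\rangle_{\boldsymbol\varepsilon}=\prod_{n=1}^N\Big(\frac{\theta(2\xi_n-2\eta)}{\theta(2\xi_n+2\eta)}\frac{\mathcal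 T(\xi_n+\frac\eta2)}{\mathbf A_{\boldsymbol\varepsilon}(\frac\eta2-\xi_n)}\Big)^{h_n}|R\rangle .$$ These form a basis of $\mathcal H$ and ${}_{\boldsymbol\varepsilon}\langle\mathbf h|\mathbf k\rangle_{\boldsymbol\varepsilon}=\delta_{\mathbf h,\mathbf k}\,\mathcal N_0/[V(\xi_1^{(h_1)},\dots,\xi_N^{(h_N)})V(\xi_1,\dots,\xi_N)]$. **Separate states.** For functions $P,Q$, $$|Q\rangle_{\boldsymbol\varepsilon}=\sum_{\mathbf h\in\{0,1\}^N}\prod_{n=1}^NQ(\xi_n^{(h_n)})\,V(\xi_1^{(h_1)},\dots,\xi_N^{(h_N)})\,|\mathbf h\rangle_{\boldsymbol\varepsilon},$$ $${}_{\boldsymbol\varepsilon}\langle P|=\frac1{\mathcal N_0}\sum_{\mathbf h\in\{0,1\}^N}\prod_{n=1}^N\Big[\Big(-\frac{\mathsf a_{\boldsymbol\varepsilon}(\frac\eta2+\xi_n)}{\mathsf a_{\boldsymbol\varepsilon}(\frac\eta2-\xi_n)}\Big)^{h_n}P(\xi_n^{(h_n)})\Big]V(\xi_1^{(1-h_1)},\dots,\xi_N^{(1-h_N)})\;{}_{\boldsymbol\varepsilon}\langle\mathbf h| ,$$ and ${}_{\boldsymbol\varepsilon}\langle P|Q\rangle_{\boldsymbol\varepsilon}$ is the pairing of these two vectors. **Conventions.** In $\partial\tau_Q(p_i)/\partial q_j$, $\tau_Q(\lambda)=[\mathbf A_{\boldsymbol\varepsilon}(\lambda)Q(\lambda-\eta)+\mathbf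 A_{\boldsymbol\varepsilon}(-\lambda)Q(\lambda+\eta)]/Q(\lambda)$ is regarded as a function of the independent variables $q_1,\dots,q_M$ with $\lambda=p_i$ fixed, and evaluated at the given Bethe roots. Expressions of the form $0/0$ at special values of the $p_j$ are understood by continuity.
   Formalization: Added: 2q_j ≠ ±η modulo (π, πω); at such roots the Bethe equation holds trivially and the eigenstate claim fails. Eigenvalue equations and matrix elements are stated off the 0/0 points and zeros of Q(λ), Q(λ±η); the ratio assumes nonzero ⟨Q|Q⟩ and det S_Q(q,q). *)

theory Defs
  imports
    "HOL-Complex_Analysis.Complex_Analysis"
    "Jordan_Normal_Form.Determinant"
    "Jordan_Normal_Form.VS_Connect"
begin

section \<open>Theta functions\<close>

definition qpow :: "complex \<Rightarrow> real \<Rightarrow> complex" where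
  "qpow \<tau> s = exp (\<i> * of_real pi * \<tau> * of_real s)"

definition theta1 :: "complex \<Rightarrow> complex \<Rightarrow> complex" where
  "theta1 \<tau> z = 2 * (\<Sum>n. (-1) ^ n * qpow \<tau> ((real n + 1/2)\<^sup>2) * sin (of_nat (2*n+1) * z))"

definition theta2 :: "complex \<Rightarrow> complex \<Rightarrow> complex" where
  "theta2 \<tau> z = 2 * (\<Sum>n. qpow \<tau> ((real n + 1/2)\<^sup>2) * cos (of_nat (2*n+1) * z))"

definition theta3 :: "complex \<Rightarrow> complex \<Rightarrow> complex" where
  "theta3 \<tau> z = 1 + 2 * (\<Sum>n. qpow \<tau> ((real (Suc n))\<^sup>2) * cos (of_nat (2 * Suc n) * z))"

definition theta4 :: "complex \<Rightarrow> complex \<Rightarrow> complex" where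
  "theta4 \<tau> z = 1 + 2 * (\<Sum>n. (-1) ^ Suc n * qpow \<tau> ((real (Suc n))\<^sup>2) * cos (of_nat (2 * Suc n) * z))"

text \<open>
  Data of the open chain. Sites are numbered \<open>1, \<dots>, len X\<close> and only \<open>inh X n\<close> with such \<open>n\<close>
  matters. \<open>bdry X True i\<close> and \<open>bdry X False i\<close>, for \<open>i = 1, 2, 3\<close>, are the boundary parameters
  \<open>\<alpha>\<^sub>i\<close> with upper index \<open>+\<close> and \<open>-\<close>; the same convention is used for the signs \<open>\<epsilon>\<close>.
\<close>

record xyz_chain =
  omega :: complex
  eta :: complex
  len :: nat
  inh :: "nat \<Rightarrow> complex"
  bdry :: "bool \<Rightarrow> nat \<Rightarrow> complex"

type_synonym signs = "bool \<Rightarrow> nat \<Rightarrow> int"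

definition theta :: "xyz_chain \<Rightarrow> complex \<Rightarrow> complex" where
  "theta X = theta1 (omega X)"

definition theta_s :: "xyz_chain \<Rightarrow> complex \<Rightarrow> complex \<Rightarrow> complex" where
  "theta_s X z w = theta X (z - w) * theta X (z + w)"

definition period_lattice :: "xyz_chain \<Rightarrow> complex set" where
  "period_lattice X = {of_int a * of_real pi + of_int b * (of_real pi * omega X) | a b. True}"

definition Vand :: "xyz_chain \<Rightarrow> nat \<Rightarrow> (nat \<Rightarrow> complex) \<Rightarrow> complex" where
  "Vand X n \<zeta> = (\<Prod>j\<in>{1..n}. \<Prod>i\<in>{1..<j}. theta_s X (\<zeta> j) (\<zeta> i))"


section \<open>The transfer matrix\<close>

definition R_mat :: "xyz_chain \<Rightarrow> complex \<Rightarrow> complex mat" where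
  "R_mat X z =
    (let \<eta> = eta X;
         v1 = theta1 (2 * omega X);
         v4 = theta4 (2 * omega X);
         D = theta2 (omega X) 0 * v4 0;
         a = 2 * v4 \<eta> * v1 (z + \<eta>) * v4 z / D;
         b = 2 * v4 \<eta> * v1 z * v4 (z + \<eta>) / D;
         c = 2 * v1 \<eta> * v4 z * v4 (z + \<eta>) / D;
         d = 2 * v1 \<eta> * v1 (z + \<eta>) * v1 z / D
     in mat_of_rows_list 4 [[a, 0, 0, d], [0, b, c, 0], [0, c, b, 0], [d, 0, 0, a]])"

definition sigma_x :: "complex mat" where
  "sigma_x = mat_of_rows_list 2 [[0, 1], [1, 0]]"

definition sigma_y :: "complex mat" where
  "sigma_y = mat_of_rows_list 2 [[0, -\<i>], [\<i>, 0]]"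

definition sigma_z :: "complex mat" where
  "sigma_z = mat_of_rows_list 2 [[1, 0], [0, -1]]"

text \<open>
  \<open>K_mat \<omega> \<alpha> z\<close> is given by the literal formula; it has its intended value when none of the four
  theta functions in the denominators vanishes at \<open>z\<close>, i.e. when \<open>2 * z\<close> is not in the lattice.
\<close>

definition K_mat :: "complex \<Rightarrow> (nat \<Rightarrow> complex) \<Rightarrow> complex \<Rightarrow> complex mat" where
  "K_mat \<omega> \<alpha> z =
    (let cx = (\<Prod>l\<in>{1..3}. theta4 \<omega> (\<alpha> l) / theta1 \<omega> (\<alpha> l));
         cy = - (\<Prod>l\<in>{1..3}. theta3 \<omega> (\<alpha> l) / theta1 \<omega> (\<alpha> l));
         cz = (\<Prod>l\<in>{1..3}. theta2 \<omega> (\<alpha> l) / theta1 \<omega> (\<alpha> l))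
     in (theta1 \<omega> (2 * z) / (2 * theta1 \<omega> z)) \<cdot>\<^sub>m
          (1\<^sub>m 2 + (cx * theta1 \<omega> z / theta4 \<omega> z) \<cdot>\<^sub>m sigma_x
                + (\<i> * cy * theta1 \<omega> z / theta3 \<omega> z) \<cdot>\<^sub>m sigma_y
                + (cz * theta1 \<omega> z / theta2 \<omega> z) \<cdot>\<^sub>m sigma_z))"

definition K_minus :: "xyz_chain \<Rightarrow> complex \<Rightarrow> complex mat" where
  "K_minus X z = K_mat (omega X) (bdry X False) (z - eta X / 2)"

definition K_plus :: "xyz_chain \<Rightarrow> complex \<Rightarrow> complex mat" where
  "K_plus X z = K_mat (omega X) (bdry X True) (z + eta X / 2)"

text \<open>
  Tensor products of copies of \<open>\<complex>\<^sup>2\<close> are coordinatised by binary expansions: in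
  \<open>\<H>\<^sub>0 \<otimes> \<H>\<close>, of dimension \<open>2 ^ Suc N\<close>, the basis vector number \<open>I\<close> has component \<open>digit I k\<close> in
  the space \<open>k \<in> {0..N}\<close>; in \<open>\<H>\<close>, of dimension \<open>2 ^ N\<close>, the component in the space \<open>k \<in> {1..N}\<close> of
  the basis vector number \<open>I\<close> is \<open>digit I (k - 1)\<close>. So \<open>2 * I + s\<close> is \<open>e\<^sub>s \<otimes> e\<^sub>I\<close>.
\<close>

definition digit :: "nat \<Rightarrow> nat \<Rightarrow> nat" where
  "digit I k = (I div 2 ^ k) mod 2"

definition on_aux_site :: "nat \<Rightarrow> nat \<Rightarrow> complex mat \<Rightarrow> complex mat" where
  "on_aux_site N n B = Matrix.mat (2 ^ Suc N) (2 ^ Suc N)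
     (\<lambda>(I, J). if \<forall>k\<in>{1..N} - {n}. digit I k = digit J k
               then B $$ (2 * digit I 0 + digit I n, 2 * digit J 0 + digit J n) else 0)"

definition on_aux :: "nat \<Rightarrow> complex mat \<Rightarrow> complex mat" where
  "on_aux N B = Matrix.mat (2 ^ Suc N) (2 ^ Suc N)
     (\<lambda>(I, J). if \<forall>k\<in>{1..N}. digit I k = digit J k then B $$ (digit I 0, digit J 0) else 0)"

definition tr_aux :: "nat \<Rightarrow> complex mat \<Rightarrow> complex mat" where
  "tr_aux N B = Matrix.mat (2 ^ N) (2 ^ N) (\<lambda>(i, j). \<Sum>s<2. B $$ (2 * i + s, 2 * j + s))"

definition mat_prod_list :: "nat \<Rightarrow> complex mat list \<Rightarrow> complex mat" where
  "mat_prod_list d Bs = foldr (*) Bs (1\<^sub>m d)"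

definition mono_T :: "xyz_chain \<Rightarrow> complex \<Rightarrow> complex mat" where
  "mono_T X z = mat_prod_list (2 ^ Suc (len X))
     (map (\<lambda>n. on_aux_site (len X) n (R_mat X (z - inh X n - eta X / 2))) [1..<Suc (len X)])"

definition mono_T_hat :: "xyz_chain \<Rightarrow> complex \<Rightarrow> complex mat" where
  "mono_T_hat X z = mat_prod_list (2 ^ Suc (len X))
     (map (\<lambda>n. on_aux_site (len X) n (R_mat X (z + inh X n - eta X / 2))) (rev [1..<Suc (len X)]))"

definition transfer :: "xyz_chain \<Rightarrow> complex \<Rightarrow> complex mat" where
  "transfer X z = tr_aux (len X)
     (on_aux (len X) (K_plus X z) * mono_T X z * on_aux (len X) (K_minus X z) * mono_T_hat X z)"


section \<open>Inhomogeneities and boundary coefficients\<close>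

definition xi_sh :: "xyz_chain \<Rightarrow> nat \<Rightarrow> nat \<Rightarrow> complex" where
  "xi_sh X n h = inh X n + eta X / 2 - of_nat h * eta X"

text \<open>\<open>xi_special X j\<close> is the point \<open>\<xi>\<close> with lower index \<open>-j\<close> and upper index \<open>(0)\<close>.\<close>

definition xi_special :: "xyz_chain \<Rightarrow> nat \<Rightarrow> complex" where
  "xi_special X j = eta X / 2 + [0, of_real pi / 2, of_real pi * omega X / 2,
                                 (of_real pi + of_real pi * omega X) / 2] ! j"

definition points_distinct :: "xyz_chain \<Rightarrow> bool" where
  "points_distinct X \<longleftrightarrow>
    (let I = {1, -1 :: int} \<times> (({1..len X} \<times> {0, 1}) <+> {0..3});
         pt = (\<lambda>(s, k). of_int s * (case k of Inl (n, h) \<Rightarrow> xi_sh X n h | Inr j \<Rightarrow> xi_special X j))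
     in \<forall>x\<in>I. \<forall>y\<in>I. x \<noteq> y \<longrightarrow> pt x - pt y \<notin> period_lattice X)"

definition a_bulk :: "xyz_chain \<Rightarrow> complex \<Rightarrow> complex" where
  "a_bulk X z = (\<Prod>n\<in>{1..len X}. theta X (z - inh X n + eta X / 2))"

definition d_bulk :: "xyz_chain \<Rightarrow> complex \<Rightarrow> complex" where
  "d_bulk X z = a_bulk X (z - eta X)"

definition a_bdry :: "xyz_chain \<Rightarrow> signs \<Rightarrow> complex \<Rightarrow> complex" where
  "a_bdry X \<epsilon> z = (\<Prod>\<sigma>\<in>UNIV. \<Prod>i\<in>{1..3}.
     theta X (z - eta X / 2 - of_int (\<epsilon> \<sigma> i) * bdry X \<sigma> i) / theta X (- of_int (\<epsilon> \<sigma> i) * bdry X \<sigma> i))"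

definition A_coef :: "xyz_chain \<Rightarrow> signs \<Rightarrow> complex \<Rightarrow> complex" where
  "A_coef X \<epsilon> z = (-1) ^ len X * (theta X (2 * z + eta X) / theta X (2 * z))
     * a_bdry X \<epsilon> z * a_bulk X z * d_bulk X (- z)"


section \<open>SoV bases and separate states\<close>

text \<open>
  Covectors are represented by their coordinate vectors in the dual basis: the covector \<open>S\<close> acts by
  \<open>v \<mapsto> S \<bullet> v\<close> (bilinear, no complex conjugation), and the covector \<open>S\<close> composed with the matrix
  \<open>B\<close> is \<open>transpose_mat B *\<^sub>v S\<close>.
\<close>

definition confs :: "nat \<Rightarrow> (nat \<Rightarrow> nat) set" where
  "confs N = {1..N} \<rightarrow>\<^sub>E {0, 1}"

definition sov_bra :: "xyz_chain \<Rightarrow> signs \<Rightarrow> complex vec \<Rightarrow> (nat \<Rightarrow> nat) \<Rightarrow> complex vec" where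
  "sov_bra X \<epsilon> S h = transpose_mat (mat_prod_list (2 ^ len X)
     (map (\<lambda>n. ((1 / A_coef X \<epsilon> (eta X / 2 - inh X n)) \<cdot>\<^sub>m transfer X (inh X n - eta X / 2)) ^\<^sub>m (1 - h n))
        [1..<Suc (len X)])) *\<^sub>v S"

definition sov_ket :: "xyz_chain \<Rightarrow> signs \<Rightarrow> complex vec \<Rightarrow> (nat \<Rightarrow> nat) \<Rightarrow> complex vec" where
  "sov_ket X \<epsilon> R h = mat_prod_list (2 ^ len X)
     (map (\<lambda>n. ((theta X (2 * inh X n - 2 * eta X) / theta X (2 * inh X n + 2 * eta X)
                  / A_coef X \<epsilon> (eta X / 2 - inh X n)) \<cdot>\<^sub>m transfer X (inh X n + eta X / 2)) ^\<^sub>m (h n))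
        [1..<Suc (len X)]) *\<^sub>v R"

definition is_covector_basis :: "xyz_chain \<Rightarrow> signs \<Rightarrow> complex vec \<Rightarrow> bool" where
  "is_covector_basis X \<epsilon> S \<longleftrightarrow>
     inj_on (sov_bra X \<epsilon> S) (confs (len X)) \<and>
     vectorspace.basis class_ring (module_vec TYPE(complex) (2 ^ len X)) (sov_bra X \<epsilon> S ` confs (len X))"

definition is_ref_vector :: "xyz_chain \<Rightarrow> signs \<Rightarrow> complex vec \<Rightarrow> complex \<Rightarrow> complex vec \<Rightarrow> bool" where
  "is_ref_vector X \<epsilon> S \<N>\<^sub>0 R \<longleftrightarrow>
     R \<in> carrier_vec (2 ^ len X) \<and>
     (\<forall>h\<in>confs (len X). sov_bra X \<epsilon> S h \<bullet> R =
        (if \<forall>n\<in>{1..len X}. h n = 0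
         then \<N>\<^sub>0 / (Vand X (len X) (\<lambda>n. xi_sh X n 0) * Vand X (len X) (inh X)) else 0))"

definition sep_ket :: "xyz_chain \<Rightarrow> signs \<Rightarrow> complex vec \<Rightarrow> (complex \<Rightarrow> complex) \<Rightarrow> complex vec" where
  "sep_ket X \<epsilon> R Q = finsum_vec TYPE(complex) (2 ^ len X)
     (\<lambda>h. ((\<Prod>n\<in>{1..len X}. Q (xi_sh X n (h n))) * Vand X (len X) (\<lambda>n. xi_sh X n (h n)))
            \<cdot>\<^sub>v sov_ket X \<epsilon> R h) (confs (len X))"

definition sep_bra ::
  "xyz_chain \<Rightarrow> signs \<Rightarrow> complex vec \<Rightarrow> complex \<Rightarrow> (complex \<Rightarrow> complex) \<Rightarrow> complex vec" where
  "sep_bra X \<epsilon> S \<N>\<^sub>0 P = (1 / \<N>\<^sub>0) \<cdot>\<^sub>v finsum_vec TYPE(complex) (2 ^ len X)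
     (\<lambda>h. ((\<Prod>n\<in>{1..len X}.
              (- (a_bdry X \<epsilon> (eta X / 2 + inh X n) / a_bdry X \<epsilon> (eta X / 2 - inh X n))) ^ h n
              * P (xi_sh X n (h n)))
            * Vand X (len X) (\<lambda>n. xi_sh X n (1 - h n)))
            \<cdot>\<^sub>v sov_bra X \<epsilon> S h) (confs (len X))"

definition sep_pairing ::
  "xyz_chain \<Rightarrow> signs \<Rightarrow> complex vec \<Rightarrow> complex \<Rightarrow> complex vec
     \<Rightarrow> (complex \<Rightarrow> complex) \<Rightarrow> (complex \<Rightarrow> complex) \<Rightarrow> complex" where
  "sep_pairing X \<epsilon> S \<N>\<^sub>0 R P Q = sep_bra X \<epsilon> S \<N>\<^sub>0 P \<bullet> sep_ket X \<epsilon> R Q"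


section \<open>Bethe roots and the determinant representation\<close>

definition Qf :: "xyz_chain \<Rightarrow> nat \<Rightarrow> (nat \<Rightarrow> complex) \<Rightarrow> complex \<Rightarrow> complex" where
  "Qf X M q z = (\<Prod>n\<in>{1..M}. theta_s X z (q n))"

definition tauQ :: "xyz_chain \<Rightarrow> signs \<Rightarrow> nat \<Rightarrow> (nat \<Rightarrow> complex) \<Rightarrow> complex \<Rightarrow> complex" where
  "tauQ X \<epsilon> M q z =
     (A_coef X \<epsilon> z * Qf X M q (z - eta X) + A_coef X \<epsilon> (- z) * Qf X M q (z + eta X)) / Qf X M q z"

definition t_fun :: "xyz_chain \<Rightarrow> complex \<Rightarrow> complex" where
  "t_fun X z = deriv (theta X) (z - eta X / 2) / theta X (z - eta X / 2)
             - deriv (theta X) (z + eta X / 2) / theta X (z + eta X / 2)"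

text \<open>
  Where \<open>theta X z \<noteq> 0\<close> this is \<open>t_fun X (z + eta X / 2) + t_fun X (z - eta X / 2)\<close>; only the reduced
  form makes sense at \<open>z = 0\<close>, where it is needed.
\<close>

definition K_fun :: "xyz_chain \<Rightarrow> complex \<Rightarrow> complex" where
  "K_fun X z = deriv (theta X) (z - eta X) / theta X (z - eta X)
             - deriv (theta X) (z + eta X) / theta X (z + eta X)"

text \<open>
  \<open>S_entry X \<epsilon> M q z j\<close> is the entry in column \<open>j\<close> of a row with \<open>p\<^sub>i = z\<close>. At \<open>z = q\<^sub>i\<close> this
  is \<open>0 \<cdot> \<infinity>\<close>; \<open>SQQ_entry\<close> is the value by continuity.
\<close>

definition S_entry :: "xyz_chain \<Rightarrow> signs \<Rightarrow> nat \<Rightarrow> (nat \<Rightarrow> complex) \<Rightarrow> complex \<Rightarrow> nat \<Rightarrow> complex" where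
  "S_entry X \<epsilon> M q z j = Qf X M q z * deriv (\<lambda>x. tauQ X \<epsilon> M (q(j := x)) z) (q j)"

definition S_entry_explicit ::
  "xyz_chain \<Rightarrow> signs \<Rightarrow> nat \<Rightarrow> (nat \<Rightarrow> complex) \<Rightarrow> complex \<Rightarrow> nat \<Rightarrow> complex" where
  "S_entry_explicit X \<epsilon> M q z j =
     A_coef X \<epsilon> z * Qf X M q (z - eta X)
       * (t_fun X (z + q j - eta X / 2) - t_fun X (z - q j - eta X / 2))
     - A_coef X \<epsilon> (- z) * Qf X M q (z + eta X)
       * (t_fun X (z + q j + eta X / 2) - t_fun X (z - q j + eta X / 2))"

definition SQQ_entry :: "xyz_chain \<Rightarrow> signs \<Rightarrow> nat \<Rightarrow> (nat \<Rightarrow> complex) \<Rightarrow> nat \<Rightarrow> nat \<Rightarrow> complex" where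
  "SQQ_entry X \<epsilon> M q i j = Lim (at (q i)) (\<lambda>z. S_entry X \<epsilon> M q z j)"

text \<open>
  The derivative of \<open>log f\<close> is written \<open>f' / f\<close>: on Bethe roots \<open>f = -1\<close>, which lies on the branch
  cut of \<open>Ln\<close>.
\<close>

definition SQQ_explicit :: "xyz_chain \<Rightarrow> signs \<Rightarrow> nat \<Rightarrow> (nat \<Rightarrow> complex) \<Rightarrow> nat \<Rightarrow> nat \<Rightarrow> complex" where
  "SQQ_explicit X \<epsilon> M q i j =
    (let f = (\<lambda>\<mu>. (A_coef X \<epsilon> \<mu> * Qf X M q (\<mu> - eta X))
                    / (A_coef X \<epsilon> (- \<mu>) * Qf X M q (\<mu> + eta X)))
     in A_coef X \<epsilon> (- q i) * Qf X M q (q i + eta X)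
          * (- (if i = j then deriv f (q i) / f (q i) else 0)
             + K_fun X (q i - q j) - K_fun X (q i + q j)))"

definition S_mat :: "xyz_chain \<Rightarrow> signs \<Rightarrow> nat \<Rightarrow> (nat \<Rightarrow> complex) \<Rightarrow> (nat \<Rightarrow> complex) \<Rightarrow> complex mat" where
  "S_mat X \<epsilon> M q p = Matrix.mat M M (\<lambda>(i, j). S_entry X \<epsilon> M q (p (Suc i)) (Suc j))"

definition SQQ_mat :: "xyz_chain \<Rightarrow> signs \<Rightarrow> nat \<Rightarrow> (nat \<Rightarrow> complex) \<Rightarrow> complex mat" where
  "SQQ_mat X \<epsilon> M q = Matrix.mat M M (\<lambda>(i, j). SQQ_entry X \<epsilon> M q (Suc i) (Suc j))"

text \<open>
  The points \<open>p\<close> at which no denominator in the right-hand side of the determinant formula vanishes,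
  including those hidden in the entries \<open>Q(p\<^sub>i) \<partial>\<tau>\<^sub>Q(p\<^sub>i)/\<partial>q\<^sub>j\<close>. Every \<open>p\<close> is a limit of such points.
\<close>

definition regular_points :: "xyz_chain \<Rightarrow> nat \<Rightarrow> (nat \<Rightarrow> complex) \<Rightarrow> (nat \<Rightarrow> complex) set" where
  "regular_points X M q = {p. Vand X M p \<noteq> 0 \<and>
     (\<forall>i\<in>{1..M}. theta_s X (2 * p i) (eta X) \<noteq> 0 \<and> theta X (2 * p i) \<noteq> 0 \<and> Qf X M q (p i) \<noteq> 0)}"

definition det_ratio ::
  "xyz_chain \<Rightarrow> signs \<Rightarrow> nat \<Rightarrow> (nat \<Rightarrow> complex) \<Rightarrow> (nat \<Rightarrow> complex) \<Rightarrow> complex" where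
  "det_ratio X \<epsilon> M q p =
     Vand X M q / Vand X M p
     * (\<Prod>j\<in>{1..M}. theta_s X (2 * q j) (eta X) / theta_s X (2 * p j) (eta X))
     * (Determinant.det (S_mat X \<epsilon> M q p) / Determinant.det (SQQ_mat X \<epsilon> M q))"

end

theory Submission
  imports Defs
begin

text \<open>The half periods act on the four theta functions, and the Pauli matrices on a spin, through the same
Heisenberg group. Written with it, the R-matrix and the K-matrix have theta functions as coefficients,
and one Riemann relation (\<open>riemann_mixed\<close>) gives the Yang-Baxter equation, the reflection
equation and the unitarity relations. Sklyanin's argument then makes the transfer matrices commute.

As a function of the spectral parameter the transfer matrix is an even theta function of order
\<open>2(N + 3)\<close> (\<open>T_even_theta\<close>), which \<open>N + 4\<close> values determine. At four special points it is
scalar (\<open>T_special\<close>); the sign condition and the boundary constraint enter here. At the points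
\<open>\<xi>\<^sub>n \<plusminus> \<eta>/2\<close> its products are scalar by fusion (\<open>T_fusion\<close>), so that at \<open>\<xi>\<^sub>n\<close> shifted
according to \<open>h\<^sub>n\<close> it sends the covector and the vector with label \<open>h\<close> to multiples of those with
\<open>h\<^sub>n\<close> replaced by \<open>1 - h\<^sub>n\<close>. Interpolation in these \<open>N + 4\<close> points proves \<open>orthogonality\<close> and
\<open>eigenstates\<close>, and the pairing becomes a symmetric bilinear form, a sum over \<open>h\<close> with explicit weights
(\<open>sep_pairing_formula\<close>).

For the determinant, let \<open>G z l\<close> be \<open>Q(z) \<partial>\<tau>\<^sub>Q(z)/\<partial>q\<^sub>l\<close>. It is an even theta function of order
\<open>2(N + 3 + M)\<close> in \<open>z\<close> that vanishes at the special points. Hence its divided difference over the special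
points, one shifted inhomogeneity for each site, and \<open>M + 1\<close> points \<open>p\<^sub>0, ..., p\<^sub>M\<close> is zero. Summed over
\<open>h\<close> with the weights of the pairing, the terms of the sites cancel in pairs under
\<open>h\<^sub>n \<mapsto> 1 - h\<^sub>n\<close>. What remains (\<open>relation_generic\<close>) is a linear relation between the rows
\<open>G p\<^sub>j\<close>, whose coefficients are the pairings of \<open>Q\<close> with the products over all points but \<open>p\<^sub>j\<close>. By
Cramer's rule the quotient of the normalised pairing \<open>H p\<close> by the determinant \<open>D p\<close> stays the same when one
of the points is replaced (\<open>exchange\<close>). Replacing the Bethe roots one by one
(\<open>determinant_formula\<close>) proves the theorem; the excluded positions are reached by analytic
continuation.\<close>

abbreviation entire :: "(complex => complex) => bool" where "entire f \<equiv> f holomorphic_on UNIV"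
abbreviation \<pi> :: complex where "\<pi> \<equiv> of_real pi"

lemmas alg = algebra_simps

text \<open>Products over the six boundary parameters.\<close>

abbreviation (input) bp where "bp f \<equiv> (\<Prod>\<sigma>::bool\<in>UNIV. \<Prod>i::nat\<in>{1..3}. f \<sigma> i)"

section \<open>Theta functions as bilateral series\<close>

text \<open>The general term of the theta series.\<close>

definition jterm :: "complex => complex => int => complex" where
 "jterm \<tau> z n = exp (\<i> * \<pi> * \<tau> * of_int (n\<^sup>2) + 2 * \<i> * of_int n * z)"

text \<open>The Jacobi theta function \<open>\<theta>\<^sub>3\<close> as a sum over all integers; the other three are its
 translates by half-periods.\<close>

definition jth :: "complex => complex => complex" where
 "jth \<tau> z = (\<Sum>\<^sub>\<infinity>n. jterm \<tau> z n)"

lemma jterm_minus: "jterm \<tau> (-z) n = jterm \<tau> z (-n)"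
 by (simp add: jterm_def)

lemma norm_jterm: "norm (jterm \<tau> z n) = exp (- pi * Im \<tau> * (of_int n)\<^sup>2 - 2 * of_int n * Im z)"
 by (simp add: jterm_def power2_eq_square alg flip: of_int_mult)

lemma summable_gauss:
 fixes t y :: real assumes "t > 0"
 shows "summable (%n::nat. exp (- t * (real n)\<^sup>2 + y * real n))"
proof -
obtain K :: nat where K: "real K \<ge> (y + 1) / t" using real_arch_simple by blast
show ?thesis
proof (rule summable_comparison_test_ev)
 show "\<forall>\<^sub>F n in sequentially. norm (exp (- t * (real n)\<^sup>2 + y * real n)) \<le> exp (-1) ^ n"
 proof (rule eventually_sequentiallyI[of K])
  fix n assume "K \<le> n"
  hence "real n \<ge> (y + 1) / t" using K by linarith
  hence "t * real n \<ge> y + 1" using assms by (simp add: field_simps)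
  hence "real n * (t * real n) \<ge> real n * (y + 1)" by (intro mult_left_mono) auto
  hence "- t * (real n)\<^sup>2 + y * real n \<le> - real n"
   by (simp add: power2_eq_square alg)
  thus "norm (exp (- t * (real n)\<^sup>2 + y * real n)) \<le> exp (-1) ^ n"
   by (simp flip: exp_of_nat_mult)
 qed
 show "summable (%n. exp (-1 :: real) ^ n)" by (rule summable_geometric) simp
qed
qed

lemma UNIV_int_split: "(UNIV :: int set) = range int \<union> range (%n. -1 - int n)"
proof -
have "x \<in> range int \<union> range (%n. -1 - int n)" for x :: int
proof (cases "x \<ge> 0")
 case True thus ?thesis by (metis UnI1 nonneg_int_cases rangeI)
next
 case False
 hence "x = -1 - int (nat (-1 - x))" by simp
 thus ?thesis by blast
qed
thus ?thesis by blast
qed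

lemma int_sums:
 fixes f :: "int => complex"
 assumes "(%n. norm (f n)) summable_on UNIV"
 shows "(%n. f (int n) + f (-1 - int n)) sums (\<Sum>\<^sub>\<infinity>n. f n)"
  "(%n. f (int (Suc n)) + f (-1 - int n)) sums ((\<Sum>\<^sub>\<infinity>n. f n) - f 0)"
proof -
let ?A = "range (%n. -1 - int n)"
have s: "f summable_on UNIV" using assms by (rule abs_summable_summable)
have 1: "f summable_on range int" "f summable_on range (%n. -1 - int n)"
 using s summable_on_subset_banach by blast+
have i: "inj int" "inj (%n. -1 - int n)" by (auto simp: inj_def)
have a: "(f has_sum (infsum f (range int))) (range int)"
  "(f has_sum (infsum f ?A)) ?A"
 using 1 by auto
have d: "range int \<inter> range (%n. -1 - int n) = {}" by auto
have tot: "infsum f UNIV = infsum f (range int) + infsum f ?A"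
 using has_sum_Un_disjoint[OF a d] UNIV_int_split infsumI by metis
have p: "(%n. f (int n)) sums infsum f (range int)"
 using a(1) has_sum_imp_sums by (simp add: has_sum_reindex[OF i(1)] o_def)
have m: "(%n. f (-1 - int n)) sums infsum f ?A"
 using a(2) has_sum_imp_sums by (simp add: has_sum_reindex[OF i(2)] o_def)
show "(%n. f (int n) + f (-1 - int n)) sums infsum f UNIV" unfolding tot by (rule sums_add[OF p m])
have "(%n. f (int (Suc n))) sums (infsum f (range int) - f 0)"
 using p sums_Suc_iff[of "%n. f (int n)" "infsum f (range int) - f 0"] by simp
from sums_add[OF this m] show "(%n. f (int (Suc n)) + f (-1 - int n)) sums (infsum f UNIV - f 0)"
 unfolding tot by (simp add: alg)
qed

lemma jterm_abs_summable:
 assumes "Im \<tau> > 0" shows "(%n. norm (jterm \<tau> z n)) summable_on UNIV"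
proof -
let ?g = "%n. exp (- (pi * Im \<tau>) * (real n)\<^sup>2 + (2 * \<bar>Im z\<bar> + 2 * pi * Im \<tau>) * real n + 2 * \<bar>Im z\<bar>)"
have s: "summable ?g"
 using summable_mult2[OF summable_gauss[of "pi * Im \<tau>" "2 * \<bar>Im z\<bar> + 2 * pi * Im \<tau>"], of "exp (2 * \<bar>Im z\<bar>)"] assms
 by (simp add: exp_add)
have b1: "norm (jterm \<tau> z (int n)) \<le> ?g n" for n
proof -
 have "- 2 * real n * Im z \<le> 2 * \<bar>Im z\<bar> * real n"
  using mult_left_mono[of "- Im z" "\<bar>Im z\<bar>" "2 * real n"] by (simp add: mult_ac)
 moreover have "0 \<le> 2 * pi * Im \<tau> * real n" using assms by simp
 ultimately show ?thesis unfolding norm_jterm by (simp add: alg)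
qed
have b2: "norm (jterm \<tau> z (-1 - int n)) \<le> ?g n" for n
proof -
 have "(1 + real n) * Im z \<le> (1 + real n) * \<bar>Im z\<bar>"
  by (intro mult_left_mono) auto
 moreover have "(1 + real n)\<^sup>2 \<ge> (real n)\<^sup>2 - 2 * real n" by (simp add: power2_eq_square alg)
 hence "pi * Im \<tau> * (1 + real n)\<^sup>2 \<ge> pi * Im \<tau> * ((real n)\<^sup>2 - 2 * real n)"
  using assms by (intro mult_left_mono) auto
 moreover have "(of_int (-1 - int n))\<^sup>2 = ((1 + real n)\<^sup>2 :: real)" by (simp add: power2_eq_square alg)
 ultimately show ?thesis unfolding norm_jterm by (simp add: alg)
qed
have h1: "(%n. norm (jterm \<tau> z n)) summable_on range int"
 using summable_comparison_test'[OF s, of 0 "%n. norm (jterm \<tau> z (int n))"] b1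
 by (subst summable_on_reindex) (auto simp: o_def summable_on_UNIV_nonneg_real_iff)
have h2: "(%n. norm (jterm \<tau> z n)) summable_on range (%n. -1 - int n)"
 using summable_comparison_test'[OF s, of 0 "%n. norm (jterm \<tau> z (-1 - int n))"] b2
 by (subst summable_on_reindex) (auto simp: o_def summable_on_UNIV_nonneg_real_iff inj_on_def)
have d: "range int \<inter> range (%n. -1 - int n) = {}" by auto
show ?thesis
 unfolding UNIV_int_split by (rule summable_on_Un_disjoint[OF h1 h2 d])
qed

lemma jth_has_sum: "Im \<tau> > 0 ==> (jterm \<tau> z has_sum jth \<tau> z) UNIV"
 unfolding jth_def by (rule has_sum_infsum[OF abs_summable_summable[OF jterm_abs_summable]])

lemma jth_minus [simp]: assumes "Im \<tau> > 0" shows "jth \<tau> (-z) = jth \<tau> z"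
proof -
have "jth \<tau> (-z) = (\<Sum>\<^sub>\<infinity>n\<in>UNIV. jterm \<tau> z (-n))" by (simp add: jth_def jterm_minus)
also have "... = (\<Sum>\<^sub>\<infinity>n\<in>range uminus. jterm \<tau> z n)"
 by (subst infsum_reindex) (auto simp: o_def)
finally show ?thesis by (simp add: jth_def)
qed

lemma jth_plus_pi [simp]: "jth \<tau> (z + \<pi>) = jth \<tau> z"
proof -
have "jterm \<tau> (z + \<pi>) n = jterm \<tau> z n" for n
proof -
 have "exp (2 * \<i> * of_int n * \<pi>) = (1::complex)"
  using exp_integer_2pi[of "of_int n"] by (simp add: mult_ac)
 thus ?thesis by (simp add: jterm_def exp_add alg)
qed
thus ?thesis by (simp add: jth_def)
qed

lemma jth_plus_tau:
 assumes "Im \<tau> > 0"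
 shows "jth \<tau> (z + \<pi> * \<tau>) = exp (- \<i> * \<pi> * \<tau> - 2 * \<i> * z) * jth \<tau> z"
proof -
have t: "jterm \<tau> (z + \<pi> * \<tau>) n = exp (- \<i> * \<pi> * \<tau> - 2 * \<i> * z) * jterm \<tau> z (n + 1)" for n
 by (simp add: jterm_def flip: exp_add) (rule arg_cong[where f = exp], simp add: power2_eq_square alg)
have "(jterm \<tau> z has_sum jth \<tau> z) (range (%n. n + 1))"
 using jth_has_sum[OF assms, of z] by (simp add: surj_plus_right)
hence "((%n. jterm \<tau> z (n + 1)) has_sum jth \<tau> z) UNIV"
 by (subst (asm) has_sum_reindex) (auto simp: o_def inj_def)
from has_sum_cmult_right[OF this, of "exp (- \<i> * \<pi> * \<tau> - 2 * \<i> * z)"]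
show ?thesis unfolding jth_def[of _ "z + _"] t by (rule infsumI)
qed

lemma jth_holomorphic: assumes "Im \<tau> > 0" shows "entire (jth \<tau>)"
proof -
define c where "c n = exp (\<i> * \<pi> * \<tau> * of_nat n ^ 2)" for n :: nat
define G where "G w = (\<Sum>n. c n * w ^ n)" for w
have sm: "summable (%n. c n * w ^ n)" for w
proof (cases "w = 0")
 case False
 have "summable (%n. norm (c n * w ^ n))"
 proof -
  have "norm (c n * w ^ n) = exp (- (pi * Im \<tau>) * (real n)\<^sup>2 + ln (norm w) * real n)" for n
  proof -
   have "norm (c n) = exp (- (pi * Im \<tau>) * (real n)\<^sup>2)"
    by (simp add: c_def power2_eq_square)
   moreover have "norm w ^ n = exp (ln (norm w) * real n)"
    using False by (metis exp_ln exp_of_nat2_mult zero_less_norm_iff)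
   ultimately show ?thesis by (simp add: norm_mult norm_power flip: exp_add)
  qed
  thus ?thesis using summable_gauss[of "pi * Im \<tau>" "ln (norm w)"] assms by simp
 qed
 thus ?thesis by (rule summable_norm_cancel)
qed simp
have hG: "entire G"
proof -
 have "G holomorphic_on ball 0 r" for r
  by (rule power_series_holomorphic[where a = c]) (use sm in \<open>auto simp: G_def intro: summable_sums\<close>)
 hence "G analytic_on ball 0 r" for r by (simp add: analytic_on_open)
 hence "G analytic_on UNIV"
  unfolding analytic_on_def by (metis centre_in_ball dense mem_ball_0 UNIV_I gt_ex)
 thus ?thesis by (rule analytic_imp_holomorphic)
qed
have "jth \<tau> z = G (exp (2 * \<i> * z)) + (G (exp (- 2 * \<i> * z)) - 1)" for z
proof -
 have a: "jterm \<tau> z (int n) = c n * exp (2 * \<i> * z) ^ n" for z n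
  by (simp add: jterm_def c_def exp_add mult_ac flip: exp_of_nat_mult)
 have b: "jterm \<tau> z (-1 - int n) = c (Suc n) * exp (- 2 * \<i> * z) ^ Suc n" for n
 proof -
  have e: "-1 - int n = - int (Suc n)" by simp
  show ?thesis unfolding e jterm_minus[symmetric] a by simp
 qed
 have "(%n. c n * exp (- 2 * \<i> * z) ^ n) sums G (exp (- 2 * \<i> * z))"
  unfolding G_def by (rule summable_sums[OF sm])
 hence "(%n. c (Suc n) * exp (- 2 * \<i> * z) ^ Suc n) sums (G (exp (- 2 * \<i> * z)) - 1)"
  by (subst sums_Suc_iff) (simp add: c_def)
 with summable_sums[OF sm[of "exp (2 * \<i> * z)"]]
 have "(%n. jterm \<tau> z (int n) + jterm \<tau> z (-1 - int n)) sums
   (G (exp (2 * \<i> * z)) + (G (exp (- 2 * \<i> * z)) - 1))"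
  unfolding a b G_def by (intro sums_add) auto
 moreover have "(%n. jterm \<tau> z (int n) + jterm \<tau> z (-1 - int n)) sums jth \<tau> z"
  unfolding jth_def using int_sums(1)[OF jterm_abs_summable[OF assms]] .
 ultimately show ?thesis using sums_unique2 by blast
qed
hence "jth \<tau> = (%z. G (exp (2 * \<i> * z)) + (G (exp ((- 2 * \<i>) * z)) - 1))" by (intro ext) simp
moreover have "entire (%z. G (exp (k * z)))" for k
 using holomorphic_on_compose_gen[of "%z. exp (k * z)" UNIV G UNIV] hG
 by (auto simp: o_def intro!: holomorphic_intros)
ultimately show ?thesis by (simp only: holomorphic_on_add holomorphic_on_diff holomorphic_on_const)
qed

lemma theta3_jth: assumes "Im \<tau> > 0" shows "theta3 \<tau> z = jth \<tau> z"
proof -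
let ?A = "%m. 2 * \<i> * of_nat m * z"
let ?c = "%m. qpow \<tau> ((real m)\<^sup>2) * cos (of_nat (2 * m) * z)"
have q: "jterm \<tau> z (int (Suc n)) + jterm \<tau> z (-1 - int n) = 2 * ?c (Suc n)" for n
proof -
 define m where "m = Suc n"
 have e: "-1 - int n = - int m" unfolding m_def by simp
 have 1: "2 * cos (of_nat (2 * m) * z) = exp (?A m) + exp (- (?A m))"
  by (simp add: cos_exp_eq mult_ac)
 have 2: "jterm \<tau> z (int m) = qpow \<tau> ((real m)\<^sup>2) * exp (?A m)"
  "jterm \<tau> z (- int m) = qpow \<tau> ((real m)\<^sup>2) * exp (- (?A m))"
  unfolding jterm_def qpow_def exp_add[symmetric] by simp_all
 have "2 * ?c m = qpow \<tau> ((real m)\<^sup>2) * (2 * cos (of_nat (2 * m) * z))" by simp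
 thus ?thesis unfolding e m_def[symmetric] 1 2 distrib_left by simp
qed
have "(%n. 2 * ?c (Suc n)) sums (jth \<tau> z - 1)"
 using int_sums(2)[OF jterm_abs_summable[OF assms, of z]] unfolding q jth_def[symmetric] by (simp add: jterm_def)
from sums_divide[OF this, of 2] have "(%n. ?c (Suc n)) sums ((jth \<tau> z - 1) / 2)" by simp
thus ?thesis unfolding theta3_def by (simp only: sums_unique[symmetric]) (simp add: field_simps)
qed

lemma theta4_theta3: "theta4 \<tau> z = theta3 \<tau> (z + \<pi> / 2)"
proof -
have "cos (of_nat (2 * Suc n) * (z + \<pi> / 2)) = (-1) ^ Suc n * cos (of_nat (2 * Suc n) * z)" for n
proof -
 have "of_nat (2 * Suc n) * (z + \<pi> / 2) = of_nat (2 * Suc n) * z + of_nat (Suc n) * \<pi>"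
  by (simp add: field_simps)
 moreover have "cos (w + of_nat k * \<pi>) = (-1) ^ k * cos (w :: complex)" for w k
  by (induction k) (auto simp: alg cos_add sin_add)
 ultimately show ?thesis by metis
qed
thus ?thesis unfolding theta4_def theta3_def by (simp only: mult_ac)
qed

lemma theta4_jth: "Im \<tau> > 0 ==> theta4 \<tau> z = jth \<tau> (z + \<pi> / 2)"
 by (simp add: theta4_theta3 theta3_jth)

lemma theta2_sums:
 assumes "Im \<tau> > 0"
 shows "(%n. 2 * (qpow \<tau> ((real n + 1/2)\<^sup>2) * cos (of_nat (2*n+1) * z))) sums
    (qpow \<tau> (1/4) * exp (\<i> * z) * jth \<tau> (z + \<pi> * \<tau> / 2))"
proof -
let ?A = "%n. (real n + 1/2)\<^sup>2"
let ?w = "z + \<pi> * \<tau> / 2"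
have A: "(%n. jterm \<tau> ?w (int n) + jterm \<tau> ?w (-1 - int n)) sums jth \<tau> ?w"
 unfolding jth_def using int_sums(1)[OF jterm_abs_summable[OF assms]] .
have q: "qpow \<tau> (1/4) * exp (\<i> * z) * (jterm \<tau> ?w (int n) + jterm \<tau> ?w (-1 - int n))
  = 2 * (qpow \<tau> (?A n) * cos (of_nat (2*n+1) * z))" for n
proof -
 have c: "2 * cos (of_nat (2*n+1) * z) = exp (\<i> * of_nat (2*n+1) * z) + exp (- \<i> * of_nat (2*n+1) * z)"
  by (simp add: cos_exp_eq alg)
 have e1: "qpow \<tau> (1/4) * exp (\<i> * z) * jterm \<tau> ?w (int n) = qpow \<tau> (?A n) * exp (\<i> * of_nat (2*n+1) * z)"
  unfolding jterm_def qpow_def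
  by (simp flip: exp_add) (rule arg_cong[where f = exp], simp add: power2_eq_square field_simps)
 have e2: "qpow \<tau> (1/4) * exp (\<i> * z) * jterm \<tau> ?w (-1 - int n) = qpow \<tau> (?A n) * exp (- \<i> * of_nat (2*n+1) * z)"
  unfolding jterm_def qpow_def
  by (simp flip: exp_add) (rule arg_cong[where f = exp], simp add: power2_eq_square field_simps)
 have "2 * (qpow \<tau> (?A n) * cos (of_nat (2*n+1) * z))
   = qpow \<tau> (?A n) * (2 * cos (of_nat (2*n+1) * z))" by simp
 thus ?thesis unfolding distrib_left[of "qpow \<tau> (1/4) * exp (\<i> * z)"] e1 e2 c distrib_left by simp
qed
show ?thesis using sums_mult[OF A, of "qpow \<tau> (1/4) * exp (\<i> * z)"] unfolding q .
qed

lemma theta2_jth: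
 assumes "Im \<tau> > 0"
 shows "theta2 \<tau> z = qpow \<tau> (1/4) * exp (\<i> * z) * jth \<tau> (z + \<pi> * \<tau> / 2)"
proof -
have "summable (%n. qpow \<tau> ((real n + 1/2)\<^sup>2) * cos (of_nat (2*n+1) * z))"
 using sums_summable[OF theta2_sums[OF assms, of z]] unfolding summable_cmult_iff by simp
from suminf_mult[OF this, of 2] show ?thesis
 using sums_unique[OF theta2_sums[OF assms, of z]] unfolding theta2_def by simp
qed

lemma theta2_plus_half: assumes "Im \<tau> > 0" shows "theta2 \<tau> (z + \<pi> / 2) = - theta1 \<tau> z"
proof -
let ?A = "%n. of_nat (2*n+1) * (z + \<pi> / 2)"
have "cos (?A n) = - ((-1) ^ n * sin (of_nat (2*n+1) * z))" for n
proof -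
 have "of_nat (2*n+1) * (z + \<pi> / 2) = (of_nat (2*n+1) * z + \<pi> / 2) + of_nat n * \<pi>"
  by (simp add: field_simps)
 moreover have "cos (w + of_nat k * \<pi>) = (-1) ^ k * cos (w :: complex)" for w k
  by (induction k) (auto simp: alg cos_add sin_add)
 ultimately have "cos (?A n) = (-1) ^ n * cos (of_nat (2*n+1) * z + \<pi> / 2)"
  by metis
 moreover have "cos (w + \<pi> / 2) = - sin (w::complex)" for w
  by (metis cos_add cos_of_real_pi_half mult_zero_right sin_of_real_pi_half mult.right_neutral diff_0)
 ultimately show ?thesis by simp
qed
hence e: "qpow \<tau> ((real n + 1/2)\<^sup>2) * cos (?A n)
 = - ((-1) ^ n * qpow \<tau> ((real n + 1/2)\<^sup>2) * sin (of_nat (2*n+1) * z))" for n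
 by (simp only: mult_ac mult_minus_right)
have "summable (%n. (-1) ^ n * qpow \<tau> ((real n + 1/2)\<^sup>2) * sin (of_nat (2*n+1) * z))"
 using sums_summable[OF theta2_sums[OF assms, of "z + \<pi> / 2"]] unfolding e
 unfolding mult_minus_right summable_minus_iff summable_cmult_iff by simp
thus ?thesis unfolding theta2_def theta1_def e by (subst suminf_minus) auto
qed

section \<open>Half-period shifts and product formulas\<close>

text \<open>The factor that \<open>\<theta>\<^sub>3\<close> takes up under a shift by half of the quasi-period, with the power of the
 nome fixed as in \<open>qpow\<close>.\<close>

definition qhalf :: "complex => complex => complex" where
 "qhalf \<tau> z = qpow \<tau> (-1/4) * exp (- \<i> * z)"

lemma exp_cong: "a = b ==> exp a = exp b" by simp

lemma entire_compose:
 "entire f ==> g holomorphic_on A ==> (%z. f (g z :: complex) :: complex) holomorphic_on A"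
 using holomorphic_on_compose_gen[of g A f UNIV] by (simp add: o_def)

lemma qhalf_nonzero [simp]: "qhalf \<tau> z ~= 0" by (simp add: qhalf_def qpow_def)

lemma theta1_theta2: "Im \<tau> > 0 ==> theta1 \<tau> z = - theta2 \<tau> (z + \<pi> / 2)"
 by (simp add: theta2_plus_half)

lemma theta3_plus_half: "Im \<tau> > 0 ==> theta3 \<tau> (z + \<pi> / 2) = theta4 \<tau> z"
 by (simp add: theta4_jth theta3_jth)

lemma theta3_plus_pi: "Im \<tau> > 0 ==> theta3 \<tau> (z + \<pi>) = theta3 \<tau> z"
 by (simp add: theta3_jth)

lemma theta4_plus_half: "Im \<tau> > 0 ==> theta4 \<tau> (z + \<pi> / 2) = theta3 \<tau> z"
 using theta3_plus_pi[of \<tau> z] by (simp add: theta3_plus_half[symmetric] add.assoc)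

lemma exp_i_pi_half [simp]: "exp (\<i> * (\<pi> / 2)) = \<i>"
 by (metis cis_pi_half cis_conv_exp of_real_divide of_real_numeral)

lemma theta2_plus_pi: "Im \<tau> > 0 ==> theta2 \<tau> (z + \<pi>) = - theta2 \<tau> z"
proof -
assume t: "Im \<tau> > 0"
have "jth \<tau> (z + \<pi> + \<pi> * \<tau> / 2) = jth \<tau> (z + \<pi> * \<tau> / 2)"
 using jth_plus_pi[of \<tau> "z + \<pi> * \<tau> / 2"] by (simp add: add_ac)
moreover have "exp (\<i> * (z + \<pi>)) = - exp (\<i> * z)"
 by (simp add: distrib_left exp_add)
ultimately show ?thesis by (simp add: theta2_jth[OF t])
qed

lemma theta1_plus_half: "Im \<tau> > 0 ==> theta1 \<tau> (z + \<pi> / 2) = theta2 \<tau> z"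
 using theta2_plus_pi[of \<tau> z] by (simp add: theta1_theta2 add.assoc)

lemma theta3_plus_tau_half: "Im \<tau> > 0 ==> theta3 \<tau> (z + \<pi> * \<tau> / 2) = qhalf \<tau> z * theta2 \<tau> z"
 by (simp add: theta3_jth theta2_jth qhalf_def qpow_def mult_ac flip: exp_add)

lemma theta2_plus_tau_half:
 assumes "Im \<tau> > 0" shows "theta2 \<tau> (z + \<pi> * \<tau> / 2) = qhalf \<tau> z * theta3 \<tau> z"
proof -
have "jth \<tau> (z + \<pi> * \<tau> / 2 + \<pi> * \<tau> / 2) = exp (- \<i> * \<pi> * \<tau> - 2 * \<i> * z) * jth \<tau> z"
 using jth_plus_tau[OF assms, of z] by (simp add: add.assoc mult.commute)
moreover have "qpow \<tau> (1/4) * exp (\<i> * (z + \<pi> * \<tau> / 2)) * exp (- \<i> * \<pi> * \<tau> - 2 * \<i> * z)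
  = qhalf \<tau> z"
 unfolding qhalf_def qpow_def exp_add[symmetric] by (rule exp_cong) (simp add: field_simps)
ultimately show ?thesis
 unfolding theta2_jth[OF assms] theta3_jth[OF assms] by (metis mult.assoc)
qed

lemma qhalf_plus_half: "qhalf \<tau> (z + \<pi> / 2) = - \<i> * qhalf \<tau> z"
proof -
have "exp (- \<i> * (z + \<pi> / 2)) = exp (- \<i> * z) * inverse (exp (\<i> * (\<pi> / 2)))"
 unfolding exp_minus[symmetric] exp_add[symmetric] by (rule exp_cong) (simp add: alg)
thus ?thesis unfolding exp_i_pi_half qhalf_def by simp
qed

lemma theta4_plus_tau_half:
 assumes "Im \<tau> > 0" shows "theta4 \<tau> (z + \<pi> * \<tau> / 2) = \<i> * qhalf \<tau> z * theta1 \<tau> z"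
 using theta3_plus_tau_half[OF assms, of "z + \<pi> / 2"] assms
 by (simp add: theta4_theta3 theta1_theta2 qhalf_plus_half add_ac)

lemma theta1_plus_tau_half:
 assumes "Im \<tau> > 0" shows "theta1 \<tau> (z + \<pi> * \<tau> / 2) = \<i> * qhalf \<tau> z * theta4 \<tau> z"
 using theta2_plus_tau_half[OF assms, of "z + \<pi> / 2"] assms
 by (simp add: theta4_theta3 theta1_theta2 qhalf_plus_half add_ac)

lemma qhalf_sq:
 "qhalf \<tau> (z + \<pi> * \<tau> / 2) * qhalf \<tau> z = exp (- \<i> * \<pi> * \<tau> - 2 * \<i> * z)"
 unfolding qhalf_def qpow_def exp_add[symmetric] by (rule exp_cong) (simp add: field_simps)

lemma theta_plus_tau:
 assumes "Im \<tau> > 0"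
 defines "N \<equiv> %z. exp (- \<i> * \<pi> * \<tau> - 2 * \<i> * z)"
 shows "theta1 \<tau> (z + \<pi> * \<tau>) = - N z * theta1 \<tau> z"
  "theta2 \<tau> (z + \<pi> * \<tau>) = N z * theta2 \<tau> z"
  "theta3 \<tau> (z + \<pi> * \<tau>) = N z * theta3 \<tau> z"
  "theta4 \<tau> (z + \<pi> * \<tau>) = - N z * theta4 \<tau> z"
proof -
have e: "z + \<pi> * \<tau> = (z + \<pi> * \<tau> / 2) + \<pi> * \<tau> / 2" by simp
note s = theta1_plus_tau_half[OF assms(1)] theta2_plus_tau_half[OF assms(1)]
 theta3_plus_tau_half[OF assms(1)] theta4_plus_tau_half[OF assms(1)]
show "theta1 \<tau> (z + \<pi> * \<tau>) = - N z * theta1 \<tau> z"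
 "theta2 \<tau> (z + \<pi> * \<tau>) = N z * theta2 \<tau> z"
 "theta3 \<tau> (z + \<pi> * \<tau>) = N z * theta3 \<tau> z"
 "theta4 \<tau> (z + \<pi> * \<tau>) = - N z * theta4 \<tau> z"
 unfolding e s N_def qhalf_sq[symmetric] by (simp_all add: mult_ac)
qed

lemma theta1_plus_pi: "Im \<tau> > 0 ==> theta1 \<tau> (z + \<pi>) = - theta1 \<tau> z"
 using theta1_plus_half[of \<tau> "z + \<pi> / 2"] theta2_plus_half[of \<tau> z] by (simp add: add.assoc)

lemma theta4_plus_pi: "Im \<tau> > 0 ==> theta4 \<tau> (z + \<pi>) = theta4 \<tau> z"
 using theta4_plus_half[of \<tau> "z + \<pi> / 2"] theta3_plus_half[of \<tau> z] by (simp add: add.assoc)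

lemma theta2_minus [simp]: "theta2 \<tau> (- z) = theta2 \<tau> z" by (simp add: theta2_def)

lemma theta1_minus:
 assumes "Im \<tau> > 0" shows "theta1 \<tau> (- z) = - theta1 \<tau> z"
proof -
have "theta1 \<tau> (- z) = - theta2 \<tau> (- (z - \<pi> / 2))" by (simp add: theta1_theta2[OF assms])
also have "... = theta2 \<tau> ((z - \<pi> / 2) + \<pi>)"
 by (subst theta2_plus_pi[OF assms]) (simp only: theta2_minus)
also have "(z - \<pi> / 2) + \<pi> = z + \<pi> / 2" by (simp add: field_simps)
finally show ?thesis by (simp add: theta1_theta2[OF assms])
qed

lemma theta4_minus [simp]: "theta4 \<tau> (- z) = theta4 \<tau> z" by (simp add: theta4_def)

lemma theta3_minus [simp]: "theta3 \<tau> (- z) = theta3 \<tau> z" by (simp add: theta3_def)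

lemma theta_holomorphic:
 assumes "Im \<tau> > 0"
 shows "entire (theta1 \<tau>)" "entire (theta2 \<tau>)"
  "entire (theta3 \<tau>)" "entire (theta4 \<tau>)"
proof -
have c: "entire (%z. jth \<tau> (z + a))" for a
 by (intro entire_compose[OF jth_holomorphic[OF assms]] holomorphic_intros)
have 2: "theta2 \<tau> = (%z. qpow \<tau> (1/4) * exp (\<i> * z) * jth \<tau> (z + \<pi> * \<tau> / 2))"
 using theta2_jth[OF assms] by auto
show h2: "entire (theta2 \<tau>)" unfolding 2 by (intro holomorphic_intros c)
have "theta1 \<tau> = (%z. - theta2 \<tau> (z + \<pi> / 2))" using theta1_theta2[OF assms] by auto
moreover have "entire (%z. theta2 \<tau> (z + \<pi> / 2))"
 by (intro entire_compose[OF h2] holomorphic_intros)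
ultimately show "entire (theta1 \<tau>)" by (auto intro!: holomorphic_intros)
have "theta4 \<tau> = (%z. jth \<tau> (z + \<pi> / 2))" using theta4_jth[OF assms] by auto
thus "entire (theta4 \<tau>)" using c by simp
have "theta3 \<tau> = jth \<tau>" using theta3_jth[OF assms] by auto
thus "entire (theta3 \<tau>)" using jth_holomorphic[OF assms] by simp
qed

lemma has_sum_product:
 fixes f :: "'a => complex" and g :: "'b => complex"
 assumes f: "(%x. norm (f x)) summable_on UNIV" "(f has_sum F) UNIV"
  and g: "(%x. norm (g x)) summable_on UNIV" "(g has_sum G) UNIV"
 shows "((%(x, y). f x * g y) has_sum F * G) UNIV"
proof -
have "(%z. norm (f (fst z) * g (snd z))) summable_on Sigma UNIV (%_. UNIV)"
proof (rule summable_on_SigmaI)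
 show "((%y. norm (f (fst (x, y)) * g (snd (x, y)))) has_sum norm (f x) * (\<Sum>\<^sub>\<infinity>y. norm (g y))) UNIV" for x
  using has_sum_cmult_right[OF has_sum_infsum[OF g(1)], of "norm (f x)"] by (simp add: norm_mult)
 show "(%x. norm (f x) * (\<Sum>\<^sub>\<infinity>y. norm (g y))) summable_on UNIV"
  using f(1) by (rule summable_on_cmult_left)
qed auto
hence s: "(%z. f (fst z) * g (snd z)) summable_on Sigma UNIV (%_. UNIV)"
 by (rule abs_summable_summable)
have "((%z. f (fst z) * g (snd z)) has_sum F * G) (Sigma UNIV (%_. UNIV))"
proof (rule has_sum_SigmaI[OF _ _ s])
 show "((%y. f (fst (x, y)) * g (snd (x, y))) has_sum f x * G) UNIV" for x
  using has_sum_cmult_right[OF g(2), of "f x"] by simp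
 show "((%x. f x * G) has_sum F * G) UNIV" using f(2) by (rule has_sum_cmult_left)
qed
thus ?thesis by (simp add: case_prod_unfold)
qed

text \<open>The double series of \<open>\<theta>\<^sub>3(u)\<theta>\<^sub>3(v)\<close>, restricted to pairs of equal parity, factorises in the
 variables \<open>m + n\<close> and \<open>m - n\<close>.\<close>

lemma theta3_product:
 assumes "Im \<tau> > 0"
 shows "theta3 \<tau> u * theta3 \<tau> v + theta4 \<tau> u * theta4 \<tau> v
    = 2 * (theta3 (2 * \<tau>) (u + v) * theta3 (2 * \<tau>) (u - v))"
proof -
let ?A = "jth \<tau> u * jth \<tau> v + jth \<tau> (u + \<pi> / 2) * jth \<tau> (v + \<pi> / 2)"
let ?B = "%(m, n). (m + n, m - n)"
have a2: "Im (2 * \<tau>) > 0" using assms by simp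
define f where "f = (%(k, l). jterm \<tau> u k * jterm \<tau> v l)"
define g where "g = (%(k, l). jterm \<tau> (u + \<pi> / 2) k * jterm \<tau> (v + \<pi> / 2) l)"
define E where "E = {(k :: int, l :: int). even (k + l)}"
have f: "(f has_sum jth \<tau> u * jth \<tau> v) UNIV" unfolding f_def
 by (intro has_sum_product jterm_abs_summable jth_has_sum assms)
have g: "(g has_sum jth \<tau> (u + \<pi> / 2) * jth \<tau> (v + \<pi> / 2)) UNIV" unfolding g_def
 by (intro has_sum_product jterm_abs_summable jth_has_sum assms)
have sh: "jterm \<tau> (z + \<pi> / 2) k = (if even k then jterm \<tau> z k else - jterm \<tau> z k)" for z k
proof -
 have "jterm \<tau> (z + \<pi> / 2) k = jterm \<tau> z k * exp (\<i> * of_int k * \<pi>)"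
  by (simp add: jterm_def exp_add[symmetric] alg)
 moreover have "exp (\<i> * of_int k * \<pi>) = (if even k then 1 else -1)"
 proof (cases "even k")
  case True
  then obtain m where "k = 2 * m" by blast
  thus ?thesis using exp_integer_2pi[of "of_int m"] by (simp add: mult_ac)
 next
  case False
  then obtain m where "k = 2 * m + 1" using oddE by blast
  thus ?thesis using exp_integer_2pi[of "of_int m"] by (simp add: mult_ac distrib_left distrib_right exp_add)
 qed
 ultimately show ?thesis by simp
qed
have fg: "f x + g x = (if x \<in> E then 2 * f x else 0)" for x
 by (cases x) (auto simp: f_def g_def sh E_def)
have "((%x. 2 * f x) has_sum ?A) E"
proof -
 have "((%x. if x \<in> E then 2 * f x else 0) has_sum
   ?A) UNIV"
  using has_sum_add[OF f g] unfolding fg .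
 thus ?thesis by (rule has_sum_cong_neutral[THEN iffD1, rotated -1]) auto
qed
moreover have "E = range ?B"
proof (intro equalityI subsetI)
 fix x assume "x \<in> E"
 then obtain k l where x: "x = (k, l)" "even (k + l)" by (auto simp: E_def)
 have "k = (k + l) div 2 + (k - l) div 2" "l = (k + l) div 2 - (k - l) div 2" using x(2) by presburger+
 thus "x \<in> range ?B" unfolding x
  by (intro image_eqI[where x = "((k + l) div 2, (k - l) div 2)"]) auto
qed (auto simp: E_def)
moreover have "inj (%(m :: int, n). (m + n, m - n))" by (auto simp: inj_on_def)
ultimately have h1: "(((%x. 2 * f x) \<circ> ?B) has_sum
   ?A) UNIV"
 by (simp only: has_sum_reindex)
have h2: "((%x. 2 * f x) \<circ> ?B)
  = (%z. 2 * (case z of (m, n) => jterm (2 * \<tau>) (u + v) m * jterm (2 * \<tau>) (u - v) n))"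
proof -
 have "f (m + n, m - n) = jterm (2 * \<tau>) (u + v) m * jterm (2 * \<tau>) (u - v) n" for m n
  unfolding f_def jterm_def prod.case exp_add[symmetric]
  by (rule exp_cong) (simp add: power2_eq_square alg)
 thus ?thesis by (auto simp: fun_eq_iff)
qed
have h3: "((%z. 2 * (case z of (m, n) => jterm (2 * \<tau>) (u + v) m * jterm (2 * \<tau>) (u - v) n)) has_sum
  2 * (jth (2 * \<tau>) (u + v) * jth (2 * \<tau>) (u - v))) UNIV"
 by (intro has_sum_cmult_right has_sum_product jterm_abs_summable jth_has_sum a2)
have "jth \<tau> u * jth \<tau> v + jth \<tau> (u + \<pi> / 2) * jth \<tau> (v + \<pi> / 2)
  = 2 * (jth (2 * \<tau>) (u + v) * jth (2 * \<tau>) (u - v))"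
 by (rule has_sum_unique[OF h1[unfolded h2] h3])
thus ?thesis by (simp add: theta3_jth[OF assms] theta4_jth[OF assms] theta3_jth[OF a2])
qed

text \<open>A fixed modulus. The products \<open>th3 u * th3 v\<close> and the like are bilinear in the functions
 \<open>d1, ..., d4\<close> of the doubled modulus.\<close>

locale modulus =
 fixes \<tau> :: complex
 assumes im: "Im \<tau> > 0"
begin

abbreviation th1 where "th1 \<equiv> theta1 \<tau>"
abbreviation th2 where "th2 \<equiv> theta2 \<tau>"
abbreviation th3 where "th3 \<equiv> theta3 \<tau>"
abbreviation th4 where "th4 \<equiv> theta4 \<tau>"
abbreviation d1 where "d1 \<equiv> theta1 (2 * \<tau>)"
abbreviation d2 where "d2 \<equiv> theta2 (2 * \<tau>)"
abbreviation d3 where "d3 \<equiv> theta3 (2 * \<tau>)"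
abbreviation d4 where "d4 \<equiv> theta4 (2 * \<tau>)"
abbreviation pt where "pt \<equiv> \<pi> * \<tau>"

lemma im2: "Im (2 * \<tau>) > 0" using im by simp

lemma theta3_product_minus:
 "th3 u * th3 v - th4 u * th4 v
   = 2 * (d2 (u + v) * d2 (u - v))"
proof -
have ag: "x * y - z * w = 2 * (p * r)"
 if "N * x * y + - N * z * w = 2 * ((q * p) * (q' * r))" "q * q' = N" "N ~= 0" for x y z w p q q' r N :: complex
proof -
 have "N * (x * y - z * w) = N * x * y + - N * z * w" by (simp add: alg)
 also have "... = (q * q') * (2 * (p * r))" unfolding that(1) by simp
 finally show ?thesis using that(2,3) by simp
qed
define N where "N = exp (- \<i> * \<pi> * \<tau> - 2 * \<i> * u)"
have "d3 (u + pt + v) = qhalf (2 * \<tau>) (u + v) * d2 (u + v)"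
 using theta3_plus_tau_half[OF im2, of "u + v"] by (simp add: add_ac)
moreover have "d3 (u + pt - v) = qhalf (2 * \<tau>) (u - v) * d2 (u - v)"
 using theta3_plus_tau_half[OF im2, of "u - v"] by (simp add: alg)
moreover have "qhalf (2 * \<tau>) (u + v) * qhalf (2 * \<tau>) (u - v) = N"
 unfolding qhalf_def qpow_def exp_add[symmetric] N_def by (rule exp_cong) (simp add: field_simps)
moreover have "N ~= 0" by (simp add: N_def)
ultimately show ?thesis
 using theta3_product[OF im, of "u + pt" v] ag
 unfolding theta_plus_tau(3,4)[OF im, of u, folded N_def] by metis
qed

lemma theta3_theta3:
 "th3 u * th3 v = d3 (u + v) * d3 (u - v)
   + d2 (u + v) * d2 (u - v)"
proof -
have "x = p + q" if "x + y = 2 * p" "x - y = 2 * q" for x y p q :: complex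
proof -
 have "2 * x = (x + y) + (x - y)" by simp
 also have "... = 2 * (p + q)" unfolding that by (simp add: alg)
 finally show ?thesis by (metis mult_left_cancel zero_neq_numeral)
qed
from this[OF theta3_product[OF im, of u v] theta3_product_minus[of u v]] show ?thesis .
qed

lemma theta3_theta4:
 "th3 u * th4 v = d4 (u + v) * d4 (u - v)
   - d1 (u + v) * d1 (u - v)"
proof -
have "d3 (u + (v + \<pi> / 2)) = d4 (u + v)"
 "d2 (u + (v + \<pi> / 2)) = - d1 (u + v)"
 using theta3_plus_half[OF im2, of "u + v"] theta2_plus_half[OF im2, of "u + v"] by (simp_all add: add_ac)
moreover have "d3 (u - (v + \<pi> / 2)) = d4 (u - v)"
 "d2 (u - (v + \<pi> / 2)) = d1 (u - v)"
 using theta4_plus_half[OF im2, of "u - v - \<pi> / 2"] theta1_plus_half[OF im2, of "u - v - \<pi> / 2"]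
 by (simp_all add: diff_diff_eq)
ultimately show ?thesis
 using theta3_theta3[of u "v + \<pi> / 2"] theta3_plus_half[OF im, of v] by simp
qed

lemma theta2_theta2:
 "th2 u * th2 v = d2 (u + v) * d3 (u - v)
   + d3 (u + v) * d2 (u - v)"
proof -
let ?h = "pt / 2"
have s: "u + ?h + (v + ?h) = (u + v) + \<pi> * (2 * \<tau>) / 2" "u + ?h - (v + ?h) = u - v" by simp_all
have q: "qhalf \<tau> u * qhalf \<tau> v = qhalf (2 * \<tau>) (u + v)"
 unfolding qhalf_def qpow_def exp_add[symmetric] by (rule exp_cong) (simp add: field_simps)
have ag: "x * y = p * r + p' * r'"
 if "k * x * (l * y) = (m * p) * r + (m * p') * r'" "k * l = m" "m ~= 0" for k l m x y p r p' r' :: complex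
proof -
 have "(k * l) * (x * y) = m * (p * r + p' * r')" using that(1) by (simp add: alg)
 thus ?thesis using that(2,3) by simp
qed
show ?thesis
 using theta3_theta3[of "u + ?h" "v + ?h"]
 unfolding s theta3_plus_tau_half[OF im] theta3_plus_tau_half[OF im2] theta2_plus_tau_half[OF im2]
 by (rule ag[OF _ q qhalf_nonzero])
qed

lemma theta1_theta2_prod:
 "th1 u * th2 v = d1 (u + v) * d4 (u - v)
   + d4 (u + v) * d1 (u - v)"
proof -
let ?h = "\<pi> / 2"
have s: "u - ?h + v = (u + v) - ?h" "u - ?h - v = (u - v) - ?h" by simp_all
have "th2 (u - ?h) = th1 u" using theta1_plus_half[OF im, of "u - ?h"] by simp
moreover have "d2 (x - ?h) = d1 x" "d3 (x - ?h) = d4 x" for x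
 using theta1_plus_half[OF im2, of "x - ?h"] theta4_plus_half[OF im2, of "x - ?h"] by simp_all
ultimately show ?thesis using theta2_theta2[of "u - ?h" v] unfolding s by simp
qed

lemma theta1_theta1:
 "th1 u * th1 v = d3 (u + v) * d2 (u - v)
   - d2 (u + v) * d3 (u - v)"
proof -
let ?h = "\<pi> / 2"
have s: "u - ?h + (v - ?h) = (u + v) - \<pi>" "u - ?h - (v - ?h) = u - v" by simp_all
have "th2 (x - ?h) = th1 x" for x using theta1_plus_half[OF im, of "x - ?h"] by simp
moreover have "d2 (x - \<pi>) = - d2 x" "d3 (x - \<pi>) = d3 x" for x
 using theta2_plus_pi[OF im2, of "x - \<pi>"] theta3_plus_pi[OF im2, of "x - \<pi>"] by simp_all
ultimately show ?thesis using theta2_theta2[of "u - ?h" "v - ?h"] unfolding s by simp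
qed

text \<open>The mixed Riemann relation. All identities for the R-matrix and the K-matrix below are
 instances of it.\<close>

lemma riemann_mixed:
 "th1 a * th2 b * th3 c * th4 d + th2 a * th1 b * th4 c * th3 d
  + th3 a * th4 b * th1 c * th2 d + th4 a * th3 b * th2 c * th1 d
  = 2 * th1 ((a + b + c + d) / 2) * th2 ((a + b - c - d) / 2)
    * th3 ((a - b + c - d) / 2) * th4 ((a - b - c + d) / 2)"
proof -
note m = theta1_minus[OF im2] theta4_minus
have 1: "th1 u * th2 v * th3 w * th4 z
  = (d1 (u + v) * d4 (u - v) + d4 (u + v) * d1 (u - v))
  * (d4 (w + z) * d4 (w - z) - d1 (w + z) * d1 (w - z))"
 for u v w z using theta1_theta2_prod[of u v] theta3_theta4[of w z] by (simp add: mult.assoc)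
have alg2: "y * x * (w * z) = P" if "x * y * z * w = P" for x y z w P :: complex using that by (simp add: mult_ac)
have t1: "th1 a * th2 b * th3 c * th4 d
  = (d1 (a + b) * d4 (a - b) + d4 (a + b) * d1 (a - b))
  * (d4 (c + d) * d4 (c - d) - d1 (c + d) * d1 (c - d))"
 by (rule 1)
have sw: "d1 (y - x) = - d1 (x - y)" "d4 (y - x) = d4 (x - y)" for x y
 using m(1)[of "x - y"] m(2)[of "2 * \<tau>" "x - y"] by simp_all
have t2: "th2 a * th1 b * th4 c * th3 d
  = (d1 (a + b) * d4 (a - b) - d4 (a + b) * d1 (a - b))
  * (d4 (c + d) * d4 (c - d) + d1 (c + d) * d1 (c - d))"
 using alg2[OF 1[of b a d c]] unfolding add.commute[of b a] add.commute[of d c] sw[of b a] sw[of d c] by (simp add: alg)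
have t3: "th3 a * th4 b * th1 c * th2 d
  = (d1 (c + d) * d4 (c - d) + d4 (c + d) * d1 (c - d))
  * (d4 (a + b) * d4 (a - b) - d1 (a + b) * d1 (a - b))"
 using 1[of c d a b] by (metis mult.assoc mult.commute)
have t4: "th4 a * th3 b * th2 c * th1 d
  = (d1 (c + d) * d4 (c - d) - d4 (c + d) * d1 (c - d))
  * (d4 (a + b) * d4 (a - b) + d1 (a + b) * d1 (a - b))"
 using alg2[OF 1[of d c b a]] unfolding add.commute[of b a] add.commute[of d c] sw[of b a] sw[of d c] by (simp add: alg)
have h: "(a + b + c + d) / 2 + (a + b - c - d) / 2 = a + b" "(a + b + c + d) / 2 - (a + b - c - d) / 2 = c + d"
 "(a - b + c - d) / 2 + (a - b - c + d) / 2 = a - b" "(a - b + c - d) / 2 - (a - b - c + d) / 2 = c - d"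
 by (simp_all add: field_simps)
have "th1 ((a + b + c + d) / 2) * th2 ((a + b - c - d) / 2)
   * th3 ((a - b + c - d) / 2) * th4 ((a - b - c + d) / 2)
  = (d1 (a + b) * d4 (c + d) + d4 (a + b) * d1 (c + d))
  * (d4 (a - b) * d4 (c - d) - d1 (a - b) * d1 (c - d))"
 using 1[of "(a + b + c + d) / 2" "(a + b - c - d) / 2" "(a - b + c - d) / 2" "(a - b - c + d) / 2"] unfolding h .
hence e: "2 * th1 ((a + b + c + d) / 2) * th2 ((a + b - c - d) / 2)
   * th3 ((a - b + c - d) / 2) * th4 ((a - b - c + d) / 2)
  = 2 * ((d1 (a + b) * d4 (c + d) + d4 (a + b) * d1 (c + d))
  * (d4 (a - b) * d4 (c - d) - d1 (a - b) * d1 (c - d)))"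
 by (simp only: mult.assoc)
show ?thesis unfolding t1 t2 t3 t4 e
 by (simp only: ring_distribs mult_2) (simp only: alg)
qed

lemma theta1_zero [simp]: "th1 0 = 0"
 using theta1_minus[OF im, of 0] by simp

text \<open>If the four arguments sum up to zero, the right-hand side vanishes.\<close>

lemma riemann_mixed_zero:
 assumes "a + b + c + d = 0"
 shows "th1 a * th2 b * th3 c * th4 d + th2 a * th1 b * th4 c * th3 d
  + th3 a * th4 b * th1 c * th2 d + th4 a * th3 b * th2 c * th1 d = 0"
proof -
have "th1 ((a + b + c + d) / 2) = 0" unfolding assms by simp
thus ?thesis by (subst riemann_mixed) (simp only: mult_zero_right mult_zero_left)
qed

text \<open>The degenerate elliptic coordinates: \<open>theta_s\<close> is a \<open>2\<times>2\<close> determinant.\<close>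

lemma theta1_sym_det:
 "th1 (z - w) * th1 (z + w)
   = d3 (2 * z) * d2 (2 * w) - d2 (2 * z) * d3 (2 * w)"
proof -
have s: "z - w + (z + w) = 2 * z" "z - w - (z + w) = - (2 * w)" by simp_all
show ?thesis using theta1_theta1[of "z - w" "z + w"] unfolding s theta2_minus theta3_minus .
qed

end

section \<open>Entire functions: division and double periodicity\<close>

lemma entire_mult_zero:
 fixes f g :: "complex => complex"
 assumes f: "entire f" and g: "entire g"
  and 0: "!!z. f z * g z = 0" and nz: "g w ~= 0"
 shows "f z = 0"
proof -
have "continuous_on UNIV g" using g holomorphic_on_imp_continuous_on by blast
hence "open {z. g z ~= 0}"
 using open_Collect_neq[of g "%_. 0"] by simp
thus ?thesis
 using analytic_continuation_open[of "{z. g z ~= 0}" UNIV f "%_. 0" z] f 0 nz by auto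
qed

lemma entire_eq_off_zeros:
 fixes f g h :: "complex => complex"
 assumes "entire f" "entire g" "entire h"
  and "!!z. h z ~= 0 ==> f z = g z" and "h w ~= 0"
 shows "f z = g z"
proof -
have "entire (%z. f z - g z)" using assms by (intro holomorphic_intros)
moreover have "(f z - g z) * h z = 0" for z using assms(4)[of z] by (cases "h z = 0") auto
ultimately have "f z - g z = 0" using entire_mult_zero assms(3,5) by blast
thus ?thesis by simp
qed

lemma entire_divide:
 fixes f g :: "complex => complex"
 assumes f: "entire f" and g: "entire g"
  and simple: "!!z. g z = 0 ==> deriv g z ~= 0" and zero: "!!z. g z = 0 ==> f z = 0"
 obtains h where "entire h" "!!z. f z = h z * g z"
proof -
define h where "h z = (if g z = 0 then deriv f z / deriv g z else f z / g z)" for z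
have cg: "continuous_on UNIV g" using g holomorphic_on_imp_continuous_on by blast
have "h field_differentiable (at z)" for z
proof (cases "g z = 0")
 case False
 have op: "open {w. g w ~= 0}" using open_Collect_neq[OF cg, of "%_. 0"] by simp
 have "(%w. f w / g w) holomorphic_on {w. g w ~= 0}"
  by (intro holomorphic_intros) (use f g in \<open>auto intro: holomorphic_on_subset\<close>)
 hence "h holomorphic_on {w. g w ~= 0}" by (rule holomorphic_transform) (simp add: h_def)
 thus ?thesis using op False by (simp add: holomorphic_on_open field_differentiable_def)
next
 case True
 define F where "F = (%w. if w = z then deriv f z else (f w - f z) / (w - z))"
 define G where "G = (%w. if w = z then deriv g z else (g w - g z) / (w - z))"
 have F: "entire F" unfolding F_def by (rule pole_lemma[OF f]) simp
 have G: "entire G" unfolding G_def by (rule pole_lemma[OF g]) simp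
 have Gz: "G z ~= 0" using simple[OF True] by (simp add: G_def)
 have cG: "continuous_on UNIV G" using G holomorphic_on_imp_continuous_on by blast
 have op: "open {w. G w ~= 0}" using open_Collect_neq[OF cG, of "%_. 0"] by simp
 have "(%w. F w / G w) holomorphic_on {w. G w ~= 0}"
  by (intro holomorphic_intros) (use F G in \<open>auto intro: holomorphic_on_subset\<close>)
 moreover have "F w / G w = h w" if "G w ~= 0" for w
 proof (cases "w = z")
  case True
  thus ?thesis using \<open>g z = 0\<close> by (simp add: F_def G_def h_def)
 next
  case False
  thus ?thesis using that True zero[OF True] by (auto simp: F_def G_def h_def)
 qed
 ultimately have "h holomorphic_on {w. G w ~= 0}" by (rule holomorphic_transform) simp
 thus ?thesis using op Gz by (simp add: holomorphic_on_open field_differentiable_def)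
qed
hence "entire h" by (simp add: holomorphic_on_def field_differentiable_at_within)
moreover have "f z = h z * g z" for z using zero[of z] by (simp add: h_def)
ultimately show ?thesis using that by blast
qed

lemma int_periodic:
 fixes p :: complex
 assumes "!!z. P (z + p) = (P z :: bool)"
 shows "P (z + of_int n * p) = P z"
proof (induction n arbitrary: z rule: int_induct[where k = 0])
case (step1 i)
have "P (z + of_int (i + 1) * p) = P ((z + of_int i * p) + p)" by (simp add: alg)
thus ?case using assms step1 by simp
next
case (step2 i)
have "P (z + of_int i * p) = P ((z + of_int (i - 1) * p) + p)" by (simp add: alg)
thus ?case using assms step2 by simp
qed simp

lemma doubly_periodic_const:
 assumes t: "Im \<tau> > 0" and f: "entire f"
  and p1: "!!z. f (z + \<pi>) = f z" and p2: "!!z. f (z + \<pi> * \<tau>) = f z"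
 shows "\<exists>c. \<forall>z. f z = (c :: complex)"
proof -
define K where "K = (%(s, t). of_real s * \<pi> + of_real t * (\<pi> * \<tau>)) ` ({0..1 :: real} \<times> {0..1 :: real})"
have "compact K" unfolding K_def
 by (intro compact_continuous_image compact_Times) (auto simp: case_prod_unfold intro!: continuous_intros)
moreover have "continuous_on K f" using f holomorphic_on_imp_continuous_on continuous_on_subset by blast
ultimately have bd: "bounded (f ` K)" by (intro compact_imp_bounded compact_continuous_image)
have "range f \<subseteq> f ` K"
proof clarify
 fix z
 define t where "t = Im z / (pi * Im \<tau>)"
 define s where "s = (Re z - t * pi * Re \<tau>) / pi"
 have z: "z = of_real s * \<pi> + of_real t * (\<pi> * \<tau>)"
  using \<open>Im \<tau> > 0\<close> by (intro complex_eqI) (auto simp: s_def t_def)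
 let ?w = "of_real (frac s) * \<pi> + of_real (frac t) * (\<pi> * \<tau>)"
 have "z = ?w + of_int \<lfloor>s\<rfloor> * \<pi> + of_int \<lfloor>t\<rfloor> * (\<pi> * \<tau>)"
  unfolding z frac_def by (simp add: alg)
 hence "f z = f ?w"
  using int_periodic[of "%z. f z = f ?w" "\<pi>" ?w "\<lfloor>s\<rfloor>"]
   int_periodic[of "%z. f z = f ?w" "\<pi> * \<tau>" "?w + of_int \<lfloor>s\<rfloor> * \<pi>" "\<lfloor>t\<rfloor>"] p1 p2 by simp
 moreover have "?w \<in> K" unfolding K_def
  by (rule image_eqI[where x = "(frac s, frac t)"]) (auto simp: frac_lt_1 less_imp_le)
 ultimately show "f z \<in> f ` K" by auto
qed
hence "bounded (range f)" using bd bounded_subset by blast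
thus ?thesis using Liouville_theorem[OF f] by (auto simp: constant_on_def)
qed

section \<open>The zeros of the theta function\<close>

text \<open>That \<open>\<theta>\<^sub>1\<close> does not vanish identically is assumed rather than proved: it is immediate whenever
 \<open>\<theta>(\<alpha>) ~= 0\<close> for a boundary parameter. Everything about the zeros follows from it.\<close>

locale theta_nz = modulus +
 assumes nz: "\<exists>z. theta1 \<tau> z ~= 0"
begin

text \<open>The period lattice.\<close>

definition lat :: "complex set" where
 "lat = {of_int a * \<pi> + of_int b * pt | a b. True}"

text \<open>\<open>theta_s\<close>, the elliptic analogue of a difference of two coordinates.\<close>

definition ts :: "complex => complex => complex" where
 "ts z w = th1 (z - w) * th1 (z + w)"

text \<open>The coordinates \<open>(tA : tB)\<close> of a point on the projective line; \<open>ts\<close> is their determinant.\<close>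

definition tA where "tA z = d3 (2 * z)"
definition tB where "tB z = d2 (2 * z)"

lemma ts_AB: "ts z w = tA z * tB w - tB z * tA w"
 unfolding ts_def tA_def tB_def by (rule theta1_sym_det)

lemma theta1_entire: "entire th1" by (rule theta_holomorphic[OF im])

lemma theta1_hol [holomorphic_intros]: "g holomorphic_on S ==> (%z. th1 (g z)) holomorphic_on S"
 by (rule entire_compose[OF theta1_entire])

lemma im2: "Im (2 * \<tau>) > 0" using im by simp

lemma AB_entire: "entire tA" "entire tB"
 unfolding tA_def tB_def by (intro entire_compose[OF theta_holomorphic(3)[OF im2]]
   entire_compose[OF theta_holomorphic(2)[OF im2]] holomorphic_intros)+

lemma theta1_avoid:
 assumes kl: "k ~= 0" "l ~= 0"
 obtains w where "th1 (a + k * w) ~= 0" "th1 (b + l * w) ~= 0"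
proof -
obtain z where z: "th1 z ~= 0" using nz by blast
have "\<exists>w. th1 (a + k * w) * th1 (b + l * w) ~= 0"
proof (rule ccontr)
 assume "\<not> ?thesis"
 hence *: "th1 (a + k * w) * th1 (b + l * w) = 0" for w by blast
 have "th1 (a + k * w) = 0" for w
  by (rule entire_mult_zero[OF _ _ *, where w = "(z - b) / l"])
    (use z kl in \<open>auto intro!: holomorphic_intros\<close>)
 from this[of "(z - a) / k"] show False using z kl by simp
qed
thus ?thesis using that by auto
qed

lemma AB_nonzero: "tA z ~= 0 \<or> tB z ~= 0"
proof (rule ccontr)
assume "\<not> ?thesis"
hence 0: "ts z w = 0" for w by (simp add: ts_AB)
obtain w where "th1 (z + (-1) * w) ~= 0" "th1 (z + 1 * w) ~= 0"
 using theta1_avoid[of "-1" 1 z z] by auto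
with 0[of w] show False by (simp add: ts_def)
qed

lemma theta1_simple:
 assumes "th1 z1 = 0" shows "deriv th1 z1 ~= 0"
proof
let ?A = "%w. tA w * deriv tB w - tB w * deriv tA w"
assume d0: "deriv th1 z1 = 0"
have dth: "(th1 has_field_derivative deriv th1 w) (at w)" for w
 using theta1_entire by (simp add: holomorphic_derivI)
have dA: "(tA has_field_derivative deriv tA w) (at w)" and dB: "(tB has_field_derivative deriv tB w) (at w)" for w
 using AB_entire by (simp_all add: holomorphic_derivI)
have W: "tA w * deriv tB w - tB w * deriv tA w = 0" for w
proof -
 define z where "z = w + z1"
 have e1: "tA z * tB w = tB z * tA w" using ts_AB[of z w] assms by (simp add: ts_def z_def)
 have "((%s. th1 (z - s) * th1 (z + s)) has_field_derivative 0) (at w)"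
  using assms d0 by (auto intro!: derivative_eq_intros DERIV_chain2[OF dth] simp: z_def)
 moreover have "((%s. tA z * tB s - tB z * tA s) has_field_derivative tA z * deriv tB w - tB z * deriv tA w) (at w)"
  by (auto intro!: derivative_eq_intros dA dB)
 moreover have "(%s. th1 (z - s) * th1 (z + s)) = (%s. tA z * tB s - tB z * tA s)"
  using ts_AB[of z] by (simp add: ts_def fun_eq_iff)
 ultimately have e2: "tA z * deriv tB w - tB z * deriv tA w = 0" using DERIV_unique by metis
 have "tA z * (?A w) = tA w * (tA z * deriv tB w - tB z * deriv tA w)
   - deriv tA w * (tA z * tB w - tB z * tA w)" by (simp add: alg)
 hence 1: "tA z * (?A w) = 0" using e1 e2 by simp
 have "tB z * (?A w) = tB w * (tA z * deriv tB w - tB z * deriv tA w)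
   - deriv tB w * (tA z * tB w - tB z * tA w)" by (simp add: alg)
 hence 2: "tB z * (?A w) = 0" using e1 e2 by simp
 show ?thesis using 1 2 AB_nonzero[of z] by auto
qed
have ts0: "ts z w = 0" for z w
proof (cases "\<exists>x. tA x ~= 0")
 case False thus ?thesis by (simp add: ts_AB)
next
 case True
 then obtain x where x: "tA x ~= 0" by blast
 have "open {z. tA z ~= 0}"
  using open_Collect_neq[of tA "%_. 0"] AB_entire(1) holomorphic_on_imp_continuous_on by simp
 then obtain r where r: "r > 0" "ball x r \<subseteq> {z. tA z ~= 0}" using x open_contains_ball by blast
 have "\<exists>c. \<forall>w\<in>ball x r. tB w / tA w = c"
 proof (rule has_field_derivative_zero_constant)
  fix w assume "w \<in> ball x r"
  hence "tA w ~= 0" using r by blast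
  hence "((%w. tB w / tA w) has_field_derivative 0) (at w)"
   using W[of w] by (auto intro!: derivative_eq_intros dA dB simp: field_simps)
  thus "((%w. tB w / tA w) has_field_derivative 0) (at w within ball x r)"
   by (rule has_field_derivative_at_within)
 qed simp
 then obtain c where c: "!!w. w \<in> ball x r ==> tB w / tA w = c" by blast
 have "tB w = c * tA w" for w
 proof (rule analytic_continuation_open[of "ball x r" UNIV tB "%w. c * tA w"])
  show "tB w = c * tA w" if "w \<in> ball x r" for w using c[OF that] r that by (auto simp: field_simps)
 qed (use r AB_entire in \<open>auto intro!: holomorphic_intros\<close>)
 thus ?thesis by (simp add: ts_AB)
qed
obtain w where "th1 (0 + (-1) * w) ~= 0" "th1 (0 + 1 * w) ~= 0"
 using theta1_avoid[of "-1" 1 0 0] by auto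
with ts0[of 0 w] show False by (simp add: ts_def)
qed

lemma theta1_zero_parallel: "th1 z0 = 0 ==> tA x * tB (x + z0) = tB x * tA (x + z0)"
 using ts_AB[of x "x + z0"] theta1_minus[OF im, of z0] by (simp add: ts_def)

lemma theta1_zeros_add:
 assumes "th1 z = 0" "th1 z0 = 0" shows "th1 (z + z0) = 0"
proof -
obtain x where "th1 ((z + z0) + 2 * x) ~= 0" using theta1_avoid[of 2 2 "z + z0" 0] by auto
hence x: "th1 (x + (x + z + z0)) ~= 0" by (simp add: alg mult_2)
define a b c d e f where "a = tA x" "b = tB x" "c = tA (x + z)" "d = tB (x + z)" "e = tA (x + z + z0)" "f = tB (x + z + z0)"
have p: "a * d = b * c" "c * f = d * e"
 using theta1_zero_parallel[OF assms(1), of x] theta1_zero_parallel[OF assms(2), of "x + z"]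
 unfolding a_b_c_d_e_f_def .
have "c * (a * f - b * e) = 0" "d * (a * f - b * e) = 0"
proof -
 have "c * (a * f - b * e) = a * (c * f) - e * (b * c)" by (simp add: alg)
 also have "... = 0" unfolding p(2) p(1)[symmetric] by simp
 finally show "c * (a * f - b * e) = 0" .
 have "d * (a * f - b * e) = f * (a * d) - b * (d * e)" by (simp add: alg)
 also have "... = 0" unfolding p(1) p(2)[symmetric] by simp
 finally show "d * (a * f - b * e) = 0" .
qed
hence "a * f - b * e = 0" using AB_nonzero[of "x + z"] unfolding a_b_c_d_e_f_def by auto
hence "ts x (x + z + z0) = 0" unfolding ts_AB a_b_c_d_e_f_def .
hence "th1 (- (z + z0)) = 0" using x by (simp add: ts_def)
thus ?thesis by (simp add: theta1_minus[OF im] del: minus_add_distrib)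
qed

theorem theta1_zeros:
 assumes z0: "th1 z0 = 0" shows "z0 \<in> lat"
proof -
have mz0: "th1 (- z0) = 0" using z0 by (simp add: theta1_minus[OF im])
have sh: "entire (%z. th1 (z + z0))" by (intro holomorphic_intros)
obtain e where e: "entire e" "!!z. th1 (z + z0) = e z * th1 z"
 using entire_divide[OF sh theta1_entire theta1_simple] theta1_zeros_add[OF _ z0] by blast
obtain z1 where z1: "th1 z1 ~= 0" using nz by blast
have de: "(e has_field_derivative deriv e w) (at w)" for w using e(1) by (simp add: holomorphic_derivI)
have dth: "(th1 has_field_derivative deriv th1 w) (at w)" for w
 using theta1_entire by (simp add: holomorphic_derivI)
have ne: "e z ~= 0" for z
proof (cases "th1 z = 0")
 case False
 have "th1 (z + z0) ~= 0" using theta1_zeros_add[OF _ mz0, of "z + z0"] False by auto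
 thus ?thesis using e(2)[of z] by auto
next
 case True
 have "((%z. th1 (z + z0)) has_field_derivative deriv th1 (z + z0)) (at z)"
  by (rule DERIV_shift[THEN iffD1, OF dth])
 moreover have "((%z. e z * th1 z) has_field_derivative e z * deriv th1 z) (at z)"
  using True by (auto intro!: derivative_eq_intros de dth)
 ultimately have "deriv th1 (z + z0) = e z * deriv th1 z"
  unfolding e(2) using DERIV_unique by blast
 thus ?thesis using theta1_simple[OF theta1_zeros_add[OF True z0]] by auto
qed
have e1: "e (z + \<pi>) = e z" for z
proof (rule entire_eq_off_zeros[OF _ e(1) theta1_entire _ z1])
 fix z assume "th1 z ~= 0"
 moreover have "e (z + \<pi>) * th1 z = e z * th1 z"
  using e(2)[of "z + \<pi>"] e(2)[of z] theta1_plus_pi[OF im, of z] theta1_plus_pi[OF im, of "z + z0"]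
  by (simp add: add_ac)
 ultimately show "e (z + \<pi>) = e z" by simp
qed (intro entire_compose[OF e(1)] holomorphic_intros)
have e2: "e (z + pt) = exp (- 2 * \<i> * z0) * e z" for z
proof (rule entire_eq_off_zeros[where f = "%z. e (z + pt)" and g = "%z. exp (- 2 * \<i> * z0) * e z",
    OF _ _ theta1_entire _ z1])
 fix z assume t: "th1 z ~= 0"
 define N where "N = exp (- \<i> * \<pi> * \<tau> - 2 * \<i> * z)"
 have N': "exp (- \<i> * \<pi> * \<tau> - 2 * \<i> * (z + z0)) = N * exp (- 2 * \<i> * z0)"
  unfolding N_def exp_add[symmetric] by (rule exp_cong) (simp add: alg)
 have t1: "th1 (z + pt + z0) = - (N * exp (- 2 * \<i> * z0)) * th1 (z + z0)"
  using theta_plus_tau(1)[OF im, of "z + z0"] unfolding N' by (simp add: add_ac)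
 have t2: "th1 (z + pt + z0) = e (z + pt) * (- N * th1 z)"
  unfolding e(2) theta_plus_tau(1)[OF im, of z] N_def ..
 have "e (z + pt) * (- N * th1 z) = - (N * exp (- 2 * \<i> * z0)) * (e z * th1 z)"
  using t1 t2 e(2)[of z] by metis
 hence "N * th1 z * e (z + pt) = N * th1 z * (exp (- 2 * \<i> * z0) * e z)"
  by (simp add: mult_ac)
 moreover have "N * th1 z ~= 0" using t by (simp add: N_def)
 ultimately show "e (z + pt) = exp (- 2 * \<i> * z0) * e z" by (metis mult_left_cancel)
qed (use e(1) in \<open>auto intro!: entire_compose[OF e(1)] holomorphic_intros\<close>)
define L where "L z = deriv e z / e z" for z
have L: "entire L" unfolding L_def
 by (intro holomorphic_intros) (use e(1) ne in auto)
have dsh: "deriv e (z + a) = c * deriv e z" if "!!z. e (z + a) = c * e z" for a c z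
proof -
 have "((%z. e (z + a)) has_field_derivative deriv e (z + a)) (at z)"
  by (rule DERIV_shift[THEN iffD1, OF de])
 moreover have "((%z. c * e z) has_field_derivative c * deriv e z) (at z)"
  by (auto intro!: derivative_eq_intros de)
 ultimately show ?thesis unfolding that using DERIV_unique by blast
qed
have "\<exists>c. \<forall>z. L z = c"
proof (rule doubly_periodic_const[OF im L])
 show "L (z + \<pi>) = L z" for z using dsh[of "\<pi>" 1 z] e1 by (simp add: L_def)
 show "L (z + pt) = L z" for z
  using dsh[of "pt" "exp (- 2 * \<i> * z0)" z, OF e2] e2[of z] by (simp add: L_def)
qed
then obtain \<alpha> where \<alpha>: "!!z. deriv e z = \<alpha> * e z" using ne by (auto simp: L_def field_simps)
have "\<exists>c. \<forall>z\<in>UNIV. e z * exp (- \<alpha> * z) = c"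
proof (rule has_field_derivative_zero_constant)
 show "((%z. e z * exp (- \<alpha> * z)) has_field_derivative 0) (at z within UNIV)" for z
  using \<alpha>[of z] by (auto intro!: derivative_eq_intros de)
qed simp
then obtain c where c: "!!z. e z * exp (- \<alpha> * z) = c" by blast
have ec: "e z = c * exp (\<alpha> * z)" for z
 using c[of z] by (simp add: exp_minus field_simps)
have c0: "c ~= 0" using ne[of 0] ec[of 0] by auto
have "exp (\<alpha> * \<pi>) = 1" using e1[of 0] c0 unfolding ec by simp
then obtain k :: int where k: "\<alpha> * \<pi> = 2 * of_int k * \<pi> * \<i>"
 using exp_eq_1 by (auto simp: complex_eq_iff)
hence k': "\<alpha> = 2 * of_int k * \<i>" by simp
have "exp (\<alpha> * pt) = exp (- 2 * \<i> * z0)" using e2[of 0] c0 unfolding ec by simp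
then obtain m :: int where "\<alpha> * pt = - 2 * \<i> * z0 + (of_int (2 * m) * pi) * \<i>"
 using exp_eq by auto
hence "2 * \<i> * z0 = 2 * \<i> * (of_int m * \<pi> + of_int (- k) * pt)"
 unfolding k' by (simp add: alg)
hence "z0 = of_int m * \<pi> + of_int (- k) * pt"
 by (subst (asm) mult_left_cancel) auto
thus ?thesis unfolding lat_def by blast
qed

lemma theta1_lat_iff: "l \<in> lat ==> th1 (z + l) = 0 \<longleftrightarrow> th1 z = 0"
proof -
assume "l \<in> lat"
then obtain a b where l: "l = of_int a * \<pi> + of_int b * pt" by (auto simp: lat_def)
have "(th1 (z + of_int a * \<pi> + of_int b * pt) = 0)
  = (th1 (z + of_int a * \<pi>) = 0)"
 by (rule int_periodic) (simp add: theta_plus_tau[OF im])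
also have "... = (th1 z = 0)"
 by (rule int_periodic) (simp add: theta1_plus_pi[OF im])
finally show ?thesis unfolding l by (simp add: add_ac)
qed

theorem theta1_eq_0_iff: "th1 z = 0 \<longleftrightarrow> z \<in> lat"
 using theta1_zeros theta1_lat_iff[of z 0] theta1_zero by auto

section \<open>Even theta functions and interpolation\<close>

text \<open>The quasi-period factor of \<open>\<theta>\<^sub>3\<close>; that of \<open>\<theta>\<^sub>1\<close> is \<open>- qper z\<close>.\<close>

definition qper :: "complex => complex" where
 "qper z = exp (- \<i> * \<pi> * \<tau> - 2 * \<i> * z)"

lemma qper_nonzero [simp]: "qper z ~= 0" by (simp add: qper_def)

lemma qper_mult: "qper (z + w) * qper (z - w) = (qper z)\<^sup>2"
 unfolding qper_def exp_add[symmetric] power2_eq_square by (rule exp_cong) (simp add: alg)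

lemma qper_shift: "qper (z + w) = qper z * exp (- 2 * \<i> * w)"
 unfolding qper_def exp_add[symmetric] by (rule exp_cong) (simp add: alg)

text \<open>Even theta functions of order \<open>2n\<close>; this space has dimension \<open>n + 1\<close>.\<close>

definition even_theta :: "nat => (complex => complex) => bool" where
 "even_theta n f \<longleftrightarrow> entire f \<and> (\<forall>z. f (- z) = f z) \<and>
   (\<forall>z. f (z + \<pi>) = f z) \<and>
   (\<forall>z. f (z + pt) = (qper z) ^ (2 * n) * f z)"

lemma even_thetaI:
 assumes "entire f" "!!z. f (- z) = f z" "!!z. f (z + \<pi>) = f z"
  "!!z. f (z + pt) = (qper z) ^ (2 * n) * f z"
 shows "even_theta n f"
 unfolding even_theta_def using assms by blast

lemma even_thetaD:
 assumes "even_theta n f"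
 shows "entire f" "f (- z) = f z" "f (z + \<pi>) = f z"
  "f (z + pt) = (qper z) ^ (2 * n) * f z"
 using assms unfolding even_theta_def by blast+

lemma even_theta_add: "even_theta n f ==> even_theta n g ==> even_theta n (%z. f z + g z)"
 by (rule even_thetaI) (auto simp: even_thetaD(2-4) distrib_left intro!: holomorphic_intros dest: even_thetaD(1))

lemma even_theta_cmult: "even_theta n f ==> even_theta n (%z. c * f z)"
 by (rule even_thetaI) (auto simp: even_thetaD(2-4) intro!: holomorphic_intros dest: even_thetaD(1))

lemma even_theta_diff: "even_theta n f ==> even_theta n g ==> even_theta n (%z. f z - g z)"
 by (rule even_thetaI) (auto simp: even_thetaD(2-4) right_diff_distrib intro!: holomorphic_intros dest: even_thetaD(1))

lemma even_theta_zero: "even_theta n (%z. 0)"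
 by (rule even_thetaI) auto

lemma even_theta_sum: "finite I ==> (!!i. i \<in> I ==> even_theta n (f i)) ==> even_theta n (%z. \<Sum>i\<in>I. f i z)"
 by (induction I rule: finite_induct) (auto intro: even_theta_zero even_theta_add)

lemma even_theta_mult:
 assumes f: "even_theta m f" and g: "even_theta n g"
 shows "even_theta (m + n) (%z. f z * g z)"
proof (rule even_thetaI)
fix z
show "f (z + pt) * g (z + pt) = qper z ^ (2 * (m + n)) * (f z * g z)"
 unfolding even_thetaD(4)[OF f] even_thetaD(4)[OF g] distrib_left power_add by (simp only: mult_ac)
qed (auto simp: even_thetaD(2,3)[OF f] even_thetaD(2,3)[OF g] intro!: holomorphic_intros even_thetaD(1)[OF f] even_thetaD(1)[OF g])

lemma even_theta_one: "even_theta 0 (%z. 1)" by (rule even_thetaI) auto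

lemma even_theta_prod:
 "finite I ==> (!!i. i \<in> I ==> even_theta 1 (f i)) ==> even_theta (card I) (%z. \<Prod>i\<in>I. f i z)"
proof (induction I rule: finite_induct)
case (insert x F)
hence "even_theta (1 + card F) (%z. f x z * (\<Prod>i\<in>F. f i z))" by (intro even_theta_mult) auto
thus ?case using insert by simp
qed (simp add: even_theta_one)

lemma ts_minus: "ts w z = - ts z w"
 using theta1_minus[OF im, of "z - w"] by (simp add: ts_def add.commute)

lemma ts_minus_left [simp]: "ts (- z) w = ts z w"
proof -
have s: "- z - w = - (z + w)" "- z + w = - (z - w)" by simp_all
show ?thesis unfolding ts_def s theta1_minus[OF im] by simp
qed

lemma ts_self [simp]: "ts z z = 0" by (simp add: ts_def theta1_zero)

lemma ts_even_theta: "even_theta 1 (%z. ts z w)"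
proof (rule even_thetaI)
show "entire (%z. ts z w)" unfolding ts_def by (intro holomorphic_intros)
fix z
show "ts (- z) w = ts z w" by simp
show "ts (z + \<pi>) w = ts z w"
 using theta1_plus_pi[OF im, of "z + w"] theta1_plus_pi[OF im, of "z - w"]
 by (simp add: ts_def alg)
have "ts (z + pt) w = (- qper (z - w) * th1 (z - w)) * (- qper (z + w) * th1 (z + w))"
 unfolding ts_def qper_def theta_plus_tau(1)[OF im, symmetric] by (simp add: alg)
also have "... = (qper (z + w) * qper (z - w)) * ts z w" by (simp add: ts_def mult_ac)
finally show "ts (z + pt) w = qper z ^ (2 * 1) * ts z w" by (simp add: qper_mult)
qed

lemma ts_zero_iff: "ts z w = 0 \<longleftrightarrow> z - w \<in> lat \<or> z + w \<in> lat"
 by (simp add: ts_def theta1_eq_0_iff)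

lemma even_theta_lat_zero:
 assumes "even_theta n f" "l \<in> lat" shows "f (z + l) = 0 \<longleftrightarrow> f z = 0"
proof -
from assms(2) obtain a b where l: "l = of_int a * \<pi> + of_int b * pt" by (auto simp: lat_def)
have "(f (z + of_int a * \<pi> + of_int b * pt) = 0) = (f (z + of_int a * \<pi>) = 0)"
 by (rule int_periodic) (simp add: even_thetaD(4)[OF assms(1)])
also have "... = (f z = 0)"
 by (rule int_periodic) (simp add: even_thetaD(3)[OF assms(1)])
finally show ?thesis unfolding l by (simp add: add_ac)
qed

lemma even_theta_zero_at:
 assumes "even_theta n f" "f x = 0" "ts z x = 0" shows "f z = 0"
proof -
from assms(3) consider "z - x \<in> lat" | "z + x \<in> lat" by (auto simp: ts_zero_iff)
thus ?thesis
proof cases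
 case 1 thus ?thesis using even_theta_lat_zero[OF assms(1), of "z - x" x] assms(2) by simp
next
 case 2 thus ?thesis
  using even_theta_lat_zero[OF assms(1), of "z + x" "-x"] assms(2) even_thetaD(2)[OF assms(1), of x] by simp
qed
qed

lemma ts_nonzero_ex: "\<exists>z. ts z x ~= 0"
proof -
obtain w where "th1 (- x + 1 * w) ~= 0" "th1 (x + 1 * w) ~= 0"
 using theta1_avoid[of 1 1 "-x" x] by auto
thus ?thesis by (intro exI[of _ w]) (simp add: ts_def add.commute)
qed

text \<open>An even theta function that vanishes at \<open>x\<close> is divisible by \<open>ts z x\<close>.\<close>

lemma even_theta_divide:
 assumes f: "even_theta (Suc n) f" and x: "f x = 0" "th1 (2 * x) ~= 0"
 obtains g where "even_theta n g" "!!z. f z = g z * ts z x"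
proof -
have e: "entire (%z. ts z x)" using even_thetaD(1)[OF ts_even_theta] .
have dth: "(th1 has_field_derivative deriv th1 w) (at w)" for w
 using theta1_entire by (simp add: holomorphic_derivI)
have simple: "deriv (%z. ts z x) z ~= 0" if z: "ts z x = 0" for z
proof -
 have "((%z. th1 (z - x) * th1 (z + x)) has_field_derivative
   deriv th1 (z - x) * th1 (z + x) + deriv th1 (z + x) * th1 (z - x)) (at z)"
  by (auto intro!: derivative_eq_intros DERIV_chain2[OF dth])
 hence d: "deriv (%z. ts z x) z
  = deriv th1 (z - x) * th1 (z + x) + deriv th1 (z + x) * th1 (z - x)"
  unfolding ts_def by (rule DERIV_imp_deriv)
 have nb: "\<not> (th1 (z - x) = 0 \<and> th1 (z + x) = 0)"
 proof
  assume a: "th1 (z - x) = 0 \<and> th1 (z + x) = 0"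
  hence "th1 (- (z - x)) = 0" by (subst theta1_minus[OF im]) simp
  from theta1_zeros_add[OF this conjunct2[OF a]] have "th1 (2 * x) = 0" by (simp add: alg mult_2)
  with x(2) show False by simp
 qed
 have "th1 (z - x) = 0 \<or> th1 (z + x) = 0" using z by (simp add: ts_def)
 thus ?thesis
 proof
  assume "th1 (z - x) = 0"
  thus ?thesis unfolding d using theta1_simple[of "z - x"] nb by auto
 next
  assume "th1 (z + x) = 0"
  thus ?thesis unfolding d using theta1_simple[of "z + x"] nb by auto
 qed
qed
obtain g where g: "entire g" "!!z. f z = g z * ts z x"
 using entire_divide[OF even_thetaD(1)[OF f] e simple] even_theta_zero_at[OF f x(1)] by blast
obtain w where w: "ts w x ~= 0" using ts_nonzero_ex by blast
have "even_theta n g"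
proof (rule even_thetaI)
 show "g (- z) = g z" for z
 proof (rule entire_eq_off_zeros[where f = "%z. g (- z)" and g = g, OF _ g(1) e _ w])
  fix z assume "ts z x ~= 0"
  thus "g (- z) = g z" using g(2)[of z] g(2)[of "-z"] even_thetaD(2)[OF f, of z] by simp
 qed (intro entire_compose[OF g(1)] holomorphic_intros)
 show "g (z + \<pi>) = g z" for z
 proof (rule entire_eq_off_zeros[where f = "%z. g (z + \<pi>)" and g = g, OF _ g(1) e _ w])
  fix z assume "ts z x ~= 0"
  thus "g (z + \<pi>) = g z"
   using g(2)[of z] g(2)[of "z + \<pi>"] even_thetaD(3)[OF f, of z] even_thetaD(3)[OF ts_even_theta, of z] by simp
 qed (intro entire_compose[OF g(1)] holomorphic_intros)
 show "g (z + pt) = qper z ^ (2 * n) * g z" for z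
 proof (rule entire_eq_off_zeros[where f = "%z. g (z + pt)" and g = "%z. qper z ^ (2 * n) * g z", OF _ _ e _ w])
  fix z assume nz: "ts z x ~= 0"
  have "f (z + pt) = g (z + pt) * (qper z ^ 2 * ts z x)"
   using g(2)[of "z + pt"] even_thetaD(4)[OF ts_even_theta, of z] by simp
  moreover have "f (z + pt) = qper z ^ 2 * qper z ^ (2 * n) * (g z * ts z x)"
   unfolding even_thetaD(4)[OF f] g(2)[of z] by (simp add: power2_eq_square)
  ultimately have "(qper z ^ 2 * ts z x) * g (z + pt) = (qper z ^ 2 * ts z x) * (qper z ^ (2 * n) * g z)"
   by (simp only: mult_ac)
  moreover have "qper z ^ 2 * ts z x ~= 0" using nz by simp
  ultimately show "g (z + pt) = qper z ^ (2 * n) * g z" by (metis mult_left_cancel)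
 qed (use g(1) in \<open>auto simp: qper_def intro!: entire_compose[OF g(1)] holomorphic_intros\<close>)
qed (rule g(1))
thus ?thesis using that g(2) by blast
qed

theorem even_theta_eq_0:
 assumes "even_theta n f" "finite I" "card I = Suc n"
  and "!!i. i \<in> I ==> f (x i) = 0" "!!i. i \<in> I ==> th1 (2 * x i) ~= 0"
  and "!!i j. i \<in> I ==> j \<in> I ==> i ~= j ==> ts (x i) (x j) ~= 0"
 shows "f z = 0"
 using assms
proof (induction n arbitrary: f I z)
case 0
then obtain i where i: "I = {i}" by (metis card_1_singletonE One_nat_def)
have "\<exists>c. \<forall>z. f z = c"
 by (rule doubly_periodic_const[OF im]) (use even_thetaD[OF 0(1)] in auto)
thus ?case using 0(4)[of i] i by auto
next
case (Suc n)
then obtain i where i: "i \<in> I" by fastforce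
obtain g where g: "even_theta n g" "!!z. f z = g z * ts z (x i)"
 using even_theta_divide[OF Suc.prems(1) Suc.prems(4)[OF i] Suc.prems(5)[OF i]] by blast
have "g z = 0" for z
proof (rule Suc.IH[OF g(1), of "I - {i}"])
 show "g (x j) = 0" if "j \<in> I - {i}" for j
  using Suc.prems(4)[of j] Suc.prems(6)[of j i] that i g(2)[of "x j"] by auto
qed (use Suc.prems i in auto)
thus ?case using g(2) by simp
qed

text \<open>The Lagrange basis for the nodes \<open>x i\<close>.\<close>

definition lagr :: "'i set => ('i => complex) => 'i => complex => complex" where
 "lagr I x i z = (\<Prod>j\<in>I - {i}. ts z (x j) / ts (x i) (x j))"

theorem even_theta_lagrange:
 assumes f: "even_theta n f" and I: "finite I" "card I = Suc n"
  and x2: "!!i. i \<in> I ==> th1 (2 * x i) ~= 0"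
  and xx: "!!i j. i \<in> I ==> j \<in> I ==> i ~= j ==> ts (x i) (x j) ~= 0"
 shows "f z = (\<Sum>i\<in>I. f (x i) * lagr I x i z)"
proof -
let ?A = "%z. \<Sum>i\<in>I. f (x i) * lagr I x i z"
have l: "even_theta n (lagr I x i)" if "i \<in> I" for i
proof -
 have "even_theta (card (I - {i})) (%z. \<Prod>j\<in>I - {i}. inverse (ts (x i) (x j)) * ts z (x j))"
  by (intro even_theta_prod even_theta_cmult ts_even_theta) (use I in auto)
 thus ?thesis using I that by (simp add: lagr_def[abs_def] divide_inverse mult.commute)
qed
have "even_theta n (%z. f z - (?A z))"
 by (intro even_theta_diff even_theta_sum even_theta_cmult f I l)
moreover have "f (x k) - (\<Sum>i\<in>I. f (x i) * lagr I x i (x k)) = 0" if k: "k \<in> I" for k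
proof -
 have "lagr I x i (x k) = (if i = k then 1 else 0)" if "i \<in> I" for i
 proof (cases "i = k")
  case True
  thus ?thesis unfolding lagr_def using xx[OF k] by (intro trans[OF prod.neutral]) auto
 next
  case False
  hence "k \<in> I - {i}" using k by simp
  hence "(\<Prod>j\<in>I - {i}. ts (x k) (x j) / ts (x i) (x j)) = 0"
   using I by (intro prod_zero) (auto intro!: bexI[of _ k])
  thus ?thesis unfolding lagr_def using False by simp
 qed
 hence "(\<Sum>i\<in>I. f (x i) * lagr I x i (x k)) = (\<Sum>i\<in>I. if i = k then f (x k) else 0)"
  by (intro sum.cong) auto
 thus ?thesis using k I by simp
qed
ultimately have "f z - (?A z) = 0"
 using even_theta_eq_0[of n "%z. f z - (?A z)" I x z] I x2 xx by blast
thus ?thesis by simp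
qed

text \<open>The divided difference over one node too many vanishes.\<close>

theorem even_theta_divided_difference:
 assumes f: "even_theta n f" and I: "finite I" "card I = Suc (Suc n)"
  and x2: "!!i. i \<in> I ==> th1 (2 * x i) ~= 0"
  and xx: "!!i j. i \<in> I ==> j \<in> I ==> i ~= j ==> ts (x i) (x j) ~= 0"
 shows "(\<Sum>i\<in>I. f (x i) / (\<Prod>j\<in>I - {i}. ts (x i) (x j))) = 0"
proof -
let ?A = "%i. \<Prod>j\<in>I - {i}. ts (x i) (x j)"
let ?B = "%k. \<Sum>i\<in>I - {k}. f (x i) / (?A i)"
obtain k where k: "k \<in> I" using I by fastforce
define P where "P = (\<Prod>j\<in>I - {k}. ts (x k) (x j))"
have P0: "P ~= 0" using xx k I by (auto simp: P_def)
have "f (x k) = (\<Sum>i\<in>I - {k}. f (x i) * lagr (I - {k}) x i (x k))"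
 by (rule even_theta_lagrange[OF f]) (use I k x2 xx in auto)
also have "... = (\<Sum>i\<in>I - {k}. - P * (f (x i) / (?A i)))"
proof (rule sum.cong)
 fix i assume i: "i \<in> I - {k}"
 have "P = ts (x k) (x i) * (\<Prod>j\<in>I - {k} - {i}. ts (x k) (x j))"
  unfolding P_def using i I by (subst prod.remove[of _ i]) auto
 moreover have "(?A i) = ts (x i) (x k) * (\<Prod>j\<in>I - {k} - {i}. ts (x i) (x j))"
  using i I k by (subst prod.remove[of _ k]) (auto intro!: arg_cong2[where f = "(*)"] prod.cong)
 moreover have "ts (x k) (x i) = - ts (x i) (x k)" by (rule ts_minus)
 moreover have "ts (x i) (x k) ~= 0" using xx i k by auto
 ultimately show "f (x i) * lagr (I - {k}) x i (x k) = - P * (f (x i) / (?A i))"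
  by (simp add: lagr_def prod_dividef)
qed simp
also have "... = - P * (?B k)"
 by (simp add: sum_distrib_left)
finally have "f (x k) / P = - (?B k)"
 using P0 by (simp add: field_simps)
moreover have "(\<Sum>i\<in>I. f (x i) / (?A i))
  = f (x k) / P + (?B k)"
 unfolding P_def using k I by (subst sum.remove[of _ k]) auto
ultimately show ?thesis by simp
qed

end

section \<open>Operators on spin configurations\<close>

text \<open>States are functions of a configuration of spins at all sites \<open>0, 1, 2, ...\<close>. Working with the
 ring of linear operators on all such functions makes it possible to use as many auxiliary
 sites as necessary.\<close>

type_synonym state = "(nat => bool) => complex"

typedef lin = "{f :: state => state. (\<forall>x y. f (%s. x s + y s) = (%s. f x s + f y s)) \<and>
  (\<forall>c x. f (%s. c * x s) = (%s. c * f x s))}"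
 morphisms app Lin
 by (rule exI[of _ "%x. x"]) auto

setup_lifting type_definition_lin

instantiation lin :: ring_1
begin
lift_definition zero_lin :: lin is "%x s. 0" by auto
lift_definition one_lin :: lin is "%x. x" by auto
lift_definition plus_lin :: "lin => lin => lin" is "%f g x s. f x s + g x s" by (auto simp: alg)
lift_definition uminus_lin :: "lin => lin" is "%f x s. - f x s" by (auto simp: alg)
lift_definition minus_lin :: "lin => lin => lin" is "%f g x s. f x s - g x s" by (auto simp: alg)
lift_definition times_lin :: "lin => lin => lin" is "%f g x. f (g x)" by (auto simp: alg)
instance
proof
show "(0 :: lin) ~= 1"
proof
 assume "(0 :: lin) = 1"
 hence "app 0 (%_. 1) = app 1 (%_. 1)" by simp
 thus False by (simp add: zero_lin.rep_eq one_lin.rep_eq fun_eq_iff)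
qed
qed (transfer, force simp: alg)+
end

lemma app_add: "app (X + Y) x s = app X x s + app Y x s" by (simp add: plus_lin.rep_eq)
lemma app_mult: "app (X * Y) x = app X (app Y x)" by (simp add: times_lin.rep_eq)
lemma app_one: "app 1 x = x" by (simp add: one_lin.rep_eq)
lemma app_zero: "app 0 x s = 0" by (simp add: zero_lin.rep_eq)
lemma lin_eqI: "(!!x s. app X x s = app Y x s) ==> X = Y"
 using app_inject by (auto simp: fun_eq_iff)

lemma app_arg_add: "app X (%s. x s + y s) = (%s. app X x s + app X y s)"
 using app[of X] by auto

lemma app_arg_cmult: "app X (%s. c * x s) = (%s. c * app X x s)"
 using app[of X] by auto

lemma app_sum: "app (\<Sum>i\<in>I. f i) x s = (\<Sum>i\<in>I. app (f i) x s)"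
 by (induction I rule: infinite_finite_induct) (auto simp: app_zero app_add)

lift_definition sc :: "complex => lin" is "%c x s. c * x s" by (auto simp: alg)

lemma sc_0 [simp]: "sc 0 = 0" by transfer simp
lemma sc_1 [simp]: "sc 1 = 1" by transfer simp
lemma sc_mult: "sc (a * b) = sc a * sc b" by transfer (simp add: fun_eq_iff)
lemma sc_add: "sc (a + b) = sc a + sc b" by transfer (simp add: fun_eq_iff alg)
lemma sc_diff: "sc (a - b) = sc a - sc b" by transfer (simp add: fun_eq_iff alg)
lemma sc_comm: "X * sc a = sc a * X" by transfer (auto simp: fun_eq_iff)
lemma sc_lc: "X * (sc a * Y) = sc a * (X * Y)" using sc_comm[of X a] by (simp flip: mult.assoc)
lemma sc_sc: "sc a * (sc b * X) = sc (a * b) * X" by (simp add: sc_mult mult.assoc)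
lemma sc_sum: "sc (\<Sum>i\<in>I. f i) = (\<Sum>i\<in>I. sc (f i))"
 by (induction I rule: infinite_finite_induct) (auto simp: sc_add)
lemma app_sc: "app (sc c) x s = c * x s" by (simp add: sc.rep_eq)
lemma sc_cancel: "c ~= 0 ==> sc c * X = sc c * Y ==> X = Y"
proof -
assume c: "c ~= 0" and e: "sc c * X = sc c * Y"
have "sc (1 / c) * sc c = 1" using c by (simp flip: sc_mult)
thus ?thesis by (metis e mult.assoc mult_1)
qed
text \<open>The Heisenberg group of one site: \<open>Dop i (p, r)\<close> is \<open>(\<sigma>\<^sup>x)\<^sup>p(\<sigma>\<^sup>z)\<^sup>r\<close> at site \<open>i\<close>.\<close>

type_synonym idx = "bool \<times> bool"

text \<open>The elements that belong to the identity and to \<open>\<sigma>\<^sup>x\<close>, \<open>\<sigma>\<^sup>y\<close> (up to a factor) and \<open>\<sigma>\<^sup>z\<close>;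
 \<open>\<Uplus>\<close> stands for sums over the group.\<close>

abbreviation gI :: idx where "gI \<equiv> (False, False)"
abbreviation gX :: idx where "gX \<equiv> (True, False)"
abbreviation gY :: idx where "gY \<equiv> (True, True)"
abbreviation gZ :: idx where "gZ \<equiv> (False, True)"
abbreviation (input) sum_all :: "('b => 'a::comm_monoid_add) => 'a" (binder "\<Uplus>" 10) where
 "\<Uplus>g. f g \<equiv> sum f UNIV"

text \<open>The group law, and the sign \<open>ph g h\<close> by which the product of the operators of \<open>g\<close> and \<open>h\<close> differs
 from the operator of \<open>g[+]h\<close>.\<close>

definition gadd :: "idx => idx => idx" (infixl "[+]" 65) where
 "g[+]h = (fst g ~= fst h, snd g ~= snd h)"

definition ph :: "idx => idx => complex" where
 "ph g h = (if snd g \<and> fst h then -1 else 1)"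

lemma gadd_assoc: "(a[+]b)[+]c = a[+](b[+]c)" by (auto simp: gadd_def)
lemma gadd_comm: "a[+]b = b[+]a" by (auto simp: gadd_def)
lemma gadd_self [simp]: "a[+]a = gI" by (auto simp: gadd_def)
lemma gadd_0 [simp]: "a[+]gI = a" "gI[+]a = a" by (auto simp: gadd_def)
lemma gadd_cancel [simp]: "a[+](a[+]b) = b" by (simp flip: gadd_assoc)
lemma gadd_cancel' [simp]: "a[+]b[+]b = a" by (simp add: gadd_assoc)
lemma gadd_eq_0 [simp]: "a[+]b = gI \<longleftrightarrow> a = b" by (cases a; cases b) (auto simp: gadd_def)

lemma ph_sq [simp]: "ph g h * ph g h = 1" "ph g h * (ph g h * x) = x" by (auto simp: ph_def)
lemma ph_add_left: "ph (g[+]h) k = ph g k * ph h k" by (auto simp: ph_def gadd_def)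
lemma ph_add_right: "ph k (g[+]h) = ph k g * ph k h" by (auto simp: ph_def gadd_def)
lemma ph_0 [simp]: "ph gI g = 1" "ph g gI = 1" by (auto simp: ph_def)

lemma sum_idx: "(\<Uplus>g. f g) = f gI + f gX + f gY + f gZ"
 for f :: "idx => 'a::comm_monoid_add"
 unfolding UNIV_Times_UNIV[symmetric] by (simp add: UNIV_bool insert_commute sum.cartesian_product[symmetric] add_ac)

lemma sum_shift: "(\<Uplus>g. f (x[+]g)) = (\<Uplus>g. f g)" for f :: "idx => 'a::comm_monoid_add"
 by (rule sum.reindex_bij_witness[where i = "%g. x[+]g" and j = "%g. x[+]g"]) auto

lift_definition Dop :: "nat => idx => lin" is
 "%i g x s. (if snd g \<and> s i ~= fst g then -1 else 1) * x (s(i := (s i ~= fst g)))"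
 by (auto simp: alg)

abbreviation (input) DD where "DD i j g \<equiv> Dop i g * Dop j g"

lemma app_Dop: "app (Dop i g) x s = (if snd g \<and> s i ~= fst g then -1 else 1) * x (s(i := (s i ~= fst g)))"
 by (simp add: Dop.rep_eq)

lemma Dop_0 [simp]: "Dop i gI = 1" by (rule lin_eqI) (simp add: app_Dop app_one)

lemma Dop_mult: "Dop i g * Dop i h = sc (ph g h) * Dop i (g[+]h)"
proof (rule lin_eqI)
fix x s
show "app (Dop i g * Dop i h) x s = app (sc (ph g h) * Dop i (g[+]h)) x s"
 by (cases g; cases h; cases "s i") (auto simp: app_mult app_Dop app_sc ph_def gadd_def)
qed

lemma Dop_comm: "i ~= j ==> Dop i g * Dop j h = Dop j h * Dop i g"
proof (rule lin_eqI)
fix x s assume "i ~= j"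
thus "app (Dop i g * Dop j h) x s = app (Dop j h * Dop i g) x s"
 by (simp add: app_mult app_Dop fun_upd_twist)
qed

lemma Dop_swap: "Dop i g * Dop i h = sc (ph g h * ph h g) * (Dop i h * Dop i g)"
proof -
have "ph g h * ph h g * ph h g = ph g h" by (simp add: mult.assoc)
thus ?thesis unfolding Dop_mult gadd_comm[of h g] sc_sc by (simp only:)
qed

lemma Dop_sq: "Dop i g * Dop i g = sc (ph g g)" by (simp add: Dop_mult)

text \<open>The partial trace over a site.\<close>

definition ptr :: "nat => lin => lin" where
 "ptr a X = sc (1 / 2) * (\<Uplus>g. sc (ph g g) * (Dop a g * X * Dop a g))"

text \<open>The operator acts trivially at the site \<open>a\<close>.\<close>

definition off :: "nat => lin => bool" where
 "off a X \<longleftrightarrow> (\<forall>g. X * Dop a g = Dop a g * X)"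

lemma offD: "off a X ==> X * Dop a g = Dop a g * X" unfolding off_def by blast

lemma off_sc [simp, intro]: "off a (sc c)" by (simp add: off_def sc_comm)
lemma off_0 [simp, intro]: "off a 0" by (simp add: off_def)
lemma off_1 [simp, intro]: "off a 1" by (simp add: off_def)
lemma off_Dop [simp, intro]: "a ~= b ==> off a (Dop b g)" by (simp add: off_def Dop_comm)
lemma off_mult [intro]: "off a X ==> off a Y ==> off a (X * Y)"
 unfolding off_def by (metis mult.assoc)
lemma off_add [intro]: "off a X ==> off a Y ==> off a (X + Y)"
 unfolding off_def by (simp add: distrib_left distrib_right)
lemma off_sum [intro]: "(!!i. i \<in> I ==> off a (f i)) ==> off a (\<Sum>i\<in>I. f i)"
 by (induction I rule: infinite_finite_induct) auto

lemma off_ptr [intro]: "off a X ==> off a (ptr b X)"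
proof -
assume X: "off a X"
show ?thesis
proof (cases "a = b")
 case False thus ?thesis unfolding ptr_def using X by (intro off_mult off_sum off_sc off_Dop)
next
 case True
 have "sc (ph g g) * (Dop b g * X * Dop b g) = X" for g
 proof -
  have "X * Dop b g = Dop b g * X" using offD[OF X, of g] True by simp
  hence "Dop b g * X * Dop b g = X * DD b b g" by (metis mult.assoc)
  also have "... = sc (ph g g) * X" unfolding Dop_sq by (rule sc_comm)
  finally show ?thesis by (simp add: sc_sc)
 qed
 hence e: "ptr b X = sc (1 / 2) * (\<Sum>g\<in>(UNIV::idx set). X)" unfolding ptr_def by (simp only:)
 show ?thesis unfolding e by (rule off_mult[OF off_sc off_sum[OF X]])
qed
qed

lemma ptr_add: "ptr a (X + Y) = ptr a X + ptr a Y"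
 by (simp add: ptr_def distrib_left distrib_right sum.distrib)

lemma ptr_0 [simp]: "ptr a 0 = 0" by (simp add: ptr_def)

lemma ptr_sum: "ptr a (\<Sum>i\<in>I. f i) = (\<Sum>i\<in>I. ptr a (f i))"
 by (induction I rule: infinite_finite_induct) (auto simp: ptr_add)

lemma ptr_left:
 assumes Y: "off a Y" shows "ptr a (Y * X) = Y * ptr a X"
proof -
have "sc (ph g g) * (Dop a g * (Y * X) * Dop a g) = Y * (sc (ph g g) * (Dop a g * X * Dop a g))" for g
proof -
 have "Dop a g * (Y * X) * Dop a g = Y * (Dop a g * X * Dop a g)"
  using offD[OF Y, of g] by (simp add: mult.assoc[symmetric])
 thus ?thesis by (simp only: sc_lc[of Y])
qed
hence "ptr a (Y * X) = sc (1 / 2) * (\<Uplus>g. Y * (sc (ph g g) * (Dop a g * X * Dop a g)))"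
 unfolding ptr_def by (simp only:)
also have "... = Y * ptr a X" unfolding ptr_def sum_distrib_left[symmetric] by (rule sc_lc[symmetric])
finally show ?thesis .
qed

lemma ptr_right:
 assumes Y: "off a Y" shows "ptr a (X * Y) = ptr a X * Y"
proof -
have "sc (ph g g) * (Dop a g * (X * Y) * Dop a g) = (sc (ph g g) * (Dop a g * X * Dop a g)) * Y" for g
proof -
 have "Dop a g * (X * Y) * Dop a g = (Dop a g * X * Dop a g) * Y"
  using offD[OF Y, of g] by (simp add: mult.assoc)
 thus ?thesis by (simp only: mult.assoc)
qed
hence "ptr a (X * Y) = sc (1 / 2) * (\<Uplus>g. (sc (ph g g) * (Dop a g * X * Dop a g)) * Y)"
 unfolding ptr_def by (simp only:)
also have "... = ptr a X * Y" unfolding ptr_def sum_distrib_right[symmetric] by (simp only: mult.assoc)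
finally show ?thesis .
qed

lemma ptr_sc: "ptr a (sc c * X) = sc c * ptr a X" by (rule ptr_left) simp

lemma ptr_cyclic_Dop: "ptr a (Dop a g * X) = ptr a (X * Dop a g)"
proof -
let ?A = "%h. Dop a h * (Dop a g * X) * Dop a h"
have "(\<Uplus>h. sc (ph h h) * (Dop a h * (X * Dop a g) * Dop a h))
  = (\<Uplus>h. sc (ph (g[+]h) (g[+]h)) * (Dop a (g[+]h) * (X * Dop a g) * Dop a (g[+]h)))"
 by (rule sum_shift[symmetric])
also have "... = (\<Uplus>h. sc (ph h h) * (?A h))"
proof (rule sum.cong[OF refl])
 fix h
 have 1: "Dop a (g[+]h) = sc (ph h g) * (Dop a h * Dop a g)"
  unfolding Dop_mult sc_sc gadd_comm[of h g] by simp
 have 2: "Dop a g * Dop a (g[+]h) = sc (ph g g * ph g h) * Dop a h"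
  unfolding Dop_mult ph_add_right by simp
 have 3: "ph (g[+]h) (g[+]h) * (ph h g * (ph g g * ph g h)) = ph h h"
  by (auto simp: ph_def gadd_def)
 have "Dop a (g[+]h) * (X * Dop a g) * Dop a (g[+]h) = Dop a (g[+]h) * (X * (Dop a g * Dop a (g[+]h)))"
  by (simp only: mult.assoc)
 also have "... = sc (ph g g * ph g h) * (Dop a (g[+]h) * (X * Dop a h))"
  unfolding 2 by (simp only: sc_lc)
 also have "... = sc (ph h g * (ph g g * ph g h)) * (?A h)"
  unfolding 1 mult.assoc sc_sc by (simp only: mult.commute[of "ph h g"] mult.assoc)
 finally show "sc (ph (g[+]h) (g[+]h)) * (Dop a (g[+]h) * (X * Dop a g) * Dop a (g[+]h))
   = sc (ph h h) * (?A h)"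
  by (simp only: sc_sc 3)
qed
finally show ?thesis by (simp add: ptr_def)
qed

lemma ptr_one: "ptr a 1 = sc 2"
proof -
have "ptr a 1 = sc (1 / 2) * (\<Sum>g\<in>(UNIV::idx set). sc 1)"
 unfolding ptr_def by (simp add: Dop_sq flip: sc_mult)
also have "... = sc (1 / 2 * (\<Sum>g\<in>(UNIV::idx set). 1))" by (simp only: sc_sum sc_mult)
also have "(\<Sum>g\<in>(UNIV::idx set). 1 :: complex) = 4" by (simp add: sum_idx)
finally show ?thesis by simp
qed

lemma ptr_Dop: "ptr a (Dop a g) = (if g = gI then sc 2 else 0)"
proof (cases "g = gI")
case True thus ?thesis by (simp add: ptr_one)
next
case False
have "sc (ph h h) * (Dop a h * Dop a g * Dop a h) = sc (ph h g * ph g h) * Dop a g" for h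
proof -
 have "Dop a h * Dop a g * Dop a h = sc (ph h g * ph g h) * (Dop a g * DD a a h)"
  unfolding Dop_swap[of a h g] by (simp only: mult.assoc)
 also have "... = sc (ph h g * ph g h) * (sc (ph h h) * Dop a g)"
  unfolding Dop_sq sc_comm[of "Dop a g"] ..
 finally show ?thesis by (simp add: sc_sc mult.left_commute[of "ph h h"])
qed
hence "ptr a (Dop a g) = sc (1/2) * (\<Uplus>h. sc (ph h g * ph g h) * Dop a g)"
 unfolding ptr_def by (simp only:)
also have "... = sc (1/2 * (\<Uplus>h. ph h g * ph g h)) * Dop a g"
 unfolding sc_mult[of "1/2"] sc_sum sum_distrib_right[symmetric] mult.assoc ..
also have "(\<Uplus>h. ph h g * ph g h) = 0" using False by (cases g) (auto simp: sum_idx ph_def)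
finally show ?thesis using False by simp
qed

lemma ptr_Dop_Dop: "ptr a (Dop a g * Dop a h) = (if g = h then sc (2 * ph g g) else 0)"
 by (auto simp: Dop_mult ptr_sc ptr_Dop mult.commute simp flip: sc_mult)

text \<open>Operators that are built from \<open>Dop a\<close> and coefficients at other sites.\<close>

definition emb :: "nat => (idx => lin) => lin" where
 "emb a u = (\<Uplus>g. Dop a g * u g)"

lemma off_emb [intro]: "a ~= b ==> (!!g. off a (u g)) ==> off a (emb b u)"
 unfolding emb_def by (rule off_sum, rule off_mult) auto

lemma ptr_emb_emb:
 assumes "!!g. off a (u g)" and that: "!!g. off a (k g)"
 shows "ptr a (emb a k * emb a u) = (\<Uplus>g. sc (2 * ph g g) * (k g * u g))"
proof -
have "ptr a (Dop a g * k g * (Dop a h * u h)) = (if g = h then sc (2 * ph g g) * (k g * u g) else 0)" for g h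
proof -
 have "Dop a g * k g * (Dop a h * u h) = Dop a g * Dop a h * (k g * u h)"
 proof -
  have "Dop a g * k g * (Dop a h * u h) = Dop a g * (k g * Dop a h) * u h" by (simp only: mult.assoc)
  also have "k g * Dop a h = Dop a h * k g" by (rule offD[OF that])
  finally show ?thesis by (simp only: mult.assoc)
 qed
 moreover have "off a (k g * u h)" by (rule off_mult[OF that assms(1)])
 ultimately show ?thesis by (simp add: ptr_right ptr_Dop_Dop)
qed
hence "ptr a (emb a k * emb a u) = (\<Uplus>g h. if g = h then sc (2 * ph g g) * (k g * u g) else 0)"
 unfolding emb_def by (simp add: sum_distrib_left sum_distrib_right ptr_sum)
thus ?thesis by simp
qed

section \<open>R-matrix and K-matrix\<close>

context theta_nz
begin

text \<open>The four theta functions indexed by the Heisenberg group, and the products of the other three.\<close>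

definition tg :: "idx => complex => complex" where
 "tg g = (if fst g then (if snd g then th3 else th4) else (if snd g then th2 else th1))"

definition tc :: "idx => complex => complex" where
 "tc g z = (\<Prod>k\<in>UNIV - {g}. tg k z)"

definition tP :: "complex => complex" where
 "tP z = th1 z * th2 z * th3 z * th4 z"

lemma tg_simps [simp]:
 "tg gI = th1" "tg gX = th4"
 "tg gY = th3" "tg gZ = th2"
 by (simp_all add: tg_def)

lemma UNIV_idx: "(UNIV :: idx set) = {gI, gX, gY, gZ}"
 by auto

lemma tc_simps [simp]:
 "tc gI z = th2 z * th3 z * th4 z"
 "tc gX z = th1 z * th2 z * th3 z"
 "tc gY z = th1 z * th2 z * th4 z"
 "tc gZ z = th1 z * th3 z * th4 z"
 unfolding tc_def UNIV_idx by (simp_all add: insert_Diff_if mult_ac)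

lemma tc_tg: "tg g z * tc g z = tP z"
 by (cases g) (auto simp: tP_def tg_def)

lemma gadd_simps [simp]: "(a, b)[+](c, d) = (a ~= c, b ~= d)" by (simp add: gadd_def)
lemma ph_simps [simp]: "ph (a, b) (c, d) = (if b \<and> c then -1 else 1)" by (simp add: ph_def)

text \<open>Normalisation of the R-matrix and the K-matrix.\<close>

definition cst :: "complex" where
 "cst = 1 / (th2 0 * (d4 0)\<^sup>2)"

text \<open>Coefficients of the R-matrix (with \<open>h = \<eta>/2\<close>) and of the K-matrix in the Heisenberg basis.\<close>

definition wR :: "complex => idx => complex => complex" where
 "wR h g z = cst * (tg g (z + h) * tc g h)"

definition kK :: "idx => complex => complex" where
 "kK g z = cst * tc g z"

definition Rop :: "complex => nat => nat => complex => lin" where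
 "Rop h i j z = (\<Uplus>g. sc (ph g g * wR h g z) * DD i j g)"

definition Kop :: "(idx => complex) => nat => complex => lin" where
 "Kop c i z = (\<Uplus>g. sc (c g * kK g z) * Dop i g)"

lemma Rop_sym: "i ~= j ==> Rop h i j z = Rop h j i z"
 unfolding Rop_def by (intro sum.cong refl) (simp add: Dop_comm[of i j])

lemma off_Rop [intro]: "a ~= i ==> a ~= j ==> off a (Rop h i j z)"
 unfolding Rop_def by (rule off_sum, rule off_mult[OF off_sc], rule off_mult) auto

lemma off_Kop [intro]: "a ~= i ==> off a (Kop c i z)"
 unfolding Kop_def by (rule off_sum, rule off_mult) auto

lemma sum_triple_product:
 fixes A B C :: "'i => 'r::ring_1"
 shows "sum A U * sum B U * sum C U = (\<Sum>g\<in>U. \<Sum>x\<in>U. \<Sum>y\<in>U. A g * B x * C y)"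
proof -
have "sum A U * sum B U * sum C U = (\<Sum>g\<in>U. \<Sum>x\<in>U. A g * B x * sum C U)"
 unfolding sum_product[of A] by (simp only: sum_distrib_right)
thus ?thesis by (simp only: sum_distrib_left)
qed

lemma idx_cases [case_names 0 X XZ Z]:
 "(g = gI ==> P) ==> (g = gX ==> P) ==> (g = gY ==> P)
  ==> (g = gZ ==> P) ==> P" for g :: idx
 by (cases g) auto

lemma sum_shift2: "(\<Uplus>x y. T x y) = (\<Uplus>x y. T (g[+]x) (g[+]y))"
 for T :: "idx => idx => 'a::comm_monoid_add"
 using sum_shift[of "%x. \<Uplus>y. T x y" g] sum_shift[of "%y. T x y" g for x] by simp

lemma sum_shift3: "(\<Uplus>g x y. T g x y) = (\<Uplus>g x y. T g (g[+]x) (g[+]y))"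
 for T :: "idx => idx => idx => 'a::comm_monoid_add"
 by (rule sum.cong[OF refl], rule sum_shift2)

lemma triple_product:
 assumes d: "i ~= j" "i ~= k" "j ~= k"
 shows "(\<Uplus>g. sc (F g) * DD i j g) * (\<Uplus>g. sc (G g) * DD i k g)
    * (\<Uplus>g. sc (H g) * DD j k g)
  = (\<Uplus>x y. sc (\<Uplus>g. F g * G (g[+]x) * H (g[+]y)
     * (ph g (g[+]x) * ph g (g[+]y) * ph (g[+]x) (g[+]y))) * (Dop i x * (Dop j y * Dop k (x[+]y))))" (is ?A)
  and "(\<Uplus>g. sc (H g) * DD j k g) * (\<Uplus>g. sc (G g) * DD i k g)
    * (\<Uplus>g. sc (F g) * DD i j g)
  = (\<Uplus>x y. sc (\<Uplus>g. F g * G (g[+]x) * H (g[+]y)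
     * (ph (g[+]x) g * ph (g[+]y) g * ph (g[+]y) (g[+]x))) * (Dop i x * (Dop j y * Dop k (x[+]y))))" (is ?B)
proof -
let ?C = "%g y x. Dop j (g[+]y) * Dop k (x[+]y)"
let ?D = "%g x y. F g * G x * H y * (ph x g * ph y g * ph y x)"
have sw: "(\<Uplus>g x y. T g x y) = (\<Uplus>x y g. T g x y)"
 for T :: "idx => idx => idx => lin"
proof -
 have "(\<Uplus>g x y. T g x y) = (\<Uplus>x g y. T g x y)" by (rule sum.swap)
 also have "... = (\<Uplus>x y g. T g x y)" by (rule sum.cong[OF refl], rule sum.swap)
 finally show ?thesis .
qed
have cm: "Dop j g * Dop i x = Dop i x * Dop j g" "Dop k g * Dop i x = Dop i x * Dop k g"
 "Dop k g * Dop j x = Dop j x * Dop k g" for g x using d by (simp_all add: Dop_comm)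
have lcm: "Dop j g * (Dop i x * X) = Dop i x * (Dop j g * X)" "Dop k g * (Dop i x * X) = Dop i x * (Dop k g * X)"
 "Dop k g * (Dop j x * X) = Dop j x * (Dop k g * X)" for g x X using cm by (simp_all flip: mult.assoc)
have mm: "Dop i g * (Dop i x * X) = sc (ph g x) * (Dop i (g[+]x) * X)" for i g x X
 by (simp only: Dop_mult flip: mult.assoc)
have gx: "(g[+]x)[+](g[+]y) = x[+]y" for g x y by (auto simp: gadd_def)
have tA: "sc (F g) * DD i j g * (sc (G x) * DD i k x) * (sc (H y) * DD j k y)
  = sc (F g * G x * H y * (ph g x * ph g y * ph x y)) * (Dop i (g[+]x) * (?C g y x))" for g x y
 by (simp only: mult.assoc sc_lc[of "Dop _ _"] cm lcm mm Dop_mult sc_comm[of "Dop _ _"] sc_sc) (simp only: mult_ac)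
have tB: "sc (H y) * DD j k y * (sc (G x) * DD i k x) * (sc (F g) * DD i j g)
  = sc (?D g x y) * (Dop i (g[+]x) * (?C g y x))" for g x y
 by (simp only: mult.assoc sc_lc[of "Dop _ _"] cm lcm mm Dop_mult sc_comm[of "Dop _ _"] sc_sc
    gadd_comm[of x g] gadd_comm[of y g] gadd_comm[of y x]) (simp only: mult_ac)
have "(\<Uplus>g. sc (F g) * DD i j g) * (\<Uplus>g. sc (G g) * DD i k g)
   * (\<Uplus>g. sc (H g) * DD j k g)
  = (\<Uplus>g x y. sc (F g * G x * H y * (ph g x * ph g y * ph x y))
    * (Dop i (g[+]x) * (?C g y x)))"
 unfolding sum_triple_product tA ..
also have "... = (\<Uplus>g x y. sc (F g * G (g[+]x) * H (g[+]y) * (ph g (g[+]x) * ph g (g[+]y) * ph (g[+]x) (g[+]y)))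
    * (Dop i x * (Dop j y * Dop k (x[+]y))))"
 by (rule trans[OF sum_shift3]) (simp only: gadd_cancel gx)
also note sw
finally show ?A by (simp only: sc_sum sum_distrib_right)
have "(\<Uplus>g. sc (H g) * DD j k g) * (\<Uplus>g. sc (G g) * DD i k g)
   * (\<Uplus>g. sc (F g) * DD i j g)
  = (\<Uplus>y x g. sc (?D g x y)
    * (Dop i (g[+]x) * (?C g y x)))"
 unfolding sum_triple_product tB ..
also have "... = (\<Uplus>g x y. sc (?D g x y)
    * (Dop i (g[+]x) * (?C g y x)))"
 by (rule trans[OF sum.swap sw[symmetric]])
also have "... = (\<Uplus>g x y. sc (F g * G (g[+]x) * H (g[+]y) * (ph (g[+]x) g * ph (g[+]y) g * ph (g[+]y) (g[+]x)))
    * (Dop i x * (Dop j y * Dop k (x[+]y))))"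
 by (rule trans[OF sum_shift3]) (simp only: gadd_cancel gx)
also note sw
finally show ?B by (simp only: sc_sum sum_distrib_right)
qed

text \<open>The mixed Riemann relation, indexed by the group; \<open>x\<close> and \<open>y\<close> do not commute.\<close>

lemma riemann_group_zero:
 assumes xy: "ph x y * ph y x = -1" and s: "a + c = b + d"
 shows "(\<Uplus>g. (ph g g * ph (g[+]x) (g[+]x) * ph (g[+]y) (g[+]y)
   * (ph g (g[+]x) * ph g (g[+]y) * ph (g[+]x) (g[+]y)))
   * (tg g a * tg (g[+]x) b * tg (g[+]y) c * tg (g[+]x[+]y) d)) = 0" (is "?S = 0")
proof -
define F where "F p q r s = th1 p * th2 q * th3 r * th4 s + th2 p * th1 q * th4 r * th3 s
 + th3 p * th4 q * th1 r * th2 s + th4 p * th3 q * th2 r * th1 s" for p q r s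
have F0: "F p q r s = 0" if "p + q + r + s = 0" for p q r s
 unfolding F_def by (rule riemann_mixed_zero[OF that])
have z: "a + - b + c + - d = 0" using s by (simp add: alg)
note Fs = F0[of a "-b" c "-d"] F0[of a "-b" "-d" c] F0[of a c "-b" "-d"] F0[of a c "-d" "-b"]
 F0[of a "-d" "-b" c] F0[of a "-d" c "-b"]
have E: "E = 0" if "F p q r s = 0" "E = F p q r s \<or> E = - F p q r s" for E p q r s using that by auto
note m = theta1_minus[OF im] theta2_minus theta3_minus theta4_minus
consider "x = gZ" "y = gY" | "x = gZ" "y = gX"
 | "x = gY" "y = gZ" | "x = gX" "y = gZ"
 | "x = gY" "y = gX" | "x = gX" "y = gY"
 using xy by (cases x; cases y) (auto split: if_splits)
thus ?thesis
proof cases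
 case 1
 show ?thesis by (rule E[OF F0[of a "-b" c "-d"]]) (use z in \<open>simp_all add: 1 sum_idx F_def m alg\<close>)
next
 case 2
 show ?thesis by (rule E[OF F0[of a "-b" "-d" c]]) (use z in \<open>simp_all add: 2 sum_idx F_def m alg\<close>)
next
 case 3
 show ?thesis by (rule E[OF F0[of a c "-b" "-d"]]) (use z in \<open>simp_all add: 3 sum_idx F_def m alg\<close>)
next
 case 4
 show ?thesis by (rule E[OF F0[of a c "-d" "-b"]]) (use z in \<open>simp_all add: 4 sum_idx F_def m alg\<close>)
next
 case 5
 show ?thesis by (rule E[OF F0[of a "-d" "-b" c]]) (use z in \<open>simp_all add: 5 sum_idx F_def m alg\<close>)
next
 case 6
 show ?thesis by (rule E[OF F0[of a "-d" c "-b"]]) (use z in \<open>simp_all add: 6 sum_idx F_def m alg\<close>)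
qed
qed

lemma tc_triple:
 assumes "ph x y * ph y x = -1"
 shows "tc g z * tc (g[+]x) z * tc (g[+]y) z = (tP z)\<^sup>2 * tg (g[+]x[+]y) z"
 using assms
 by (cases x rule: idx_cases; cases y rule: idx_cases; cases g rule: idx_cases)
   (simp_all add: tP_def power2_eq_square)

theorem yang_baxter:
 assumes d: "i ~= j" "i ~= k" "j ~= k"
 shows "Rop h i j u * Rop h i k (u + v) * Rop h j k v
    = Rop h j k v * Rop h i k (u + v) * Rop h i j u"
proof -
define F G H where "F g = ph g g * wR h g u" and "G g = ph g g * wR h g (u + v)" and "H g = ph g g * wR h g v" for g
define s1 s2 where "s1 g x y = ph g (g[+]x) * ph g (g[+]y) * ph (g[+]x) (g[+]y)"
 and "s2 g x y = ph (g[+]x) g * ph (g[+]y) g * ph (g[+]y) (g[+]x)" for g x y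
have s: "s2 g x y = ph x y * ph y x * s1 g x y" for g x y
 by (cases g; cases x; cases y) (auto simp: s1_def s2_def)
have "(\<Uplus>g. F g * G (g[+]x) * H (g[+]y) * s1 g x y) = (\<Uplus>g. F g * G (g[+]x) * H (g[+]y) * s2 g x y)" for x y
proof (cases "ph x y * ph y x = 1")
 case True thus ?thesis by (simp add: s)
next
 case False
 hence m: "ph x y * ph y x = -1" by (auto simp: ph_def split: if_splits)
 have "(\<Uplus>g. F g * G (g[+]x) * H (g[+]y) * s1 g x y)
   = (\<Uplus>g. (cst ^ 3 * (tP h)\<^sup>2) * ((ph g g * ph (g[+]x) (g[+]x) * ph (g[+]y) (g[+]y) * s1 g x y)
     * (tg g (u + h) * tg (g[+]x) (u + v + h) * tg (g[+]y) (v + h) * tg (g[+]x[+]y) h)))"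
 proof (rule sum.cong[OF refl])
  fix g
  have "F g * G (g[+]x) * H (g[+]y) * s1 g x y = cst ^ 3 * (tc g h * tc (g[+]x) h * tc (g[+]y) h)
   * ((ph g g * ph (g[+]x) (g[+]x) * ph (g[+]y) (g[+]y) * s1 g x y)
     * (tg g (u + h) * tg (g[+]x) (u + v + h) * tg (g[+]y) (v + h)))"
   unfolding F_def G_def H_def wR_def power3_eq_cube by (simp only: mult_ac)
  also have "... = (cst ^ 3 * (tP h)\<^sup>2) * ((ph g g * ph (g[+]x) (g[+]x) * ph (g[+]y) (g[+]y) * s1 g x y)
     * (tg g (u + h) * tg (g[+]x) (u + v + h) * tg (g[+]y) (v + h) * tg (g[+]x[+]y) h))"
   unfolding tc_triple[OF m] by (simp only: mult_ac)
  finally show "F g * G (g[+]x) * H (g[+]y) * s1 g x y = ..." .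
 qed
 also have "... = 0"
 proof -
  have "u + h + (v + h) = u + v + h + h" by simp
  from riemann_group_zero[OF m this] show ?thesis
   unfolding sum_distrib_left[symmetric] s1_def by simp
 qed
 finally show ?thesis by (simp add: s m sum_negf)
qed
thus ?thesis
 unfolding Rop_def F_def[symmetric] G_def[symmetric] H_def[symmetric] triple_product[OF d]
  s1_def[symmetric] s2_def[symmetric] by (simp only:)
qed

text \<open>The half-sums and half-differences of the Riemann relation.\<close>

definition hs0 :: "complex => complex => complex => complex => complex" where
 "hs0 a b c d = (a + b + c + d) / 2"

definition hs :: "complex => complex => complex => complex => complex" where
 "hs a b c d = (a + b - c - d) / 2"

lemma hs_swap: "hs a b c d = hs a b d c" by (simp add: hs_def)

lemma hs0_swap: "hs0 a b c d = hs0 a b d c" "hs0 a b c d = hs0 a c b d"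
 by (simp_all add: hs0_def)

text \<open>The sign in the commutation of the operators of \<open>g\<close> and \<open>h\<close>.\<close>

definition cc :: "idx => idx => complex" where "cc g h = ph g h * ph h g"

lemma cc_sq [simp]: "cc g h * cc g h = 1" "cc g h * (cc g h * x) = x"
 unfolding cc_def by (cases g rule: idx_cases; cases h rule: idx_cases; simp)+
lemma cc_simps [simp]: "cc (a, b) (c, d) = (if (a \<and> d) ~= (b \<and> c) then -1 else 1)" by (auto simp: cc_def)

lemma sum_shift_dep: "(\<Uplus>g x. T g x) = (\<Uplus>g x. T g (g[+]x))"
 for T :: "idx => idx => 'a::comm_monoid_add"
 by (rule sum.cong[OF refl], rule sum_shift[symmetric])

lemma double_product:
 assumes "i ~= j"
 shows "(\<Uplus>g. sc (F g) * DD i j g) * (\<Uplus>g. sc (G g) * DD i j g)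
  = (\<Uplus>x. sc (\<Uplus>g. F g * G (g[+]x)) * DD i j x)"
proof -
have t: "sc (F g) * DD i j g * (sc (G x) * DD i j x)
  = sc (F g * G x) * (Dop i (g[+]x) * Dop j (g[+]x))" for g x
proof -
 have c: "Dop j g * DD i j x = Dop i x * (Dop j g * Dop j x)"
  using Dop_comm[OF assms, of x g] by (simp flip: mult.assoc)
 have "Dop i g * Dop j g * DD i j x = (Dop i g * Dop i x) * (Dop j g * Dop j x)"
  unfolding mult.assoc c ..
 also have "... = sc (ph g x * ph g x) * (Dop i (g[+]x) * Dop j (g[+]x))"
  unfolding Dop_mult by (simp only: mult.assoc sc_lc[of "Dop _ _"] sc_sc)
 finally have "Dop i g * Dop j g * DD i j x = Dop i (g[+]x) * Dop j (g[+]x)" by simp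
 thus ?thesis by (simp only: mult.assoc sc_lc[of "Dop _ _"] sc_sc)
qed
have "(\<Uplus>g. sc (F g) * DD i j g) * (\<Uplus>g. sc (G g) * DD i j g)
  = (\<Uplus>g x. sc (F g * G x) * (Dop i (g[+]x) * Dop j (g[+]x)))"
 unfolding sum_product t ..
also have "... = (\<Uplus>g x. sc (F g * G (g[+]x)) * DD i j x)"
 by (rule trans[OF sum_shift_dep]) (simp only: gadd_cancel)
also note sum.swap
finally show ?thesis by (simp only: sc_sum sum_distrib_right)
qed

lemma eps_shift: "ph g g * ph (g[+]x) (g[+]x) = ph x x * cc g x"
 by (cases g rule: idx_cases; cases x rule: idx_cases) simp_all

text \<open>The permutation of two sites.\<close>

definition perm :: "nat => nat => lin" where
 "perm i j = sc (1 / 2) * (\<Uplus>g. sc (ph g g) * DD i j g)"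

lemma perm_alt: "perm i j = (\<Uplus>g. sc (ph g g / 2) * DD i j g)"
 unfolding perm_def sum_distrib_left sc_sc by simp

lemma perm_Dop:
 assumes "i ~= j"
 shows "perm i j * Dop i h = Dop j h * perm i j"
proof -
have "(\<Uplus>g. sc (ph g g) * DD i j g) * Dop i h
  = (\<Uplus>g. sc (ph g g * ph g h) * (Dop i (g[+]h) * Dop j g))"
proof -
 have "sc (ph g g) * DD i j g * Dop i h = sc (ph g g * ph g h) * (Dop i (g[+]h) * Dop j g)" for g
 proof -
  have "Dop i g * Dop j g * Dop i h = Dop i g * Dop i h * Dop j g"
   using Dop_comm[OF assms, of h g] by (simp add: mult.assoc)
  thus ?thesis unfolding Dop_mult by (simp only: mult.assoc sc_sc)
 qed
 thus ?thesis unfolding sum_distrib_right by (simp only:)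
qed
also have "... = (\<Uplus>g. sc (ph (h[+]g) (h[+]g) * ph (h[+]g) h) * (Dop i g * Dop j (h[+]g)))"
 by (rule trans[OF sum_shift[symmetric, where x = h]]) (simp only: gadd_comm[of "_[+]_" h] gadd_cancel)
also have "... = (\<Uplus>g. sc (ph g g * ph h g) * (Dop i g * Dop j (h[+]g)))"
proof -
 have "ph (h[+]g) (h[+]g) * ph (h[+]g) h = ph g g * ph h g" for g
  by (cases g rule: idx_cases; cases h rule: idx_cases) simp_all
 thus ?thesis by (simp only:)
qed
also have "... = Dop j h * (\<Uplus>g. sc (ph g g) * DD i j g)"
proof -
 have "Dop j h * (sc (ph g g) * DD i j g) = sc (ph g g * ph h g) * (Dop i g * Dop j (h[+]g))" for g
 proof -
  have "Dop j h * DD i j g = Dop i g * (Dop j h * Dop j g)"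
   using Dop_comm[OF assms, of g h] by (simp flip: mult.assoc)
  thus ?thesis unfolding Dop_mult sc_lc[of "Dop j h"] by (simp only: sc_lc[of "Dop i g"] sc_sc)
 qed
 thus ?thesis unfolding sum_distrib_left by (simp only:)
qed
finally show ?thesis unfolding perm_def by (simp only: mult.assoc sc_lc[of "Dop j h"])
qed

lemma tg_minus: "tg g (- z) = (if g = gI then - tg g z else tg g z)"
 by (cases g rule: idx_cases) (simp_all add: theta1_minus[OF im])

lemma tg_sign: "e = 1 \<or> e = -1 ==> tg g (e * z) = (if g = gI then e else 1) * tg g z"
 by (auto simp: tg_minus theta1_minus[OF im])

text \<open>The mixed Riemann relation in group form; the character \<open>cc _ y\<close> is absorbed in signs of the
 arguments because only \<open>\<theta>\<^sub>1\<close> is odd.\<close>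

lemma riemann_group:
 fixes x m y :: idx and a b c d :: complex
 assumes x: "x ~= gI" "m ~= gI" "x ~= m"
 defines "b' \<equiv> cc x y * b" and "c' \<equiv> cc m y * c" and "d' \<equiv> cc (m[+]x) y * d"
 shows "(\<Uplus>g. cc g y * (tg g a * tg (g[+]x) b * tg (g[+]m) c * tg (g[+](m[+]x)) d))
  = 2 * (tg gI (hs0 a b' c' d') * tg x (hs a b' c' d')
    * tg m (hs a c' b' d') * tg (m[+]x) (hs a d' b' c'))"
proof -
note m = theta1_minus[OF im] theta2_minus theta3_minus theta4_minus
define G where "G p q r s = th1 p * th2 q * th3 r * th4 s + th2 p * th1 q * th4 r * th3 s
 + th3 p * th4 q * th1 r * th2 s + th4 p * th3 q * th2 r * th1 s" for p q r s
define H where "H p q r s = 2 * th1 (hs0 p q r s) * th2 (hs p q r s)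
   * th3 (hs p r q s) * th4 (hs p s q r)" for p q r s
have GH: "G p q r s = H p q r s" for p q r s
proof -
 have e: "hs0 p q r s = (p + q + r + s) / 2" "hs p q r s = (p + q - r - s) / 2"
  "hs p r q s = (p - q + r - s) / 2" "hs p s q r = (p - q - r + s) / 2"
  unfolding hs0_def hs_def by (simp_all add: alg)
 show ?thesis unfolding G_def H_def e by (rule riemann_mixed)
qed
have pm: "cc u v = 1 \<or> cc u v = -1" for u v by (auto simp: cc_def ph_def)
have "cc g y * (tg g a * tg (g[+]x) b * tg (g[+]m) c * tg (g[+](m[+]x)) d)
  = tg g a * tg (g[+]x) b' * tg (g[+]m) c' * tg (g[+](m[+]x)) d'" for g
proof -
 have "g = gI \<or> g = x \<or> g = m \<or> g = m[+]x"
  using x by (cases g rule: idx_cases; cases x rule: idx_cases; cases m rule: idx_cases) simp_all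
 moreover have "m ~= m[+]x" "x ~= m[+]x" using x
  by (cases x rule: idx_cases; cases m rule: idx_cases; simp)+
 moreover have "cc gI y = 1" by (simp add: cc_def)
 ultimately show ?thesis
  using x unfolding b'_def c'_def d'_def tg_sign[OF pm] gadd_eq_0 by auto
qed
hence "(\<Uplus>g. cc g y * (tg g a * tg (g[+]x) b * tg (g[+]m) c * tg (g[+](m[+]x)) d))
 = (\<Uplus>g. tg g a * tg (g[+]x) b' * tg (g[+]m) c' * tg (g[+](m[+]x)) d')"
 by (simp only:)
also have "... = 2 * (tg gI (hs0 a b' c' d') * tg x (hs a b' c' d')
   * tg m (hs a c' b' d') * tg (m[+]x) (hs a d' b' c'))"
proof -
 have R: "S = W" if "G p q r s = H p q r s" "S = G p q r s" "H p q r s = W" for S W p q r s using that by simp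
 consider "x = gZ" "m = gY" | "x = gZ" "m = gX"
  | "x = gY" "m = gZ" | "x = gX" "m = gZ"
  | "x = gY" "m = gX" | "x = gX" "m = gY"
  using x by (cases x rule: idx_cases; cases m rule: idx_cases) simp_all
 thus ?thesis
 proof cases
  case 1 show ?thesis
   by (rule R[OF GH[of a b' c' d']], simp add: 1 sum_idx G_def mult_ac add_ac,
     simp add: 1 H_def hs_swap hs0_swap mult_ac)
 next
  case 2 show ?thesis
   by (rule R[OF GH[of a b' d' c']], simp add: 2 sum_idx G_def mult_ac add_ac,
     simp add: 2 H_def hs_swap hs0_swap mult_ac)
 next
  case 3 show ?thesis
   by (rule R[OF GH[of a c' b' d']], simp add: 3 sum_idx G_def mult_ac add_ac,
     simp add: 3 H_def hs_swap hs0_swap mult_ac)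
 next
  case 4 show ?thesis
   by (rule R[OF GH[of a c' d' b']], simp add: 4 sum_idx G_def mult_ac add_ac,
     simp add: 4 H_def hs_swap hs0_swap mult_ac)
 next
  case 5 show ?thesis
   by (rule R[OF GH[of a d' b' c']], simp add: 5 sum_idx G_def mult_ac add_ac,
     simp add: 5 H_def hs_swap hs0_swap mult_ac)
 next
  case 6 show ?thesis
   by (rule R[OF GH[of a d' c' b']], simp add: 6 sum_idx G_def mult_ac add_ac,
     simp add: 6 H_def hs_swap hs0_swap mult_ac)
 qed
qed
finally show ?thesis .
qed

lemma tc_pair:
 assumes "x ~= gI" "m ~= gI" "x ~= m"
 shows "tc g z * tc (g[+]x) z = tP z * (tg (g[+]m) z * tg (g[+](m[+]x)) z)"
 using assms
 by (cases x rule: idx_cases; cases m rule: idx_cases; cases g rule: idx_cases)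
   (simp_all add: tP_def mult_ac)

text \<open>The sums over the group that occur in all quadratic relations.\<close>

lemma wR_pair:
 fixes x m y :: idx and u v h :: complex
 assumes x: "x ~= gI" "m ~= gI" "x ~= m"
 defines "b' \<equiv> cc x y * (v + h)" and "c' \<equiv> cc m y * h" and "d' \<equiv> cc (m[+]x) y * h" and "a \<equiv> u + h"
 shows "(\<Uplus>g. cc g y * (wR h g u * wR h (g[+]x) v))
   = 2 * cst\<^sup>2 * tP h * (tg gI (hs0 a b' c' d') * tg x (hs a b' c' d')
    * tg m (hs a c' b' d') * tg (m[+]x) (hs a d' b' c'))"
proof -
let ?A = "%g. tg g a * tg (g[+]x) (v + h) * tg (g[+]m) h * tg (g[+](m[+]x)) h"
let ?B = "cst\<^sup>2 * tP h"
have "cc g y * (wR h g u * wR h (g[+]x) v) = ?B *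
  (cc g y * (?A g))" for g
proof -
 have "cc g y * (wR h g u * wR h (g[+]x) v) = cst\<^sup>2 * (tc g h * tc (g[+]x) h)
   * (cc g y * (tg g a * tg (g[+]x) (v + h)))"
  unfolding wR_def a_def power2_eq_square by (simp only: mult_ac)
 also have "... = ?B *
  (cc g y * (?A g))"
  unfolding tc_pair[OF x] by (simp only: mult_ac)
 finally show ?thesis .
qed
hence "(\<Uplus>g. cc g y * (wR h g u * wR h (g[+]x) v)) = ?B *
  (\<Uplus>g. cc g y * (?A g))"
 by (simp only: sum_distrib_left)
also have "... = ?B * (2 * (tg gI (hs0 a b' c' d') * tg x (hs a b' c' d')
   * tg m (hs a c' b' d') * tg (m[+]x) (hs a d' b' c')))"
 unfolding b'_def c'_def d'_def by (subst riemann_group[OF x]) (rule refl)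
finally show ?thesis by (simp only: mult_ac)
qed

lemma third_ex: "x ~= gI ==> \<exists>m. m ~= gI \<and> x ~= m" for x :: idx
 by (cases x rule: idx_cases) auto

lemma tg0_0: "tg gI 0 = 0" by (simp add: theta1_zero)

text \<open>The scalar to which \<open>R(u) R(-u)\<close> is equal.\<close>

definition rho :: "complex => complex => complex" where
 "rho h u = (\<Uplus>g. wR h g u * wR h g (- u))"

lemma R_unitarity:
 assumes "i ~= j"
 shows "Rop h i j u * Rop h i j (- u) = sc (rho h u)"
proof -
let ?A = "%g x. ph (g[+]x) (g[+]x) * wR h (g[+]x) (- u)"
have z: "(\<Uplus>g. ph g g * wR h g u * (?A g x))
  = (if x = gI then rho h u else 0)" for x
proof (cases "x = gI")
 case True
 have e: "ph g g * w * (ph g g * w') = w * w'" for g and w w' :: complex by (auto simp: ph_def)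
 show ?thesis using True by (simp add: rho_def e)
next
 case False
 then obtain m where m: "m ~= gI" "x ~= m" using third_ex by blast
 have "ph g g * wR h g u * (?A g x)
  = ph x x * (cc g x * (wR h g u * wR h (g[+]x) (- u)))" for g
  using eps_shift[of g x] by (metis (no_types, lifting) mult.assoc mult.left_commute)
 hence "(\<Uplus>g. ph g g * wR h g u * (?A g x))
  = ph x x * (\<Uplus>g. cc g x * (wR h g u * wR h (g[+]x) (- u)))"
  by (simp only: sum_distrib_left)
 moreover have c: "cc x x = 1" "cc m x = -1" "cc (m[+]x) x = -1"
  using m False by (cases x rule: idx_cases; cases m rule: idx_cases; simp)+
 have "(\<Uplus>g. cc g x * (wR h g u * wR h (g[+]x) (- u))) = 0"
  by (subst wR_pair[OF False m]) (simp add: c hs0_def theta1_zero)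
 ultimately show ?thesis using False by simp
qed
have "Rop h i j u * Rop h i j (- u) = (\<Uplus>x. sc (if x = gI then rho h u else 0) * DD i j x)"
 unfolding Rop_def double_product[OF assms] z ..
thus ?thesis by (simp add: sum_idx)
qed

text \<open>Crossing unitarity: the inverse of the partial transpose, written as a sum over the group.\<close>

lemma R_crossing_unitarity:
 "(\<Uplus>g. cc g x * (ph g g * wR h g (- v - 4 * h) * (ph (g[+]x) (g[+]x) * wR h (g[+]x) v)))
   = (if x = gI then rho h (v + 2 * h) else 0)"
proof (cases "x = gI")
case True
have e: "ph g g * w * (ph g g * w') = w * w'" for g and w w' :: complex by (auto simp: ph_def)
have "wR h g (- v - 4 * h) * wR h g v = wR h g (v + 2 * h) * wR h g (- (v + 2 * h))" for g
proof -
 have s: "- v - 4 * h + h = - (v + 3 * h)" "v + 2 * h + h = v + 3 * h" "- (v + 2 * h) + h = - (v + h)" by simp_all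
 show ?thesis unfolding wR_def s tg_minus by simp
qed
thus ?thesis using True by (simp add: rho_def e cc_def)
next
case False
then obtain m where m: "m ~= gI" "x ~= m" using third_ex by blast
have "cc g x * (ph g g * wR h g (- v - 4 * h) * (ph (g[+]x) (g[+]x) * wR h (g[+]x) v))
  = ph x x * (cc g gI * (wR h g (- v - 4 * h) * wR h (g[+]x) v))" for g
proof -
 have "cc g gI = 1" by (simp add: cc_def)
 moreover have "cc g x * (ph g g * a * (ph (g[+]x) (g[+]x) * b)) = cc g x * (ph g g * ph (g[+]x) (g[+]x)) * (a * b)" for a b
  by (simp only: mult_ac)
 ultimately show ?thesis unfolding eps_shift by (simp add: mult_ac)
qed
hence "(\<Uplus>g. cc g x * (ph g g * wR h g (- v - 4 * h) * (ph (g[+]x) (g[+]x) * wR h (g[+]x) v)))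
  = ph x x * (\<Uplus>g. cc g gI * (wR h g (- v - 4 * h) * wR h (g[+]x) v))"
 by (simp only: sum_distrib_left)
moreover have c: "cc n gI = 1" for n by (simp add: cc_def)
have "(\<Uplus>g. cc g gI * (wR h g (- v - 4 * h) * wR h (g[+]x) v)) = 0"
 by (subst wR_pair[OF False m]) (simp add: c hs0_def theta1_zero)
ultimately show ?thesis using False by simp
qed

text \<open>The R-matrix composed with the permutation has the same form with spectral and crossing
 parameter exchanged.\<close>

lemma wR_dual: "(\<Uplus>k. cc k x * wR h k z) = 2 * (cst * (tg x (z / 2 + 2 * h) * tc x (z / 2)))"
proof -
let ?x = "gZ :: idx" and ?m = "gY :: idx"
have xm: "?x ~= gI" "?m ~= gI" "?x ~= ?m" by simp_all
have t: "tc g h = tg (g[+]?x) h * tg (g[+]?m) h * tg (g[+](?m[+]?x)) h" for g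
 by (cases g rule: idx_cases) (simp_all add: mult_ac)
have "(\<Uplus>k. cc k x * wR h k z) = cst * (\<Uplus>g. cc g x * (tg g (z + h) * tg (g[+]?x) h * tg (g[+]?m) h * tg (g[+](?m[+]?x)) h))"
 unfolding wR_def t sum_distrib_left by (simp only: mult_ac)
also have "... = 2 * (cst * (tg x (z / 2 + 2 * h) * tc x (z / 2)))"
proof -
 have half: "(z + h + h + h + h) / 2 = z / 2 + 2 * h" by (simp add: field_simps)
 show ?thesis
  unfolding riemann_group[OF xm]
  by (cases x rule: idx_cases) (simp_all add: hs0_def hs_def add_divide_distrib diff_divide_distrib mult_ac add_ac)
qed
finally show ?thesis .
qed

lemma perm_Rop:
 assumes "i ~= j"
 shows "perm i j * Rop h i j z = (\<Uplus>g. sc (ph g g * (cst * (tg g (z / 2 + 2 * h) * tc g (z / 2)))) * DD i j g)"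
  "Rop h i j z * perm i j = (\<Uplus>g. sc (ph g g * (cst * (tg g (z / 2 + 2 * h) * tc g (z / 2)))) * DD i j g)"
proof -
let ?A = "%g x. ph (g[+]x) (g[+]x) * wR h (g[+]x) z"
have "(\<Uplus>g. ph g g / 2 * (?A g x))
  = ph x x * (cst * (tg x (z / 2 + 2 * h) * tc x (z / 2)))" for x
proof -
 have "ph g g / 2 * (?A g x) = (ph x x / 2) * (cc (g[+]x) x * wR h (g[+]x) z)" for g
 proof -
  have "cc (g[+]x) x = cc g x" by (cases g rule: idx_cases; cases x rule: idx_cases) simp_all
  thus ?thesis using eps_shift[of g x] by (simp add: mult.assoc[symmetric])
 qed
 hence "(\<Uplus>g. ph g g / 2 * (?A g x)) = (ph x x / 2) * (\<Uplus>g. cc (g[+]x) x * wR h (g[+]x) z)"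
  by (simp only: sum_distrib_left)
 also have "(\<Uplus>g. cc (g[+]x) x * wR h (g[+]x) z) = (\<Uplus>k. cc k x * wR h k z)"
  using sum_shift[of "%k. cc k x * wR h k z" x] by (simp only: gadd_comm[of x])
 finally show ?thesis unfolding wR_dual by simp
qed
thus 1: "perm i j * Rop h i j z = (\<Uplus>g. sc (ph g g * (cst * (tg g (z / 2 + 2 * h) * tc g (z / 2)))) * DD i j g)"
 unfolding perm_alt Rop_def double_product[OF assms] by (simp only:)
have cm: "(\<Uplus>g. F g * G (g[+]x)) = (\<Uplus>g. G g * F (g[+]x))" for F G :: "idx => complex" and x
 by (rule trans[OF sum_shift[symmetric, where x = x]]) (simp add: gadd_comm[of x] mult.commute)
have "Rop h i j z * perm i j = perm i j * Rop h i j z"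
 unfolding perm_alt Rop_def double_product[OF assms]
 by (rule sum.cong[OF refl], rule arg_cong2[where f = "(*)"], rule arg_cong[where f = sc],
   rule cm[of "%g. ph g g * wR h g z" "%g. ph g g / 2"], rule refl)
thus "Rop h i j z * perm i j = (\<Uplus>g. sc (ph g g * (cst * (tg g (z / 2 + 2 * h) * tc g (z / 2)))) * DD i j g)"
 using 1 by simp
qed

lemma tg_plus_pi: "tg g (z + \<pi>) = (if fst g then 1 else -1) * tg g z"
 using im by (cases g rule: idx_cases) (simp_all add: theta1_plus_pi theta2_plus_pi theta3_plus_pi theta4_plus_pi)

lemma tg_plus_tau: "tg g (z + pt) = (if snd g then 1 else -1) * qper z * tg g z"
 using im by (cases g rule: idx_cases) (simp_all add: theta_plus_tau qper_def)

lemma tg_hol: "entire (tg g)"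
 using im by (cases g rule: idx_cases) (simp_all add: theta_holomorphic)

lemma re_expand:
 assumes ij: "i ~= j"
 shows "(\<Uplus>g. sc (F g) * DD i j g) * (\<Uplus>g. sc (K g) * Dop i g)
   * (\<Uplus>g. sc (G g) * DD i j g) * (\<Uplus>g. sc (L g) * Dop j g)
  = (\<Uplus>x v w. sc (K v * L w * (\<Uplus>g. F g * G (g[+]x) * (cc g v * ph v x * ph x w)))
    * (Dop i (x[+]v) * Dop j (x[+]w)))" (is ?A)
  and "(\<Uplus>g. sc (L g) * Dop j g) * (\<Uplus>g. sc (G g) * DD i j g)
   * (\<Uplus>g. sc (K g) * Dop i g) * (\<Uplus>g. sc (F g) * DD i j g)
  = (\<Uplus>x v w. sc (K v * L w * (\<Uplus>g. F g * G (g[+]x) * (cc x (v[+]w) * (cc g v * ph v x * ph x w))))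
    * (Dop i (x[+]v) * Dop j (x[+]w)))" (is ?B)
proof -
let ?C = "%i g. Dop i g * Dop j g"
have cm: "Dop j g * Dop i x = Dop i x * Dop j g" for g x using ij by (simp add: Dop_comm)
have lcm: "Dop j g * (Dop i x * X) = Dop i x * (Dop j g * X)" for g x X using cm by (simp flip: mult.assoc)
have mm: "Dop i g * (Dop i x * X) = sc (ph g x) * (Dop i (g[+]x) * X)" for i g x X
 by (simp only: Dop_mult flip: mult.assoc)
have quad: "sum a U * sum b U * sum c U * sum d U = (\<Sum>g\<in>U. \<Sum>k\<in>U. \<Sum>v\<in>U. \<Sum>w\<in>U. a g * b v * c k * d w)"
 for a b c d :: "idx => lin" and U
proof -
 have "sum a U * sum b U * sum c U = (\<Sum>g\<in>U. \<Sum>k\<in>U. \<Sum>v\<in>U. a g * b v * c k)"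
  unfolding sum_triple_product by (rule sum.cong[OF refl], rule sum.swap)
 hence "sum a U * sum b U * sum c U * sum d U = (\<Sum>g\<in>U. \<Sum>k\<in>U. \<Sum>v\<in>U. a g * b v * c k * sum d U)"
  by (simp only: sum_distrib_right[of _ _ "sum d U"])
 thus ?thesis by (simp only: sum_distrib_left)
qed
have rq: "sum d U * sum c U * sum b U * sum a U = (\<Sum>g\<in>U. \<Sum>k\<in>U. \<Sum>v\<in>U. \<Sum>w\<in>U. d w * c k * b v * a g)"
 for a b c d :: "idx => lin" and U
 by (simp only: sum_distrib_left[of _ a], simp only: sum_distrib_left[of _ c], simp only: sum_distrib_right[of "%k. sum d U * c k"],
  simp only: sum_distrib_left[of _ b], simp only: sum_distrib_right)
have move: "(\<Uplus>g x v w. S g x v w) = (\<Uplus>x v w g. S g x v w)"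
 for S :: "idx => idx => idx => idx => lin"
proof -
 have "(\<Uplus>g x v w. S g x v w) = (\<Uplus>x g v w. S g x v w)"
  by (rule sum.swap)
 also have "... = (\<Uplus>x v g w. S g x v w)"
  by (rule sum.cong[OF refl], rule sum.swap)
 also have "... = (\<Uplus>x v w g. S g x v w)"
  by (rule sum.cong[OF refl], rule sum.cong[OF refl], rule sum.swap)
 finally show ?thesis .
qed
have tA: "sc (F g) * (?C i g) * (sc (K v) * Dop i v) * (sc (G k) * DD i j k) * (sc (L w) * Dop j w)
  = sc (F g * K v * G k * L w * (ph g v * ph (g[+]v) k * (ph g k * ph (g[+]k) w)))
   * (Dop i (g[+]v[+]k) * Dop j (g[+]k[+]w))" for g k v w
 by (simp only: mult.assoc sc_lc[of "Dop _ _"] cm lcm mm Dop_mult sc_comm[of "Dop _ _"] sc_sc) (simp only: mult_ac)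
have tB: "sc (L w) * Dop j w * (sc (G k) * DD i j k) * (sc (K v) * Dop i v) * (sc (F g) * (?C i g))
  = sc (F g * K v * G k * L w * (ph k v * ph (k[+]v) g * (ph w k * ph (w[+]k) g)))
   * (Dop i (k[+]v[+]g) * Dop j (w[+]k[+]g))" for g k v w
 by (simp only: mult.assoc sc_lc[of "Dop _ _"] cm lcm mm Dop_mult sc_comm[of "Dop _ _"] sc_sc) (simp only: mult_ac)
have pA: "ph g v * ph (g[+]v) (g[+]x) * (ph g (g[+]x) * ph (g[+](g[+]x)) w) = cc g v * ph v x * ph x w" for g x v w
 unfolding cc_def ph_add_left ph_add_right by (simp add: mult_ac)
have pB: "ph (g[+]x) v * ph (g[+]x[+]v) g * (ph w (g[+]x) * ph (w[+](g[+]x)) g) = cc x (v[+]w) * (cc g v * ph v x * ph x w)" for g x v w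
 unfolding cc_def ph_add_left ph_add_right by (simp add: mult_ac)
have dA: "g[+]v[+](g[+]x) = x[+]v" "g[+](g[+]x)[+]w = x[+]w"
 "g[+]x[+]v[+]g = x[+]v" "w[+](g[+]x)[+]g = x[+]w" for g x v w
 by (cases g rule: idx_cases; cases x rule: idx_cases; cases v rule: idx_cases; simp;
   cases w rule: idx_cases; simp)+
have fin: "(\<Uplus>g x v w. sc (F g * K v * G (g[+]x) * L w * p g x v w) * (Dop i (x[+]v) * Dop j (x[+]w)))
  = (\<Uplus>x v w. sc (K v * L w * (\<Uplus>g. F g * G (g[+]x) * p g x v w))
   * (Dop i (x[+]v) * Dop j (x[+]w)))" for p
proof -
 have e: "F g * K v * G (g[+]x) * L w * p g x v w = K v * L w * (F g * G (g[+]x) * p g x v w)" for g x v w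
  by (simp only: mult_ac)
 show ?thesis unfolding e by (rule trans[OF move]) (simp only: sum_distrib_left sc_sum sum_distrib_right)
qed
have "(\<Uplus>g. sc (F g) * (?C i g)) * (\<Uplus>g. sc (K g) * Dop i g)
  * (\<Uplus>g. sc (G g) * (?C i g)) * (\<Uplus>g. sc (L g) * Dop j g)
 = (\<Uplus>g k v w. sc (F g * K v * G k * L w * (ph g v * ph (g[+]v) k * (ph g k * ph (g[+]k) w)))
   * (Dop i (g[+]v[+]k) * Dop j (g[+]k[+]w)))"
 using quad[of "%g. sc (F g) * (?C i g)" UNIV "%g. sc (K g) * Dop i g"
   "%g. sc (G g) * (?C i g)" "%g. sc (L g) * Dop j g"]
 by (simp only: tA)
also note sum_shift_dep
also have "(\<Uplus>g x v w. sc (F g * K v * G (g[+]x) * L w * (ph g v * ph (g[+]v) (g[+]x) * (ph g (g[+]x) * ph (g[+](g[+]x)) w)))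
   * (Dop i (g[+]v[+](g[+]x)) * Dop j (g[+](g[+]x)[+]w)))
  = (\<Uplus>g x v w. sc (F g * K v * G (g[+]x) * L w * (cc g v * ph v x * ph x w)) * (Dop i (x[+]v) * Dop j (x[+]w)))"
 unfolding pA dA ..
also note fin[of "%g x v w. cc g v * ph v x * ph x w"]
finally show ?A .
have "(\<Uplus>g. sc (L g) * Dop j g) * (\<Uplus>g. sc (G g) * (?C i g))
  * (\<Uplus>g. sc (K g) * Dop i g) * (\<Uplus>g. sc (F g) * (?C i g))
 = (\<Uplus>g k v w. sc (F g * K v * G k * L w * (ph k v * ph (k[+]v) g * (ph w k * ph (w[+]k) g)))
   * (Dop i (k[+]v[+]g) * Dop j (w[+]k[+]g)))"
 using rq[of "%g. sc (L g) * Dop j g" UNIV "%g. sc (G g) * (?C i g)"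
   "%g. sc (K g) * Dop i g" "%g. sc (F g) * (?C i g)"]
 by (simp only: tB)
also note sum_shift_dep
also have "(\<Uplus>g x v w. sc (F g * K v * G (g[+]x) * L w * (ph (g[+]x) v * ph (g[+]x[+]v) g * (ph w (g[+]x) * ph (w[+](g[+]x)) g)))
   * (Dop i (g[+]x[+]v[+]g) * Dop j (w[+](g[+]x)[+]g)))
  = (\<Uplus>g x v w. sc (F g * K v * G (g[+]x) * L w * (cc x (v[+]w) * (cc g v * ph v x * ph x w))) * (Dop i (x[+]v) * Dop j (x[+]w)))"
 unfolding pB dA ..
also note fin[of "%g x v w. cc x (v[+]w) * (cc g v * ph v x * ph x w)"]
finally show ?B .
qed

lemma lat_coords:
 assumes "of_real x * \<pi> + of_real y * pt \<in> lat"
 shows "x \<in> \<int>" "y \<in> \<int>"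
proof -
obtain a b :: int where e: "of_real x * \<pi> + of_real y * pt = of_int a * \<pi> + of_int b * pt"
 using assms by (auto simp: lat_def)
have "y * (pi * Im \<tau>) = of_int b * (pi * Im \<tau>)" using arg_cong[OF e, of Im] by simp
hence y: "y = of_int b" using im by simp
have "x * pi = of_int a * pi" using arg_cong[OF e, of Re] y by simp
hence "x = of_int a" by simp
thus "x \<in> \<int>" "y \<in> \<int>" using y by auto
qed

lemma half_notin_Ints: "(1 / 2 :: real) \<notin> \<int>"
proof
assume "(1 / 2 :: real) \<in> \<int>"
then obtain n :: int where "(1 / 2 :: real) = of_int n" by (auto elim: Ints_cases)
hence "(1 :: real) = of_int (2 * n)" by simp
hence "(1 :: int) = 2 * n" by linarith
thus False by presburger
qed

lemma theta_nullwerte: "th2 0 ~= 0" "th3 0 ~= 0" "th4 0 ~= 0"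
proof -
have "th1 (\<pi> / 2) ~= 0"
 using lat_coords(1)[of "1/2" 0] half_notin_Ints by (auto simp: theta1_eq_0_iff)
thus "th2 0 ~= 0" using theta1_plus_half[OF im, of 0] by simp
have "th1 (pt / 2) ~= 0"
 using lat_coords(2)[of 0 "1/2"] half_notin_Ints by (auto simp: theta1_eq_0_iff)
thus "th4 0 ~= 0" using theta1_plus_tau_half[OF im, of 0] by auto
have "th1 (\<pi> / 2 + pt / 2) ~= 0"
 using lat_coords(2)[of "1/2" "1/2"] half_notin_Ints by (auto simp: theta1_eq_0_iff)
hence "th2 (pt / 2) ~= 0"
 using theta1_plus_half[OF im, of "pt / 2"] by (simp add: add.commute)
thus "th3 0 ~= 0" using theta2_plus_tau_half[OF im, of 0] by auto
qed

lemma theta4_double_sq: "(d4 0)\<^sup>2 = th3 0 * th4 0"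
 using theta3_theta4[of 0 0] by (simp add: modulus.theta1_zero[OF modulus.intro[OF im2]] power2_eq_square)

lemma theta4_double_nz: "d4 0 ~= 0"
 using theta4_double_sq theta_nullwerte by auto

lemma cst_nz [simp]: "cst ~= 0"
 using theta4_double_nz theta_nullwerte by (simp add: cst_def)

lemma cst_tc0: "cst * (th2 0 * th3 0 * th4 0) = 1"
 using theta4_double_sq theta_nullwerte by (simp add: cst_def)

lemma theta1_double: "th1 (2 * z) = 2 * cst * tP z"
proof -
let ?f1 = "d1" and ?f4 = "d4"
have a: "th1 z * th2 z = ?f1 (2 * z) * ?f4 0"
 using theta1_theta2_prod[of z z] by (simp add: modulus.theta1_zero[OF modulus.intro[OF im2]] flip: mult_2)
have b: "th3 z * th4 z = ?f4 (2 * z) * ?f4 0"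
 using theta3_theta4[of z z] by (simp add: modulus.theta1_zero[OF modulus.intro[OF im2]] flip: mult_2)
have c: "th1 (2 * z) * th2 0 = 2 * (?f1 (2 * z) * ?f4 (2 * z))"
 using theta1_theta2_prod[of "2 * z" 0] by simp
have "tP z = (th1 z * th2 z) * (th3 z * th4 z)" by (simp add: tP_def)
also have "... = (?f1 (2 * z) * ?f4 (2 * z)) * (?f4 0)\<^sup>2" unfolding a b by (simp add: power2_eq_square)
finally have "2 * cst * tP z = (2 * (?f1 (2 * z) * ?f4 (2 * z))) / th2 0"
 using theta4_double_nz by (simp add: cst_def)
thus ?thesis unfolding c[symmetric] using theta_nullwerte by simp
qed

lemma wR_0: "wR h g 0 = th1 (2 * h) / 2"
 unfolding wR_def theta1_double by (simp add: tc_tg)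

lemma Rop_0: "Rop h i j 0 = sc (th1 (2 * h)) * perm i j"
 unfolding Rop_def perm_alt wR_0 sum_distrib_left sc_sc by (simp add: mult.commute)

lemma tg_pair_even: "even_theta 1 (%u. tg g (u + h) * tg g (u - h))"
proof (rule even_thetaI)
show "entire (%u. tg g (u + h) * tg g (u - h))"
 by (intro holomorphic_intros entire_compose[OF tg_hol])
fix z
have s: "- z + h = - (z - h)" "- z - h = - (z + h)" by simp_all
show "tg g (- z + h) * tg g (- z - h) = tg g (z + h) * tg g (z - h)"
 unfolding s tg_minus by simp
have s: "z + \<pi> + h = (z + h) + \<pi>" "z + \<pi> - h = (z - h) + \<pi>" by simp_all
show "tg g (z + \<pi> + h) * tg g (z + \<pi> - h) = tg g (z + h) * tg g (z - h)"
 unfolding s tg_plus_pi by simp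
have s: "z + pt + h = (z + h) + pt" "z + pt - h = (z - h) + pt" by simp_all
have "tg g (z + pt + h) * tg g (z + pt - h)
  = (qper (z + h) * qper (z - h)) * (tg g (z + h) * tg g (z - h))"
 unfolding s tg_plus_tau by simp
thus "tg g (z + pt + h) * tg g (z + pt - h)
  = qper z ^ (2 * 1) * (tg g (z + h) * tg g (z - h))" by (simp add: qper_mult)
qed

lemma rho_eq:
 assumes h: "th1 (2 * h) ~= 0" "th1 (4 * h) ~= 0"
 shows "rho h u = ts (2 * h) u"
proof -
let ?A = "th1 (2 * h)"
let ?B = "%g. tg g (3 * h) * tc g h"
define e where "e g = (if g = gI then -1 else 1 :: complex)" for g :: idx
have r: "rho h u = (\<Uplus>g. ((cst * tc g h)\<^sup>2 * e g) * (tg g (u + h) * tg g (u - h)))" for u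
 unfolding rho_def
proof (rule sum.cong[OF refl])
 fix g
 have s: "- u + h = - (u - h)" by simp
 show "wR h g u * wR h g (- u) = ((cst * tc g h)\<^sup>2 * e g) * (tg g (u + h) * tg g (u - h))"
  unfolding wR_def s tg_minus e_def by (simp add: power2_eq_square mult_ac)
qed
have E: "even_theta (Suc 0) (rho h)"
 unfolding r[abs_def] One_nat_def[symmetric]
 by (intro even_theta_sum even_theta_cmult tg_pair_even) simp
have z: "rho h (2 * h) = 0"
proof -
 let ?x = "gZ :: idx" and ?m = "gY :: idx"
 have xm: "?x ~= gI" "?m ~= gI" "?x ~= ?m" by simp_all
 have c: "cc g gI = 1" for g by (simp add: cc_def)
 have "(\<Uplus>g. e g * (?B g)) = - (\<Uplus>g. cc g gI * (tg g (3 * h) * tg (g[+]?x) (- h) * tg (g[+]?m) (- h) * tg (g[+](?m[+]?x)) (- h)))"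
  by (simp add: sum_idx e_def theta1_minus[OF im] c)
 also have "... = 0"
  by (subst riemann_group[OF xm]) (simp add: c hs0_def theta1_zero)
 finally have *: "(\<Uplus>g. e g * (?B g)) = 0" .
 have "rho h (2 * h) = (\<Uplus>g. (cst\<^sup>2 * tP h) * (e g * (?B g)))"
  unfolding r
 proof (rule sum.cong[OF refl])
  fix g
  have s: "2 * h + h = 3 * h" "2 * h - h = h" by simp_all
  have "(cst * tc g h)\<^sup>2 * e g * (tg g (3 * h) * tg g h)
   = cst\<^sup>2 * (tg g h * tc g h) * (e g * (?B g))"
   by (simp add: power2_eq_square mult_ac)
  thus "(cst * tc g h)\<^sup>2 * e g * (tg g (2 * h + h) * tg g (2 * h - h))
   = (cst\<^sup>2 * tP h) * (e g * (?B g))" unfolding s tc_tg .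
 qed
 thus ?thesis using * by (simp flip: sum_distrib_left)
qed
have "th1 (2 * (2 * h)) ~= 0" using h by simp
then obtain f where f: "even_theta 0 f" "!!u. rho h u = f u * ts u (2 * h)"
 using even_theta_divide[OF E z] by blast
have "\<exists>c. \<forall>z. f z = c" by (rule doubly_periodic_const[OF im]) (use even_thetaD[OF f(1)] in auto)
then obtain c where c: "!!u. rho h u = c * ts u (2 * h)" using f(2) by auto
have "rho h 0 = ?A\<^sup>2"
 unfolding rho_def minus_zero wR_0 by (simp add: sum_idx power2_eq_square field_simps)
moreover have "ts 0 (2 * h) = - ?A\<^sup>2"
 by (simp add: ts_def theta1_minus[OF im] power2_eq_square)
ultimately have e: "c * (- ?A\<^sup>2) = ?A\<^sup>2" using c[of 0] by metis
have "(c + 1) * ?A\<^sup>2 = ?A\<^sup>2 - c * (- ?A\<^sup>2)"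
 by (simp add: alg)
hence "(c + 1) * ?A\<^sup>2 = 0" unfolding e by simp
hence "c = -1" using h(1) by (simp add: eq_neg_iff_add_eq_0)
thus ?thesis using c[of u] ts_minus[of u "2 * h"] by simp
qed

lemma cc_add_right: "cc g (x[+]y) = cc g x * cc g y"
 unfolding cc_def ph_add_left ph_add_right by (simp add: mult_ac)

lemma cc_add_left: "cc (x[+]y) g = cc x g * cc y g"
 unfolding cc_def ph_add_left ph_add_right by (simp add: mult_ac)

lemma cc_pm: "cc x y = 1 \<or> cc x y = -1"
 by (cases x rule: idx_cases; cases y rule: idx_cases) simp_all

lemma cc_self [simp]: "cc x x = 1" by (cases x rule: idx_cases) simp_all

text \<open>The quadratic sums at spectral parameters \<open>a - b\<close> and \<open>a + b\<close>.\<close>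

lemma wR_pair_pm:
 fixes x m y :: idx and a b h :: complex
 assumes x: "x ~= gI" "m ~= gI" "x ~= m"
 defines "e \<equiv> cc m y"
 shows "(\<Uplus>g. cc g y * (wR h g (a - b) * wR h (g[+]x) (a + b)))
   = 2 * cst\<^sup>2 * tP h * (if cc x y = 1
     then tg gI (a + h + e * h) * tg x (a + h - e * h) * tg m (- b) * tg (m[+]x) (- b)
     else tg gI (- b) * tg x (- b) * tg m (a + h + e * h) * tg (m[+]x) (a + h - e * h))"
proof (cases "cc x y = 1")
case True
have d: "cc (m[+]x) y = e" unfolding cc_add_left True e_def by simp
have "hs0 (a - b + h) (1 * (a + b + h)) (e * h) (e * h) = a + h + e * h"
 "hs (a - b + h) (1 * (a + b + h)) (e * h) (e * h) = a + h - e * h"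
 "hs (a - b + h) (e * h) (1 * (a + b + h)) (e * h) = - b"
 by (simp_all add: hs0_def hs_def field_simps)
thus ?thesis unfolding wR_pair[OF x] d True unfolding e_def[symmetric] by simp
next
case False
hence c: "cc x y = -1" using cc_pm by blast
have d: "cc (m[+]x) y = - e" unfolding cc_add_left c e_def by simp
have "hs0 (a - b + h) (-1 * (a + b + h)) (e * h) (- e * h) = - b"
 "hs (a - b + h) (-1 * (a + b + h)) (e * h) (- e * h) = - b"
 "hs (a - b + h) (e * h) (-1 * (a + b + h)) (- e * h) = a + h + e * h"
 "hs (a - b + h) (- e * h) (-1 * (a + b + h)) (e * h) = a + h - e * h"
 by (simp_all add: hs0_def hs_def field_simps)
thus ?thesis unfolding wR_pair[OF x] d c unfolding e_def[symmetric] by simp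
qed

lemma re_scalar:
 fixes x v w :: idx and a b h :: complex
 assumes c: "cc x (v[+]w) = -1"
 defines "W \<equiv> %x v. \<Uplus>g. cc g (v[+]x) * (wR h g (a - b) * wR h (g[+]x) (a + b))"
 shows "ph v x * ph x w * ph x x * W x v * (kK v a * kK w b)
  + ph w (x[+]v[+]w) * ph (x[+]v[+]w) v * ph (x[+]v[+]w) (x[+]v[+]w)
   * W (x[+]v[+]w) w * (kK w a * kK v b) = 0"
proof -
define m where "m = v[+]w"
define x' where "x' = x[+]v[+]w"
have x: "x ~= gI" "m ~= gI" "x ~= m"
 using c[folded m_def] by (cases x rule: idx_cases; cases m rule: idx_cases; simp)+
have x': "x' ~= gI" "x' ~= m"
 using x by (auto simp: x'_def m_def gadd_assoc)
   (metis gadd_cancel gadd_comm gadd_0(2) gadd_self)+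
have m: "th1 (- b) = - th1 b" by (rule theta1_minus[OF im])
define Q where "Q = 2 * cst\<^sup>2 * tP h"
have W1: "W x v = Q * (if cc x (v[+]x) = 1
    then tg gI (a + h + cc m (v[+]x) * h) * tg x (a + h - cc m (v[+]x) * h) * tg m (- b) * tg (m[+]x) (- b)
    else tg gI (- b) * tg x (- b) * tg m (a + h + cc m (v[+]x) * h) * tg (m[+]x) (a + h - cc m (v[+]x) * h))"
 unfolding W_def Q_def by (rule wR_pair_pm[OF x])
have W2: "W x' w = Q * (if cc x' (w[+]x') = 1
    then tg gI (a + h + cc m (w[+]x') * h) * tg x' (a + h - cc m (w[+]x') * h) * tg m (- b) * tg (m[+]x') (- b)
    else tg gI (- b) * tg x' (- b) * tg m (a + h + cc m (w[+]x') * h) * tg (m[+]x') (a + h - cc m (w[+]x') * h))"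
 unfolding W_def Q_def by (rule wR_pair_pm[OF x'(1) x(2) x'(2)])
have f: "f (a + h + 1 * h) = f (a + 2 * h)" "f (a + h - (- 1) * h) = f (a + 2 * h)" "f (a + h - 1 * h) = f a" "f (a + h + (- 1) * h) = f a"
 for f :: "complex => complex" by (rule arg_cong[where f = f], simp)+
show ?thesis
 unfolding x'_def[symmetric] W1 W2
 using c unfolding x'_def m_def kK_def
 by (cases x rule: idx_cases; cases v rule: idx_cases; cases w rule: idx_cases)
   (simp_all add: m add.assoc)
qed

theorem reflection_equation:
 assumes ij: "i ~= j"
 shows "Rop h i j (a - b) * Kop c i a * Rop h i j (a + b) * Kop c j b
  = Kop c j b * Rop h i j (a + b) * Kop c i a * Rop h i j (a - b)"
proof -
let ?A = "%g x. wR h g (a - b) * wR h (g[+]x) (a + b)"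
define F G K L where "F g = ph g g * wR h g (a - b)" and "G g = ph g g * wR h g (a + b)"
 and "K g = c g * kK g a" and "L g = c g * kK g b" for g
define S where "S x v w = (\<Uplus>g. F g * G (g[+]x) * (cc g v * ph v x * ph x w))" for x v w
define W where "W x v = (\<Uplus>g. cc g (v[+]x) * (?A g x))" for x v
define d where "d x v w = Dop i (x[+]v) * Dop j (x[+]w)" for x v w
define T where "T x v w = sc (K v * L w * ((1 - cc x (v[+]w)) * S x v w)) * d x v w" for x v w
have S: "S x v w = ph v x * ph x w * ph x x * W x v" for x v w
 unfolding S_def W_def sum_distrib_left
proof (rule sum.cong[OF refl])
 fix g
 have "F g * G (g[+]x) * (cc g v * ph v x * ph x w)
  = (ph g g * ph (g[+]x) (g[+]x)) * (cc g v * ph v x * ph x w * (?A g x))"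
  unfolding F_def G_def by (simp only: mult_ac)
 also have "... = ph v x * ph x w * ph x x * (cc g (v[+]x) * (?A g x))"
  unfolding eps_shift cc_add_right by (simp only: mult_ac)
 finally show "F g * G (g[+]x) * (cc g v * ph v x * ph x w) = ..." .
qed
have T0: "T x v w + T (x[+]v[+]w) w v = 0" for x v w
proof -
 have d: "d (x[+]v[+]w) w v = d x v w"
 proof -
  have "x[+]v[+]w[+]w = x[+]v" "x[+]v[+]w[+]v = x[+]w"
   by (cases x rule: idx_cases; cases v rule: idx_cases; cases w rule: idx_cases; simp)+
  thus ?thesis by (simp add: d_def)
 qed
 have cx: "cc (x[+]v[+]w) (w[+]v) = cc x (v[+]w)"
  unfolding gadd_comm[of w v] gadd_assoc cc_add_left[of x] by simp
 show ?thesis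
 proof (cases "cc x (v[+]w) = 1")
  case True thus ?thesis unfolding T_def cx by simp
 next
  case False
  hence c1: "cc x (v[+]w) = -1" using cc_pm by blast
  have "T x v w + T (x[+]v[+]w) w v = sc (2 * (c v * c w) *
    (ph v x * ph x w * ph x x * W x v * (kK v a * kK w b)
    + ph w (x[+]v[+]w) * ph (x[+]v[+]w) v * ph (x[+]v[+]w) (x[+]v[+]w)
  * W (x[+]v[+]w) w * (kK w a * kK v b))) * d x v w"
   unfolding T_def cx d c1 S K_def L_def distrib_right[symmetric] sc_add[symmetric]
   by (rule arg_cong2[where f = "(*)"], rule arg_cong[where f = sc]) (simp_all add: alg)
  also have "... = 0" unfolding W_def re_scalar[OF c1] by simp
  finally show ?thesis .
 qed
qed
have inv: "(\<Uplus>x v w. T x v w) = (\<Uplus>x v w. T (x[+]v[+]w) w v)"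
proof -
 have "(\<Uplus>x v w. T x v w) = (\<Uplus>v x w. T x v w)" by (rule sum.swap)
 also have "... = (\<Uplus>v w x. T x v w)" by (rule sum.cong[OF refl], rule sum.swap)
 also have "... = (\<Uplus>w v x. T x v w)" by (rule sum.swap)
 also have "... = (\<Uplus>w v x. T (x[+]w[+]v) v w)"
 proof (rule sum.cong[OF refl], rule sum.cong[OF refl])
  fix w v
  have "(\<Uplus>x. T x v w) = (\<Uplus>x. T ((w[+]v)[+]x) v w)" by (rule sum_shift[symmetric])
  thus "(\<Uplus>x. T x v w) = (\<Uplus>x. T (x[+]w[+]v) v w)"
   by (simp only: gadd_comm[of "w[+]v"] gadd_assoc[symmetric])
 qed
 also have "... = (\<Uplus>w x v. T (x[+]w[+]v) v w)" by (rule sum.cong[OF refl], rule sum.swap)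
 also have "... = (\<Uplus>x w v. T (x[+]w[+]v) v w)" by (rule sum.swap)
 finally show ?thesis .
qed
define Z where "Z = (\<Uplus>x v w. T x v w)"
have "Z + Z = (\<Uplus>x v w. T x v w + T (x[+]v[+]w) w v)"
 unfolding Z_def by (subst (2) inv) (simp only: sum.distrib)
also have "... = 0" unfolding T0 by simp
finally have "sc 2 * Z = sc 2 * 0" using sc_add[of 1 1] by (simp add: mult_2)
hence Z0: "Z = 0" using sc_cancel[of 2 Z 0] by simp
have "Rop h i j (a - b) * Kop c i a * Rop h i j (a + b) * Kop c j b
 - Kop c j b * Rop h i j (a + b) * Kop c i a * Rop h i j (a - b) = Z"
proof -
 have t: "sc (p * s) * X - sc (p * (\<Uplus>g. f g * (q * r g))) * X = sc (p * ((1 - q) * s)) * X"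
  if "s = (\<Uplus>g. f g * r g)" for p q s X and f r :: "idx => complex"
 proof -
  have "(\<Uplus>g. f g * (q * r g)) = q * s" unfolding that sum_distrib_left by (simp only: mult.left_commute)
  thus ?thesis unfolding left_diff_distrib[symmetric] sc_diff[symmetric]
   by (simp add: alg)
 qed
 show ?thesis
  unfolding Rop_def Kop_def F_def[symmetric] G_def[symmetric] K_def[symmetric] L_def[symmetric] re_expand[OF ij]
   sum_subtractf[symmetric] Z_def T_def d_def S_def
  by (rule sum.cong[OF refl], rule sum.cong[OF refl], rule sum.cong[OF refl], rule t[OF refl])
qed
thus ?thesis using Z0 by simp
qed

section \<open>The double-row monodromy\<close>

text \<open>Dressing by one site in components: \<open>wdress h xi g b\<close> is the coefficient with which the
 component \<open>b\<close> of the inner operator contributes to the component \<open>g\<close>.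

 \<open>Uop h c L a z\<close> is the boundary matrix on the auxiliary site \<open>a\<close>, dressed by the sites with
 inhomogeneities in the list \<open>L\<close>, and \<open>ucomp\<close> are its components; \<open>Top\<close> is the trace over \<open>a\<close> of
 its product with the other boundary matrix.\<close>

definition wdress :: "complex => complex => idx => idx => complex => complex" where
 "wdress h xi g b z = ph (g[+]b) (g[+]b) * ph b (g[+]b) *
   (\<Uplus>k. cc k g * (wR h k (z - xi - h) * wR h (k[+](g[+]b)) (z + xi - h)))"

fun ucomp :: "complex => (idx => complex) => (nat \<times> complex) list => idx => complex => lin" where
 "ucomp h c [] g z = sc (c g * kK g (z - h))"
| "ucomp h c ((n, xi) # L) g z = (\<Uplus>b. sc (wdress h xi g b z) * (Dop n (g[+]b) * ucomp h c L b z))"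

definition Uop :: "complex => (idx => complex) => (nat \<times> complex) list => nat => complex => lin" where
 "Uop h c L a z = emb a (%g. ucomp h c L g z)"

definition Top :: "complex => (idx => complex) => (idx => complex) => (nat \<times> complex) list => complex => lin" where
 "Top h c' c L z = (\<Uplus>g. sc (2 * ph g g * (c' g * kK g (z + h))) * ucomp h c L g z)"

lemma off_ucomp: "a \<notin> fst ` set L ==> off a (ucomp h c L g z)"
proof (induction L arbitrary: g)
case (Cons p L)
obtain n xi where p: "p = (n, xi)" by fastforce
show ?case unfolding p ucomp.simps
 by (rule off_sum, rule off_mult[OF off_sc], rule off_mult) (use Cons p in auto)
qed simp

lemma off_Uop: "a \<notin> fst ` set L ==> a ~= b ==> off a (Uop h c L b z)"
 unfolding Uop_def by (intro off_emb off_ucomp)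

lemma Uop_Nil: "Uop h c [] a z = Kop c a (z - h)"
 unfolding Uop_def emb_def Kop_def ucomp.simps by (intro sum.cong refl sc_comm)

lemma Uop_Cons:
 assumes a: "a ~= n" "a \<notin> fst ` set L" "n \<notin> fst ` set L"
 shows "Uop h c ((n, xi) # L) a z = Rop h a n (z - xi - h) * Uop h c L a z * Rop h a n (z + xi - h)"
proof -
let ?A = "%k b x. ph k b * ph (k[+]b) (k[+]x) * ph k (k[+]x)"
define F G where "F k = ph k k * wR h k (z - xi - h)" and "G k = ph k k * wR h k (z + xi - h)" for k
define u where "u g = ucomp h c L g z" for g
have ca: "u g * Dop a k = Dop a k * u g" and cn: "u g * Dop n k = Dop n k * u g" for g k
 unfolding u_def by (rule offD[OF off_ucomp[OF a(2)], symmetric] offD[OF off_ucomp[OF a(2)]], rule offD[OF off_ucomp[OF a(3)], symmetric] offD[OF off_ucomp[OF a(3)]])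
have cl: "u g * (Dop a k * X) = Dop a k * (u g * X)" "u g * (Dop n k * X) = Dop n k * (u g * X)" for g k X
 using ca[of g k] cn[of g k] by (simp_all flip: mult.assoc)
have cm: "Dop n g * Dop a x = Dop a x * Dop n g" for g x using a by (simp add: Dop_comm)
have lcm: "Dop n g * (Dop a x * X) = Dop a x * (Dop n g * X)" for g x X using cm by (simp flip: mult.assoc)
have mm: "Dop i g * (Dop i x * X) = sc (ph g x) * (Dop i (g[+]x) * X)" for i g x X
 by (simp only: Dop_mult flip: mult.assoc)
have t: "sc (F k) * DD a n k * (Dop a b * u b) * (sc (G l) * DD a n l)
  = sc (F k * G l * (ph k b * ph (k[+]b) l * ph k l)) * (Dop a (k[+]b[+]l) * (Dop n (k[+]l) * u b))" for k b l
 by (simp only: mult.assoc sc_lc[of "Dop _ _"] sc_lc[of "u _"] ca cn cl cm lcm mm sc_comm[of "Dop _ _"] sc_sc)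
   (simp only: mult_ac)
have d: "k[+]b[+](k[+]x) = x[+]b" "k[+](k[+]x) = x" for k b x
 by (cases k rule: idx_cases; cases b rule: idx_cases; cases x rule: idx_cases; simp)+
have s: "(\<Uplus>k. F k * G (k[+]x) * (?A k b x)) = wdress h xi (x[+]b) b z" for x b
proof -
 have "F k * G (k[+]x) * (?A k b x)
   = ph x x * ph b x * (cc k (x[+]b) * (wR h k (z - xi - h) * wR h (k[+]x) (z + xi - h)))" for k
 proof -
  have p: "ph k b * ph (k[+]b) (k[+]x) * ph k (k[+]x) = cc k b * ph b x"
   unfolding cc_def ph_add_left ph_add_right by (simp add: mult_ac)
  have "F k * G (k[+]x) * (cc k b * ph b x) = (ph k k * ph (k[+]x) (k[+]x)) * (cc k b * ph b x)
    * (wR h k (z - xi - h) * wR h (k[+]x) (z + xi - h))"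
   unfolding F_def G_def by (simp only: mult_ac)
  thus ?thesis unfolding p eps_shift cc_add_right by (simp only: mult_ac)
 qed
 thus ?thesis unfolding wdress_def by (simp add: sum_distrib_left)
qed
have "Rop h a n (z - xi - h) * Uop h c L a z * Rop h a n (z + xi - h)
  = (\<Uplus>k b l. sc (F k * G l * (ph k b * ph (k[+]b) l * ph k l)) * (Dop a (k[+]b[+]l) * (Dop n (k[+]l) * u b)))"
 unfolding Rop_def Uop_def emb_def F_def[symmetric] G_def[symmetric] u_def[symmetric]
 by (rule trans[OF sum_triple_product]) (simp only: t)
also have "... = (\<Uplus>b k l. sc (F k * G l * (ph k b * ph (k[+]b) l * ph k l)) * (Dop a (k[+]b[+]l) * (Dop n (k[+]l) * u b)))"
 by (rule sum.swap)
also have "... = (\<Uplus>b k x. sc (F k * G (k[+]x) * (?A k b x)) * (Dop a (x[+]b) * (Dop n x * u b)))"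
 by (rule sum.cong[OF refl], rule trans[OF sum_shift_dep]) (simp only: d)
also have "... = (\<Uplus>b x k. sc (F k * G (k[+]x) * (?A k b x)) * (Dop a (x[+]b) * (Dop n x * u b)))"
 by (rule sum.cong[OF refl], rule sum.swap)
also have "... = (\<Uplus>b x. sc (wdress h xi (x[+]b) b z) * (Dop a (x[+]b) * (Dop n x * u b)))"
 unfolding s[symmetric] sc_sum sum_distrib_right ..
also have "... = (\<Uplus>b g. sc (wdress h xi g b z) * (Dop a g * (Dop n (g[+]b) * u b)))"
proof (rule sum.cong[OF refl])
 fix b
 have "(\<Uplus>g. sc (wdress h xi g b z) * (Dop a g * (Dop n (g[+]b) * u b)))
   = (\<Uplus>x. sc (wdress h xi (b[+]x) b z) * (Dop a (b[+]x) * (Dop n (b[+]x[+]b) * u b)))"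
  by (rule sum_shift[symmetric])
 moreover have "b[+]x[+]b = x" for x by (simp add: gadd_comm[of b])
 ultimately show "(\<Uplus>x. sc (wdress h xi (x[+]b) b z) * (Dop a (x[+]b) * (Dop n x * u b)))
   = (\<Uplus>g. sc (wdress h xi g b z) * (Dop a g * (Dop n (g[+]b) * u b)))"
  by (simp add: gadd_comm[of b])
qed
also have "... = (\<Uplus>g b. sc (wdress h xi g b z) * (Dop a g * (Dop n (g[+]b) * u b)))" by (rule sum.swap)
also have "... = Uop h c ((n, xi) # L) a z"
 unfolding Uop_def emb_def ucomp.simps u_def[symmetric] sum_distrib_left by (simp only: sc_lc[of "Dop a _"])
finally show ?thesis by simp
qed

lemma Top_ptr:
 assumes "a \<notin> fst ` set L"
 shows "Top h c' c L z = ptr a (Kop c' a (z + h) * Uop h c L a z)"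
proof -
have k: "Kop c' a (z + h) = emb a (%g. sc (c' g * kK g (z + h)))"
 unfolding Kop_def emb_def by (intro sum.cong refl sc_comm[symmetric])
show ?thesis unfolding k Uop_def Top_def
 by (subst ptr_emb_emb[OF off_ucomp[OF assms] off_sc]) (simp only: sc_sc)
qed

lemma ptr_swap:
 assumes "a ~= b"
 shows "ptr a (ptr b Z) = ptr b (ptr a Z)"
proof -
have e: "ptr i (ptr j Z) = (\<Uplus>g k. sc (1 / 2 * ph g g * (1 / 2 * ph k k)) * (Dop i g * Dop j k * Z * (Dop j k * Dop i g)))" for i j
proof -
 have t: "sc (1 / 2 * ph g g) * (Dop i g * (sc (1 / 2 * ph k k) * (Dop j k * Z * Dop j k)) * Dop i g)
   = sc (1 / 2 * ph g g * (1 / 2 * ph k k)) * (Dop i g * Dop j k * Z * (Dop j k * Dop i g))" for g k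
  by (simp only: mult.assoc sc_lc[of "Dop _ _"] flip: sc_sc)
 have p: "ptr i W = (\<Uplus>g. sc (1 / 2 * ph g g) * (Dop i g * W * Dop i g))" for i W
  unfolding ptr_def sum_distrib_left sc_sc[symmetric] by (simp only: mult.assoc)
 show ?thesis unfolding p[of i] unfolding p[of j] unfolding sum_distrib_left sum_distrib_right
  by (simp only: t)
qed
have t: "sc (1 / 2 * ph g g * (1 / 2 * ph k k)) * (Dop a g * Dop b k * Z * (Dop b k * Dop a g))
  = sc (1 / 2 * ph k k * (1 / 2 * ph g g)) * (Dop b k * Dop a g * Z * (Dop a g * Dop b k))" for g k
proof -
 have s: "1 / 2 * ph g g * (1 / 2 * ph k k) = 1 / 2 * ph k k * (1 / 2 * ph g g)" by (rule mult.commute)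
 show ?thesis by (subst s, subst Dop_comm[OF assms, of g k], subst Dop_comm[OF assms, of g k]) (rule refl)
qed
show ?thesis unfolding e t by (rule sum.swap)
qed

lemma Uop_reflection:
 assumes "a ~= b" "a \<notin> fst ` set L" "b \<notin> fst ` set L" "distinct (map fst L)"
 shows "Rop h a b (x - y) * Uop h c L a x * Rop h a b (x + y - 2 * h) * Uop h c L b y
  = Uop h c L b y * Rop h a b (x + y - 2 * h) * Uop h c L a x * Rop h a b (x - y)"
 using assms
proof (induction L)
case Nil
have "x - h - (y - h) = x - y" "x - h + (y - h) = x + y - 2 * h" by simp_all
thus ?case using reflection_equation[OF Nil(1), of h "x - h" "y - h" c] unfolding Uop_Nil by simp
next
case (Cons p L)
obtain n xi where p: "p = (n, xi)" by fastforce
have n: "a ~= n" "b ~= n" "n \<notin> fst ` set L" and ab: "a ~= b" "a \<notin> fst ` set L" "b \<notin> fst ` set L"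
 using Cons.prems p by (auto simp: rev_image_eqI)
define R1 R2 R3 R4 S T where "R1 = Rop h a n (x - xi - h)" "R2 = Rop h a n (x + xi - h)"
 "R3 = Rop h b n (y - xi - h)" "R4 = Rop h b n (y + xi - h)"
 "S = Rop h a b (x - y)" "T = Rop h a b (x + y - 2 * h)"
define U V where "U = Uop h c L a x" "V = Uop h c L b y"
note defs = R1_R2_R3_R4_S_T_def U_V_def
have IH: "S * U * T * V = V * T * U * S" unfolding defs
 by (rule Cons.IH) (use Cons.prems in auto)
have Y1: "S * R1 * R3 = R3 * R1 * S"
proof -
 have e: "x - xi - h = (x - y) + (y - xi - h)" by simp
 show ?thesis unfolding defs unfolding e
  using yang_baxter[of a b n h "x - y" "y - xi - h"] ab n by simp
qed
have Y4: "S * R2 * R4 = R4 * R2 * S"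
proof -
 have e: "x + xi - h = (x - y) + (y + xi - h)" by simp
 show ?thesis unfolding defs unfolding e
  using yang_baxter[of a b n h "x - y" "y + xi - h"] ab n by simp
qed
have Y2: "R2 * T * R3 = R3 * T * R2"
proof -
 have e: "x + y - 2 * h = (x + xi - h) + (y - xi - h)" by simp
 show ?thesis unfolding defs unfolding e
  using yang_baxter[of a n b h "x + xi - h" "y - xi - h"] ab n
  by (simp add: Rop_sym[of n b])
qed
have Y3: "R1 * T * R4 = R4 * T * R1"
proof -
 have e: "x + y - 2 * h = (x - xi - h) + (y + xi - h)" by simp
 show ?thesis unfolding defs unfolding e
  using yang_baxter[of a n b h "x - xi - h" "y + xi - h"] ab n
  by (simp add: Rop_sym[of n b])
qed
have off_comm: "X * Rop h i j z = Rop h i j z * X" if "off i X" "off j X" for X i j z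
proof -
 have "X * (sc s * DD i j g) = sc s * DD i j g * X" for s g
 proof -
  have "X * DD i j g = Dop i g * Dop j g * X"
   using offD[OF that(1), of g] offD[OF that(2), of g] by (metis mult.assoc)
  thus ?thesis by (simp add: sc_lc[of X] mult.assoc)
 qed
 thus ?thesis unfolding Rop_def sum_distrib_left sum_distrib_right by (simp only:)
qed
have c1: "U * R3 = R3 * U" "U * R4 = R4 * U" unfolding defs
 by (rule off_comm; rule off_Uop; use ab n in auto)+
have c2: "V * R1 = R1 * V" "V * R2 = R2 * V" unfolding defs
 by (rule off_comm; rule off_Uop; use ab n in auto)+
have Ua: "Uop h c (p # L) a x = R1 * U * R2" and Ub: "Uop h c (p # L) b y = R3 * V * R4"
 unfolding p defs using Uop_Cons n ab by auto
have "S * (R1 * U * R2) * T * (R3 * V * R4) = S * R1 * U * (R2 * T * R3) * V * R4" by (simp only: mult.assoc)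
also have "... = S * R1 * (U * R3) * T * (R2 * V) * R4" unfolding Y2 by (simp only: mult.assoc)
also have "... = (S * R1 * R3) * U * T * V * R2 * R4" unfolding c1 c2(2)[symmetric] by (simp only: mult.assoc)
also have "... = R3 * R1 * (S * U * T * V) * R2 * R4" unfolding Y1 by (simp only: mult.assoc)
also have "... = R3 * R1 * V * T * U * (S * R2 * R4)" unfolding IH by (simp only: mult.assoc)
also have "... = R3 * (R1 * V) * T * (U * R4) * R2 * S" unfolding Y4 by (simp only: mult.assoc)
also have "... = R3 * V * (R1 * T * R4) * U * R2 * S" unfolding c1 c2(1)[symmetric] by (simp only: mult.assoc)
also have "... = (R3 * V * R4) * T * (R1 * U * R2) * S" unfolding Y3 by (simp only: mult.assoc)
finally show ?case unfolding Ua Ub defs(5,6) .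
qed

lemma kK_minus: "kK g (- z) = (if g = gI then kK g z else - kK g z)"
 by (cases g rule: idx_cases) (simp_all add: kK_def theta1_minus[OF im])

lemma dual_reflection:
 assumes "a ~= b"
 shows "Rop h a b (x - y) * Kop c b (y + h) * Rop h a b (- x - y - 2 * h) * Kop c a (x + h)
  = Kop c a (x + h) * Rop h a b (- x - y - 2 * h) * Kop c b (y + h) * Rop h a b (x - y)"
proof -
define c' where "c' g = (if g = gI then c g else - c g)" for g
have k: "Kop c i z = Kop c' i (- z)" for i z
 unfolding Kop_def kK_minus c'_def by (intro sum.cong refl) simp
have e: "- (y + h) - - (x + h) = x - y" "- (y + h) + - (x + h) = - x - y - 2 * h" by simp_all
show ?thesis
 using reflection_equation[OF assms[symmetric], of h "- (y + h)" "- (x + h)" c']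
 unfolding e k[symmetric] Rop_sym[OF assms[symmetric]] .
qed

lemma ptr_Rop_cyclic:
 assumes "a ~= b"
 shows "ptr a (ptr b (X * Rop h a b z)) = ptr a (ptr b (Rop h a b z * X))"
proof -
have "ptr a (ptr b (X * (sc s * DD a b g))) = ptr a (ptr b (sc s * DD a b g * X))" for s g
proof -
 have "ptr b (X * DD a b g) = ptr b (Dop b g * (X * Dop a g))"
  unfolding mult.assoc[symmetric] by (simp only: ptr_cyclic_Dop mult.assoc)
 also have "Dop b g * (X * Dop a g) = (Dop b g * X) * Dop a g" by (simp only: mult.assoc)
 also have "ptr b ... = ptr b (Dop b g * X) * Dop a g" by (rule ptr_right) (use assms in auto)
 finally have "ptr a (ptr b (X * DD a b g)) = ptr a (Dop a g * ptr b (Dop b g * X))"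
  by (simp only: ptr_cyclic_Dop)
 also have "Dop a g * ptr b (Dop b g * X) = ptr b (Dop a g * (Dop b g * X))"
  by (rule ptr_left[symmetric]) (use assms in auto)
 finally show ?thesis by (simp only: mult.assoc sc_lc[of X] ptr_sc)
qed
thus ?thesis unfolding Rop_def sum_distrib_left sum_distrib_right ptr_sum by (simp only:)
qed

lemma Top_product:
 assumes ab: "a ~= b" "a \<notin> fst ` set L" "b \<notin> fst ` set L"
 shows "sc (rho h (x + y)) * (Top h c' c L x * Top h c' c L y)
  = ptr a (ptr b (Kop c' b (y + h) * Rop h a b (- x - y - 2 * h) * Kop c' a (x + h)
    * Uop h c L a x * Rop h a b (x + y - 2 * h) * Uop h c L b y))"
proof -
let ?A = "%F k. sc (F k) * DD a b k"
let ?B = "%G l. sc (G l) * DD a b l"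
define A B U V where "A = Kop c' a (x + h)" "B = Kop c' b (y + h)" "U = Uop h c L a x" "V = Uop h c L b y"
note defs = A_B_U_V_def
have oa: "off a B" "off a V" and ob: "off b A" "off b U"
 unfolding defs using ab by (auto intro!: off_Kop off_Uop)
have Bcomm: "B * X = X * B" if "off b X" for X
proof -
 have "sc s * Dop b g * X = X * (sc s * Dop b g)" for s g
  by (simp only: mult.assoc sc_lc[of X] offD[OF that])
 thus ?thesis unfolding defs Kop_def sum_distrib_left sum_distrib_right by (simp only:)
qed
define F G where "F k = ph k k * wR h k (- x - y - 2 * h)" and "G k = ph k k * wR h k (x + y - 2 * h)" for k
define Y where "Y g = ptr a (Dop a g * (A * U)) * ptr b (B * Dop b g * V)" for g
have t: "ptr a (ptr b (B * (?A F k) * A * U * (?B G l) * V))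
  = sc (F k * G l * (ph l k * ph k l)) * Y (k[+]l)" for k l
proof -
 define X where "X = Dop a k * (A * U) * Dop a l"
 have oX: "off b X" unfolding X_def using ob ab by (intro off_mult) auto
 have bX: "Dop b k * (A * (U * (Dop a l * Z))) = A * (U * (Dop a l * (Dop b k * Z)))" for Z
  using offD[OF ob(1), of k] offD[OF ob(2), of k] Dop_comm[OF ab(1), of l k] by (metis mult.assoc)
 have "B * (?A F k) * A * U * (?B G l) * V
   = sc (F k) * (sc (G l) * (B * (Dop a k * (Dop b k * (A * (U * (Dop a l * (Dop b l * V))))))))"
  by (simp only: mult.assoc sc_lc[of "Dop _ _"] sc_lc[of A] sc_lc[of B] sc_lc[of U])
 also have "... = sc (F k * G l) * (B * X * (Dop b k * (Dop b l * V)))"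
  unfolding bX X_def by (simp only: mult.assoc sc_sc)
 also have "... = sc (F k * G l) * (X * (B * (Dop b k * Dop b l) * V))"
  unfolding Bcomm[OF oX] by (simp only: mult.assoc)
 finally have "ptr a (ptr b (B * (?A F k) * A * U * (?B G l) * V))
   = sc (F k * G l) * (ptr a X * ptr b (B * (Dop b k * Dop b l) * V))"
  using oX oa ab by (simp add: ptr_sc ptr_left off_mult ptr_right off_ptr)
 also have "ptr a X = ptr a (Dop a l * Dop a k * (A * U))"
  unfolding X_def ptr_cyclic_Dop[symmetric] by (simp only: mult.assoc)
 also have "... = sc (ph l k) * ptr a (Dop a (k[+]l) * (A * U))"
  unfolding Dop_mult gadd_comm[of l k] by (simp only: mult.assoc ptr_sc)
 also have "ptr b (B * (Dop b k * Dop b l) * V) = sc (ph k l) * ptr b (B * Dop b (k[+]l) * V)"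
  unfolding Dop_mult by (simp only: mult.assoc sc_lc[of B] ptr_sc)
 finally show ?thesis unfolding Y_def
  by (simp only: mult.assoc sc_lc[of "ptr a _"] sc_sc)
qed
have "ptr a (ptr b (B * Rop h a b (- x - y - 2 * h) * A * U * Rop h a b (x + y - 2 * h) * V))
  = (\<Uplus>k l. sc (F k * G l * (ph l k * ph k l)) * Y (k[+]l))"
proof -
 have "B * Rop h a b (- x - y - 2 * h) * A * U * Rop h a b (x + y - 2 * h) * V
  = (\<Uplus>k l. B * (?A F k) * A * U * (?B G l) * V)"
  unfolding Rop_def F_def[symmetric] G_def[symmetric]
  by (simp only: sum_distrib_left[of B] sum_distrib_right[of _ _ A] sum_distrib_right[of _ _ U])
    (simp only: sum_product sum_distrib_right[of _ _ V])
 thus ?thesis by (simp only: ptr_sum t)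
qed
also have "... = (\<Uplus>k g. sc (F k * G (k[+]g) * cc k g) * Y g)"
proof -
 have "ph (k[+]g) k * ph k (k[+]g) = cc k g" for k g
  unfolding cc_def ph_add_left ph_add_right by (simp add: mult_ac)
 thus ?thesis by (subst sum_shift_dep) (simp only: gadd_cancel)
qed
also have "... = (\<Uplus>g. sc (\<Uplus>k. F k * G (k[+]g) * cc k g) * Y g)"
 unfolding sc_sum sum_distrib_right by (rule sum.swap)
also have "... = (\<Uplus>g. sc (if g = gI then rho h (x + y) else 0) * Y g)"
proof -
 have "(\<Uplus>k. F k * G (k[+]g) * cc k g) = (if g = gI then rho h (x + y) else 0)" for g
 proof -
  have e: "- (x + y - 2 * h) - 4 * h = - x - y - 2 * h" "x + y - 2 * h + 2 * h = x + y" by simp_all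
  show ?thesis using R_crossing_unitarity[of g h "x + y - 2 * h"]
   unfolding e F_def G_def by (simp only: mult_ac)
 qed
 thus ?thesis by (simp only:)
qed
also have "... = sc (rho h (x + y)) * Y gI" unfolding sum_idx by simp
also have "Y gI = Top h c' c L x * Top h c' c L y"
 unfolding Y_def defs Dop_0 mult_1_left mult_1_right Top_ptr[OF ab(2), symmetric] Top_ptr[OF ab(3), symmetric] ..
finally show ?thesis unfolding defs by (rule sym)
qed

theorem Top_commute:
 assumes "distinct (map fst L)"
 shows "sc (rho h (x - y) * rho h (x + y)) * (Top h c' c L x * Top h c' c L y)
  = sc (rho h (x - y) * rho h (x + y)) * (Top h c' c L y * Top h c' c L x)"
proof -
obtain a where a: "a \<notin> fst ` set L" using ex_new_if_finite[of "fst ` set L"] infinite_UNIV_nat by auto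
obtain b where b: "b \<notin> insert a (fst ` set L)" using ex_new_if_finite[of "insert a (fst ` set L)"] infinite_UNIV_nat by auto
have ab: "a ~= b" "a \<notin> fst ` set L" "b \<notin> fst ` set L" using a b by auto
define A B U V where "A = Kop c' a (x + h)" "B = Kop c' b (y + h)" "U = Uop h c L a x" "V = Uop h c L b y"
define S S' T Q where "S = Rop h a b (x - y)" "S' = Rop h a b (- (x - y))"
 "T = Rop h a b (x + y - 2 * h)" "Q = Rop h a b (- x - y - 2 * h)"
note defs = A_B_U_V_def S_S'_T_Q_def
define r where "r = rho h (x - y)"
have un: "S * S' = sc r" "S' * S = sc r"
proof -
 show "S * S' = sc r" unfolding defs r_def by (rule R_unitarity[OF ab(1)])
 have "rho h (- (x - y)) = rho h (x - y)"
  unfolding rho_def by (intro sum.cong refl) (simp add: mult.commute)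
 thus "S' * S = sc r" using R_unitarity[OF ab(1), of h "- (x - y)"] unfolding defs r_def by simp
qed
have RE: "S * U * T * V = V * T * U * S" unfolding defs by (rule Uop_reflection[OF ab assms])
have DR: "S * B * Q * A = A * Q * B * S" unfolding defs by (rule dual_reflection[OF ab(1)])
have xy: "sc (rho h (x + y)) * (Top h c' c L x * Top h c' c L y) = ptr a (ptr b (B * Q * A * U * T * V))"
 unfolding defs by (rule Top_product[OF ab])
have yx: "sc (rho h (x + y)) * (Top h c' c L y * Top h c' c L x) = ptr a (ptr b (A * Q * B * V * T * U))"
proof -
 have e: "- y - x - 2 * h = - x - y - 2 * h" "y + x = x + y" by simp_all
 have sw: "ptr a (ptr b Z) = ptr b (ptr a Z)" for Z by (rule ptr_swap[OF ab(1)])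
 show ?thesis
  using Top_product[OF ab(1)[symmetric] ab(3,2), of h y x c' c]
  unfolding e Rop_sym[OF ab(1)[symmetric]] sw[symmetric] defs .
qed
\<comment> \<open>Insert \<open>S' S\<close>, use the two reflection equations, and move \<open>S\<close> around the trace.\<close>
have "sc r * ptr a (ptr b (B * Q * A * U * T * V)) = ptr a (ptr b (B * Q * A * (S' * S) * U * T * V))"
 unfolding un by (simp only: mult.assoc sc_lc[of A] sc_lc[of Q] sc_lc[of B] ptr_sc)
also have "... = ptr a (ptr b (B * Q * A * S' * (S * U * T * V)))" by (simp only: mult.assoc)
also have "... = ptr a (ptr b (B * Q * A * S' * V * T * U * S))" unfolding RE by (simp only: mult.assoc)
also have "... = ptr a (ptr b (S * (B * Q * A * S' * V * T * U)))"
 unfolding defs(5) by (rule ptr_Rop_cyclic[OF ab(1)])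
also have "... = ptr a (ptr b ((S * B * Q * A) * S' * V * T * U))" by (simp only: mult.assoc)
also have "... = ptr a (ptr b (A * Q * B * (S * S') * V * T * U))" unfolding DR by (simp only: mult.assoc)
also have "... = sc r * ptr a (ptr b (A * Q * B * V * T * U))"
 unfolding un by (simp only: mult.assoc sc_lc[of A] sc_lc[of Q] sc_lc[of B] ptr_sc)
finally show ?thesis unfolding xy[symmetric] yx[symmetric] r_def[symmetric] by (simp only: sc_sc)
qed

section \<open>The transfer matrix as an even theta function of the spectral parameter\<close>

lemma wdress_off_diagonal:
 assumes "g ~= b"
 shows "\<exists>K. \<forall>z. wdress h xi g b z = K * (tg g (z + h) * tg b (z - h))"
proof -
define x where "x = g[+]b"
have x0: "x ~= gI" unfolding x_def using assms by simp
have b: "b = g[+]x" unfolding x_def by simp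
have w: "wdress h xi g b z = ph x x * ph b x * (2 * cst\<^sup>2 * tP h * (if cc x g = 1
    then tg gI (z + cc m g * h) * tg x (z - cc m g * h) * tg m (- xi) * tg (m[+]x) (- xi)
    else tg gI (- xi) * tg x (- xi) * tg m (z + cc m g * h) * tg (m[+]x) (z - cc m g * h)))"
 if "m ~= gI" "x ~= m" for m z
proof -
 have e: "z - xi - h = z - h - xi" "z + xi - h = z - h + xi" by simp_all
 show ?thesis unfolding wdress_def x_def[symmetric] e wR_pair_pm[OF x0 that, of g h "z - h" xi] by simp
qed
show ?thesis
proof (cases "cc x g = 1")
 case False
 hence g: "g ~= gI" "x ~= g" by (auto simp: cc_def)
 have gx: "g[+]x = b" unfolding x_def by simp
 show ?thesis using w[OF g] False unfolding gx cc_self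
  by (intro exI[of _ "ph x x * ph b x * (2 * cst\<^sup>2 * tP h * (tg gI (- xi) * tg x (- xi)))"]) (simp add: mult_ac)
next
 case True
 obtain m where m: "m ~= gI" "x ~= m" using third_ex[OF x0] by blast
 have "g = gI \<or> g = x" using True x0
  by (cases g rule: idx_cases; cases x rule: idx_cases; simp)
 thus ?thesis
 proof
  assume g: "g = gI"
  have b: "b = x" unfolding b g by simp
  show ?thesis using w[OF m] True unfolding g b
   by (intro exI[of _ "ph x x * ph x x * (2 * cst\<^sup>2 * tP h * (tg m (- xi) * tg (m[+]x) (- xi)))"]) (simp add: cc_def mult_ac)
 next
  assume g: "g = x"
  have b: "b = gI" unfolding b g by simp
  have mx: "cc m x = -1" using m x0
   by (cases m rule: idx_cases; cases x rule: idx_cases; simp)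
  show ?thesis using w[OF m] True unfolding g b
   by (intro exI[of _ "ph x x * (2 * cst\<^sup>2 * tP h * (tg m (- xi) * tg (m[+]x) (- xi)))"]) (simp add: mx mult_ac)
 qed
qed
qed

lemma wdress_diagonal:
 "wdress h xi g g z = (\<Uplus>k. cc k g * (wR h k (z - xi - h) * wR h k (z + xi - h)))"
 unfolding wdress_def by simp

lemma wdress_gauge:
 "\<exists>E. even_theta 1 E \<and> (\<forall>z. wdress h xi g b z * kK b (z - h) = kK g (z - h) * E z)"
proof (cases "g = b")
case True
have "even_theta 1 (%z. \<Uplus>k. cc k g * (cst * tc k h)\<^sup>2 * (tg k (z + xi) * tg k (z - xi)))"
 by (intro even_theta_sum even_theta_cmult tg_pair_even) simp
also have "(%z. \<Uplus>k. cc k g * (cst * tc k h)\<^sup>2 * (tg k (z + xi) * tg k (z - xi))) = wdress h xi g g"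
 by (rule ext, unfold wdress_diagonal wR_def, rule sum.cong[OF refl]) (simp add: power2_eq_square mult_ac)
finally show ?thesis using True by (intro exI[of _ "wdress h xi g g"]) (simp add: mult.commute)
next
case False
obtain K where K: "!!z. wdress h xi g b z = K * (tg g (z + h) * tg b (z - h))"
 using wdress_off_diagonal[OF False] by blast
have "K * (tg g (z + h) * tg b (z - h)) * kK b (z - h) = kK g (z - h) * (K * (tg g (z + h) * tg g (z - h)))" for z
proof -
 have "K * (tg g (z + h) * tg b (z - h)) * kK b (z - h)
   = K * tg g (z + h) * cst * (tg b (z - h) * tc b (z - h))" unfolding kK_def by (simp add: mult_ac)
 also have "... = K * tg g (z + h) * cst * (tg g (z - h) * tc g (z - h))" unfolding tc_tg ..
 finally show ?thesis unfolding kK_def by (simp add: mult_ac)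
qed
thus ?thesis unfolding K
 by (intro exI[of _ "%z. K * (tg g (z + h) * tg g (z - h))"] conjI even_theta_cmult tg_pair_even) simp
qed

lemma ucomp_gauge:
 "\<exists>v. (\<forall>z. ucomp h c L g z = sc (kK g (z - h)) * v z) \<and> (\<forall>\<psi> s. even_theta (length L) (%z. app (v z) \<psi> s))"
proof (induction L arbitrary: g)
case Nil
have "even_theta 0 (%z. app (sc (c g)) \<psi> s)" for \<psi> s
 using even_theta_cmult[OF even_theta_one, of "c g * \<psi> s"] unfolding app_sc by simp
thus ?case by (intro exI[of _ "%z. sc (c g)"]) (simp add: sc_mult[symmetric] mult.commute)
next
case (Cons p L)
obtain n xi where p: "p = (n, xi)" by fastforce
obtain v where v: "!!b z. ucomp h c L b z = sc (kK b (z - h)) * v b z"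
 "!!b \<psi> s. even_theta (length L) (%z. app (v b z) \<psi> s)" using Cons by metis
obtain E where E: "!!b. even_theta 1 (E b)"
 "!!b z. wdress h xi g b z * kK b (z - h) = kK g (z - h) * E b z" using wdress_gauge by metis
have a: "app (\<Uplus>b. sc (E b z) * (Dop n (g[+]b) * v b z)) \<psi> s
  = (\<Uplus>b. (if snd (g[+]b) \<and> s n ~= fst (g[+]b) then -1 else 1) * (E b z * app (v b z) \<psi> (s(n := (s n ~= fst (g[+]b))))))" for z \<psi> s
 unfolding app_sum app_mult app_sc app_Dop by (simp only: mult.left_commute)
have "even_theta (1 + length L) (%z. app (\<Uplus>b. sc (E b z) * (Dop n (g[+]b) * v b z)) \<psi> s)" for \<psi> s
 unfolding a by (intro even_theta_sum even_theta_cmult even_theta_mult E v) simp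
moreover have "ucomp h c (p # L) g z = sc (kK g (z - h)) * (\<Uplus>b. sc (E b z) * (Dop n (g[+]b) * v b z))" for z
proof -
 have "ucomp h c (p # L) g z = (\<Uplus>b. sc (wdress h xi g b z * kK b (z - h)) * (Dop n (g[+]b) * v b z))"
  unfolding p ucomp.simps v(1) sc_lc[of "Dop _ _"] sc_sc ..
 thus ?thesis unfolding E(2) sum_distrib_left sc_sc .
qed
ultimately show ?case by (intro exI[of _ "%z. \<Uplus>b. sc (E b z) * (Dop n (g[+]b) * v b z)"]) simp
qed

lemma kK_pair_even: "even_theta 3 (%z. kK g (z + h) * kK g (z - h))"
proof -
have c: "card (UNIV - {g}) = 3" unfolding UNIV_idx by (cases g rule: idx_cases) (simp_all add: insert_Diff_if)
have "even_theta (card (UNIV - {g})) (%z. \<Prod>k\<in>UNIV - {g}. tg k (z + h) * tg k (z - h))"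
 by (intro even_theta_prod tg_pair_even) simp
from even_theta_cmult[OF this, of "cst\<^sup>2"] show ?thesis
 unfolding c kK_def tc_def prod.distrib by (simp add: power2_eq_square mult_ac)
qed

theorem Top_even_theta: "even_theta (length L + 3) (%z. app (Top h c' c L z) \<psi> s)"
proof -
obtain v where v: "!!b z. ucomp h c L b z = sc (kK b (z - h)) * v b z"
 "!!b \<psi> s. even_theta (length L) (%z. app (v b z) \<psi> s)" using ucomp_gauge by metis
have "app (Top h c' c L z) \<psi> s = (\<Uplus>g. 2 * ph g g * c' g * (app (v g z) \<psi> s * (kK g (z + h) * kK g (z - h))))" for z
 unfolding Top_def app_sum v(1) sc_sc app_mult app_sc by (intro sum.cong refl) (simp only: mult_ac)
moreover have "even_theta (length L + 3) (%z. \<Uplus>g. 2 * ph g g * c' g * (app (v g z) \<psi> s * (kK g (z + h) * kK g (z - h))))"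
 by (intro even_theta_sum even_theta_cmult even_theta_mult v kK_pair_even) simp
ultimately show ?thesis by simp
qed

corollary Top_minus: "Top h c' c L (- z) = Top h c' c L z"
 by (rule lin_eqI) (rule even_thetaD(2)[OF Top_even_theta])

lemma app_ucomp_hol:
 assumes "!!s. (%x. \<phi> x s) holomorphic_on UNIV"
 shows "entire (%x. app (ucomp h c L g z) (\<phi> x) s)"
proof (induction L arbitrary: g s)
case Nil
show ?case unfolding ucomp.simps app_sc by (intro holomorphic_intros assms)
next
case (Cons p L)
obtain n xi where p: "p = (n, xi)" by fastforce
show ?case unfolding p ucomp.simps app_sum app_mult app_sc app_Dop by (intro holomorphic_intros Cons)
qed

lemma app_Top_hol:
 assumes "!!s. (%x. \<phi> x s) holomorphic_on UNIV"
 shows "entire (%x. app (Top h c' c L z) (\<phi> x) s)"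
 unfolding Top_def app_sum app_mult app_sc by (intro holomorphic_intros app_ucomp_hol assms)

text \<open>The exchange relation gives commutativity only up to a scalar factor; the exceptional values
 of the spectral parameters are reached by analytic continuation.\<close>

corollary Top_comm:
 assumes "distinct (map fst L)" and h: "th1 (2 * h) ~= 0" "th1 (4 * h) ~= 0"
 shows "Top h c' c L x * Top h c' c L y = Top h c' c L y * Top h c' c L x"
proof (rule lin_eqI)
fix \<psi> s
let ?T = "Top h c' c L"
have hol: "entire (%x. app (?T x) \<phi> s)" for \<phi> s
 by (rule even_thetaD(1)[OF Top_even_theta])
define f where "f x = app (?T x * ?T y) \<psi> s - app (?T y * ?T x) \<psi> s" for x
have f: "entire f"
 unfolding f_def app_mult by (intro holomorphic_intros hol app_Top_hol)
have m: "entire (%x. ts (2 * h) (x - y))" "entire (%x. ts (2 * h) (x + y))"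
 unfolding ts_def by (intro holomorphic_intros)+
obtain u where u: "ts u (2 * h) ~= 0" using ts_nonzero_ex by blast
have n: "ts (2 * h) ((u + y) - y) ~= 0" "ts (2 * h) ((u - y) + y) ~= 0"
 using u ts_minus[of "2 * h" u] by simp_all
have "f x * (ts (2 * h) (x - y) * ts (2 * h) (x + y)) = 0" for x
proof -
 have "app (sc (rho h (x - y) * rho h (x + y)) * (?T x * ?T y)) \<psi> s
   = app (sc (rho h (x - y) * rho h (x + y)) * (?T y * ?T x)) \<psi> s"
  by (rule arg_cong[OF Top_commute[OF assms(1)], of "%X. app X \<psi> s"])
 thus ?thesis unfolding f_def app_mult[of "sc _"] app_sc rho_eq[OF h] by (simp add: alg)
qed
hence "f x * ts (2 * h) (x - y) * ts (2 * h) (x + y) = 0" for x by (simp add: mult.assoc)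
hence "f x * ts (2 * h) (x - y) = 0" for x
 by (rule entire_mult_zero[OF holomorphic_on_mult[OF f m(1)] m(2) _ n(2)])
hence "f x = 0" for x by (rule entire_mult_zero[OF f m(1) _ n(1)])
thus "app (?T x * ?T y) \<psi> s = app (?T y * ?T x) \<psi> s" unfolding f_def by simp
qed

section \<open>Special values of the transfer matrix\<close>

lemma kK_zero: "tg \<beta> s = 0 ==> g ~= \<beta> ==> kK g s = 0"
 unfolding kK_def tc_def by (auto intro!: prod_zero)

lemma ucomp_special:
 assumes "tg \<beta> s = 0"
 shows "g ~= \<beta> ==> ucomp h c L g (h + s) = 0"
  and "ucomp h c L \<beta> (h + s) = sc (c \<beta> * kK \<beta> s * (\<Prod>(n, xi)\<leftarrow>L. wdress h xi \<beta> \<beta> (h + s)))"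
proof -
have 0: "ucomp h c L g (h + s) = 0" if "g ~= \<beta>" for g L
proof -
 obtain v where "!!z. ucomp h c L g z = sc (kK g (z - h)) * v z" using ucomp_gauge by metis
 thus ?thesis using kK_zero[OF assms that] by simp
qed
show "g ~= \<beta> ==> ucomp h c L g (h + s) = 0" by (rule 0)
show "ucomp h c L \<beta> (h + s) = sc (c \<beta> * kK \<beta> s * (\<Prod>(n, xi)\<leftarrow>L. wdress h xi \<beta> \<beta> (h + s)))"
proof (induction L)
 case (Cons p L)
 obtain n xi where p: "p = (n, xi)" by fastforce
 have "ucomp h c (p # L) \<beta> (h + s)
   = (\<Uplus>b. if b = \<beta> then sc (wdress h xi \<beta> \<beta> (h + s)) * ucomp h c L \<beta> (h + s) else 0)"
  unfolding p ucomp.simps by (intro sum.cong refl) (auto simp: 0)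
 also have "... = sc (wdress h xi \<beta> \<beta> (h + s)) * ucomp h c L \<beta> (h + s)" by simp
 finally show ?case unfolding Cons p by (simp add: mult_ac flip: sc_mult)
qed simp
qed

lemma Top_special:
 assumes "tg \<beta> s = 0"
 shows "Top h c' c L (h + s) = sc (2 * ph \<beta> \<beta> * (c' \<beta> * kK \<beta> (h + s + h))
  * (c \<beta> * kK \<beta> s * (\<Prod>(n, xi)\<leftarrow>L. wdress h xi \<beta> \<beta> (h + s))))"
proof -
have "Top h c' c L (h + s) = (\<Uplus>g. if g = \<beta> then sc (2 * ph \<beta> \<beta> * (c' \<beta> * kK \<beta> (h + s + h))) * ucomp h c L \<beta> (h + s) else 0)"
 unfolding Top_def by (intro sum.cong refl) (auto simp: ucomp_special(1)[OF assms])
thus ?thesis unfolding ucomp_special(2)[OF assms] by (simp flip: sc_mult)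
qed

lemma wdress_special:
 assumes "!!k z. tg k (z + 2 * s) = cc k \<beta> * \<phi> z * tg k z"
 shows "wdress h xi \<beta> \<beta> (h + s) = \<phi> (xi - s + h) * rho h (xi - s)"
proof -
have "cc k \<beta> * (wR h k (h + s - xi - h) * wR h k (h + s + xi - h))
  = \<phi> (xi - s + h) * (wR h k (xi - s) * wR h k (- (xi - s)))" for k
proof -
 have "wR h k (h + s + xi - h) = cst * (tg k (xi - s + h + 2 * s) * tc k h)"
  unfolding wR_def by (simp add: alg)
 also have "... = cc k \<beta> * (\<phi> (xi - s + h) * wR h k (xi - s))"
  unfolding assms wR_def by (simp only: mult_ac)
 finally have 1: "wR h k (h + s + xi - h) = cc k \<beta> * (\<phi> (xi - s + h) * wR h k (xi - s))" .
 have 2: "h + s - xi - h = - (xi - s)" by simp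
 have "cc k \<beta> * (x * (cc k \<beta> * y)) = x * y" for x y :: complex
  by (simp add: mult.left_commute[of x])
 thus ?thesis unfolding 1 2 by (simp add: mult_ac)
qed
thus ?thesis unfolding wdress_diagonal rho_def sum_distrib_left by (simp only:)
qed

section \<open>Fusion\<close>

text \<open>Unitarity of the boundary matrix. For the coefficients that occur, the scalar factorises; this
 comes down to an identity between polynomials in theta functions of modulus \<open>2 * \<tau>\<close>.\<close>

definition kap :: "(idx => complex) => complex => complex" where
 "kap c z = (\<Uplus>g. (if g = gI then 1 else -1) * ph g g * (c g * kK g z)\<^sup>2)"

lemma K_unitarity: "Kop c i z * Kop c i (- z) = sc (kap c z)"
proof -
let ?A = "%k s x. \<Uplus>g. k g * (s (g[+]x) * k (g[+]x)) * ph g (g[+]x)"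
define s where "s g = (if g = gI then 1 else -1 :: complex)" for g :: idx
define k where "k g = c g * kK g z" for g
have m: "c g * kK g (- z) = s g * k g" for g
 unfolding kK_minus s_def k_def by simp
have "Kop c i z * Kop c i (- z)
  = (\<Uplus>g x. sc (k g * (s x * k x) * ph g x) * Dop i (g[+]x))"
 unfolding Kop_def sum_product m k_def[symmetric]
 by (simp only: mult.assoc sc_lc[of "Dop _ _"] Dop_mult sc_sc)
also have "... = (\<Uplus>g x. sc (k g * (s (g[+]x) * k (g[+]x)) * ph g (g[+]x)) * Dop i x)"
 by (subst sum_shift_dep) (simp only: gadd_cancel)
also have "... = (\<Uplus>x. sc (?A k s x) * Dop i x)"
 unfolding sc_sum sum_distrib_right by (rule sum.swap)
also have "... = (\<Uplus>x. sc (if x = gI then kap c z else 0) * Dop i x)"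
proof (rule sum.cong[OF refl])
 fix x :: idx
 have "(?A k s x) = (if x = gI then kap c z else 0)"
 proof (cases "x = gI")
  case True
  thus ?thesis unfolding kap_def s_def[symmetric] k_def[symmetric] by (simp add: power2_eq_square mult_ac)
 next
  case False
  thus ?thesis unfolding sum_idx s_def
   by (cases x rule: idx_cases) simp_all
 qed
 thus "sc (?A k s x) * Dop i x
   = sc (if x = gI then kap c z else 0) * Dop i x" by (simp only:)
qed
also have "... = sc (kap c z)" unfolding sum_idx by simp
finally show ?thesis .
qed

lemma theta_squares:
 defines "X z \<equiv> d3 (2 * z)" and "Y z \<equiv> d2 (2 * z)"
 shows "(th1 z)\<^sup>2 = X z * Y 0 - Y z * X 0" "(th2 z)\<^sup>2 = X z * Y 0 + Y z * X 0"
  "(th3 z)\<^sup>2 = X z * X 0 + Y z * Y 0" "(th4 z)\<^sup>2 = X z * X 0 - Y z * Y 0"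
proof -
have t4: "th4 z * th4 z = X z * X 0 - Y z * Y 0"
proof -
 let ?h = "\<pi> / 2 :: complex"
 have "d3 (z + ?h + (z + ?h)) = X z" "d2 (z + ?h + (z + ?h)) = - Y z"
  using theta3_plus_pi[OF im2, of "2 * z"] theta2_plus_pi[OF im2, of "2 * z"]
  unfolding X_def Y_def by (simp_all add: alg)
 thus ?thesis using theta3_theta3[of "z + ?h" "z + ?h"] unfolding theta3_plus_half[OF im]
  by (simp add: X_def Y_def)
qed
show "(th1 z)\<^sup>2 = X z * Y 0 - Y z * X 0" "(th2 z)\<^sup>2 = X z * Y 0 + Y z * X 0"
 "(th3 z)\<^sup>2 = X z * X 0 + Y z * Y 0" "(th4 z)\<^sup>2 = X z * X 0 - Y z * Y 0"
 using theta1_theta1[of z z] theta2_theta2[of z z] theta3_theta3[of z z] t4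
 unfolding X_def Y_def power2_eq_square mult_2 by simp_all
qed

lemma boundary_polynomial:
 fixes p q X Y x1 x2 x3 y1 y2 y3 :: complex
 shows "((x1 * q - y1 * p) * (x2 * q - y2 * p) * (x3 * q - y3 * p)) * ((X * q + Y * p) * (X * p + Y * q) * (X * p - Y * q))
   - ((x1 * p - y1 * q) * (x2 * p - y2 * q) * (x3 * p - y3 * q)) * ((X * q - Y * p) * (X * q + Y * p) * (X * p + Y * q))
   + ((x1 * p + y1 * q) * (x2 * p + y2 * q) * (x3 * p + y3 * q)) * ((X * q - Y * p) * (X * q + Y * p) * (X * p - Y * q))
   - ((x1 * q + y1 * p) * (x2 * q + y2 * p) * (x3 * q + y3 * p)) * ((X * q - Y * p) * (X * p + Y * q) * (X * p - Y * q))
  = (2 * p * q * (p ^ 4 - q ^ 4)) * ((x1 * Y - y1 * X) * (x2 * Y - y2 * X) * (x3 * Y - y3 * X))"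
proof -
let ?A = "(X * q + Y * p) * (X * p + Y * q) * (X * p - Y * q)"
let ?B = "(X * q - Y * p) * (X * q + Y * p) * (X * p + Y * q)"
let ?C = "(X * q - Y * p) * (X * q + Y * p) * (X * p - Y * q)"
let ?D = "(X * q - Y * p) * (X * p + Y * q) * (X * p - Y * q)"
let ?E = "2 * p * q * (p ^ 4 - q ^ 4)"
have split: "((x1 * q - y1 * p) * (x2 * q - y2 * p) * (x3 * q - y3 * p)) * a
  - ((x1 * p - y1 * q) * (x2 * p - y2 * q) * (x3 * p - y3 * q)) * b
  + ((x1 * p + y1 * q) * (x2 * p + y2 * q) * (x3 * p + y3 * q)) * c
  - ((x1 * q + y1 * p) * (x2 * q + y2 * p) * (x3 * q + y3 * p)) * d
 = x1 * x2 * x3 * (q * q * q * a - p * p * p * b + p * p * p * c - q * q * q * d)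
  + (x1 * x2 * y3 + x1 * y2 * x3 + y1 * x2 * x3) * (- (q * q * p * a) + p * p * q * b + p * p * q * c - q * q * p * d)
  + (x1 * y2 * y3 + y1 * x2 * y3 + y1 * y2 * x3) * (q * p * p * a - p * q * q * b + p * q * q * c - q * p * p * d)
  + y1 * y2 * y3 * (- (p * p * p * a) + q * q * q * b + q * q * q * c - p * p * p * d)" for a b c d
 by (simp add: alg)
have coeffs:
 "q * q * q * ?A - p * p * p * ?B
  + p * p * p * ?C - q * q * q * ?D
  = ?E * (Y * Y * Y)"
 "- (q * q * p * ?A) + p * p * q * ?B
  + p * p * q * ?C - q * q * p * ?D
  = - (?E * (Y * Y * X))"
 "q * p * p * ?A - p * q * q * ?B
  + p * q * q * ?C - q * p * p * ?D
  = ?E * (Y * X * X)"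
 "- (p * p * p * ?A) + q * q * q * ?B
  + q * q * q * ?C - p * p * p * ?D
  = - (?E * (X * X * X))"
 by (simp_all add: alg power4_eq_xxxx)
have final: "x1 * x2 * x3 * (k * (Y * Y * Y)) + (x1 * x2 * y3 + x1 * y2 * x3 + y1 * x2 * x3) * - (k * (Y * Y * X))
  + (x1 * y2 * y3 + y1 * x2 * y3 + y1 * y2 * x3) * (k * (Y * X * X)) + y1 * y2 * y3 * - (k * (X * X * X))
  = k * ((x1 * Y - y1 * X) * (x2 * Y - y2 * X) * (x3 * Y - y3 * X))" for k
 by (simp add: alg)
show ?thesis unfolding split coeffs by (rule final)
qed

lemma kap_factor:
 assumes a: "!!l. l \<in> {1..3} ==> th1 (\<alpha> l) ~= 0"
  and c: "!!g. c g = (\<Prod>l\<in>{1..3}. tg g (\<alpha> l) / th1 (\<alpha> l))"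
 shows "kap c z = (\<Prod>l\<in>{1..3::nat}. ts (\<alpha> l) z / (th1 (\<alpha> l))\<^sup>2)"
proof -
define X Y where "X = d3 (2 * z)" and "Y = d2 (2 * z)"
define x y where "x l = d3 (2 * \<alpha> l)" and "y l = d2 (2 * \<alpha> l)" for l
define p q where "p = d3 0" and "q = d2 0"
define D where "D = (\<Prod>l\<in>{1..3::nat}. (th1 (\<alpha> l))\<^sup>2)"
have D: "D ~= 0" unfolding D_def using a by simp
note sq = theta_squares[of z, simplified, folded X_def Y_def p_def q_def]
note sq0 = theta_squares[of 0, simplified, folded p_def q_def]
note sql = theta_squares[of "\<alpha> _", simplified, folded x_def y_def p_def q_def]
have pr: "(\<Prod>l\<in>{1..3::nat}. f l) = f 1 * f 2 * f 3" for f :: "nat => complex"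
 by (simp add: numeral_3_eq_3 numeral_2_eq_2 mult_ac)
have cs: "(c g)\<^sup>2 * D = (tg g (\<alpha> 1))\<^sup>2 * (tg g (\<alpha> 2))\<^sup>2 * (tg g (\<alpha> 3))\<^sup>2" for g
 using a[of 1] a[of 2] a[of 3] unfolding c D_def pr by (simp add: power_divide power_mult_distrib)
have "cst\<^sup>2 * (2 * p * q * (p ^ 4 - q ^ 4)) = 1"
proof -
 have "cst\<^sup>2 * ((th2 0)\<^sup>2 * (th3 0)\<^sup>2 * (th4 0)\<^sup>2) = 1"
  using cst_tc0 by (metis power_mult_distrib power_one)
 thus ?thesis unfolding sq0 by (simp add: alg power4_eq_xxxx power2_eq_square)
qed
have "kap c z * D = cst\<^sup>2 * ((c gI)\<^sup>2 * D * ((th2 z)\<^sup>2 * (th3 z)\<^sup>2 * (th4 z)\<^sup>2)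
  - (c gX)\<^sup>2 * D * ((th1 z)\<^sup>2 * (th2 z)\<^sup>2 * (th3 z)\<^sup>2)
  + (c gY)\<^sup>2 * D * ((th1 z)\<^sup>2 * (th2 z)\<^sup>2 * (th4 z)\<^sup>2)
  - (c gZ)\<^sup>2 * D * ((th1 z)\<^sup>2 * (th3 z)\<^sup>2 * (th4 z)\<^sup>2))"
 unfolding kap_def sum_idx kK_def by (simp add: alg power_mult_distrib)
also have "... = cst\<^sup>2 * (2 * p * q * (p ^ 4 - q ^ 4)) * ((x 1 * Y - y 1 * X) * (x 2 * Y - y 2 * X) * (x 3 * Y - y 3 * X))"
 unfolding cs tg_simps sq sql boundary_polynomial by (simp only: mult.assoc)
also have "... = ts (\<alpha> 1) z * ts (\<alpha> 2) z * ts (\<alpha> 3) z"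
 unfolding \<open>cst\<^sup>2 * (2 * p * q * (p ^ 4 - q ^ 4)) = 1\<close> ts_AB tA_def tB_def X_def Y_def x_def y_def by simp
finally have "kap c z * D = ts (\<alpha> 1) z * ts (\<alpha> 2) z * ts (\<alpha> 3) z" .
thus ?thesis using D unfolding pr D_def by (simp add: field_simps)
qed

lemma Uop_unitarity:
 assumes "a \<notin> fst ` set L" "distinct (map fst L)"
 shows "Uop h c L a (h + x) * Uop h c L a (h - x) = sc (kap c x * (\<Prod>(n, xi)\<leftarrow>L. rho h (x - xi) * rho h (x + xi)))"
 using assms
proof (induction L)
case Nil
thus ?case using K_unitarity[of c a x] by (simp add: Uop_Nil)
next
case (Cons p L)
obtain n xi where p: "p = (n, xi)" by fastforce
have n: "a ~= n" "a \<notin> fst ` set L" "n \<notin> fst ` set L" "distinct (map fst L)" using Cons.prems p by auto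
have e: "h + x - xi - h = x - xi" "h + x + xi - h = x + xi" "h - x - xi - h = - (x + xi)" "h - x + xi - h = - (x - xi)" by simp_all
have "Uop h c (p # L) a (h + x) * Uop h c (p # L) a (h - x)
  = Rop h a n (x - xi) * Uop h c L a (h + x) * (Rop h a n (x + xi) * Rop h a n (- (x + xi))) * Uop h c L a (h - x) * Rop h a n (- (x - xi))"
 unfolding p Uop_Cons[OF n(1-3)] e by (simp only: mult.assoc)
also have "... = sc (rho h (x + xi)) * (Rop h a n (x - xi) * (Uop h c L a (h + x) * Uop h c L a (h - x)) * Rop h a n (- (x - xi)))"
 unfolding R_unitarity[OF n(1)] by (simp only: mult.assoc sc_lc[of "Rop _ _ _ _"] sc_lc[of "Uop _ _ _ _ _"])
also have "... = sc (rho h (x + xi)) * (sc (kap c x * (\<Prod>(n, xi)\<leftarrow>L. rho h (x - xi) * rho h (x + xi))) * sc (rho h (x - xi)))"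
 unfolding Cons.IH[OF n(2,4)] R_unitarity[OF n(1), symmetric]
 by (simp only: mult.assoc sc_lc[of "Rop _ _ _ _"])
finally show ?case unfolding p by (simp add: mult_ac flip: sc_mult)
qed

lemma perm_Uop:
 assumes "i ~= j" "i \<notin> fst ` set L" "j \<notin> fst ` set L"
 shows "perm i j * Uop h c L i z = Uop h c L j z * perm i j"
proof -
have "perm i j * (Dop i g * ucomp h c L g z) = Dop j g * ucomp h c L g z * perm i j" for g
proof -
 have "ucomp h c L g z * DD i j k = Dop i k * Dop j k * ucomp h c L g z" for k
  using offD[OF off_ucomp[OF assms(2)], of h c g z k] offD[OF off_ucomp[OF assms(3)], of h c g z k]
  by (metis mult.assoc)
 hence "perm i j * ucomp h c L g z = ucomp h c L g z * perm i j"
  unfolding perm_alt sum_distrib_left sum_distrib_right by (simp only: sc_lc[of "ucomp _ _ _ _ _"] mult.assoc)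
 thus ?thesis using perm_Dop[OF assms(1), of g] by (metis mult.assoc)
qed
thus ?thesis unfolding Uop_def emb_def sum_distrib_left sum_distrib_right by (simp only:)
qed

lemma ptr_Kop_perm_Rop:
 assumes "a ~= n"
 shows "ptr a (Kop c a (x + 2 * h) * (perm a n * Rop h a n (2 * x))) = sc (th1 (2 * x + 4 * h)) * Kop c n x"
proof -
define w where "w g = ph g g * (cst * (tg g (x + 2 * h) * tc g x))" for g
have pr: "perm a n * Rop h a n (2 * x) = (\<Uplus>g. sc (w g) * DD a n g)"
 unfolding perm_Rop(1)[OF assms] w_def by simp
have "ptr a (sc u * Dop a g * (sc v * DD a n k)) = (if g = k then sc (2 * ph g g * u * v) * Dop n g else 0)" for u v g k
proof -
 have "ptr a (sc u * Dop a g * (sc v * DD a n k)) = sc (u * v) * (ptr a (Dop a g * Dop a k * Dop n k))"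
  by (simp only: mult.assoc sc_lc[of "Dop _ _"] ptr_sc sc_sc)
 also have "... = sc (u * v) * (ptr a (Dop a g * Dop a k) * Dop n k)"
  using ptr_right[OF off_Dop[OF assms]] by (simp only:)
 finally show ?thesis unfolding ptr_Dop_Dop by (simp add: sc_sc mult_ac flip: sc_mult)
qed
hence "ptr a (Kop c a (x + 2 * h) * (perm a n * Rop h a n (2 * x)))
  = (\<Uplus>g. sc (2 * ph g g * (c g * kK g (x + 2 * h)) * w g) * Dop n g)"
 unfolding pr Kop_def sum_product ptr_sum by (simp add: sum.delta)
also have "... = (\<Uplus>g. sc (th1 (2 * x + 4 * h)) * (sc (c g * kK g x) * Dop n g))"
proof (rule sum.cong[OF refl])
 fix g
 have "2 * ph g g * (c g * kK g (x + 2 * h)) * w g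
   = (ph g g * ph g g) * (2 * cst * (tg g (x + 2 * h) * tc g (x + 2 * h))) * (c g * kK g x)"
  unfolding w_def kK_def by (simp only: mult_ac)
 also have "... = th1 (2 * x + 4 * h) * (c g * kK g x)"
  unfolding tc_tg theta1_double[symmetric] by (simp add: alg)
 finally show "sc (2 * ph g g * (c g * kK g (x + 2 * h)) * w g) * Dop n g = sc (th1 (2 * x + 4 * h)) * (sc (c g * kK g x) * Dop n g)"
  by (simp only: sc_sc)
qed
finally show ?thesis unfolding Kop_def sum_distrib_left .
qed

lemma Top_at_site:
 assumes "distinct (map fst ((n, xi) # L))"
 shows "Top h c' c ((n, xi) # L) (h + xi) = sc (th1 (2 * h) * th1 (2 * xi + 4 * h)) * (Uop h c L n (h + xi) * Kop c' n xi)"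
  and "Top h c' c ((n, xi) # L) (h - xi) = sc (th1 (2 * h) * th1 (4 * h - 2 * xi)) * (Kop c' n (- xi) * Uop h c L n (h - xi))"
proof -
let ?A = "th1 (2 * h)"
obtain a where a: "a \<notin> insert n (fst ` set L)" using ex_new_if_finite[of "insert n (fst ` set L)"] infinite_UNIV_nat by auto
have an: "a ~= n" "a \<notin> fst ` set L" "n \<notin> fst ` set L" "a \<notin> fst ` set ((n, xi) # L)" using a assms by auto
note P = perm_Uop[OF an(1-3)]
have oU: "off a (Uop h c L n z)" for z by (rule off_Uop[OF an(2,1)])
have KU: "Kop c' a w * Uop h c L n z = Uop h c L n z * Kop c' a w" for w z
 unfolding Kop_def sum_distrib_left sum_distrib_right
 by (rule sum.cong[OF refl]) (simp only: mult.assoc sc_lc[of "Uop _ _ _ _ _"] offD[OF oU])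
have e: "h + xi - xi - h = 0" "h + xi + xi - h = 2 * xi" "h + xi + h = xi + 2 * h" by simp_all
have "Top h c' c ((n, xi) # L) (h + xi)
  = ptr a (Kop c' a (xi + 2 * h) * (sc ?A * perm a n * Uop h c L a (h + xi) * Rop h a n (2 * xi)))"
 unfolding Top_ptr[OF an(4)] Uop_Cons[OF an(1-3)] e Rop_0 ..
also have "... = sc ?A * ptr a (Kop c' a (xi + 2 * h) * (perm a n * Uop h c L a (h + xi) * Rop h a n (2 * xi)))"
 by (simp only: mult.assoc sc_lc[of "Kop _ _ _"] ptr_sc)
also have "Kop c' a (xi + 2 * h) * (perm a n * Uop h c L a (h + xi) * Rop h a n (2 * xi))
  = Uop h c L n (h + xi) * (Kop c' a (xi + 2 * h) * (perm a n * Rop h a n (2 * xi)))"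
 unfolding P by (simp only: mult.assoc[symmetric] KU)
also have "ptr a ... = Uop h c L n (h + xi) * (sc (th1 (2 * xi + 4 * h)) * Kop c' n xi)"
 unfolding ptr_left[OF oU] ptr_Kop_perm_Rop[OF an(1)] ..
finally show "Top h c' c ((n, xi) # L) (h + xi) = sc (th1 (2 * h) * th1 (2 * xi + 4 * h)) * (Uop h c L n (h + xi) * Kop c' n xi)"
 by (simp only: sc_lc[of "Uop _ _ _ _ _"] sc_sc)
have e: "h - xi - xi - h = 2 * (- xi)" "h - xi + xi - h = 0" "h - xi + h = - xi + 2 * h" by simp_all
have "Top h c' c ((n, xi) # L) (h - xi)
  = ptr a (Kop c' a (- xi + 2 * h) * (Rop h a n (2 * (- xi)) * Uop h c L a (h - xi) * (sc ?A * perm a n)))"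
 unfolding Top_ptr[OF an(4)] Uop_Cons[OF an(1-3)] e Rop_0 ..
also have "... = sc ?A * ptr a (Kop c' a (- xi + 2 * h) * (Rop h a n (2 * (- xi)) * (Uop h c L a (h - xi) * perm a n)))"
 by (simp only: mult.assoc sc_lc[of "Kop _ _ _"] sc_lc[of "Rop _ _ _ _"] sc_lc[of "Uop _ _ _ _ _"] ptr_sc)
also have "Uop h c L a (h - xi) * perm a n = perm a n * Uop h c L n (h - xi)"
proof -
 have "perm n a = perm a n" unfolding perm_alt Dop_comm[OF an(1)[symmetric]] ..
 thus ?thesis using perm_Uop[OF an(1)[symmetric] an(3,2), of h c "h - xi"] by simp
qed
also have "Kop c' a (- xi + 2 * h) * (Rop h a n (2 * (- xi)) * (perm a n * Uop h c L n (h - xi)))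
  = Kop c' a (- xi + 2 * h) * (perm a n * Rop h a n (2 * (- xi))) * Uop h c L n (h - xi)"
 unfolding perm_Rop(1)[OF an(1)] unfolding perm_Rop(2)[OF an(1), symmetric] by (simp only: mult.assoc)
also have "ptr a ... = sc (th1 (2 * (- xi) + 4 * h)) * Kop c' n (- xi) * Uop h c L n (h - xi)"
 unfolding ptr_right[OF oU] ptr_Kop_perm_Rop[OF an(1)] ..
finally show "Top h c' c ((n, xi) # L) (h - xi) = sc (th1 (2 * h) * th1 (4 * h - 2 * xi)) * (Kop c' n (- xi) * Uop h c L n (h - xi))"
 by (simp only: mult.assoc sc_sc) (simp add: alg)
qed

lemma fusion_head:
 assumes "distinct (map fst ((n, xi) # L))"
 shows "Top h c' c ((n, xi) # L) (h + xi) * Top h c' c ((n, xi) # L) (h - xi)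
  = sc ((th1 (2 * h))\<^sup>2 * ts (4 * h) (2 * xi) * kap c' xi * kap c xi * (\<Prod>(m, \<zeta>)\<leftarrow>L. rho h (xi - \<zeta>) * rho h (xi + \<zeta>)))"
proof -
have n: "n \<notin> fst ` set L" "distinct (map fst L)" using assms by auto
define s t where "s = th1 (2 * h) * th1 (2 * xi + 4 * h)" and "t = th1 (2 * h) * th1 (4 * h - 2 * xi)"
have "Top h c' c ((n, xi) # L) (h + xi) * Top h c' c ((n, xi) # L) (h - xi)
 = sc (s * t) * (Uop h c L n (h + xi) * (Kop c' n xi * Kop c' n (- xi)) * Uop h c L n (h - xi))"
 unfolding Top_at_site[OF assms] s_def[symmetric] t_def[symmetric]
 by (simp only: mult.assoc sc_lc[of "Kop _ _ _"] sc_lc[of "Uop _ _ _ _ _"] sc_sc)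
also have "... = sc (s * t) * (sc (kap c' xi) * (Uop h c L n (h + xi) * Uop h c L n (h - xi)))"
 unfolding K_unitarity by (simp only: mult.assoc sc_lc[of "Uop _ _ _ _ _"])
finally show ?thesis unfolding Uop_unitarity[OF n] s_def t_def
 by (simp only: sc_mult[symmetric]) (simp add: ts_def power2_eq_square mult_ac add.commute)
qed

text \<open>Any site can be moved to the front of the chain by a similarity transformation.\<close>

lemma Rop_off: "off i X ==> off j X ==> X * Rop h i j z = Rop h i j z * X"
proof -
assume X: "off i X" "off j X"
have "X * (sc s * DD i j g) = sc s * DD i j g * X" for s g
proof -
 have "X * DD i j g = Dop i g * Dop j g * X"
  using offD[OF X(1), of g] offD[OF X(2), of g] by (metis mult.assoc)
 thus ?thesis by (simp add: sc_lc[of X] mult.assoc)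
qed
thus ?thesis unfolding Rop_def sum_distrib_left sum_distrib_right by (simp only:)
qed

lemma Uop_swap:
 assumes "distinct (map fst ((m, \<zeta>) # (n, xi) # L))" "a \<notin> fst ` set ((m, \<zeta>) # (n, xi) # L)"
 shows "Uop h c ((m, \<zeta>) # (n, xi) # L) a z * Rop h m n (\<zeta> - xi) = Rop h m n (\<zeta> - xi) * Uop h c ((n, xi) # (m, \<zeta>) # L) a z"
proof -
have d: "a ~= m" "a ~= n" "m ~= n" "a \<notin> fst ` set L" "m \<notin> fst ` set L" "n \<notin> fst ` set L" using assms by auto
define S M N M' N' U where "S = Rop h m n (\<zeta> - xi)" "M = Rop h a m (z - \<zeta> - h)" "N = Rop h a n (z - xi - h)"
 "M' = Rop h a m (z + \<zeta> - h)" "N' = Rop h a n (z + xi - h)" "U = Uop h c L a z"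
note defs = S_M_N_M'_N'_U_def
have 1: "M * N * S = S * N * M"
proof -
 have e: "z - xi - h = (z - \<zeta> - h) + (\<zeta> - xi)" by simp
 show ?thesis unfolding defs e by (rule yang_baxter[OF d(1,2,3)])
qed
have 2: "N' * M' * S = S * M' * N'"
proof -
 have e: "z + \<zeta> - h = (z + xi - h) + (\<zeta> - xi)" by simp
 show ?thesis unfolding defs Rop_sym[OF d(3)] e by (rule yang_baxter[OF d(2,1) d(3)[symmetric]])
qed
have 3: "U * S = S * U" unfolding defs by (rule Rop_off; rule off_Uop; use d in auto)
have u: "Uop h c ((m, \<zeta>) # (n, xi) # L) a z = M * (N * U * N') * M'"
 "Uop h c ((n, xi) # (m, \<zeta>) # L) a z = N * (M * U * M') * N'"
 unfolding defs using d by (auto simp: Uop_Cons)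
have "M * (N * U * N') * M' * S = M * N * U * (N' * M' * S)" by (simp only: mult.assoc)
also have "... = M * N * (U * S) * M' * N'" unfolding 2 by (simp only: mult.assoc)
also have "... = (M * N * S) * U * M' * N'" unfolding 3 by (simp only: mult.assoc)
also have "... = S * (N * (M * U * M') * N')" unfolding 1 by (simp only: mult.assoc)
finally show ?thesis unfolding u defs(1) .
qed

lemma Uop_to_front:
 assumes "distinct (map fst L)" "(n, xi) \<in> set L"
  and r: "\<forall>p\<in>set L. fst p ~= n \<longrightarrow> rho h (snd p - xi) ~= 0"
 shows "\<exists>L' X Y. mset ((n, xi) # L') = mset L \<and> X * Y = 1 \<and>
   (\<forall>a. a \<notin> fst ` set L \<longrightarrow> off a X \<and> (\<forall>z. Uop h c L a z * X = X * Uop h c ((n, xi) # L') a z))"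
 using assms
proof (induction L)
case (Cons p L)
obtain m \<zeta> where p: "p = (m, \<zeta>)" by fastforce
show ?case
proof (cases "p = (n, xi)")
 case True
 thus ?thesis by (intro exI[of _ L] exI[of _ 1]) auto
next
 case False
 hence nL: "(n, xi) \<in> set L" using Cons.prems by auto
 have mn: "m ~= n" "m \<notin> fst ` set L" "distinct (map fst L)" using Cons.prems(1) nL p by (force+)
 obtain L' X Y where IH: "mset ((n, xi) # L') = mset L" "X * Y = 1"
  "!!a. a \<notin> fst ` set L ==> off a X"
  "!!a z. a \<notin> fst ` set L ==> Uop h c L a z * X = X * Uop h c ((n, xi) # L') a z"
  using Cons.IH[OF mn(3) nL] Cons.prems(3) by (metis list.set_intros(2))
 have sL: "set L = insert (n, xi) (set L')" using IH(1) by (metis set_mset_mset list.simps(15))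
 have dn: "distinct (map fst ((n, xi) # L'))"
  using IH(1) mn(3) by (metis mset_eq_imp_distinct_iff mset_map)
 have r0: "rho h (\<zeta> - xi) ~= 0" using Cons.prems(3) p mn by simp
 define R where "R = Rop h m n (\<zeta> - xi)"
 define R' where "R' = sc (1 / rho h (\<zeta> - xi)) * Rop h m n (- (\<zeta> - xi))"
 have RR: "R * R' = 1" unfolding R_def R'_def sc_lc R_unitarity[OF mn(1)]
  using r0 by (simp flip: sc_mult)
 have "mset ((n, xi) # (m, \<zeta>) # L') = mset (p # L)" using IH(1) p by simp
 moreover have "X * R * (R' * Y) = 1" using RR IH(2) by (metis mult.assoc mult_1_right)
 moreover have "off a (X * R) \<and> (\<forall>z. Uop h c (p # L) a z * (X * R) = X * R * Uop h c ((n, xi) # (m, \<zeta>) # L') a z)"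
  if a: "a \<notin> fst ` set (p # L)" for a
 proof (intro conjI allI)
  have a': "a ~= m" "a \<notin> fst ` set L" "a ~= n" "a \<notin> fst ` set L'" "m \<notin> fst ` set L'" using a p sL mn by auto
  show "off a (X * R)" unfolding R_def by (intro off_mult IH(3) off_Rop a')
  fix z
  have c: "X * Rop h a m w = Rop h a m w * X" for w
   by (rule Rop_off) (use IH(3) a' mn in auto)
  have "Uop h c (p # L) a z * X = Rop h a m (z - \<zeta> - h) * (Uop h c L a z * X) * Rop h a m (z + \<zeta> - h)"
   unfolding p Uop_Cons[OF a'(1,2) mn(2)] mult.assoc c ..
  also have "... = X * Uop h c ((m, \<zeta>) # (n, xi) # L') a z"
  proof -
   have am: "a \<notin> fst ` set ((n, xi) # L')" "m \<notin> fst ` set ((n, xi) # L')" using a' mn by auto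
   thus ?thesis unfolding IH(4)[OF a'(2)] Uop_Cons[OF a'(1) am]
    by (simp only: mult.assoc[symmetric] c)
  qed
  finally have "Uop h c (p # L) a z * (X * R) = X * (Uop h c ((m, \<zeta>) # (n, xi) # L') a z * R)"
   by (simp only: mult.assoc[symmetric])
  also have "... = X * (R * Uop h c ((n, xi) # (m, \<zeta>) # L') a z)"
   unfolding R_def by (subst Uop_swap) (use dn a' mn in auto)
  finally show "Uop h c (p # L) a z * (X * R) = X * R * Uop h c ((n, xi) # (m, \<zeta>) # L') a z"
   by (simp only: mult.assoc)
 qed
 ultimately show ?thesis by blast
qed
qed simp

theorem fusion:
 assumes "distinct (map fst L)" "(n, xi) \<in> set L"
  and r: "\<forall>p\<in>set L. fst p ~= n \<longrightarrow> rho h (snd p - xi) ~= 0"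
 shows "Top h c' c L (h + xi) * Top h c' c L (h - xi)
  = sc ((th1 (2 * h))\<^sup>2 * ts (4 * h) (2 * xi) * kap c' xi * kap c xi * (\<Prod>(m, \<zeta>)\<leftarrow>remove1 (n, xi) L. rho h (xi - \<zeta>) * rho h (xi + \<zeta>)))"
proof -
let ?A = "\<Prod>(m, \<zeta>)\<leftarrow>remove1 (n, xi) L. rho h (xi - \<zeta>) * rho h (xi + \<zeta>)"
obtain L' X Y where P: "mset ((n, xi) # L') = mset L \<and> X * Y = 1 \<and>
  (\<forall>a. a \<notin> fst ` set L \<longrightarrow> off a X \<and> (\<forall>z. Uop h c L a z * X = X * Uop h c ((n, xi) # L') a z))"
 using Uop_to_front[OF assms, where c = c] by (elim exE) (rule that)
have L': "mset ((n, xi) # L') = mset L" and XY: "X * Y = 1" using P by simp_all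
have offX: "off a X" and U: "Uop h c L a z * X = X * Uop h c ((n, xi) # L') a z"
 if "a \<notin> fst ` set L" for a z using P that by auto
have d: "distinct (map fst ((n, xi) # L'))"
 using L' assms(1) by (metis mset_eq_imp_distinct_iff mset_map)
have s: "set L = set ((n, xi) # L')" using L' by (metis set_mset_mset)
obtain a where a: "a \<notin> fst ` set L" using ex_new_if_finite[of "fst ` set L"] infinite_UNIV_nat by auto
have T: "Top h c' c L z * X = X * Top h c' c ((n, xi) # L') z" for z
proof -
 have K: "Kop c' a w * X = X * Kop c' a w" for w
  unfolding Kop_def sum_distrib_left sum_distrib_right
  by (rule sum.cong[OF refl]) (simp only: mult.assoc sc_lc[of X] offD[OF offX[OF a]])
 have a': "a \<notin> fst ` set ((n, xi) # L')" using a s by simp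
 have "Kop c' a (z + h) * Uop h c L a z * X = X * (Kop c' a (z + h) * Uop h c ((n, xi) # L') a z)"
  unfolding mult.assoc U[OF a] unfolding mult.assoc[symmetric] K ..
 thus ?thesis unfolding Top_ptr[OF a] Top_ptr[OF a'] ptr_right[OF offX[OF a], symmetric] ptr_left[OF offX[OF a], symmetric]
  by (rule arg_cong)
qed
define k where "k = (th1 (2 * h))\<^sup>2 * ts (4 * h) (2 * xi) * kap c' xi * kap c xi"
have "mset L' = mset (remove1 (n, xi) L)" using L'[symmetric] by simp
hence e: "(\<Prod>(m, \<zeta>)\<leftarrow>L'. rho h (xi - \<zeta>) * rho h (xi + \<zeta>)) = ?A"
 unfolding prod_mset_prod_list[symmetric] mset_map by simp
have "Top h c' c L (h + xi) * Top h c' c L (h - xi) * X = X * (Top h c' c ((n, xi) # L') (h + xi) * Top h c' c ((n, xi) # L') (h - xi))"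
 unfolding mult.assoc T unfolding mult.assoc[symmetric] T ..
also have "... = sc (k * ?A) * X"
 unfolding fusion_head[OF d] e k_def by (rule sc_comm)
finally have "Top h c' c L (h + xi) * Top h c' c L (h - xi) * (X * Y)
  = sc (k * ?A) * (X * Y)"
 by (simp only: mult.assoc[symmetric])
thus ?thesis unfolding XY k_def by simp
qed

section \<open>Matrices of operators on chains\<close>

text \<open>\<open>num o N s\<close> is the number of the basis vector with components \<open>s o, ..., s N\<close>; the offset \<open>o\<close>
 is \<open>0\<close> when the auxiliary space is included and \<open>1\<close> otherwise.\<close>

fun num :: "nat => nat => (nat => bool) => nat" where
 "num o' N s = (\<Sum>k<Suc N - o'. of_bool (s (k + o')) * 2 ^ k)"

declare num.simps [simp del]

lemma binary_sum_less: "(\<Sum>k<n. of_bool (f k) * 2 ^ k) < (2 :: nat) ^ n"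
proof (induction n)
case (Suc n)
have "(of_bool (f n) :: nat) * 2 ^ n \<le> 2 ^ n" by simp
with Suc show ?case by simp
qed simp

lemma digit_binary_sum:
 "k < n ==> digit (\<Sum>k<n. of_bool (f k) * 2 ^ k) k = of_bool (f k)"
proof (induction n)
case (Suc n)
define S where "S = (\<Sum>k<n. of_bool (f k) * (2 :: nat) ^ k)"
have S: "S < 2 ^ n" unfolding S_def by (rule binary_sum_less)
show ?case
proof (cases "k = n")
 case True
 have "(S + of_bool (f n) * 2 ^ n) div 2 ^ n = of_bool (f n)" using S by simp
 thus ?thesis using True by (simp add: digit_def flip: S_def)
next
 case False
 hence k: "k < n" using Suc.prems by simp
 have "(S + of_bool (f n) * 2 ^ n) div 2 ^ k = S div 2 ^ k + of_bool (f n) * 2 ^ (n - k)"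
 proof -
  have "(2 :: nat) ^ n = 2 ^ (n - k) * 2 ^ k" using k by (simp flip: power_add)
  thus ?thesis by (simp add: mult.assoc[symmetric])
 qed
 moreover have "even ((2 :: nat) ^ (n - k))" using k by simp
 ultimately have "digit (S + of_bool (f n) * 2 ^ n) k = digit S k"
  unfolding digit_def by (metis even_mult_iff mod2_eq_if even_add)
 thus ?thesis using Suc.IH[OF k] unfolding S_def by simp
qed
qed simp

lemma binary_expansion: "(I :: nat) < 2 ^ n ==> I = (\<Sum>k<n. of_bool (digit I k = 1) * 2 ^ k)"
proof (induction n arbitrary: I)
case (Suc n)
have d: "digit (I div 2) k = digit I (Suc k)" for k unfolding digit_def by (simp add: div_mult2_eq)
have "I div 2 < 2 ^ n" using Suc.prems by simp
hence e: "I div 2 = (\<Sum>k<n. of_bool (digit I (Suc k) = 1) * 2 ^ k)" using Suc.IH[of "I div 2"] unfolding d by simp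
have m: "of_bool (digit I 0 = 1) = I mod 2" unfolding digit_def by (simp add: mod2_eq_if)
have "I = I mod 2 + 2 * (I div 2)" by simp
also have "... = (\<Sum>k<Suc n. of_bool (digit I k = 1) * 2 ^ k)"
 unfolding sum.lessThan_Suc_shift m[symmetric] e sum_distrib_left by (simp add: mult_ac)
finally show ?case .
qed simp

lemma num_less [simp]: "num o' N s < 2 ^ (Suc N - o')"
 unfolding num.simps by (rule binary_sum_less)

lemma digit_num: "k \<in> {o'..N} ==> digit (num o' N s) (k - o') = of_bool (s k)"
 unfolding num.simps by (subst digit_binary_sum) auto

lemma digit_num0: "k \<le> N ==> digit (num 0 N s) k = of_bool (s k)"
 using digit_num[of k 0 N s] by simp

lemma num_surj: "I < 2 ^ (Suc N - o') ==> \<exists>s. I = num o' N s"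
 using binary_expansion[of I "Suc N - o'"] unfolding num.simps
 by (intro exI[of _ "%k. digit I (k - o') = 1"]) simp

lemma num_cong: "(!!k. k \<in> {o'..N} ==> s k = t k) ==> num o' N s = num o' N t"
 unfolding num.simps by (intro sum.cong refl) auto

lemma num_eq_iff: "num o' N s = num o' N t \<longleftrightarrow> (\<forall>k\<in>{o'..N}. s k = t k)"
proof
assume e: "num o' N s = num o' N t"
show "\<forall>k\<in>{o'..N}. s k = t k"
proof
 fix k assume "k \<in> {o'..N}"
 from digit_num[OF this, of s] digit_num[OF this, of t] show "s k = t k" unfolding e by (simp add: of_bool_eq_iff)
qed
qed (blast intro: num_cong)

lemma num_0_1: "num 0 N s = 2 * num 1 N s + of_bool (s 0)"
proof -
have "(\<Sum>k<Suc N. of_bool (s k) * 2 ^ k) = of_bool (s 0) + (\<Sum>k<N. of_bool (s (Suc k)) * 2 ^ Suc k :: nat)"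
 by (subst sum.lessThan_Suc_shift) simp
also have "(\<Sum>k<N. of_bool (s (Suc k)) * 2 ^ Suc k :: nat) = (\<Sum>k<N. 2 * (of_bool (s (Suc k)) * 2 ^ k))"
 by (rule sum.cong) simp_all
finally show ?thesis unfolding num.simps sum_distrib_left[symmetric] by simp
qed

text \<open>The matrix \<open>B\<close> represents the operator \<open>X\<close> on the chain with sites \<open>o, ..., N\<close>.\<close>

definition repr :: "nat => nat => complex mat => lin => bool" where
 "repr o' N B X \<longleftrightarrow> B \<in> carrier_mat (2 ^ (Suc N - o')) (2 ^ (Suc N - o')) \<and>
   (\<forall>v\<in>carrier_vec (2 ^ (Suc N - o')). \<forall>s. app X (%s. v $ num o' N s) s = (B *\<^sub>v v) $ num o' N s)"

lemma reprD:
 assumes "repr o' N B X"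
 shows "B \<in> carrier_mat (2 ^ (Suc N - o')) (2 ^ (Suc N - o'))"
  and "v \<in> carrier_vec (2 ^ (Suc N - o')) ==> app X (%s. v $ num o' N s) = (%s. (B *\<^sub>v v) $ num o' N s)"
 using assms unfolding repr_def by auto

lemma repr_mult:
 assumes "repr o' N B X" "repr o' N C Y"
 shows "repr o' N (B * C) (X * Y)"
 unfolding repr_def
proof (intro conjI ballI allI)
let ?A = "2 ^ (Suc N - o')"
note d = reprD(1)[OF assms(1)] reprD(1)[OF assms(2)]
show "B * C \<in> carrier_mat ?A ?A" using d by simp
fix v :: "complex vec" and s assume v: "v \<in> carrier_vec ?A"
have "C *\<^sub>v v \<in> carrier_vec ?A" using d v by simp
from reprD(2)[OF assms(1) this]
show "app (X * Y) (%s. v $ num o' N s) s = (B * C *\<^sub>v v) $ num o' N s"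
 unfolding app_mult reprD(2)[OF assms(2) v] assoc_mult_mat_vec[OF d v] by (rule fun_cong)
qed

lemma repr_one: "repr o' N (1\<^sub>m (2 ^ (Suc N - o'))) 1"
 unfolding repr_def app_one by simp

lemma repr_sc: "repr o' N (c \<cdot>\<^sub>m 1\<^sub>m (2 ^ (Suc N - o'))) (sc c)"
proof -
have "c \<cdot>\<^sub>m 1\<^sub>m n *\<^sub>v v = c \<cdot>\<^sub>v v" if "v \<in> carrier_vec n" for v :: "complex vec" and n
 using that by (intro eq_vecI) (auto simp: row_smult)
thus ?thesis unfolding repr_def app_sc by auto
qed

lemma repr_prod_list:
 "list_all2 (repr o' N) Bs Xs ==> repr o' N (mat_prod_list (2 ^ (Suc N - o')) Bs) (prod_list Xs)"
 unfolding mat_prod_list_def by (induction rule: list_all2_induct) (auto intro: repr_one repr_mult)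

lemma repr_unique:
 assumes "repr o' N B X" "repr o' N C X"
 shows "B = C"
proof (rule eq_matI)
let ?d = "2 ^ (Suc N - o')"
note d = reprD(1)[OF assms(1)] reprD(1)[OF assms(2)]
show "dim_row B = dim_row C" "dim_col B = dim_col C" using d by auto
fix i j assume "i < dim_row C" "j < dim_col C"
hence ij: "i < ?d" "j < ?d" using d by auto
obtain s where s: "i = num o' N s" using num_surj[OF ij(1)] by blast
have u: "unit_vec ?d j \<in> carrier_vec ?d" by simp
have "(B *\<^sub>v unit_vec ?d j) $ i = (C *\<^sub>v unit_vec ?d j) $ i"
 using reprD(2)[OF assms(1) u] reprD(2)[OF assms(2) u] unfolding s by (metis (no_types))
thus "B $$ (i, j) = C $$ (i, j)" using d ij by simp
qed

text \<open>Components of a represented operator, expressed through the operator.\<close>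

lemma repr_entry:
 assumes "repr o' N B X" "j < 2 ^ (Suc N - o')"
 shows "B $$ (num o' N s, j) = app X (%s. of_bool (num o' N s = j)) s"
proof -
let ?d = "2 ^ (Suc N - o')"
have d: "B \<in> carrier_mat ?d ?d" by (rule reprD(1)[OF assms(1)])
have u: "unit_vec ?d j \<in> carrier_vec ?d" by simp
have "(%s. unit_vec ?d j $ num o' N s) = (%s. of_bool (num o' N s = j) :: complex)"
 using assms(2) by (simp add: fun_eq_iff)
hence "app X (%s. of_bool (num o' N s = j)) s = (B *\<^sub>v unit_vec ?d j) $ num o' N s"
 using reprD(2)[OF assms(1) u] by simp
thus ?thesis using d assms(2) by simp
qed

lemma sum_two_sites:
 assumes n: "n \<in> {1..N}" and f: "!!a b. f (num 0 N (s(0 := a, n := b))) = g a b"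
 shows "(\<Sum>J<2 ^ Suc N. if \<forall>k\<in>{1..N} - {n}. digit (num 0 N s) k = digit J k then f J else (0 :: complex))
  = (\<Uplus>a b. g a b)"
proof -
let ?P = "%J. \<forall>k\<in>{1..N} - {n}. digit (num 0 N s) k = digit J k"
let ?h = "%(a, b). num 0 N (s(0 := a, n := b))"
have inj: "inj ?h"
proof (rule injI)
 fix x y :: "bool \<times> bool" assume e: "?h x = ?h y"
 obtain a b a' b' where xy: "x = (a, b)" "y = (a', b')" by fastforce
 from e have "\<forall>k\<in>{0..N}. (s(0 := a, n := b)) k = (s(0 := a', n := b')) k" unfolding xy split num_eq_iff .
 from bspec[OF this, of 0] bspec[OF this, of n] n show "x = y" unfolding xy by auto
qed
have im: "{J \<in> {..<2 ^ Suc N}. ?P J} = range ?h"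
proof (intro equalityI subsetI)
 fix J assume "J \<in> {J \<in> {..<2 ^ Suc N}. ?P J}"
 hence J: "J < 2 ^ Suc N" "?P J" by auto
 obtain t where t: "J = num 0 N t" using num_surj[of J N 0] J(1) by auto
 have "J = ?h (t 0, t n)" unfolding t split
 proof (rule num_cong)
  fix k assume k: "k \<in> {0..N}"
  show "t k = (s(0 := t 0, n := t n)) k"
  proof (cases "k = 0 \<or> k = n")
   case False
   hence "k \<in> {1..N} - {n}" using k by auto
   hence "digit (num 0 N s) k = digit (num 0 N t) k" using J(2) t by blast
   thus ?thesis using False k by (simp add: digit_num0 of_bool_eq_iff)
  qed auto
 qed
 thus "J \<in> range ?h" by blast
next
 fix J assume "J \<in> range ?h"
 then obtain a b where J: "J = num 0 N (s(0 := a, n := b))" by auto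
 show "J \<in> {J \<in> {..<2 ^ Suc N}. ?P J}"
  using num_less[of 0 N "s(0 := a, n := b)"] unfolding J by (auto simp: digit_num0)
qed
have "(\<Sum>J<2 ^ Suc N. if ?P J then f J else 0) = (\<Sum>J\<in>{J \<in> {..<2 ^ Suc N}. ?P J}. f J)"
 by (rule sum.inter_filter[symmetric]) simp
also have "... = (\<Uplus>x. f (?h x))" unfolding im by (subst sum.reindex[OF inj]) simp
also have "... = (\<Sum>(a, b)\<in>UNIV \<times> UNIV. g a b)" unfolding UNIV_Times_UNIV by (rule sum.cong) (auto simp: f)
finally show ?thesis by (simp only: sum.cartesian_product)
qed

lemma sum_aux_site:
 assumes f: "!!a. f (num 0 N (s(0 := a))) = g a"
 shows "(\<Sum>J<2 ^ Suc N. if \<forall>k\<in>{1..N}. digit (num 0 N s) k = digit J k then f J else (0 :: complex)) = (\<Uplus>a. g a)"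
proof -
let ?P = "%J. \<forall>k\<in>{1..N}. digit (num 0 N s) k = digit J k"
let ?h = "%a. num 0 N (s(0 := a))"
have inj: "inj ?h"
proof (rule injI)
 fix a b assume "?h a = ?h b"
 hence "\<forall>k\<in>{0..N}. (s(0 := a)) k = (s(0 := b)) k" unfolding num_eq_iff .
 from bspec[OF this, of 0] show "a = b" by simp
qed
have im: "{J \<in> {..<2 ^ Suc N}. ?P J} = range ?h"
proof (intro equalityI subsetI)
 fix J assume "J \<in> {J \<in> {..<2 ^ Suc N}. ?P J}"
 hence J: "J < 2 ^ Suc N" "?P J" by auto
 obtain t where t: "J = num 0 N t" using num_surj[of J N 0] J(1) by auto
 have "J = ?h (t 0)" unfolding t
 proof (rule num_cong)
  fix k assume k: "k \<in> {0..N}"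
  show "t k = (s(0 := t 0)) k"
  proof (cases "k = 0")
   case False
   hence "k \<in> {1..N}" using k by auto
   hence "digit (num 0 N s) k = digit (num 0 N t) k" using J(2) t by blast
   thus ?thesis using False k by (simp add: digit_num0 of_bool_eq_iff)
  qed auto
 qed
 thus "J \<in> range ?h" by blast
next
 fix J assume "J \<in> range ?h"
 then obtain a where J: "J = num 0 N (s(0 := a))" by auto
 show "J \<in> {J \<in> {..<2 ^ Suc N}. ?P J}"
  using num_less[of 0 N "s(0 := a)"] unfolding J by (auto simp: digit_num0)
qed
have "(\<Sum>J<2 ^ Suc N. if ?P J then f J else 0) = (\<Sum>J\<in>{J \<in> {..<2 ^ Suc N}. ?P J}. f J)"
 by (rule sum.inter_filter[symmetric]) simp
also have "... = (\<Uplus>x. f (?h x))" unfolding im by (subst sum.reindex[OF inj]) simp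
finally show ?thesis unfolding f .
qed

lemma repr_on_aux_site:
 assumes n: "n \<in> {1..N}"
  and X: "!!\<psi> s. app X \<psi> s = (\<Uplus>a b. B $$ (2 * of_bool (s 0) + of_bool (s n), 2 * of_bool a + of_bool b) * \<psi> (s(0 := a, n := b)))"
 shows "repr 0 N (on_aux_site N n B) X"
 unfolding repr_def
proof (intro conjI ballI allI)
show "on_aux_site N n B \<in> carrier_mat (2 ^ (Suc N - 0)) (2 ^ (Suc N - 0))" unfolding on_aux_site_def by simp
fix v :: "complex vec" and s assume v: "v \<in> carrier_vec (2 ^ (Suc N - 0))"
define I where "I = num 0 N s"
have I: "I < 2 ^ Suc N" using num_less[of 0 N s] unfolding I_def by simp
have "(on_aux_site N n B *\<^sub>v v) $ I = (\<Sum>J<2 ^ Suc N. on_aux_site N n B $$ (I, J) * v $ J)"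
 using v I unfolding on_aux_site_def by (simp add: scalar_prod_def atLeast0LessThan del: power_Suc)
also have "... = (\<Sum>J<2 ^ Suc N. if \<forall>k\<in>{1..N} - {n}. digit (num 0 N s) k = digit J k
  then B $$ (2 * digit I 0 + digit I n, 2 * digit J 0 + digit J n) * v $ J else 0)"
 using I unfolding on_aux_site_def I_def by (intro sum.cong refl) (simp del: power_Suc)
also have "... = (\<Uplus>a b. B $$ (2 * of_bool (s 0) + of_bool (s n), 2 * of_bool a + of_bool b) * v $ num 0 N (s(0 := a, n := b)))"
 using n by (intro sum_two_sites) (simp_all add: digit_num0 I_def)
finally show "app X (%s. v $ num 0 N s) s = (on_aux_site N n B *\<^sub>v v) $ num 0 N s" unfolding X I_def by simp
qed

lemma repr_on_aux:
 assumes X: "!!\<psi> s. app X \<psi> s = (\<Uplus>a. B $$ (of_bool (s 0), of_bool a) * \<psi> (s(0 := a)))"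
 shows "repr 0 N (on_aux N B) X"
 unfolding repr_def
proof (intro conjI ballI allI)
show "on_aux N B \<in> carrier_mat (2 ^ (Suc N - 0)) (2 ^ (Suc N - 0))" unfolding on_aux_def by simp
fix v :: "complex vec" and s assume v: "v \<in> carrier_vec (2 ^ (Suc N - 0))"
define I where "I = num 0 N s"
have I: "I < 2 ^ Suc N" using num_less[of 0 N s] unfolding I_def by simp
have "(on_aux N B *\<^sub>v v) $ I = (\<Sum>J<2 ^ Suc N. on_aux N B $$ (I, J) * v $ J)"
 using v I unfolding on_aux_def by (simp add: scalar_prod_def atLeast0LessThan del: power_Suc)
also have "... = (\<Sum>J<2 ^ Suc N. if \<forall>k\<in>{1..N}. digit (num 0 N s) k = digit J k
  then B $$ (digit I 0, digit J 0) * v $ J else 0)"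
 using I unfolding on_aux_def I_def by (intro sum.cong refl) (simp del: power_Suc)
also have "... = (\<Uplus>a. B $$ (of_bool (s 0), of_bool a) * v $ num 0 N (s(0 := a)))"
 by (intro sum_aux_site) (simp add: digit_num0 I_def)
finally show "app X (%s. v $ num 0 N s) s = (on_aux N B *\<^sub>v v) $ num 0 N s" unfolding X I_def by simp
qed

lemma app_ptr:
 assumes indep: "!!s t. \<psi> (s(a := t)) = \<psi> s"
 shows "app (ptr a X) \<psi> s = (\<Uplus>t. app X (%s'. of_bool (s' a = t) * \<psi> s') (s(a := t)))"
proof -
let ?A = "%t. %s'. of_bool (s' a = t) * \<psi> s'"
define F where "F r t = app X (%s'. (if r \<and> s' a then -1 else 1) * \<psi> s') (s(a := t))" for r t
have D: "app (Dop a (p, r)) \<psi> = (%s'. (if r \<and> p then -1 else 1) * ((if r \<and> s' a then -1 else 1) * \<psi> s'))" for p r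
 by (rule ext) (auto simp: app_Dop indep)
have "app (sc (ph (p, r) (p, r)) * (Dop a (p, r) * X * Dop a (p, r))) \<psi> s = (if r \<and> (s a ~= p) then -1 else 1) * F r (s a ~= p)" for p r
 unfolding app_mult app_sc D app_arg_cmult app_Dop F_def by auto
hence "app (ptr a X) \<psi> s = 1 / 2 * (\<Uplus>g. (if snd g \<and> (s a ~= fst g) then -1 else 1) * F (snd g) (s a ~= fst g))"
 unfolding ptr_def app_mult[of "sc (1/2)"] app_sc app_sum
 by (intro arg_cong[of _ _ "%x. 1 / 2 * x"] sum.cong refl) (auto simp only: split_paired_all fst_conv snd_conv)
also have "... = (\<Uplus>t. 1 / 2 * (F False t + (if t then -1 else 1) * F True t))"
 unfolding sum_idx UNIV_bool by (cases "s a") (simp_all add: alg)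
also have "... = (\<Uplus>t. app X (?A t) (s(a := t)))"
proof (rule sum.cong[OF refl])
 fix t :: bool
 have e: "(?A t) = (%s'. 1 / 2 * (((if False \<and> s' a then -1 else 1) * \<psi> s') + (if t then -1 else 1) * ((if True \<and> s' a then -1 else 1) * \<psi> s')))"
  by (rule ext) auto
 show "1 / 2 * (F False t + (if t then -1 else 1) * F True t) = app X (?A t) (s(a := t))"
  unfolding e app_arg_cmult app_arg_add F_def ..
qed
finally show ?thesis .
qed

lemma repr_tr_aux:
 assumes "repr 0 N B X"
 shows "repr 1 N (tr_aux N B) (ptr 0 X)"
 unfolding repr_def
proof (intro conjI ballI allI)
show "tr_aux N B \<in> carrier_mat (2 ^ (Suc N - 1)) (2 ^ (Suc N - 1))" unfolding tr_aux_def by simp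
fix v :: "complex vec" and s assume v: "v \<in> carrier_vec (2 ^ (Suc N - 1))"
have B: "B \<in> carrier_mat (2 ^ Suc N) (2 ^ Suc N)" using reprD(1)[OF assms] by simp
define i where "i = num 1 N s"
have i: "i < 2 ^ N" using num_less[of 1 N s] unfolding i_def by simp
have s1: "num 1 N (s(0 := t)) = num 1 N s" for s t by (rule num_cong) auto
define V where "V t = Matrix.vec (2 ^ Suc N) (%J. if J mod 2 = of_bool t then v $ (J div 2) else 0)" for t
have V: "V t \<in> carrier_vec (2 ^ (Suc N - 0))" for t unfolding V_def by simp
have Vs: "(%s'. of_bool (s' 0 = t) * v $ num 1 N s') = (%s'. V t $ num 0 N s')" for t
proof (rule ext)
 fix s'
 have "num 0 N s' < 2 ^ Suc N" using num_less[of 0 N s'] by simp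
 hence "V t $ num 0 N s' = (if num 0 N s' mod 2 = of_bool t then v $ (num 0 N s' div 2) else 0)" unfolding V_def by simp
 moreover have "num 0 N s' mod 2 = of_bool (s' 0)" "num 0 N s' div 2 = num 1 N s'" unfolding num_0_1 by (simp_all add: of_bool_def)
 ultimately show "of_bool (s' 0 = t) * v $ num 1 N s' = V t $ num 0 N s'" by simp
qed
have "(B *\<^sub>v V t) $ (2 * i + of_bool t) = (\<Sum>j<2 ^ N. B $$ (2 * i + of_bool t, 2 * j + of_bool t) * v $ j)" for t
proof -
 have l: "2 * i + of_bool t < 2 ^ Suc N" using i by (cases t) auto
 have "(B *\<^sub>v V t) $ (2 * i + of_bool t) = (\<Sum>J<2 ^ Suc N. B $$ (2 * i + of_bool t, J) * V t $ J)"
  using l B V[of t] by (simp add: scalar_prod_def atLeast0LessThan del: power_Suc)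
 also have "... = (\<Sum>J<2 * 2 ^ N. if J mod 2 = of_bool t then B $$ (2 * i + of_bool t, J) * v $ (J div 2) else 0)"
  unfolding V_def power_Suc by (intro sum.cong refl) simp
 also have "... = (\<Sum>J\<in>{J \<in> {..<2 * 2 ^ N}. J mod 2 = of_bool t}. B $$ (2 * i + of_bool t, J) * v $ (J div 2))"
  by (rule sum.inter_filter[symmetric]) simp
 also have "{J \<in> {..<2 * 2 ^ N :: nat}. J mod 2 = of_bool t} =  (%j. 2 * j + of_bool t) ` {..<2 ^ N}"
 proof (intro equalityI subsetI)
  fix J :: nat assume "J \<in> {J \<in> {..<2 * 2 ^ N}. J mod 2 = of_bool t}"
  hence J: "J < 2 * 2 ^ N" "J mod 2 = of_bool t" by auto
  have "J = 2 * (J div 2) + J mod 2" by simp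
  hence "J = 2 * (J div 2) + of_bool t" "J div 2 < 2 ^ N" using J by simp_all
  thus "J \<in> (%j. 2 * j + of_bool t) ` {..<2 ^ N}" by blast
 qed (cases t; auto)
 also have "(\<Sum>J\<in>.... B $$ (2 * i + of_bool t, J) * v $ (J div 2)) = (\<Sum>j<2 ^ N. B $$ (2 * i + of_bool t, 2 * j + of_bool t) * v $ j)"
  by (subst sum.reindex) (cases t; auto simp: inj_on_def)+
 finally show ?thesis .
qed
moreover have "num 0 N (s(0 := t)) = 2 * i + of_bool t" for t unfolding num_0_1 s1 i_def by simp
ultimately have t: "app X (%s'. of_bool (s' 0 = t) * v $ num 1 N s') (s(0 := t)) = (\<Sum>j<2 ^ N. B $$ (2 * i + of_bool t, 2 * j + of_bool t) * v $ j)" for t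
 unfolding Vs reprD(2)[OF assms V] by simp
have "app (ptr 0 X) (%s. v $ num 1 N s) s = (\<Uplus>t. \<Sum>j<2 ^ N. B $$ (2 * i + of_bool t, 2 * j + of_bool t) * v $ j)"
 unfolding t[symmetric] by (rule app_ptr) (simp only: s1)
also have "... = (\<Sum>j<2 ^ N. (\<Sum>s<2. B $$ (2 * i + s, 2 * j + s)) * v $ j)"
proof (subst sum.swap, rule sum.cong[OF refl])
 fix j
 have two: "(\<Sum>s<2. g s) = g 0 + g 1" for g :: "nat => complex" by (simp add: numeral_2_eq_2)
 show "(\<Uplus>t. B $$ (2 * i + of_bool t, 2 * j + of_bool t) * v $ j) = (\<Sum>s<2. B $$ (2 * i + s, 2 * j + s)) * v $ j"
  unfolding UNIV_bool two by (simp add: distrib_right)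
qed
also have "... = (tr_aux N B *\<^sub>v v) $ i"
 using i v unfolding tr_aux_def by (simp add: scalar_prod_def atLeast0LessThan)
finally show "app (ptr 0 X) (%s. v $ num 1 N s) s = (tr_aux N B *\<^sub>v v) $ num 1 N s" unfolding i_def .
qed

section \<open>The transfer matrix of the chain as an operator\<close>

text \<open>The coefficients of the boundary matrix with parameters \<open>\<alpha>\<close>, and the sites of a chain.\<close>

definition cbd :: "(nat => complex) => idx => complex" where
 "cbd \<alpha> g = (\<Prod>l\<in>{1..3}. tg g (\<alpha> l) / th1 (\<alpha> l))"

definition sites :: "xyz_chain => (nat \<times> complex) list" where
 "sites X = map (%n. (n, inh X n)) [1..<Suc (len X)]"

lemma Uop_prod_list:
 assumes "distinct (map fst L)" "a \<notin> fst ` set L"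
 shows "Uop h c L a z = prod_list (map (%(n, xi). Rop h a n (z - xi - h)) L) * Kop c a (z - h)
  * prod_list (map (%(n, xi). Rop h a n (z + xi - h)) (rev L))"
 using assms
proof (induction L)
case (Cons p L)
obtain n xi where p: "p = (n, xi)" by fastforce
have n: "a ~= n" "a \<notin> fst ` set L" "n \<notin> fst ` set L" "distinct (map fst L)" using Cons.prems p by auto
show ?case unfolding p Uop_Cons[OF n(1-3)] Cons.IH[OF n(4,2)] by (simp add: mult.assoc)
qed (simp add: Uop_Nil)

lemma R_entries:
 fixes h z :: complex
 defines "w \<equiv> %g. wR h g z" and "D \<equiv> th2 0 * d4 0" and "v1 \<equiv> d1" and "v4 \<equiv> d4"
 shows "w gI + w gZ = 2 * v4 (2 * h) * v1 (z + 2 * h) * v4 z / D"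
  "w gI - w gZ = 2 * v4 (2 * h) * v1 z * v4 (z + 2 * h) / D"
  "w gX + w gY = 2 * v1 (2 * h) * v4 z * v4 (z + 2 * h) / D"
  "w gX - w gY = 2 * v1 (2 * h) * v1 (z + 2 * h) * v1 z / D"
proof -
have m: "v1 (- x) = - v1 x" "v4 (- x) = v4 x" for x unfolding v1_def v4_def by (simp_all add: theta1_minus[OF im2])
have v10: "v1 0 = 0" using m(1)[of 0] by simp
have e: "z + h + h = z + 2 * h" "z + h - h = z" "h + (z + h) = z + 2 * h" "h - (z + h) = - z" "h + h = 2 * h" "h - h = 0" by simp_all
note A = theta1_theta2_prod[folded v1_def v4_def] and B = theta3_theta4[folded v1_def v4_def]
have h12: "th1 h * th2 h = v1 (2 * h) * v4 0" using A[of h h] unfolding e v10 by simp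
have h34: "th3 h * th4 h = v4 (2 * h) * v4 0" using B[of h h] unfolding e v10 by simp
have c: "cst * v4 0 = 1 / D" unfolding cst_def D_def v4_def using theta4_double_nz by (simp add: power2_eq_square)
have s: "th1 (z + h) * th2 h = v1 (z + 2 * h) * v4 z + v4 (z + 2 * h) * v1 z"
 "th1 h * th2 (z + h) = v1 (z + 2 * h) * v4 z - v4 (z + 2 * h) * v1 z"
 "th3 h * th4 (z + h) = v4 (z + 2 * h) * v4 z + v1 (z + 2 * h) * v1 z"
 "th3 (z + h) * th4 h = v4 (z + 2 * h) * v4 z - v1 (z + 2 * h) * v1 z"
 using A[of "z + h" h] A[of h "z + h"] B[of h "z + h"] B[of "z + h" h] unfolding e m by simp_all
have w: "w gI = cst * (th3 h * th4 h) * (th1 (z + h) * th2 h)"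
 "w gZ = cst * (th3 h * th4 h) * (th1 h * th2 (z + h))"
 "w gX = cst * (th1 h * th2 h) * (th3 h * th4 (z + h))"
 "w gY = cst * (th1 h * th2 h) * (th3 (z + h) * th4 h)"
 unfolding w_def wR_def by simp_all
have f: "cst * (x * v4 0) * y = x * y / D" for x y using c
proof -
 have "cst * (x * v4 0) * y = (cst * v4 0) * (x * y)" by (simp only: mult_ac)
 thus ?thesis unfolding c by simp
qed
show "w gI + w gZ = 2 * v4 (2 * h) * v1 (z + 2 * h) * v4 z / D"
 "w gI - w gZ = 2 * v4 (2 * h) * v1 z * v4 (z + 2 * h) / D"
 "w gX + w gY = 2 * v1 (2 * h) * v4 z * v4 (z + 2 * h) / D"
 "w gX - w gY = 2 * v1 (2 * h) * v1 (z + 2 * h) * v1 z / D"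
 unfolding w h12 h34 s f by (simp_all add: alg add_divide_distrib[symmetric] diff_divide_distrib[symmetric])
qed

lemma app_Rop:
 assumes "n ~= 0"
 shows "app (Rop h 0 n z) \<psi> s = (wR h gI z + (if s 0 = s n then 1 else -1) * wR h gZ z) * \<psi> s
  + (wR h gX z - (if s 0 = s n then 1 else -1) * wR h gY z) * \<psi> (s(0 := \<not> s 0, n := \<not> s n))"
proof -
have "app (Rop h 0 n z) \<psi> s = (\<Uplus>g. ph g g * wR h g z * ((if snd g \<and> s 0 ~= fst g then -1 else 1)
  * ((if snd g \<and> (s(0 := (s 0 ~= fst g))) n ~= fst g then -1 else 1) * \<psi> (s(0 := (s 0 ~= fst g), n := ((s(0 := (s 0 ~= fst g))) n ~= fst g))))))"
 unfolding Rop_def app_sum app_mult app_sc app_Dop ..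
moreover have "s(0 := s 0, n := s n) = s" by auto
ultimately show ?thesis unfolding sum_idx using assms
 by (cases "s 0"; cases "s n") (simp_all add: alg)
qed

lemma repr_R:
 assumes "omega X = \<tau>" "n \<in> {1..N}"
 shows "repr 0 N (on_aux_site N n (R_mat X z)) (Rop (eta X / 2) 0 n z)"
proof (rule repr_on_aux_site[OF assms(2)])
fix \<psi> :: state and s :: "nat => bool"
have n: "n ~= 0" using assms by auto
define w where "w g = wR (eta X / 2) g z" for g
have e: "R_mat X z = mat_of_rows_list 4 [[w gI + w gZ, 0, 0, w gX - w gY],
  [0, w gI - w gZ, w gX + w gY, 0],
  [0, w gX + w gY, w gI - w gZ, 0],
  [w gX - w gY, 0, 0, w gI + w gZ]]"
 unfolding R_mat_def Let_def w_def R_entries assms(1) by simp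
have s0: "s(0 := s 0, n := s n) = s" by auto
show "app (Rop (eta X / 2) 0 n z) \<psi> s = (\<Uplus>a b. R_mat X z $$ (2 * of_bool (s 0) + of_bool (s n), 2 * of_bool a + of_bool b) * \<psi> (s(0 := a, n := b)))"
 unfolding e app_Rop[OF n] w_def[symmetric] UNIV_bool
 using s0 by (cases "s 0"; cases "s n") (simp_all add: mat_of_rows_list_def)
qed

text \<open>The boundary matrix in a form without denominators.\<close>

definition KM :: "(idx => complex) => complex => complex mat" where
 "KM c z = (let k = (%g. c g * kK g z) in
   mat_of_rows_list 2 [[k gI + k gZ, k gX - k gY],
    [k gX + k gY, k gI - k gZ]])"

lemma repr_K: "repr 0 N (on_aux N (KM c z)) (Kop c 0 z)"
proof (rule repr_on_aux)
fix \<psi> :: state and s :: "nat => bool"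
have s0: "s(0 := s 0) = s" by auto
show "app (Kop c 0 z) \<psi> s = (\<Uplus>a. KM c z $$ (of_bool (s 0), of_bool a) * \<psi> (s(0 := a)))"
 unfolding Kop_def app_sum app_mult app_sc app_Dop unfolding sum_idx UNIV_bool KM_def Let_def mat_of_rows_list_def
 using s0 by (cases "s 0") (simp_all add: alg)
qed

lemma K_mat_eq_KM:
 assumes a: "!!l. l \<in> {1..3} ==> th1 (\<alpha> l) ~= 0" and z: "th1 (2 * z) ~= 0"
 shows "K_mat \<tau> \<alpha> z = KM (cbd \<alpha>) z"
proof -
have nz: "th1 z ~= 0" "th2 z ~= 0" "th3 z ~= 0" "th4 z ~= 0"
 using z unfolding theta1_double tP_def by auto
define k where "k g = cbd \<alpha> g" for g
have c0: "k gI = 1" unfolding cbd_def k_def using a by simp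
have c: "(\<Prod>l\<in>{1..3}. th4 (\<alpha> l) / th1 (\<alpha> l)) = k gX"
 "(\<Prod>l\<in>{1..3}. th3 (\<alpha> l) / th1 (\<alpha> l)) = k gY"
 "(\<Prod>l\<in>{1..3}. th2 (\<alpha> l) / th1 (\<alpha> l)) = k gZ"
 unfolding cbd_def k_def by simp_all
have d: "th1 (2 * z) / (2 * th1 z) = cst * (th2 z * th3 z * th4 z)"
 unfolding theta1_double tP_def using nz by (simp add: field_simps)
show ?thesis
 unfolding K_mat_def KM_def Let_def d c k_def[symmetric]
 by (rule eq_matI)
   (use nz in \<open>auto simp: sigma_x_def sigma_y_def sigma_z_def mat_of_rows_list_def less_Suc_eq numeral_2_eq_2 c0 kK_def field_simps\<close>)
qed

text \<open>The transfer matrix, with the removable singularities of the boundary matrices removed.\<close>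

definition TM :: "xyz_chain => complex => complex mat" where
 "TM X z = tr_aux (len X) (on_aux (len X) (KM (cbd (bdry X True)) (z + eta X / 2)) * mono_T X z
   * on_aux (len X) (KM (cbd (bdry X False)) (z - eta X / 2)) * mono_T_hat X z)"

definition TO :: "xyz_chain => complex => lin" where
 "TO X z = Top (eta X / 2) (cbd (bdry X True)) (cbd (bdry X False)) (sites X) z"

lemma transfer_eq_TM:
 assumes "omega X = \<tau>" "!!\<sigma> i. i \<in> {1..3} ==> theta X (bdry X \<sigma> i) ~= 0"
  and "theta X (2 * z - eta X) ~= 0" "theta X (2 * z + eta X) ~= 0"
 shows "transfer X z = TM X z"
proof -
have e: "2 * (z + eta X / 2) = 2 * z + eta X" "2 * (z - eta X / 2) = 2 * z - eta X" by simp_all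
have t: "theta X = th1" unfolding theta_def assms(1) ..
have "K_plus X z = KM (cbd (bdry X True)) (z + eta X / 2)"
 unfolding K_plus_def assms(1) using assms unfolding t by (intro K_mat_eq_KM) (simp_all add: e)
moreover have "K_minus X z = KM (cbd (bdry X False)) (z - eta X / 2)"
 unfolding K_minus_def assms(1) using assms unfolding t by (intro K_mat_eq_KM) (simp_all add: e)
ultimately show ?thesis unfolding transfer_def TM_def by simp
qed

theorem repr_TM:
 assumes "omega X = \<tau>"
 shows "repr 1 (len X) (TM X z) (TO X z)"
proof -
let ?h = "eta X / 2" and ?N = "len X"
have fs: "fst ` set (sites X) = {1..?N}" "map fst (sites X) = [1..<Suc ?N]"
 unfolding sites_def by (auto simp: image_image comp_def simp del: upt_Suc)
have d: "distinct (map fst (sites X))" "0 \<notin> fst ` set (sites X)" unfolding fs by auto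
have T: "repr 0 ?N (mono_T X z) (prod_list (map (%(n, xi). Rop ?h 0 n (z - xi - ?h)) (sites X)))"
proof -
 have "list_all2 (repr 0 ?N) (map (%n. on_aux_site ?N n (R_mat X (z - inh X n - ?h))) [1..<Suc ?N])
   (map (%(n, xi). Rop ?h 0 n (z - xi - ?h)) (sites X))"
  unfolding sites_def list.map_comp comp_def list_all2_map1 list_all2_map2 split list_all2_same
  by (auto intro!: repr_R assms simp del: upt_Suc)
 from repr_prod_list[OF this] show ?thesis unfolding mono_T_def by simp
qed
have T': "repr 0 ?N (mono_T_hat X z) (prod_list (map (%(n, xi). Rop ?h 0 n (z + xi - ?h)) (rev (sites X))))"
proof -
 have "list_all2 (repr 0 ?N) (map (%n. on_aux_site ?N n (R_mat X (z + inh X n - ?h))) (rev [1..<Suc ?N]))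
   (map (%(n, xi). Rop ?h 0 n (z + xi - ?h)) (rev (sites X)))"
  unfolding sites_def rev_map list.map_comp comp_def list_all2_map1 list_all2_map2 split list_all2_same
  by (auto intro!: repr_R assms simp del: upt_Suc)
 from repr_prod_list[OF this] show ?thesis unfolding mono_T_hat_def by simp
qed
have "TO X z = ptr 0 (Kop (cbd (bdry X True)) 0 (z + ?h)
  * prod_list (map (%(n, xi). Rop ?h 0 n (z - xi - ?h)) (sites X)) * Kop (cbd (bdry X False)) 0 (z - ?h)
  * prod_list (map (%(n, xi). Rop ?h 0 n (z + xi - ?h)) (rev (sites X))))"
 unfolding TO_def Top_ptr[OF d(2)] Uop_prod_list[OF d] by (simp only: mult.assoc)
thus ?thesis unfolding TM_def
 by (simp only:) (intro repr_tr_aux repr_mult repr_K T T')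
qed

section \<open>Half periods\<close>

text \<open>The half periods, in the order of the special points, and their effect on the theta functions:
 the shift by \<open>hp r\<close> translates the index by \<open>bet r\<close>, with a root of unity \<open>sgk r\<close> and a
 factor \<open>qh r\<close>.\<close>

definition hp :: "nat => complex" where
 "hp r = [0, \<pi> / 2, \<pi> * \<tau> / 2, (\<pi> + pt) / 2] ! r"

definition bet :: "nat => idx" where
 "bet r = [gI, gZ, gX, gY] ! r"

definition sgk :: "nat => idx => complex" where
 "sgk r k = [1, if k = gZ then -1 else 1, if snd k then 1 else \<i>,
   if k = gZ then - \<i> else if k = gY then \<i> else 1] ! r"

definition qh :: "nat => complex => complex" where
 "qh r z = (if r \<ge> 2 then qhalf \<tau> z else 1)"

lemma qh_nz [simp]: "qh r z ~= 0" unfolding qh_def by simp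

lemma qh_add: "qh r (z + w) = qh r z * (if r \<ge> 2 then exp (- \<i> * w) else 1)"
 unfolding qh_def qhalf_def by (simp add: exp_add[symmetric] alg)

lemma r_cases [consumes 1, case_names 0 1 2 3]:
 "r < 4 ==> (r = 0 ==> P) ==> (r = 1 ==> P) ==> (r = 2 ==> P) ==> (r = 3 ==> P) ==> P" for r :: nat
 by linarith

lemma tg_plus_half_period:
 assumes "r < 4"
 shows "tg k (z + hp r) = sgk r k * qh r z * tg (k[+]bet r) z"
 using assms
proof (cases r rule: r_cases)
case 0
thus ?thesis by (simp add: hp_def sgk_def qh_def bet_def)
next
case 1
thus ?thesis using theta1_plus_half[OF im] theta2_plus_half[OF im] theta3_plus_half[OF im] theta4_plus_half[OF im]
 by (cases k rule: idx_cases) (simp_all add: hp_def sgk_def qh_def bet_def)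
next
case 2
thus ?thesis using theta1_plus_tau_half[OF im] theta2_plus_tau_half[OF im] theta3_plus_tau_half[OF im] theta4_plus_tau_half[OF im]
 by (cases k rule: idx_cases) (simp_all add: hp_def sgk_def qh_def bet_def)
next
case 3
have e: "z + (\<pi> + pt) / 2 = (z + pt / 2) + \<pi> / 2" by (simp add: field_simps)
show ?thesis unfolding 3 using theta1_plus_tau_half[OF im] theta2_plus_tau_half[OF im] theta3_plus_tau_half[OF im] theta4_plus_tau_half[OF im]
 theta1_plus_half[OF im] theta2_plus_half[OF im] theta3_plus_half[OF im] theta4_plus_half[OF im]
 by (cases k rule: idx_cases) (simp_all add: hp_def sgk_def qh_def bet_def e)
qed

lemma tg_bet_zero: "r < 4 ==> tg (bet r) (hp r) = 0"
 using tg_plus_half_period[of r "bet r" 0] tg0_0 by simp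

lemma tg_plus_period:
 assumes "r < 4"
 shows "tg k (z + 2 * hp r) = cc k (bet r) * (sgk r gI * sgk r (bet r) * qh r (z + hp r) * qh r z) * tg k z"
proof -
have "tg k (z + 2 * hp r) = tg k (z + hp r + hp r)" by (simp add: alg)
also have "... = (sgk r k * sgk r (k[+]bet r)) * (qh r (z + hp r) * qh r z) * tg k z"
 unfolding tg_plus_half_period[OF assms] by simp
also have "sgk r k * sgk r (k[+]bet r) = cc k (bet r) * (sgk r gI * sgk r (bet r))"
 using assms by (cases r rule: r_cases; cases k rule: idx_cases) (simp_all add: sgk_def bet_def)
finally show ?thesis by (simp only: mult_ac)
qed

lemma two_hp_lat: "r < 4 ==> 2 * hp r \<in> lat"
proof -
have "of_int a * \<pi> + of_int b * pt \<in> lat" for a b unfolding lat_def by blast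
note l = this[of 0 0] this[of 1 0] this[of 0 1] this[of 1 1]
assume "r < 4"
thus ?thesis using l by (cases r rule: r_cases) (auto simp: hp_def add_divide_distrib)
qed

lemma even_theta_special:
 assumes Q: "even_theta M Q" and r: "r < 4"
 shows "Q (hp r - h) = (if r \<ge> 2 then exp (4 * \<i> * h * of_nat M) else 1) * Q (hp r + h)"
 using r
proof (cases r rule: r_cases)
case 0
thus ?thesis using even_thetaD(2)[OF Q, of h] by (simp add: hp_def)
next
case 1
have "Q (- (\<pi> / 2 + h) + \<pi>) = Q (\<pi> / 2 + h)"
 unfolding even_thetaD(3)[OF Q] by (rule even_thetaD(2)[OF Q])
thus ?thesis using 1 by (simp add: hp_def)
next
case 2
have "Q (- (pt / 2 + h) + pt) = qper (- (pt / 2 + h)) ^ (2 * M) * Q (pt / 2 + h)"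
 unfolding even_thetaD(4)[OF Q] even_thetaD(2)[OF Q] ..
also have "qper (- (pt / 2 + h)) ^ (2 * M) = exp (4 * \<i> * h * of_nat M)"
 unfolding qper_def exp_of_nat_mult[symmetric] by (rule exp_cong) (simp add: alg)
finally show ?thesis using 2 by (simp add: hp_def mult.commute)
next
case 3
let ?s = "(\<pi> + pt) / 2"
have "Q (- (?s + h) + \<pi> + pt) = qper (- (?s + h) + \<pi>) ^ (2 * M) * Q (?s + h)"
 unfolding even_thetaD(4)[OF Q] even_thetaD(3)[OF Q] even_thetaD(2)[OF Q] ..
also have "- (?s + h) + \<pi> + pt = ?s - h" by (simp add: field_simps)
also have "qper (- (?s + h) + \<pi>) ^ (2 * M) = exp (4 * \<i> * h * of_nat M)"
proof -
 have "qper (- (?s + h) + \<pi>) = exp (2 * \<i> * h + - (\<i> * \<pi>))"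
  unfolding qper_def by (rule exp_cong) (simp add: field_simps)
 also have "... = - exp (2 * \<i> * h)" unfolding exp_add exp_minus by simp
 finally have q: "qper (- (?s + h) + \<pi>) = - exp (2 * \<i> * h)" .
 have "(- exp (2 * \<i> * h)) ^ (2 * M) = exp (2 * \<i> * h) ^ (2 * M)" by (simp add: power_mult)
 also have "... = exp (4 * \<i> * h * of_nat M)"
  unfolding exp_of_nat_mult[symmetric] by (rule exp_cong) simp
 finally show ?thesis unfolding q .
qed
finally show ?thesis using 3 by (simp add: hp_def)
qed

lemma theta1_double_zero:
 assumes "th1 (2 * w) = 0"
 obtains r where "r < 4" "th1 (w + hp r) = 0"
proof -
have "\<exists>k. tg k w = 0" using assms unfolding theta1_double tP_def
 by auto (metis tg_simps)+
then obtain k where k: "tg k w = 0" by blast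
have "\<exists>r<4. k = bet r"
 by (cases k rule: idx_cases) (auto simp: bet_def intro: exI[of _ 0] exI[of _ 1] exI[of _ 2] exI[of _ 3])
then obtain r where r: "r < 4" "k = bet r" by blast
have "th1 (w + hp r) = sgk r gI * qh r w * tg (bet r) w"
 using tg_plus_half_period[OF r(1), of "gI" w] by simp
thus ?thesis using that[OF r(1)] k r(2) by simp
qed

end

section \<open>The setting of the theorem\<close>

text \<open>A chain whose parameters satisfy the genericity assumptions and the boundary constraint. Below,
 \<open>h\<close> is \<open>\<eta>/2\<close>, and \<open>xs n j\<close> is \<open>\<xi>\<^sub>n + \<eta>/2 - j\<eta>\<close>.\<close>

locale xyz =
 fixes X :: xyz_chain and \<epsilon> :: signs and M :: nat
 assumes im0: "Im (omega X) > 0"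
  and eta_generic: "!!n :: int. n ~= 0 ==> of_int n * eta X \<notin> period_lattice X"
  and points: "points_distinct X"
  and bdry_nz: "!!\<sigma> i. i \<in> {1..3} ==> theta X (bdry X \<sigma> i) ~= 0"
  and A_nz: "!!n. n \<in> {1..len X} ==> A_coef X \<epsilon> (eta X / 2 - inh X n) ~= 0"
  and signs: "!!\<sigma> i. i \<in> {1..3} ==> \<epsilon> \<sigma> i \<in> {1, -1}"
  and sign_prod: "bp \<epsilon> = 1"
  and constraint: "(\<Sum>\<sigma>\<in>UNIV. \<Sum>i\<in>{1..3}. of_int (\<epsilon> \<sigma> i) * bdry X \<sigma> i)
     = of_int (int (len X) - 2 * int M - 1) * eta X"
begin

sublocale theta_nz "omega X"
 by unfold_locales (use im0 bdry_nz[of 1 True] in \<open>auto simp: theta_def\<close>)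

abbreviation h where "h \<equiv> eta X / 2"
abbreviation N where "N \<equiv> len X"
abbreviation \<omega> where "\<omega> \<equiv> omega X"
abbreviation xi where "xi \<equiv> inh X"
abbreviation xs where "xs \<equiv> xi_sh X"
abbreviation bd where "bd \<equiv> a_bdry X \<epsilon>"
abbreviation eb where "eb \<sigma> i \<equiv> of_int (\<epsilon> \<sigma> i) * bdry X \<sigma> i"
abbreviation mb where "mb \<sigma> i \<equiv> - of_int (\<epsilon> \<sigma> i) * bdry X \<sigma> i"
abbreviation \<Lambda> where "\<Lambda> \<equiv> A_coef X \<epsilon>"

lemma th: "theta X = th1" "theta_s X = ts" "period_lattice X = lat"
 unfolding theta_def theta_s_def period_lattice_def lat_def ts_def by (simp_all add: fun_eq_iff theta_def)

lemma eta_nz: "th1 (eta X) ~= 0" "th1 (2 * eta X) ~= 0" "th1 (2 * h) ~= 0" "th1 (4 * h) ~= 0"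
 using eta_generic[of 1] eta_generic[of 2] unfolding th theta1_eq_0_iff by simp_all

text \<open>The points where the transfer matrix is evaluated: two for every site, and the four special
 points.\<close>

definition nd :: "(nat \<times> nat) + nat => complex" where
 "nd k = (case k of Inl (n, j) => xs n j | Inr r => xi_special X r)"

definition NI :: "((nat \<times> nat) + nat) set" where
 "NI = ({1..N} \<times> {0, 1}) <+> {0..3}"

lemma xi_special_hp: "xi_special X r = h + hp r"
 unfolding xi_special_def hp_def ..

lemma xi_sh_01: "xs n 0 = xi n + h" "xs n (Suc 0) = xi n - h"
 unfolding xi_sh_def by (simp_all add: field_simps)

lemma nodes_distinct:
 assumes "k \<in> NI"
 shows "th1 (2 * nd k) ~= 0" and "l \<in> NI ==> k ~= l ==> ts (nd k) (nd l) ~= 0"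
proof -
have p: "of_int s * nd k - of_int t * nd l \<notin> lat"
 if "s \<in> {1, -1}" "t \<in> {1, -1}" "l \<in> NI" "(s, k) ~= (t, l)" for s t :: int and l
proof -
 have "(s, k) \<in> {1, - 1} \<times> NI" "(t, l) \<in> {1, - 1} \<times> NI" using assms that by auto
 from points[unfolded points_distinct_def Let_def th, folded NI_def, rule_format, OF this that(4)]
 show ?thesis unfolding nd_def by simp
qed
have "nd k - - nd k \<notin> lat" using p[of 1 "-1" k] assms by simp
thus "th1 (2 * nd k) ~= 0" unfolding theta1_eq_0_iff by simp
assume "l \<in> NI" "k ~= l"
thus "ts (nd k) (nd l) ~= 0" unfolding ts_zero_iff using p[of 1 1 l] p[of 1 "-1" l] by simp
qed

lemma NI_I: "n \<in> {1..N} ==> Inl (n, 0) \<in> NI" "n \<in> {1..N} ==> Inl (n, Suc 0) \<in> NI" "r < 4 ==> Inr r \<in> NI"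
 unfolding NI_def by auto

lemma nd_simps [simp]: "nd (Inl (n, j)) = xs n j" "nd (Inr r) = xi_special X r"
 unfolding nd_def by simp_all

lemma xi_nz:
 assumes n: "n \<in> {1..N}"
 shows "th1 (2 * xi n + 2 * h) ~= 0" "th1 (2 * xi n - 2 * h) ~= 0"
  "th1 (2 * xi n + 4 * h) ~= 0" "th1 (2 * xi n - 4 * h) ~= 0"
proof -
let ?x = "xi n"
have e: "2 * (?x + h) = 2 * ?x + 2 * h" "2 * (?x - h) = 2 * ?x - 2 * h" by (simp_all add: alg)
show "th1 (2 * ?x + 2 * h) ~= 0" "th1 (2 * ?x - 2 * h) ~= 0"
 using nodes_distinct(1)[OF NI_I(1)[OF n]] nodes_distinct(1)[OF NI_I(2)[OF n]] unfolding nd_simps xi_sh_01 e .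
show "th1 (2 * ?x + 4 * h) ~= 0"
proof
 assume "th1 (2 * ?x + 4 * h) = 0"
 moreover have "2 * ?x + 4 * h = 2 * (?x + 2 * h)" by (simp add: alg)
 ultimately obtain r where r: "r < 4" "th1 (?x + 2 * h + hp r) = 0" using theta1_double_zero by metis
 have e: "?x + 2 * h + hp r = (?x + h) + (h + hp r)" by (simp add: alg)
 have "ts (?x + h) (h + hp r) = 0" unfolding ts_def r(2)[unfolded e] by (rule mult_zero_right)
 thus False using nodes_distinct(2)[OF NI_I(1)[OF n] NI_I(3)[OF r(1)]] unfolding nd_simps xi_sh_01 xi_special_hp by blast
qed
show "th1 (2 * ?x - 4 * h) ~= 0"
proof
 assume "th1 (2 * ?x - 4 * h) = 0"
 moreover have "2 * ?x - 4 * h = 2 * (?x - 2 * h)" by (simp add: alg)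
 ultimately obtain r where r: "r < 4" "th1 (?x - 2 * h + hp r) = 0" using theta1_double_zero by metis
 have e: "?x - 2 * h + hp r = (?x - h) - (h + hp r) + 2 * hp r" by (simp add: alg)
 have "th1 ((?x - h) - (h + hp r)) = 0" using r(2)[unfolded e theta1_lat_iff[OF two_hp_lat[OF r(1)]]] .
 hence "ts (?x - h) (h + hp r) = 0" unfolding ts_def by simp
 thus False using nodes_distinct(2)[OF NI_I(2)[OF n] NI_I(3)[OF r(1)]] unfolding nd_simps xi_sh_01 xi_special_hp by blast
qed
qed

lemma xi_pair_nz:
 assumes n: "n \<in> {1..N}" "m \<in> {1..N}" "n ~= m"
 shows "ts (2 * h) (xi n - xi m) ~= 0" "ts (2 * h) (xi n + xi m) ~= 0"
proof -
let ?A = "xi n + xi m"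
have a: "ts (xi n + h) (xi m - h) ~= 0" "ts (xi m + h) (xi n - h) ~= 0"
 "ts (xi n + h) (xi m + h) ~= 0" "ts (xi n - h) (xi m - h) ~= 0"
 using nodes_distinct(2)[OF NI_I(1)[OF n(1)] NI_I(2)[OF n(2)]] nodes_distinct(2)[OF NI_I(1)[OF n(2)] NI_I(2)[OF n(1)]]
  nodes_distinct(2)[OF NI_I(1)[OF n(1)] NI_I(1)[OF n(2)]] nodes_distinct(2)[OF NI_I(2)[OF n(1)] NI_I(2)[OF n(2)]] n
 by (auto simp: xi_sh_01)
have m: "th1 (- x) = - th1 x" for x by (rule theta1_minus[OF im])
have "th1 (2 * h - (xi n - xi m)) ~= 0" using a(2) unfolding ts_def by (simp add: alg)
moreover have "th1 (2 * h + (xi n - xi m)) ~= 0" using a(1) unfolding ts_def by (simp add: alg)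
moreover have "th1 (2 * h + ?A) ~= 0" using a(3) unfolding ts_def by (simp add: alg)
moreover have "th1 (2 * h - ?A) ~= 0" using a(4) m[of "eta X - ?A"] unfolding ts_def by (simp add: alg)
ultimately show "ts (2 * h) (xi n - xi m) ~= 0" "ts (2 * h) ?A ~= 0" unfolding ts_def by auto
qed

end

section \<open>Functional relations for the transfer matrix\<close>

context xyz
begin

abbreviation T where "T \<equiv> TM X"

lemma rT: "repr 1 N (T z) (TO X z)" by (rule repr_TM[OF refl])

lemma T_carrier [simp]: "T z \<in> carrier_mat (2 ^ N) (2 ^ N)"
 using reprD(1)[OF rT] by simp

lemma T_dim [simp]: "dim_row (T z) = 2 ^ N" "dim_col (T z) = 2 ^ N"
 using T_carrier[of z] by (rule carrier_matD)+

lemma T_eqI: "repr 1 N C (TO X z * TO X w) ==> T z * T w = C"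
 by (rule repr_unique[OF repr_mult[OF rT rT]])

lemma T_scI: "TO X z = sc c ==> T z = c \<cdot>\<^sub>m 1\<^sub>m (2 ^ N)"
 using rT[of z] repr_sc[of 1 N c] by (auto intro: repr_unique)

lemma fst_sites: "map fst (sites X) = [1..<Suc N]"
 unfolding sites_def by (simp add: comp_def del: upt_Suc)

lemma set_sites: "set (sites X) = (%n. (n, xi n)) ` {1..N}"
 unfolding sites_def by auto

lemma distinct_sites: "distinct (map fst (sites X))" "distinct (sites X)"
proof -
show d: "distinct (map fst (sites X))" unfolding fst_sites by simp
show "distinct (sites X)" using d by (simp add: distinct_map)
qed

lemma length_sites: "length (sites X) = N"
 unfolding sites_def by simp

lemma T_comm: "T z * T w = T w * T z"
proof (rule T_eqI)
have "TO X z * TO X w = TO X w * TO X z"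
 unfolding TO_def by (rule Top_comm[OF distinct_sites(1) eta_nz(3,4)])
thus "repr 1 N (T w * T z) (TO X z * TO X w)" using repr_mult[OF rT rT] by simp
qed

lemma T_even_theta:
 assumes "i < 2 ^ N" "j < 2 ^ N"
 shows "even_theta (N + 3) (%z. T z $$ (i, j))"
proof -
obtain s where s: "i = num 1 N s" using num_surj[of i N 1] assms(1) by auto
have "T z $$ (i, j) = app (TO X z) (%s. of_bool (num 1 N s = j)) s" for z
 unfolding s by (rule repr_entry[OF rT]) (simp add: assms)
thus ?thesis using Top_even_theta[of "sites X"] unfolding TO_def length_sites by simp
qed

lemma T_minus: "T (- z) = T z"
 by (rule eq_matI) (simp_all add: even_thetaD(2)[OF T_even_theta])

lemma prod_sites: "(\<Prod>(n, \<xi>)\<leftarrow>sites X. f n \<xi>) = (\<Prod>n\<in>{1..N}. f n (xi n))" for f :: "nat => complex => complex"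
proof -
have "(\<Prod>(n, \<xi>)\<leftarrow>sites X. f n \<xi>) = prod_list (map (%n. f n (xi n)) [1..<Suc N])"
 unfolding sites_def by (simp add: comp_def del: upt_Suc)
also have "... = (\<Prod>n\<in>set [1..<Suc N]. f n (xi n))"
 by (rule prod.distinct_set_conv_list[symmetric]) simp
finally show ?thesis by (simp add: atLeastLessThanSuc_atLeastAtMost del: upt_Suc)
qed

lemma prod_sites_remove1:
 fixes f :: "nat => complex => complex"
 assumes "n \<in> {1..N}"
 shows "(\<Prod>(m, \<xi>)\<leftarrow>remove1 (n, xi n) (sites X). f m \<xi>) = (\<Prod>m\<in>{1..N} - {n}. f m (xi m))"
proof -
have "(\<Prod>(m, \<xi>)\<leftarrow>remove1 (n, xi n) (sites X). f m \<xi>) = (\<Prod>p\<in>set (remove1 (n, xi n) (sites X)). case p of (m, \<xi>) => f m \<xi>)"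
 by (rule prod.distinct_set_conv_list[symmetric]) (simp add: distinct_sites)
also have "set (remove1 (n, xi n) (sites X)) = (%n. (n, xi n)) ` ({1..N} - {n})"
 using distinct_sites(2) unfolding set_remove1_eq[OF distinct_sites(2)] set_sites by auto
also have "(\<Prod>p\<in>.... case p of (m, \<xi>) => f m \<xi>) = (\<Prod>m\<in>{1..N} - {n}. f m (xi m))"
 by (subst prod.reindex) (auto simp: inj_on_def)
finally show ?thesis .
qed

lemma rho: "rho h u = ts (2 * h) u" by (rule rho_eq[OF eta_nz(3,4)])

lemma eps_cases: "i \<in> {1..3} ==> of_int (\<epsilon> \<sigma> i) = (1 :: complex) \<or> of_int (\<epsilon> \<sigma> i) = (- 1 :: complex)"
 using signs[of i \<sigma>] by auto

lemma th1_minus: "th1 (- z) = - th1 z" by (rule theta1_minus[OF im])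

lemma bdry_nz': "i \<in> {1..3} ==> th1 (bdry X \<sigma> i) ~= 0"
 using bdry_nz[of i \<sigma>] unfolding th .

lemma prod3: "(\<Prod>l\<in>{1..3::nat}. f l) = f 1 * f 2 * f 3" for f :: "nat => complex"
 by (simp add: numeral_3_eq_3 numeral_2_eq_2 mult_ac)

lemma kap_bdry: "kap (cbd (bdry X \<sigma>)) z = (\<Prod>i\<in>{1..3}. ts (bdry X \<sigma> i) z / (th1 (bdry X \<sigma> i))\<^sup>2)"
 by (rule kap_factor) (simp_all add: bdry_nz' cbd_def)

lemma A_formula:
 "\<Lambda> z = (-1) ^ N * (th1 (2 * z + 2 * h) / th1 (2 * z)) * bp (%\<sigma> i. th1 (z - h - eb \<sigma> i) / th1 (mb \<sigma> i))
   * (\<Prod>n\<in>{1..N}. th1 (z - xi n + h) * th1 (- z - xi n - h))"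
proof -
have e: "- z - eta X - x + eta X / 2 = - z - x - eta X / 2" for x by (simp add: field_simps)
show ?thesis unfolding A_coef_def a_bdry_def a_bulk_def d_bulk_def th prod.distrib
 by (simp add: e mult_ac)
qed

lemma fusion_scalar:
 assumes n: "n \<in> {1..N}"
 shows "\<Lambda> (xi n + h) * \<Lambda> (h - xi n)
  = (th1 (2 * h))\<^sup>2 * ts (4 * h) (2 * xi n) * kap (cbd (bdry X True)) (xi n) * kap (cbd (bdry X False)) (xi n)
   * (\<Prod>m\<in>{1..N} - {n}. rho h (xi n - xi m) * rho h (xi n + xi m))"
proof -
define x where "x = xi n"
let ?b = "%z \<sigma> i. th1 (z - h - eb \<sigma> i) / th1 (mb \<sigma> i)"
let ?c = "%z m. th1 (z - xi m + h) * th1 (- z - xi m - h)"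
have b: "?b (x + h) \<sigma> i * ?b (h - x) \<sigma> i = ts (bdry X \<sigma> i) x / (th1 (bdry X \<sigma> i))\<^sup>2" if i: "i \<in> {1..3}" for \<sigma> i
proof -
 let ?e = "of_int (\<epsilon> \<sigma> i) :: complex" and ?\<alpha> = "bdry X \<sigma> i"
 have 1: "th1 (x + h - h - ?e * ?\<alpha>) * th1 (h - x - h - ?e * ?\<alpha>) = ts ?\<alpha> x"
  using eps_cases[OF i, of \<sigma>]
 proof
  assume e: "?e = 1"
  have a: "x + h - h - ?\<alpha> = - (?\<alpha> - x)" "h - x - h - ?\<alpha> = - (?\<alpha> + x)" by simp_all
  show ?thesis unfolding e mult_1_left a ts_def th1_minus by simp
 next
  assume e: "?e = -1"
  have a: "x + h - h - -1 * ?\<alpha> = ?\<alpha> + x" "h - x - h - -1 * ?\<alpha> = ?\<alpha> - x" by simp_all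
  show ?thesis unfolding e a ts_def by (rule mult.commute)
 qed
 have 2: "th1 (- ?e * ?\<alpha>) * th1 (- ?e * ?\<alpha>) = (th1 ?\<alpha>)\<^sup>2"
  using eps_cases[OF i, of \<sigma>] by (auto simp: th1_minus power2_eq_square)
 show ?thesis unfolding times_divide_times_eq 1 2 ..
qed
have c: "?c (x + h) m * ?c (h - x) m = rho h (x - xi m) * rho h (x + xi m)" for m
proof -
 have a: "x + h - xi m + h = 2 * h + (x - xi m)" "- (x + h) - xi m - h = - (2 * h + (x + xi m))"
  "h - x - xi m + h = 2 * h - (x + xi m)" "- (h - x) - xi m - h = - (2 * h - (x - xi m))" by simp_all
 show ?thesis unfolding a th1_minus rho ts_def by (simp only: mult_minus_left mult_minus_right minus_minus mult_ac)
qed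
have t: "th1 (2 * (x + h) + 2 * h) = th1 (4 * h + 2 * x)" "th1 (2 * (x + h)) = th1 (2 * h + 2 * x)"
 "th1 (2 * (h - x) + 2 * h) = th1 (4 * h - 2 * x)" "th1 (2 * (h - x)) = th1 (2 * h - 2 * x)"
 by (simp_all add: alg)
have nz: "th1 (2 * h + 2 * x) ~= 0" "th1 (2 * h - 2 * x) ~= 0"
 using xi_nz(1,2)[OF n] th1_minus[of "2 * x - 2 * h"] unfolding x_def by (simp_all add: add.commute)
have s: "(-1) ^ N * (-1) ^ N = (1 :: complex)" by (simp flip: power_mult_distrib)
have r0: "rho h (x - xi n) * rho h (x + xi n) = (th1 (2 * h))\<^sup>2 * (th1 (2 * h + 2 * x) * th1 (2 * h - 2 * x))"
 unfolding rho ts_def x_def by (simp add: power2_eq_square mult_ac flip: mult_2)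
have "\<Lambda> (x + h) * \<Lambda> (h - x) = ((-1) ^ N * (-1) ^ N) * (th1 (4 * h + 2 * x) / th1 (2 * h + 2 * x) * (th1 (4 * h - 2 * x) / th1 (2 * h - 2 * x)))
  * (bp (%\<sigma> i. ?b (x + h) \<sigma> i) * bp (%\<sigma> i. ?b (h - x) \<sigma> i))
  * ((\<Prod>m\<in>{1..N}. ?c (x + h) m) * (\<Prod>m\<in>{1..N}. ?c (h - x) m))"
 unfolding A_formula t by (simp only: mult_ac)
also have "bp (%\<sigma> i. ?b (x + h) \<sigma> i) * bp (%\<sigma> i. ?b (h - x) \<sigma> i)
  = (\<Prod>\<sigma>\<in>UNIV. kap (cbd (bdry X \<sigma>)) x)"
 unfolding kap_bdry prod.distrib[symmetric] by (intro prod.cong refl b)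
also have "(\<Prod>m\<in>{1..N}. ?c (x + h) m) * (\<Prod>m\<in>{1..N}. ?c (h - x) m) = (\<Prod>m\<in>{1..N}. rho h (x - xi m) * rho h (x + xi m))"
 unfolding prod.distrib[symmetric] c[symmetric] ..
also have "(\<Prod>m\<in>{1..N}. rho h (x - xi m) * rho h (x + xi m))
  = (th1 (2 * h))\<^sup>2 * (th1 (2 * h + 2 * x) * th1 (2 * h - 2 * x)) * (\<Prod>m\<in>{1..N} - {n}. rho h (x - xi m) * rho h (x + xi m))"
 unfolding r0[symmetric] by (rule prod.remove) (use n in auto)
finally show ?thesis using nz unfolding s x_def[symmetric] UNIV_bool
 by (simp add: ts_def field_simps)
qed

theorem T_fusion:
 assumes n: "n \<in> {1..N}"
 shows "T (xi n + h) * T (xi n - h) = (\<Lambda> (xi n + h) * \<Lambda> (h - xi n)) \<cdot>\<^sub>m 1\<^sub>m (2 ^ N)"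
proof -
have "TO X (h + xi n) * TO X (h - xi n) = sc (\<Lambda> (xi n + h) * \<Lambda> (h - xi n))"
 unfolding TO_def fusion_scalar[OF n] prod_sites_remove1[OF n, of "%m \<xi>. rho h (xi n - \<xi>) * rho h (xi n + \<xi>)", symmetric]
proof (rule fusion[OF distinct_sites(1)])
 show "(n, xi n) \<in> set (sites X)" using n unfolding set_sites by blast
 show "\<forall>p\<in>set (sites X). fst p ~= n \<longrightarrow> rho h (snd p - xi n) ~= 0"
  unfolding set_sites rho using xi_pair_nz(1)[of _ n] n by auto
qed
hence "T (h + xi n) * T (h - xi n) = (\<Lambda> (xi n + h) * \<Lambda> (h - xi n)) \<cdot>\<^sub>m 1\<^sub>m (2 ^ N)"
 using repr_sc[of 1 N] by (intro T_eqI) simp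
moreover have "T (xi n - h) = T (h - xi n)" using T_minus[of "h - xi n"] by simp
ultimately show ?thesis by (simp add: add.commute)
qed

text \<open>At the four special points the transfer matrix is scalar; its value is forced by the boundary
 constraint to be the one that the \<open>TQ\<close>-equation gives.\<close>

lemma wdress_half_period:
 assumes r: "r < 4"
 shows "wdress h \<xi> (bet r) (bet r) (h + hp r)
  = (if r \<ge> 2 then exp (2 * \<i> * h) else 1) * (th1 (2 * h + hp r - \<xi>) * th1 (2 * h + hp r + \<xi>))"
proof -
let ?A = "2 * h + \<xi> - hp r"
define \<phi> where "\<phi> z = sgk r gI * sgk r (bet r) * qh r (z + hp r) * qh r z" for z
have p: "tg k (z + 2 * hp r) = cc k (bet r) * \<phi> z * tg k z" for k z
 unfolding \<phi>_def by (rule tg_plus_period[OF r])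
have f: "\<phi> (z - h) = (if r \<ge> 2 then exp (2 * \<i> * h) else 1) * \<phi> z" for z
proof -
 have "z - h + hp r = z + hp r + - h" "z - h = z + - h" by simp_all
 hence "\<phi> (z - h) = \<phi> z * ((if r \<ge> 2 then exp (- \<i> * - h) else 1) * (if r \<ge> 2 then exp (- \<i> * - h) else 1))"
  unfolding \<phi>_def by (simp only: qh_add[of r _ "- h"] mult_ac)
 thus ?thesis by (simp add: exp_add[symmetric] mult_ac)
qed
have "wdress h \<xi> (bet r) (bet r) (h + hp r) = \<phi> (2 * h + \<xi> - hp r - h) * rho h (\<xi> - hp r)"
 unfolding wdress_special[OF p] by (simp add: alg)
also have "... = (if r \<ge> 2 then exp (2 * \<i> * h) else 1) * (th1 (2 * h + hp r - \<xi>) * (\<phi> ?A * th1 ?A))"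
 unfolding f rho ts_def by (simp add: alg)
also have "\<phi> ?A * th1 ?A = th1 (2 * h + hp r + \<xi>)"
 using p[of "gI" "2 * h + \<xi> - hp r"] by (simp add: cc_def alg)
finally show ?thesis .
qed

lemma qh_prod:
 assumes "r \<ge> 2"
 shows "bp (%\<sigma> i. qh r (mb \<sigma> i))
  = qpow \<omega> (-1/4) ^ 6 * exp (\<i> * (of_int (int N - 2 * int M - 1) * (2 * h)))"
proof -
have "qh r (mb \<sigma> i) = qpow \<omega> (-1/4) * exp (\<i> * (eb \<sigma> i))" for \<sigma> i
 unfolding qh_def qhalf_def using assms by simp
hence "bp (%\<sigma> i. qh r (mb \<sigma> i))
  = qpow \<omega> (-1/4) ^ 6 * bp (%\<sigma> i. exp (\<i> * (eb \<sigma> i)))"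
 by (simp add: prod.distrib prod_constant power_mult[symmetric] card_UNIV_bool)
also have "bp (%\<sigma> i. exp (\<i> * (eb \<sigma> i)))
  = exp (\<i> * (\<Sum>\<sigma>\<in>UNIV. \<Sum>i\<in>{1..3}. eb \<sigma> i))"
 unfolding sum_distrib_left by (simp add: exp_sum)
finally show ?thesis unfolding constraint by simp
qed

lemma kK_special: "r < 4 ==> kK (bet r) (hp r) = ([1, 1, \<i>, - \<i>] ! r) * qh r 0 ^ 3"
proof -
assume r: "r < 4"
have t: "tg k (hp r) = sgk r k * qh r 0 * tg (k[+]bet r) 0" for k
 using tg_plus_half_period[OF r, of k 0] by simp
note t4 = t[of "gI"] t[of "gZ"] t[of "gX"] t[of "gY"]
have c: "cst * (x * th2 0 * (y * th3 0) * (w * th4 0)) = x * y * w" for x y w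
proof -
 have "cst * (x * th2 0 * (y * th3 0) * (w * th4 0)) = (cst * (th2 0 * th3 0 * th4 0)) * (x * y * w)"
  by (simp only: mult_ac)
 thus ?thesis unfolding cst_tc0 by simp
qed
show ?thesis using r
proof (cases r rule: r_cases)
 case 0
 thus ?thesis using t4 cst_tc0 by (simp add: kK_def bet_def sgk_def power3_eq_cube qh_def hp_def mult.assoc)
next
 case 1
 thus ?thesis using t4 c[of "qh r 0" "qh r 0" "qh r 0"] by (simp add: kK_def bet_def sgk_def power3_eq_cube mult_ac)
next
 case 2
 thus ?thesis using t4 c[of "qh r 0" "qh r 0" "\<i> * qh r 0"] by (simp add: kK_def bet_def sgk_def power3_eq_cube mult_ac)
next
 case 3
 thus ?thesis using t4 c[of "qh r 0" "qh r 0" "- \<i> * qh r 0"] by (simp add: kK_def bet_def sgk_def power3_eq_cube mult_ac)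
qed
qed

theorem T_special:
 assumes r: "r < 4"
 shows "T (h + hp r) = (\<Lambda> (h + hp r) * (if r \<ge> 2 then exp (4 * \<i> * h * of_nat M) else 1)) \<cdot>\<^sub>m 1\<^sub>m (2 ^ N)"
proof (rule T_scI)
let ?A = "\<Prod>\<sigma>\<in>UNIV. \<Prod>i\<in>{1..3}. qh r (mb \<sigma> i)"
let ?B = "if r \<ge> 2 then exp (4 * \<i> * h * of_nat M) else 1"
let ?C = "%u. - \<i> * u * (\<pi> / 2)"
define s \<beta> where "s = hp r" and "\<beta> = bet r"
define \<kappa> where "\<kappa> = sgk r gI"
define \<rho> where "\<rho> = th1 (4 * h + 2 * s) / th1 (2 * h + 2 * s)"
define c where "c \<sigma> = cbd (bdry X \<sigma>) \<beta>" for \<sigma>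
define P where "P = (\<Prod>n\<in>{1..N}. th1 (2 * h + s - xi n) * th1 (2 * h + s + xi n))"
define e2 where "e2 x = (if r \<ge> 2 then exp (2 * \<i> * h * x) else 1)" for x
have shift: "th1 (z + s) = \<kappa> * qh r z * tg \<beta> z" for z
 using tg_plus_half_period[OF r, of "gI" z] unfolding s_def \<beta>_def \<kappa>_def by simp
have nz: "th1 (2 * h + 2 * s) ~= 0" unfolding s_def theta1_lat_iff[OF two_hp_lat[OF r]] by (rule eta_nz(3))
have k1: "kK \<beta> (h + s + h) = \<rho> * \<kappa> * qh r (2 * h + s) / 2"
proof -
 have a: "th1 (2 * h + 2 * s) = \<kappa> * qh r (2 * h + s) * tg \<beta> (2 * h + s)"
  using shift[of "2 * h + s"] by (simp add: alg)
 have "th1 (2 * (2 * h + s)) = 2 * (tg \<beta> (2 * h + s) * kK \<beta> (2 * h + s))"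
  unfolding theta1_double kK_def tc_tg[of \<beta>, symmetric] by (simp add: mult_ac)
 moreover have "2 * (2 * h + s) = 4 * h + 2 * s" "h + s + h = 2 * h + s" by simp_all
 ultimately have b: "th1 (4 * h + 2 * s) = 2 * (tg \<beta> (2 * h + s) * kK \<beta> (h + s + h))" by simp
 show ?thesis unfolding \<rho>_def b using nz unfolding a by (simp add: field_simps)
qed
have wd: "(\<Prod>(n, \<xi>)\<leftarrow>sites X. wdress h \<xi> \<beta> \<beta> (h + s)) = e2 (of_nat N) * P"
proof -
 have "(\<Prod>(n, \<xi>)\<leftarrow>sites X. wdress h \<xi> \<beta> \<beta> (h + s)) = (\<Prod>n\<in>{1..N}. wdress h (xi n) \<beta> \<beta> (h + s))"
  by (rule prod_sites)
 also have "... = e2 1 ^ N * P"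
  unfolding \<beta>_def s_def wdress_half_period[OF r] P_def e2_def by (simp add: prod.distrib)
 also have "e2 1 ^ N = e2 (of_nat N)"
  unfolding e2_def exp_of_nat_mult[symmetric] by (simp add: exp_of_nat_mult[symmetric] mult_ac)
 finally show ?thesis .
qed
have A: "\<Lambda> (h + s) = \<rho> * (\<kappa> ^ 6 * ?A * (c True * c False)) * P"
proof -
 define e where "e \<sigma> i = (if r = 0 then 1 else - of_int (\<epsilon> \<sigma> i) :: complex)" for \<sigma> i
 have b: "th1 (h + s - h - eb \<sigma> i) / th1 (mb \<sigma> i)
   = \<kappa> * qh r (mb \<sigma> i) * e \<sigma> i * (tg \<beta> (bdry X \<sigma> i) / th1 (bdry X \<sigma> i))" if i: "i \<in> {1..3}" for \<sigma> i
 proof -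
  have 1: "h + s - h - x = - x + s" for x by simp
  have b0: "\<beta> = gI \<longleftrightarrow> r = 0" using r unfolding \<beta>_def by (cases r rule: r_cases) (simp_all add: bet_def)
  show ?thesis unfolding 1 minus_mult_left shift e_def
   using eps_cases[OF i, of \<sigma>] bdry_nz'[OF i, of \<sigma>] tg_minus[of \<beta> "bdry X \<sigma> i"] b0
   by (auto simp: th1_minus)
 qed
 have e1: "bp e = 1"
 proof (cases "r = 0")
  case False
  have "bp (%\<sigma> i. of_int (\<epsilon> \<sigma> i) :: complex) = of_int (bp \<epsilon>)" by simp
  hence "bp (%\<sigma> i. of_int (\<epsilon> \<sigma> i) :: complex) = 1" unfolding sign_prod by simp
  thus ?thesis using False unfolding e_def UNIV_bool prod3 by (simp add: mult_ac)
 qed (simp add: e_def)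
 have b': "bp (%\<sigma> i. th1 (h + s - h - eb \<sigma> i) / th1 (mb \<sigma> i))
   = \<kappa> ^ 6 * ?A * (c True * c False)"
 proof -
  have "bp (%\<sigma> i. th1 (h + s - h - eb \<sigma> i) / th1 (mb \<sigma> i))
    = bp (%\<sigma> i. \<kappa> * qh r (mb \<sigma> i) * e \<sigma> i * (tg \<beta> (bdry X \<sigma> i) / th1 (bdry X \<sigma> i)))"
   by (intro prod.cong refl b)
  also have "... = (\<Prod>\<sigma>\<in>(UNIV::bool set). \<Prod>i\<in>{1..3::nat}. \<kappa>) * ?A
    * bp e * (\<Prod>\<sigma>\<in>UNIV. c \<sigma>)"
   unfolding c_def cbd_def prod.distrib ..
  finally show ?thesis unfolding e1 by (simp add: UNIV_bool mult_ac power_mult[symmetric] power_add[symmetric])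
 qed
 have p: "(\<Prod>n\<in>{1..N}. th1 (h + s - xi n + h) * th1 (- (h + s) - xi n - h)) = (-1) ^ N * P"
 proof -
  have "th1 (h + s - x + h) * th1 (- (h + s) - x - h) = -1 * (th1 (2 * h + s - x) * th1 (2 * h + s + x))" for x
  proof -
   have a: "h + s - x + h = 2 * h + s - x" "- (h + s) - x - h = - (2 * h + s + x)" by simp_all
   show ?thesis unfolding a th1_minus by simp
  qed
  thus ?thesis unfolding P_def by (simp only: prod.distrib prod_constant) simp
 qed
 have q: "th1 (2 * (h + s) + 2 * h) / th1 (2 * (h + s)) = \<rho>" unfolding \<rho>_def by (simp add: alg)
 have m: "(-1) ^ N * (-1) ^ N = (1 :: complex)" by (simp flip: power_mult_distrib)
 have "\<Lambda> (h + s) = ((-1) ^ N * (-1) ^ N) * (\<rho> * (\<kappa> ^ 6 * ?A * (c True * c False)) * P)"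
  unfolding A_formula q b' p by (simp only: mult_ac)
 thus ?thesis unfolding m by simp
qed
have k: "ph \<beta> \<beta> * \<kappa> * ([1, 1, \<i>, - \<i>] ! r) * (qh r (2 * h + s) * qh r 0 ^ 3) * e2 (of_nat N)
  = \<kappa> ^ 6 * ?A * ?B"
proof (cases "r \<ge> 2")
 case False
 hence "r = 0 \<or> r = 1" by linarith
 thus ?thesis unfolding \<kappa>_def e2_def \<beta>_def qh_def by (auto simp: sgk_def bet_def)
next
 case True
 define C where "C = qpow \<omega> (-1/4)"
 have C2: "C * C = exp (- \<i> * \<pi> * \<omega> / 2)"
  unfolding C_def qpow_def exp_add[symmetric] by (rule exp_cong) (simp add: field_simps)
 define u where "u = (if r = 2 then 0 else 1 :: complex)"
 have s: "s = pt / 2 + u * (\<pi> / 2)"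
  using r True unfolding s_def u_def by (cases r rule: r_cases) (simp_all add: hp_def add_divide_distrib)
 have q: "qh r (2 * h + s) * qh r 0 ^ 3 = C ^ 6 * exp (- 2 * \<i> * h) * exp (?C u)"
 proof -
  have "C ^ 6 = C ^ 4 * (C * C)" by (simp add: power_numeral_reduce)
  moreover have "qh r (2 * h + s) * qh r 0 ^ 3 = C ^ 4 * exp (- \<i> * (2 * h + s))"
   unfolding qh_def qhalf_def using True by (simp add: C_def power_numeral_reduce)
  moreover have "exp (- \<i> * (2 * h + s)) = exp (- \<i> * \<pi> * \<omega> / 2) * exp (- 2 * \<i> * h) * exp (?C u)"
   unfolding exp_add[symmetric] s by (rule exp_cong) (simp add: alg)
  ultimately show ?thesis unfolding C2 by (simp add: mult_ac)
 qed
 have c: "ph \<beta> \<beta> * \<kappa> * ([1, 1, \<i>, - \<i>] ! r) * exp (?C u) = \<kappa> ^ 6"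
 proof -
  have "exp (- \<i> * 1 * (\<pi> / 2)) = - \<i>"
   using exp_i_pi_half by (simp add: exp_minus)
  moreover have "r = 2 \<or> r = 3" using r True by linarith
  ultimately show ?thesis unfolding \<kappa>_def \<beta>_def u_def
   by (auto simp: sgk_def bet_def power_numeral_reduce)
 qed
 have e: "exp (- 2 * \<i> * h) * e2 (of_nat N) = exp (\<i> * (of_int (int N - 2 * int M - 1) * (2 * h))) * exp (4 * \<i> * h * of_nat M)"
  unfolding e2_def using True by (simp add: exp_add[symmetric]) (rule exp_cong, simp add: alg)
 have "ph \<beta> \<beta> * \<kappa> * ([1, 1, \<i>, - \<i>] ! r) * (qh r (2 * h + s) * qh r 0 ^ 3) * e2 (of_nat N)
   = (ph \<beta> \<beta> * \<kappa> * ([1, 1, \<i>, - \<i>] ! r) * exp (?C u)) * C ^ 6 * (exp (- 2 * \<i> * h) * e2 (of_nat N))"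
  unfolding q by (simp only: mult_ac)
 thus ?thesis unfolding c e qh_prod[OF True] C_def[symmetric] using True by (simp only: mult_ac if_True)
qed
have "TO X (h + s) = sc (2 * ph \<beta> \<beta> * (c True * kK \<beta> (h + s + h)) * (c False * kK \<beta> s * (e2 (of_nat N) * P)))"
 unfolding TO_def s_def \<beta>_def Top_special[OF tg_bet_zero[OF r]] wd[unfolded s_def \<beta>_def] c_def ..
also have "2 * ph \<beta> \<beta> * (c True * kK \<beta> (h + s + h)) * (c False * kK \<beta> s * (e2 (of_nat N) * P))
  = (ph \<beta> \<beta> * \<kappa> * ([1, 1, \<i>, - \<i>] ! r) * (qh r (2 * h + s) * qh r 0 ^ 3) * e2 (of_nat N)) * (\<rho> * (c True * c False) * P)"
 unfolding k1 kK_special[OF r, folded s_def \<beta>_def] by (simp add: mult_ac)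
also have "... = \<Lambda> (h + s) * ?B"
 unfolding k A by (simp only: mult_ac)
finally show "TO X (h + hp r) = sc (\<Lambda> (h + hp r) * ?B)"
 unfolding s_def .
qed

end

section \<open>Separation of variables\<close>

lemma mat_prod_list_carrier:
 "(!!C. C \<in> set Bs ==> C \<in> carrier_mat d d) ==> mat_prod_list d Bs \<in> carrier_mat d d"
 unfolding mat_prod_list_def by (induction Bs) (auto intro!: mult_carrier_mat[of _ d d])

lemma mat_prod_list_commute:
 assumes "!!C. C \<in> set Bs ==> C \<in> carrier_mat d d \<and> C * F = F * C" and F: "F \<in> carrier_mat d d"
 shows "mat_prod_list d Bs * F = F * mat_prod_list d Bs"
 using assms(1)
proof (induction Bs)
case Nil
thus ?case using F by (simp add: mat_prod_list_def)
next
case (Cons C Bs)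
have C: "C \<in> carrier_mat d d" "C * F = F * C" using Cons.prems by auto
have P: "mat_prod_list d Bs \<in> carrier_mat d d" using Cons.prems by (intro mat_prod_list_carrier) auto
have IH: "mat_prod_list d Bs * F = F * mat_prod_list d Bs" using Cons by auto
have e: "mat_prod_list d (C # Bs) = C * mat_prod_list d Bs" by (simp add: mat_prod_list_def)
show ?case unfolding e assoc_mult_mat[OF C(1) P F] IH
 unfolding assoc_mult_mat[OF C(1) F P, symmetric] C(2) by (rule assoc_mult_mat[OF F C(1) P])
qed

lemma pow_mat_commute:
 fixes C F :: "complex mat"
 assumes C: "C \<in> carrier_mat d d" and F: "F \<in> carrier_mat d d" and c: "C * F = F * C"
 shows "C ^\<^sub>m k * F = F * C ^\<^sub>m k"
proof (induction k)
case (Suc k)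
have P: "C ^\<^sub>m k \<in> carrier_mat d d" using C by simp
show ?case using Suc unfolding pow_mat.simps assoc_mult_mat[OF P C F] c
 by (simp add: assoc_mult_mat[OF P F C, symmetric] assoc_mult_mat[OF F P C])
qed (use C F in simp)

lemma mat_prod_list_power_update:
 fixes F :: "nat => complex mat"
 assumes F: "!!m. F m \<in> carrier_mat d d" and c: "!!m m'. F m * F m' = F m' * F m"
  and L: "distinct L" "n \<in> set L"
 shows "mat_prod_list d (map (%m. F m ^\<^sub>m (k(n := Suc (k n))) m) L) = F n * mat_prod_list d (map (%m. F m ^\<^sub>m k m) L)"
 using L
proof (induction L)
let ?A = "%k. k(n := Suc (k n))"
case (Cons l L)
define P where "P k = mat_prod_list d (map (%m. F m ^\<^sub>m k m) L)" for k
have P: "P k \<in> carrier_mat d d" for k unfolding P_def using F by (intro mat_prod_list_carrier) auto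
have e: "mat_prod_list d (map (%m. F m ^\<^sub>m k m) (l # L)) = F l ^\<^sub>m k l * P k" for k
 unfolding P_def by (simp add: mat_prod_list_def)
have pw: "F l ^\<^sub>m j \<in> carrier_mat d d" for j using F by simp
have cm: "F l ^\<^sub>m j * F n = F n * F l ^\<^sub>m j" for j by (rule pow_mat_commute[OF F F c])
show ?case
proof (cases "l = n")
 case True
 have "P (?A k) = P k" unfolding P_def using Cons.prems True
  by (intro arg_cong[of _ _ "mat_prod_list d"] map_cong refl) auto
 hence "F l ^\<^sub>m (?A k) l * P (?A k) = F n * (F l ^\<^sub>m k l * P k)"
  using True cm[of "k l"] assoc_mult_mat[OF F pw P, of n "k l" k] by simp
 thus ?thesis unfolding e .
next
 case False
 hence "P (?A k) = F n * P k" unfolding P_def using Cons by auto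
 hence "F l ^\<^sub>m (?A k) l * P (?A k) = F n * (F l ^\<^sub>m k l * P k)"
  using False assoc_mult_mat[OF pw F P, of "k l" n k] assoc_mult_mat[OF F pw P, of n "k l" k] cm[of "k l"] by simp
 thus ?thesis unfolding e .
qed
qed simp

lemma scalar_prod_finsum:
 fixes f :: "'i => complex vec"
 assumes "finite I" "!!i. i \<in> I ==> f i \<in> carrier_vec d" "v \<in> carrier_vec d"
 shows "finsum_vec TYPE(complex) d f I \<bullet> v = (\<Sum>i\<in>I. f i \<bullet> v)"
  and "v \<bullet> finsum_vec TYPE(complex) d f I = (\<Sum>i\<in>I. v \<bullet> f i)"
proof -
have f: "f \<in> I \<rightarrow> carrier_vec d" using assms(2) by auto
have i: "finsum_vec TYPE(complex) d f I $ j = (\<Sum>i\<in>I. f i $ j)" if "j < d" for j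
 by (rule index_finsum_vec[OF assms(1) that f])
have c: "finsum_vec TYPE(complex) d f I \<in> carrier_vec d" by (rule finsum_vec_closed[OF f])
have "finsum_vec TYPE(complex) d f I \<bullet> v = (\<Sum>j = 0..<d. (\<Sum>i\<in>I. f i $ j) * v $ j)"
 using assms(3) by (simp add: scalar_prod_def i)
also have "... = (\<Sum>i\<in>I. \<Sum>j = 0..<d. f i $ j * v $ j)"
 unfolding sum_distrib_right by (rule sum.swap)
finally show "finsum_vec TYPE(complex) d f I \<bullet> v = (\<Sum>i\<in>I. f i \<bullet> v)"
 using assms(3) by (simp add: scalar_prod_def)
have "v \<bullet> finsum_vec TYPE(complex) d f I = (\<Sum>j = 0..<d. v $ j * (\<Sum>i\<in>I. f i $ j))"
 using c by (auto simp: scalar_prod_def i)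
also have "... = (\<Sum>i\<in>I. \<Sum>j = 0..<d. v $ j * f i $ j)"
 unfolding sum_distrib_left by (rule sum.swap)
also have "... = (\<Sum>i\<in>I. v \<bullet> f i)"
 unfolding scalar_prod_def using assms(2) by (intro sum.cong refl) (metis carrier_vecD)
finally show "v \<bullet> finsum_vec TYPE(complex) d f I = (\<Sum>i\<in>I. v \<bullet> f i)" .
qed

context xyz
begin

text \<open>Dependence of the generalised Vandermonde product on one of its arguments.\<close>

lemma Vand_update:
 assumes n: "n \<in> {1..K}"
 shows "\<exists>W. \<forall>z. Vand X K (\<zeta>(n := z)) = W * (\<Prod>m\<in>{1..K} - {n}. ts z (\<zeta> m))"
proof (intro exI allI)
fix z
let ?I = "{1..K} - {n}" and ?v = "\<zeta>(n := z)"
define w where "w j = (if n < j then -1 else 1) * (\<Prod>i\<in>{1..<j} - {n}. ts (\<zeta> j) (\<zeta> i))" for j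
define r where "r j = (if n < j then ts z (\<zeta> j) else 1)" for j
have row: "(\<Prod>i\<in>{1..<j}. ts (?v j) (?v i)) = w j * r j" if j: "j \<in> ?I" for j
proof -
 have a: "(\<Prod>i\<in>{1..<j} - {n}. ts (?v j) (?v i)) = (\<Prod>i\<in>{1..<j} - {n}. ts (\<zeta> j) (\<zeta> i))"
  using j by (intro prod.cong refl) auto
 show ?thesis
 proof (cases "n < j")
  case True
  hence "(\<Prod>i\<in>{1..<j}. ts (?v j) (?v i)) = ts (\<zeta> j) z * (\<Prod>i\<in>{1..<j} - {n}. ts (\<zeta> j) (\<zeta> i))"
   using n j unfolding a[symmetric] by (subst prod.remove[of _ n]) auto
  thus ?thesis using True ts_minus[of "\<zeta> j" z] unfolding w_def r_def by simp
 next
  case False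
  hence "{1..<j} - {n} = {1..<j}" by auto
  thus ?thesis using a False unfolding w_def r_def by simp
 qed
qed
have "(\<Prod>i\<in>{1..<n}. ts (?v n) (?v i)) = (\<Prod>j\<in>?I. if n < j then 1 else ts z (\<zeta> j))"
 using n by (intro prod.mono_neutral_cong_left) auto
hence "(\<Prod>i\<in>{1..<n}. ts (?v n) (?v i)) * (\<Prod>j\<in>?I. r j) = (\<Prod>j\<in>?I. ts z (\<zeta> j))"
 unfolding r_def by (simp add: if_distrib prod.distrib[symmetric] cong: if_cong)
moreover have "Vand X K ?v = (\<Prod>i\<in>{1..<n}. ts (?v n) (?v i)) * ((\<Prod>j\<in>?I. w j) * (\<Prod>j\<in>?I. r j))"
 unfolding Vand_def th prod.remove[OF finite_atLeastAtMost n] prod.distrib[symmetric]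
 by (intro arg_cong2[of _ _ _ _ "(*)"] refl prod.cong row)
ultimately show "Vand X K ?v = (\<Prod>j\<in>?I. w j) * (\<Prod>m\<in>?I. ts z (\<zeta> m))" by (simp add: mult_ac)
qed

lemma finite_confs: "finite (confs N)"
 unfolding confs_def by (rule finite_PiE) auto

lemma confs_cases: "k \<in> confs N ==> n \<in> {1..N} ==> k n = 0 \<or> k n = Suc 0"
 unfolding confs_def by fastforce

lemma confs_upd: "k \<in> confs N ==> n \<in> {1..N} ==> j \<le> Suc 0 ==> k(n := j) \<in> confs N"
 unfolding confs_def by (auto simp: PiE_iff extensional_def)

lemma confs_eqI: "k \<in> confs N ==> l \<in> confs N ==> (!!n. n \<in> {1..N} ==> k n = l n) ==> k = l"
 unfolding confs_def by (rule PiE_ext)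

text \<open>Evaluation nodes for a configuration: the special points, and one of the two shifted
 inhomogeneities for every site.\<close>

definition nodes :: "(nat => nat) => ((nat \<times> nat) + nat) set" where
 "nodes k = (%n. Inl (n, k n)) ` {1..N} \<union> Inr ` {..<4}"

lemma nodes_finite: "finite (nodes k)" and nodes_card: "card (nodes k) = Suc (N + 3)"
proof -
show "finite (nodes k)" unfolding nodes_def by simp
have "card (nodes k) = card ((%n. Inl (n, k n) :: (nat \<times> nat) + nat) ` {1..N}) + card (Inr ` {..<4 :: nat} :: ((nat \<times> nat) + nat) set)"
 unfolding nodes_def by (rule card_Un_disjoint) auto
also have "... = N + 4" by (subst card_image, simp add: inj_on_def)+ simp
finally show "card (nodes k) = Suc (N + 3)" by simp
qed

lemma nodes_NI: "k \<in> confs N ==> nodes k \<subseteq> NI"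
 using confs_cases unfolding nodes_def NI_def by fastforce

lemma node_interpolation:
 assumes k: "k \<in> confs N" and f: "even_theta (N + 3) f" "even_theta (N + 3) g"
  and s: "!!r. r < 4 ==> f (h + hp r) = g (h + hp r)"
  and x: "!!n. n \<in> {1..N} ==> f (xs n (k n)) = g (xs n (k n))"
 shows "f z = g z"
proof -
have "f z - g z = 0"
proof (rule even_theta_eq_0[OF even_theta_diff[OF f] nodes_finite nodes_card])
 show "f (nd i) - g (nd i) = 0" if "i \<in> nodes k" for i
  using that s x unfolding nodes_def by (auto simp: xi_special_hp)
 show "th1 (2 * nd i) ~= 0" if "i \<in> nodes k" for i
  using nodes_distinct(1) nodes_NI[OF k] that by blast
 show "ts (nd i) (nd j) ~= 0" if "i \<in> nodes k" "j \<in> nodes k" "i ~= j" for i j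
  using nodes_distinct(2) nodes_NI[OF k] that by blast
qed
thus ?thesis by simp
qed

text \<open>The product that vanishes at the special points; up to a constant it is \<open>ts (2 * z) (2 * h)\<close>.\<close>

definition PR :: "complex => complex" where
 "PR z = (\<Prod>r<4. ts z (h + hp r))"

lemma PR_formula: "\<exists>K. K ~= 0 \<and> (\<forall>z. PR z = K * (th1 (2 * z - 2 * h) * th1 (2 * z + 2 * h)))"
proof -
define s where "s = (\<Prod>r<4. sgk r gI)"
have bP: "(\<Prod>r<4. tg (bet r) w) = tP w" for w
 by (simp add: bet_def tP_def numeral_eq_Suc lessThan_Suc mult_ac)
have qP: "(\<Prod>r<4. qh r w) = qhalf \<omega> w * qhalf \<omega> w" for w
 by (simp add: qh_def numeral_eq_Suc lessThan_Suc)
have p: "(\<Prod>r<4. th1 (w + hp r)) = s * (qhalf \<omega> w * qhalf \<omega> w) * tP w" for w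
proof -
 have "(\<Prod>r<4. th1 (w + hp r)) = (\<Prod>r<4. sgk r gI * qh r w * tg (bet r) w)"
  using tg_plus_half_period[of _ "gI" w] by (intro prod.cong refl) auto
 thus ?thesis unfolding prod.distrib s_def bP qP .
qed
have s0: "s ~= 0" unfolding s_def by (simp add: sgk_def numeral_eq_Suc lessThan_Suc)
have tP: "tP w = th1 (2 * w) / (2 * cst)" for w unfolding theta1_double by simp
define K where "K = s * s * (qpow \<omega> (-1/4) ^ 4 * exp (- \<i> * (2 * h)) ^ 2) * (- 1 / (2 * cst) ^ 2)"
have K0: "K ~= 0" unfolding K_def using s0 by (simp add: qpow_def)
have "PR z = K * (th1 (2 * z - 2 * h) * th1 (2 * z + 2 * h))" for z
proof -
 have "ts z (h + hp r) = - 1 * (th1 ((h - z) + hp r) * th1 ((z + h) + hp r))" for r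
  using th1_minus[of "(h - z) + hp r"] unfolding ts_def by (simp add: alg)
 hence "PR z = (-1) ^ 4 * ((\<Prod>r<4. th1 ((h - z) + hp r)) * (\<Prod>r<4. th1 ((z + h) + hp r)))"
  unfolding PR_def by (simp only: prod.distrib prod_constant card_lessThan)
 also have "... = s * s * ((qhalf \<omega> (h - z) * qhalf \<omega> (z + h)) ^ 2) * (tP (h - z) * tP (z + h))"
  unfolding p by (simp add: power2_eq_square mult_ac)
 also have "qhalf \<omega> (h - z) * qhalf \<omega> (z + h) = qpow \<omega> (-1/4) ^ 2 * exp (- \<i> * (2 * h))"
  unfolding qhalf_def by (simp add: power2_eq_square mult_ac exp_add[symmetric]) (rule disjI2, rule exp_cong, simp add: alg)
 also have "tP (h - z) * tP (z + h) = (- 1 / (2 * cst) ^ 2) * (th1 (2 * z - 2 * h) * th1 (2 * z + 2 * h))"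
  unfolding tP using th1_minus[of "2 * z - 2 * h"] by (simp add: alg power2_eq_square)
 finally show ?thesis unfolding K_def by (simp add: power_mult_distrib power_mult[symmetric] mult_ac)
qed
thus ?thesis using K0 by blast
qed

lemma xi2_nz: assumes n: "n \<in> {1..N}" shows "th1 (2 * xi n) ~= 0"
proof
assume "th1 (2 * xi n) = 0"
then obtain r where r: "r < 4" "th1 (xi n + hp r) = 0" using theta1_double_zero by metis
have e: "xi n + hp r = (xi n + h - (h + hp r)) + 2 * hp r" by (simp add: alg)
have "th1 (xi n + h - (h + hp r)) = 0" using r(2)[unfolded e theta1_lat_iff[OF two_hp_lat[OF r(1)]]] .
hence "ts (xi n + h) (h + hp r) = 0" unfolding ts_def by simp
thus False using nodes_distinct(2)[OF NI_I(1)[OF n] NI_I(3)[OF r(1)]] unfolding nd_simps xi_sh_01 xi_special_hp by blast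
qed

text \<open>The constant in the definition of the vectors, and the values of \<open>A\<close> at the two shifted
 inhomogeneities.\<close>

definition kn where "kn n = th1 (2 * xi n - 4 * h) / th1 (2 * xi n + 4 * h)"
definition an where "an n = \<Lambda> (h - xi n)"
definition bn where "bn n = \<Lambda> (h + xi n)"

lemma an_nz: "n \<in> {1..N} ==> an n ~= 0" unfolding an_def by (rule A_nz)
lemma kn_nz: "n \<in> {1..N} ==> kn n ~= 0" unfolding kn_def using xi_nz(3,4) by simp

lemma kn_PR:
 assumes n: "n \<in> {1..N}"
 shows "kn n * PR (xs n 0) = PR (xs n (Suc 0))" "PR (xs n (Suc 0)) ~= 0"
proof -
obtain K where K: "K ~= 0" "!!z. PR z = K * (th1 (2 * z - 2 * h) * th1 (2 * z + 2 * h))" using PR_formula by blast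
have e: "2 * (xi n + h) - 2 * h = 2 * xi n" "2 * (xi n + h) + 2 * h = 2 * xi n + 4 * h"
 "2 * (xi n - h) - 2 * h = 2 * xi n - 4 * h" "2 * (xi n - h) + 2 * h = 2 * xi n" by (simp_all add: alg)
show "kn n * PR (xs n 0) = PR (xs n (Suc 0))" "PR (xs n (Suc 0)) ~= 0"
 unfolding K(2) xi_sh_01 e kn_def using K(1) xi_nz(3,4)[OF n] xi2_nz[OF n] by simp_all
qed

lemma transfer_at_sites:
 assumes n: "n \<in> {1..N}"
 shows "transfer X (xi n - h) = T (xi n - h)" "transfer X (xi n + h) = T (xi n + h)"
proof -
have e: "2 * (xi n - h) - eta X = 2 * xi n - 4 * h" "2 * (xi n - h) + eta X = 2 * xi n"
 "2 * (xi n + h) - eta X = 2 * xi n" "2 * (xi n + h) + eta X = 2 * xi n + 4 * h" by (simp_all add: alg)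
show "transfer X (xi n - h) = T (xi n - h)" "transfer X (xi n + h) = T (xi n + h)"
 by (rule transfer_eq_TM[OF refl bdry_nz]; (simp only: e th)?; use xi_nz(3,4)[OF n] xi2_nz[OF n] in simp)+
qed

end

locale sov = xyz +
 fixes S R :: "complex vec" and N0 :: complex
 assumes S: "S \<in> carrier_vec (2 ^ len X)" "is_covector_basis X \<epsilon> S"
  and N0: "N0 ~= 0" and ref: "is_ref_vector X \<epsilon> S N0 R"
begin

abbreviation dm :: nat where "dm \<equiv> 2 ^ N"
abbreviation HV where "HV \<equiv> carrier_vec dm :: complex vec set"
abbreviation sk where "sk \<equiv> sep_ket X \<epsilon> R"
abbreviation sb where "sb \<equiv> sep_bra X \<epsilon> S N0"
abbreviation sp where "sp \<equiv> sep_pairing X \<epsilon> S N0 R"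
abbreviation br where "br \<equiv> sov_bra X \<epsilon> S"
abbreviation kt where "kt \<equiv> sov_ket X \<epsilon> R"

lemma R_carrier: "R \<in> HV" using ref unfolding is_ref_vector_def by blast

text \<open>The factors of one site in the covectors and vectors of the bases, and the products over all
 sites.\<close>

definition Fb where "Fb n = (if n \<in> {1..N} then (1 / an n) \<cdot>\<^sub>m T (xi n - h) else 1\<^sub>m dm)"
definition Gb where "Gb n = (if n \<in> {1..N} then (kn n / an n) \<cdot>\<^sub>m T (xi n + h) else 1\<^sub>m dm)"
definition PB where "PB k = mat_prod_list dm (map (%n. Fb n ^\<^sub>m k n) [1..<Suc N])"
definition PK where "PK k = mat_prod_list dm (map (%n. Gb n ^\<^sub>m k n) [1..<Suc N])"

lemma smult_T_comm: "(c \<cdot>\<^sub>m T x) * (c' \<cdot>\<^sub>m T y) = (c' \<cdot>\<^sub>m T y) * (c \<cdot>\<^sub>m T x)"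
proof -
have e: "(c \<cdot>\<^sub>m T x) * (c' \<cdot>\<^sub>m T y) = (c * c') \<cdot>\<^sub>m (T x * T y)" for c c' x y
proof -
 have "(c \<cdot>\<^sub>m T x) * (c' \<cdot>\<^sub>m T y) = c \<cdot>\<^sub>m (c' \<cdot>\<^sub>m (T x * T y))"
  by (subst mult_smult_assoc_mat[of _ dm dm _ dm], auto)
 also have "... = (c * c') \<cdot>\<^sub>m (T x * T y)" by (rule eq_matI) auto
 finally show ?thesis .
qed
show ?thesis unfolding e T_comm[of x y] mult.commute[of c c'] ..
qed

lemma FG_carrier [simp]: "Fb n \<in> carrier_mat dm dm" "Gb n \<in> carrier_mat dm dm"
 unfolding Fb_def Gb_def by auto

lemma FG_comm: "Fb m * Fb n = Fb n * Fb m" "Gb m * Gb n = Gb n * Gb m"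
 unfolding Fb_def Gb_def using smult_T_comm by auto

lemma PB_PK_carrier [simp]: "PB k \<in> carrier_mat dm dm" "PK k \<in> carrier_mat dm dm"
 unfolding PB_def PK_def by (auto intro!: mat_prod_list_carrier)

lemma PB_upd: "n \<in> {1..N} ==> PB (k(n := Suc (k n))) = Fb n * PB k"
 unfolding PB_def by (intro mat_prod_list_power_update FG_comm) auto

lemma PK_upd: "n \<in> {1..N} ==> PK (k(n := Suc (k n))) = Gb n * PK k"
 unfolding PK_def by (intro mat_prod_list_power_update FG_comm) auto

lemma br_eq: "br k = transpose_mat (PB (%n. 1 - k n)) *\<^sub>v S"
proof -
have "map (%n. ((1 / A_coef X \<epsilon> (eta X / 2 - xi n)) \<cdot>\<^sub>m transfer X (xi n - eta X / 2)) ^\<^sub>m (1 - k n)) [1..<Suc N]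
  = map (%n. Fb n ^\<^sub>m (1 - k n)) [1..<Suc N]"
 by (rule map_cong[OF refl]) (auto simp: Fb_def transfer_at_sites(1) an_def simp del: upt_Suc)
thus ?thesis unfolding sov_bra_def PB_def by (rule arg_cong)
qed

lemma kt_eq: "kt k = PK k *\<^sub>v R"
proof -
have e: "2 * xi n - 2 * eta X = 2 * xi n - 4 * h" "2 * xi n + 2 * eta X = 2 * xi n + 4 * h" for n by simp_all
have g: "(theta X (2 * xi n - 2 * eta X) / theta X (2 * xi n + 2 * eta X)
  / A_coef X \<epsilon> (eta X / 2 - xi n)) \<cdot>\<^sub>m transfer X (xi n + eta X / 2) = Gb n" if "n \<in> {1..N}" for n
 unfolding Gb_def kn_def an_def if_P[OF that] transfer_at_sites(2)[OF that] e th ..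
have "map (%n. ((theta X (2 * xi n - 2 * eta X) / theta X (2 * xi n + 2 * eta X)
        / A_coef X \<epsilon> (eta X / 2 - xi n)) \<cdot>\<^sub>m transfer X (xi n + eta X / 2)) ^\<^sub>m (k n)) [1..<Suc N]
  = map (%n. Gb n ^\<^sub>m k n) [1..<Suc N]"
proof (rule map_cong[OF refl])
 fix n assume "n \<in> set [1..<Suc N]"
 hence "n \<in> {1..N}" by auto
 from g[OF this] show "((theta X (2 * xi n - 2 * eta X) / theta X (2 * xi n + 2 * eta X)
        / A_coef X \<epsilon> (eta X / 2 - xi n)) \<cdot>\<^sub>m transfer X (xi n + eta X / 2)) ^\<^sub>m (k n) = Gb n ^\<^sub>m k n"
  by (simp only:)
qed
thus ?thesis unfolding sov_ket_def PK_def by (rule arg_cong)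
qed

lemma br_kt_carrier [simp]: "br k \<in> HV" "kt k \<in> HV"
proof -
show "br k \<in> HV" unfolding br_eq
 by (rule mult_mat_vec_carrier[OF _ S(1)], rule transpose_carrier_mat[THEN iffD2], rule PB_PK_carrier(1))
show "kt k \<in> HV" unfolding kt_eq by (rule mult_mat_vec_carrier[OF PB_PK_carrier(2) R_carrier])
qed

lemma br_scalar: "v \<in> HV ==> br k \<bullet> v = S \<bullet> (PB (%n. 1 - k n) *\<^sub>v v)"
 unfolding br_eq by (rule transpose_vec_mult_scalar[OF PB_PK_carrier(1) _ S(1)])

lemma T_vec [simp]: "v \<in> HV ==> T z *\<^sub>v v \<in> HV"
 by (rule mult_mat_vec_carrier[OF T_carrier])

lemma T_fusion_vec:
 assumes n: "n \<in> {1..N}" and v: "v \<in> HV"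
 shows "T (xi n - h) *\<^sub>v (T (xi n + h) *\<^sub>v v) = (an n * bn n) \<cdot>\<^sub>v v"
proof -
have "T (xi n - h) *\<^sub>v (T (xi n + h) *\<^sub>v v) = (T (xi n - h) * T (xi n + h)) *\<^sub>v v"
 by (rule assoc_mult_mat_vec[OF T_carrier T_carrier v, symmetric])
also have "T (xi n - h) * T (xi n + h) = (an n * bn n) \<cdot>\<^sub>m 1\<^sub>m dm"
 unfolding T_comm[of "xi n - h"] T_fusion[OF n] an_def bn_def by (simp add: mult.commute add.commute)
finally show ?thesis using v by (auto intro!: eq_vecI simp: row_smult)
qed

lemma smult_mat_vec: "C \<in> carrier_mat dm dm ==> v \<in> HV ==> (c \<cdot>\<^sub>m C) *\<^sub>v v = c \<cdot>\<^sub>v (C *\<^sub>v v)"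
 for C :: "complex mat"
 by (rule eq_vecI) (auto simp: row_smult)

lemma br_step:
 assumes n: "n \<in> {1..N}" and k: "k n = Suc 0" and v: "v \<in> HV"
 shows "br (k(n := 0)) \<bullet> v = br k \<bullet> (Fb n *\<^sub>v v)"
proof -
define j where "j = (%m. 1 - k m)"
have "(%m. 1 - (k(n := 0)) m) = j(n := Suc (j n))" unfolding j_def using k by auto
hence "br (k(n := 0)) \<bullet> v = S \<bullet> ((Fb n * PB j) *\<^sub>v v)" unfolding br_scalar[OF v] by (simp add: PB_upd[OF n])
also have "Fb n * PB j = PB j * Fb n"
 unfolding PB_def by (rule mat_prod_list_commute[symmetric]) (auto intro!: pow_mat_commute[of _ dm] FG_comm)
also have "(PB j * Fb n) *\<^sub>v v = PB j *\<^sub>v (Fb n *\<^sub>v v)"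
 by (rule assoc_mult_mat_vec[OF PB_PK_carrier(1) FG_carrier(1) v])
also have "S \<bullet> ... = br k \<bullet> (Fb n *\<^sub>v v)"
 unfolding j_def by (rule br_scalar[symmetric], rule mult_mat_vec_carrier[OF FG_carrier(1) v])
finally show ?thesis .
qed

lemma Fb_vec: "n \<in> {1..N} ==> v \<in> HV ==> Fb n *\<^sub>v v = (1 / an n) \<cdot>\<^sub>v (T (xi n - h) *\<^sub>v v)"
 unfolding Fb_def by (simp only: if_True smult_mat_vec[OF T_carrier])

lemma Gb_vec: "n \<in> {1..N} ==> v \<in> HV ==> Gb n *\<^sub>v v = (kn n / an n) \<cdot>\<^sub>v (T (xi n + h) *\<^sub>v v)"
 unfolding Gb_def by (simp only: if_True smult_mat_vec[OF T_carrier])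

lemma br_T1:
 assumes n: "n \<in> {1..N}" and k: "k n = Suc 0" and v: "v \<in> HV"
 shows "br k \<bullet> (T (xi n - h) *\<^sub>v v) = an n * (br (k(n := 0)) \<bullet> v)"
proof -
have "br (k(n := 0)) \<bullet> v = 1 / an n * (br k \<bullet> (T (xi n - h) *\<^sub>v v))"
 unfolding br_step[of n k v, OF assms] Fb_vec[OF n v]
 by (rule scalar_prod_smult_distrib[OF br_kt_carrier(1) T_vec[OF v]])
thus ?thesis using an_nz[OF n] by simp
qed

lemma br_T0:
 assumes n: "n \<in> {1..N}" and k: "k n = 0" and v: "v \<in> HV"
 shows "br k \<bullet> (T (xi n + h) *\<^sub>v v) = bn n * (br (k(n := Suc 0)) \<bullet> v)"
proof -
let ?A = "T (xi n + h) *\<^sub>v v"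
have e: "(k(n := Suc 0))(n := 0) = k" using k by auto
have "br k \<bullet> ?A = br (k(n := Suc 0)) \<bullet> (Fb n *\<^sub>v ?A)"
 using br_step[of n "k(n := Suc 0)" "T (xi n + h) *\<^sub>v v"] n v unfolding e by (simp del: fun_upd_apply add: fun_upd_same)
also have "Fb n *\<^sub>v ?A = bn n \<cdot>\<^sub>v v"
 unfolding Fb_vec[OF n T_vec[OF v]] T_fusion_vec[OF n v] smult_smult_assoc using an_nz[OF n] by simp
finally show ?thesis using v by (simp only: scalar_prod_smult_distrib[OF br_kt_carrier(1)])
qed

lemma kt_step: "n \<in> {1..N} ==> k n = 0 ==> kt (k(n := Suc 0)) = Gb n *\<^sub>v kt k"
 using PK_upd[of n k] unfolding kt_eq by (simp add: assoc_mult_mat_vec[OF FG_carrier(2) PB_PK_carrier(2) R_carrier])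

lemma kt_T0:
 assumes n: "n \<in> {1..N}" and k: "k n = 0"
 shows "T (xi n + h) *\<^sub>v kt k = (an n / kn n) \<cdot>\<^sub>v kt (k(n := Suc 0))"
 unfolding kt_step[of n k, OF assms] Gb_vec[OF n br_kt_carrier(2)] smult_smult_assoc
 using an_nz[OF n] kn_nz[OF n] by simp

lemma kt_T1:
 assumes n: "n \<in> {1..N}" and k: "k n = Suc 0"
 shows "T (xi n - h) *\<^sub>v kt k = (kn n * bn n) \<cdot>\<^sub>v kt (k(n := 0))"
proof -
have e: "(k(n := 0))(n := Suc 0) = k" using k by auto
have "kt k = Gb n *\<^sub>v kt (k(n := 0))"
 using kt_step[of n "k(n := 0)"] n unfolding e by (simp del: fun_upd_apply add: fun_upd_same)
hence "T (xi n - h) *\<^sub>v kt k = T (xi n - h) *\<^sub>v ((kn n / an n) \<cdot>\<^sub>v (T (xi n + h) *\<^sub>v kt (k(n := 0))))"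
 unfolding Gb_vec[OF n br_kt_carrier(2)] by (rule arg_cong)
also have "... = (kn n / an n) \<cdot>\<^sub>v ((an n * bn n) \<cdot>\<^sub>v kt (k(n := 0)))"
 unfolding mult_mat_vec[OF T_carrier T_vec[OF br_kt_carrier(2)]] T_fusion_vec[OF n br_kt_carrier(2)] ..
finally show ?thesis unfolding smult_smult_assoc using an_nz[OF n] by simp
qed

end

section \<open>Orthogonality and eigenstates\<close>

lemma ratio_identity:
 fixes k a f x y u v b :: complex
 assumes "y * v * f = a * b * (x * u)" "k * x = y" "y ~= 0" "v ~= 0" "a ~= 0"
 shows "k / a * f = u / v * b"
proof -
have "y * (k * v * f) = k * (y * v * f)" by (simp only: mult_ac)
also have "... = (k * x) * (a * b * u)" unfolding assms(1) by (simp only: mult_ac)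
finally have "k * v * f = a * b * u" unfolding assms(2) using assms(3) by simp
thus ?thesis using assms(4,5) by (simp add: field_simps)
qed

context sov
begin

text \<open>The values of the transfer matrix at the special points.\<close>

definition tr :: "nat => complex" where
 "tr r = \<Lambda> (h + hp r) * (if r \<ge> 2 then exp (4 * \<i> * h * of_nat M) else 1)"

text \<open>The coefficients with which the transfer matrix at \<open>xs n (k n)\<close> acts on the covectors (\<open>Bc\<close>) and
 the vectors (\<open>Kc\<close>) with label \<open>k\<close>; the result has the label \<open>flip n k\<close>.\<close>

definition Bc where "Bc n j = (if j = 0 then bn n else an n)" for j :: nat
definition Kc where "Kc n j = (if j = 0 then an n / kn n else kn n * bn n)" for j :: nat
definition flip where "flip n k = k(n := 1 - k n)" for k :: "nat => nat"

lemma flip_confs: "k \<in> confs N ==> n \<in> {1..N} ==> flip n k \<in> confs N"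
 unfolding flip_def by (rule confs_upd) simp_all

lemma sandwich_even:
 assumes "u \<in> HV" "v \<in> HV"
 shows "even_theta (N + 3) (%z. u \<bullet> (T z *\<^sub>v v))"
proof -
let ?A = "%z i. \<Sum>j\<in>{0..<dm}. v $ j * T z $$ (i, j)"
have "u \<bullet> (T z *\<^sub>v v) = (\<Sum>i\<in>{0..<dm}. u $ i * (?A z i))" for z
proof -
 have "(T z *\<^sub>v v) $ i = (?A z i)" if "i < dm" for i
  using that assms(2) by (simp add: scalar_prod_def mult.commute)
 thus ?thesis unfolding scalar_prod_def by (simp del: index_mult_mat_vec)
qed
moreover have "even_theta (N + 3) (%z. \<Sum>i\<in>{0..<dm}. u $ i * (?A z i))"
 by (intro even_theta_sum even_theta_cmult T_even_theta) auto
ultimately show ?thesis by simp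
qed

lemma T_special_vec: "r < 4 ==> v \<in> HV ==> T (h + hp r) *\<^sub>v v = tr r \<cdot>\<^sub>v v"
 unfolding T_special tr_def[symmetric] by (subst smult_mat_vec) auto

lemma br_T_node:
 assumes k: "k \<in> confs N" and n: "n \<in> {1..N}" and v: "v \<in> HV"
 shows "br k \<bullet> (T (xs n (k n)) *\<^sub>v v) = Bc n (k n) * (br (flip n k) \<bullet> v)"
 using confs_cases[OF k n]
proof
assume 0: "k n = 0"
show ?thesis using br_T0[of n k v, OF n 0 v] unfolding 0 xi_sh_01 Bc_def flip_def by simp
next
assume 1: "k n = Suc 0"
show ?thesis using br_T1[of n k v, OF n 1 v] unfolding 1 xi_sh_01 Bc_def flip_def by simp
qed

lemma kt_T_node:
 assumes k: "k \<in> confs N" and n: "n \<in> {1..N}"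
 shows "T (xs n (k n)) *\<^sub>v kt k = Kc n (k n) \<cdot>\<^sub>v kt (flip n k)"
 using confs_cases[OF k n]
proof
assume 0: "k n = 0"
show ?thesis using kt_T0[of n k, OF n 0] unfolding 0 xi_sh_01 Kc_def flip_def by simp
next
assume 1: "k n = Suc 0"
show ?thesis using kt_T1[of n k, OF n 1] unfolding 1 xi_sh_01 Kc_def flip_def by simp
qed

text \<open>The products \<open>V\<close> for a label, for the opposite label, and for the bare inhomogeneities.\<close>

definition Vk where "Vk k = Vand X N (%n. xs n (k n))"
definition Vb where "Vb k = Vand X N (%n. xs n (1 - k n))"
definition V0 where "V0 = Vand X N (xi)"

lemma xs_ts_nz:
 assumes "n \<in> {1..N}" "m \<in> {1..N}" "n ~= m" "i \<le> 1" "j \<le> 1"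
 shows "ts (xs n i) (xs m j) ~= 0"
proof -
have "Inl (n, i) \<in> NI" "Inl (m, j) \<in> NI" using assms unfolding NI_def by auto
from nodes_distinct(2)[OF this] show ?thesis using assms(3) by simp
qed

lemma Vand_nz:
 assumes "!!n m. n \<in> {1..K} ==> m \<in> {1..K} ==> n ~= m ==> ts (\<zeta> n) (\<zeta> m) ~= 0"
 shows "Vand X K \<zeta> ~= 0"
 unfolding Vand_def th using assms by (auto simp: prod_zero_iff)

lemma Vk_nz: "k \<in> confs N ==> Vk k ~= 0"
 unfolding Vk_def by (rule Vand_nz, rule xs_ts_nz) (use confs_cases in force)+

lemma xi_pm_nz:
 assumes n: "n \<in> {1..N}" "m \<in> {1..N}" "n ~= m"
 shows "th1 (xi n - xi m) ~= 0" "th1 (xi n + xi m) ~= 0"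
proof -
have e: "xi n + h - (xi m + h) = xi n - xi m" "xi n + h + (xi m - h) = xi n + xi m" by simp_all
have "ts (xi n + h) (xi m + h) ~= 0" "ts (xi n + h) (xi m - h) ~= 0"
 using xs_ts_nz[OF n, of 0 0] xs_ts_nz[OF n, of 0 1] by (simp_all add: xi_sh_01)
thus "th1 (xi n - xi m) ~= 0" "th1 (xi n + xi m) ~= 0" unfolding ts_def e by auto
qed

lemma V0_nz: "V0 ~= 0"
 unfolding V0_def by (rule Vand_nz) (use xi_pm_nz in \<open>simp add: ts_def\<close>)

lemma PR_special: "r < 4 ==> PR (h + hp r) = 0"
 unfolding PR_def by (rule prod_zero) (auto intro!: bexI[of _ r])

lemma PR_even: "even_theta 4 PR"
 using even_theta_prod[of "{..<4::nat}" "%r z. ts z (h + hp r)"] ts_even_theta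
 unfolding PR_def[abs_def] by simp

lemma kt_zero: "(!!n. n \<in> {1..N} ==> k n = 0) ==> kt k = R"
proof -
assume k: "!!n. n \<in> {1..N} ==> k n = 0"
have "mat_prod_list dm (map (%n. Gb n ^\<^sub>m k n) L) = 1\<^sub>m dm" if "set L \<subseteq> {1..N}" for L
 using that
proof (induction L)
 case (Cons m L)
 have "k m = 0" using k Cons.prems by simp
 moreover have "dim_row (Gb m) = dm" by (rule carrier_matD(1)[OF FG_carrier(2)])
 ultimately show ?case using Cons by (simp add: mat_prod_list_def)
qed (simp add: mat_prod_list_def)
moreover have "set [1..<Suc N] \<subseteq> {1..N}" by auto
ultimately have "PK k = 1\<^sub>m dm" unfolding PK_def by blast
thus ?thesis unfolding kt_eq using R_carrier by simp
qed

text \<open>Induction on the number of ones in \<open>l\<close>. The vector of \<open>l\<close> is, up to a factor, \<open>T\<close> at a node applied to that of a label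
 \<open>l'\<close> with fewer ones, and that \<open>T\<close> is interpolated from the nodes of \<open>k\<close>, which act on the covector.\<close>

theorem orthogonality:
 assumes "k \<in> confs N" "l \<in> confs N"
 shows "br k \<bullet> kt l = (if k = l then N0 / (Vk k * V0) else 0)"
 using assms
proof (induction "\<Sum>n\<in>{1..N}. l n" arbitrary: k l rule: less_induct)
case less
show ?case
proof (cases "\<forall>n\<in>{1..N}. l n = 0")
 case True
 have "k = l \<longleftrightarrow> (\<forall>n\<in>{1..N}. k n = 0)" using True confs_eqI[OF less.prems] by auto
 moreover have "Vk k = Vand X N (%n. xs n 0)" if "\<forall>n\<in>{1..N}. k n = 0"
  unfolding Vk_def Vand_def using that by (intro prod.cong refl) auto
 moreover have "br k \<bullet> R = (if \<forall>n\<in>{1..N}. k n = 0 then N0 / (Vand X N (%n. xs n 0) * Vand X N (xi)) else 0)"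
  using ref less.prems(1) unfolding is_ref_vector_def by blast
 ultimately show ?thesis using kt_zero[of l] True unfolding V0_def by auto
next
 case False
 then obtain n where n: "n \<in> {1..N}" "l n = Suc 0" using confs_cases[OF less.prems(2)] by blast
 define l' where "l' = l(n := 0)"
 have l': "l' \<in> confs N" "l' n = 0" unfolding l'_def using confs_upd[OF less.prems(2) n(1), of 0] by auto
 have ll: "l = l'(n := Suc 0)" unfolding l'_def using n by auto
 have "(\<Sum>m\<in>{1..N}. l' m) < (\<Sum>m\<in>{1..N}. l m)"
  by (rule sum_strict_mono_ex1) (use n in \<open>auto simp: l'_def\<close>)
 note IH = less.hyps[OF this _ l'(1)]
 have kl: "kt l = (kn n / an n) \<cdot>\<^sub>v (T (xi n + h) *\<^sub>v kt l')"
  unfolding ll kt_step[of n l', OF n(1) l'(2)] by (rule Gb_vec[OF n(1) br_kt_carrier(2)])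
 define f where "f z = br k \<bullet> (T z *\<^sub>v kt l')" for z
 have bk: "br k \<bullet> kt l = kn n / an n * f (xs n 0)"
  unfolding kl f_def xi_sh_01 by (rule scalar_prod_smult_distrib[OF br_kt_carrier(1) T_vec[OF br_kt_carrier(2)]])
 show ?thesis using confs_cases[OF less.prems(1) n(1)]
 proof
  assume 0: "k n = 0"
  have "f (xs n 0) = Bc n 0 * (br (flip n k) \<bullet> kt l')"
   using br_T_node[OF less.prems(1) n(1) br_kt_carrier(2), of l'] unfolding f_def 0 .
  moreover have "flip n k ~= l'" using 0 l'(2) unfolding flip_def by auto
  moreover have "k ~= l" using 0 n by auto
  ultimately show ?thesis unfolding bk using IH[OF flip_confs[OF less.prems(1) n(1)]] by simp
 next
  assume 1: "k n = Suc 0"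
  define Wn where "Wn z = (\<Prod>m\<in>{1..N} - {n}. ts z (xs m (k m)))" for z
  define F where "F z = PR z * Wn z" for z
  define x y where "x = xs n 0" and "y = xs n (Suc 0)"
  have ne: "br k' \<bullet> kt l' = 0" if "k' \<in> confs N" "k' n = Suc 0" for k' using IH[OF that(1)] that(2) l'(2) by auto
  have fev: "even_theta (N + 3) f" unfolding f_def by (rule sandwich_even) simp_all
  have Fev: "even_theta (N + 3) F"
  proof -
   have "even_theta (4 + card ({1..N} - {n})) (%z. PR z * Wn z)"
    unfolding Wn_def by (intro even_theta_mult PR_even even_theta_prod ts_even_theta) simp
   moreover have c: "4 + card ({1..N} - {n}) = N + 3" using n by simp
   ultimately show ?thesis unfolding c F_def[abs_def] by (simp only:)
  qed
  have e1: "F y * f x = f y * F x"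
  proof (rule node_interpolation[OF less.prems(1) even_theta_cmult[OF fev] even_theta_cmult[OF Fev]])
   fix r :: nat assume r: "r < 4"
   have "f (h + hp r) = tr r * (br k \<bullet> kt l')"
    unfolding f_def T_special_vec[OF r br_kt_carrier(2)] by (rule scalar_prod_smult_distrib[OF br_kt_carrier])
   thus "F y * f (h + hp r) = f y * F (h + hp r)"
    using ne[OF less.prems(1) 1] PR_special[OF r] unfolding F_def by simp
  next
   fix m assume m: "m \<in> {1..N}"
   show "F y * f (xs m (k m)) = f y * F (xs m (k m))"
   proof (cases "m = n")
    case True
    thus ?thesis unfolding y_def using 1 by simp
   next
    case False
    have "Wn (xs m (k m)) = 0" unfolding Wn_def using m False by (intro prod_zero) (auto intro!: bexI[of _ m])
    moreover have "f (xs m (k m)) = 0"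
     unfolding f_def br_T_node[OF less.prems(1) m br_kt_carrier(2)]
     using ne[OF flip_confs[OF less.prems(1) m]] False 1 unfolding flip_def by simp
    ultimately show ?thesis unfolding F_def by simp
   qed
  qed
  have e2: "f y = an n * (br (flip n k) \<bullet> kt l')"
   using br_T_node[OF less.prems(1) n(1) br_kt_carrier(2), of l'] unfolding f_def y_def 1 Bc_def by simp
  have e3: "kn n * PR x = PR y" "PR y ~= 0" unfolding x_def y_def by (rule kn_PR[OF n(1)])+
  have W: "Wn (xs n j) ~= 0" if j: "j \<le> 1" for j
  proof
   assume "Wn (xs n j) = 0"
   hence "\<exists>m\<in>{1..N} - {n}. ts (xs n j) (xs m (k m)) = 0"
    unfolding Wn_def by (subst (asm) prod_zero_iff) simp_all
   then obtain m where m: "m \<in> {1..N} - {n}" "ts (xs n j) (xs m (k m)) = 0" by blast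
   have "k m \<le> 1" using confs_cases[OF less.prems(1), of m] m(1) by auto
   from xs_ts_nz[OF n(1) _ _ j this] m show False by auto
  qed
  have Wy: "Wn y ~= 0" "Wn x ~= 0" unfolding x_def y_def using W[of 0] W[of 1] by simp_all
  have "br k \<bullet> kt l = Wn x / Wn y * (br (flip n k) \<bullet> kt l')"
   unfolding bk x_def[symmetric]
   by (rule ratio_identity[OF _ e3 Wy(1) an_nz[OF n(1)]]) (use e1 in \<open>simp only: e2 F_def\<close>)
  also have "... = (if k = l then N0 / (Vk k * V0) else 0)"
  proof (cases "k = l")
   case False
   have "flip n k ~= l'"
   proof
    assume "flip n k = l'"
    hence "(flip n k)(n := Suc 0) = l" unfolding ll by simp
    thus False using False 1 unfolding flip_def by auto
   qed
   thus ?thesis using False IH[OF flip_confs[OF less.prems(1) n(1)]] by simp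
  next
   case True
   have fl: "flip n k = l'" unfolding flip_def l'_def True using n by simp
   obtain W where W: "!!z. Vand X N ((%m. xs m (k m))(n := z)) = W * Wn z"
    using Vand_update[OF n(1), of "%m. xs m (k m)"] unfolding Wn_def by auto
   have Vy: "Vk k = W * Wn y"
   proof -
    have "(%m. xs m (k m)) = (%m. xs m (k m))(n := y)" unfolding y_def using 1 by auto
    thus ?thesis unfolding Vk_def using W[of y] by simp
   qed
   have Vx: "Vk l' = W * Wn x"
   proof -
    have "(%m. xs m (l' m)) = (%m. xs m (k m))(n := x)" unfolding x_def l'_def True by auto
    thus ?thesis unfolding Vk_def using W[of x] by simp
   qed
   have W0: "W ~= 0" using Vk_nz[OF less.prems(1)] unfolding Vy by auto
   have b: "br (flip n k) \<bullet> kt l' = N0 / (Vk l' * V0)" using IH[OF l'(1)] unfolding fl by simp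
   show ?thesis unfolding if_P[OF True] b Vy Vx using W0 Wy by simp
  qed
  finally show ?thesis .
 qed
qed
qed

text \<open>Nondegeneracy, from the assumption that the covectors form a basis.\<close>

lemma covector_expansion:
 assumes w: "w \<in> HV"
 shows "\<exists>a. \<forall>v\<in>HV. w \<bullet> v = (\<Sum>k\<in>confs N. a k * (br k \<bullet> v))"
proof -
let ?A = "%c i. \<Sum>k\<in>confs N. c (br k) * br k $ i"
interpret V: vec_space "TYPE(complex)" dm .
have b: "V.basis (br ` confs N)" and inj: "inj_on br (confs N)" using S(2) unfolding is_covector_basis_def by auto
hence "w \<in> V.span (br ` confs N)" using w unfolding V.basis_def by auto
then obtain a C where C: "finite C" "C \<subseteq> br ` confs N" "w = V.lincomb a C"
 unfolding V.span_def by auto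
have Cc: "C \<subseteq> HV" using C(2) by auto
define c where "c x = (if x \<in> C then a x else 0)" for x
have wi: "w $ i = (?A c i)" if "i < dm" for i
proof -
 have "w $ i = (\<Sum>x\<in>C. a x * x $ i)" unfolding C(3) by (rule V.lincomb_index[OF that Cc])
 also have "... = (\<Sum>x\<in>br ` confs N. c x * x $ i)"
  by (rule sum.mono_neutral_cong_left) (use C finite_confs in \<open>auto simp: c_def\<close>)
 also have "... = (?A c i)" by (rule sum.reindex[OF inj, unfolded o_def])
 finally show ?thesis .
qed
have "w \<bullet> v = (\<Sum>k\<in>confs N. c (br k) * (br k \<bullet> v))" if v: "v \<in> HV" for v
proof -
 have "w \<bullet> v = (\<Sum>i = 0..<dm. (?A c i) * v $ i)"
  using v by (auto simp: scalar_prod_def wi)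
 also have "... = (\<Sum>k\<in>confs N. \<Sum>i = 0..<dm. c (br k) * br k $ i * v $ i)"
  unfolding sum_distrib_right by (rule sum.swap)
 also have "... = (\<Sum>k\<in>confs N. c (br k) * (br k \<bullet> v))"
  using v by (simp add: scalar_prod_def sum_distrib_left mult.assoc)
 finally show ?thesis .
qed
thus ?thesis by (intro exI[of _ "%k. c (br k)"] ballI)
qed

lemma vec_eqI_br:
 assumes v: "v \<in> HV" "v' \<in> HV" and e: "!!k. k \<in> confs N ==> br k \<bullet> v = br k \<bullet> v'"
 shows "v = v'"
proof (rule eq_vecI)
fix i assume "i < dim_vec v'"
hence i: "i < dm" using v by simp
have u: "unit_vec dm i \<in> HV" by simp
obtain a where "\<forall>v\<in>HV. unit_vec dm i \<bullet> v = (\<Sum>k\<in>confs N. a k * (br k \<bullet> v))"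
 using covector_expansion[OF u] by blast
hence "unit_vec dm i \<bullet> v = unit_vec dm i \<bullet> v'" using v e by simp
thus "v $ i = v' $ i" using v i by simp
qed (use v in auto)

lemma covec_eqI_kt:
 assumes w: "w \<in> HV" "w' \<in> HV" and e: "!!k. k \<in> confs N ==> w \<bullet> kt k = w' \<bullet> kt k"
 shows "w = w'"
proof (rule eq_vecI)
let ?A = "%l. N0 / (Vk l * V0)"
fix i assume "i < dim_vec w'"
hence i: "i < dm" using w by simp
obtain a b where ab: "\<forall>v\<in>HV. w \<bullet> v = (\<Sum>k\<in>confs N. a k * (br k \<bullet> v))"
 "\<forall>v\<in>HV. w' \<bullet> v = (\<Sum>k\<in>confs N. b k * (br k \<bullet> v))"
 using covector_expansion[OF w(1)] covector_expansion[OF w(2)] by blast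
have "a l = b l" if l: "l \<in> confs N" for l
proof -
 have s: "(\<Sum>k\<in>confs N. c k * (br k \<bullet> kt l)) = c l * (?A l)" for c
 proof -
  have "(\<Sum>k\<in>confs N. c k * (br k \<bullet> kt l)) = (\<Sum>k\<in>confs N. if k = l then c l * (?A l) else 0)"
   by (intro sum.cong refl) (auto simp: orthogonality l)
  thus ?thesis using l finite_confs by simp
 qed
 have "w \<bullet> kt l = a l * (?A l)" "w' \<bullet> kt l = b l * (?A l)"
  using ab(1)[rule_format, of "kt l"] ab(2)[rule_format, of "kt l"] unfolding s by simp_all
 hence "a l * (?A l) = b l * (?A l)" using e[OF l] by (simp only:)
 thus ?thesis using N0 Vk_nz[OF l] V0_nz by simp
qed
hence "w \<bullet> unit_vec dm i = w' \<bullet> unit_vec dm i" using ab by simp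
thus "w $ i = w' $ i" using w i by simp
qed (use w in auto)

end

section \<open>Separate states\<close>

context xyz
begin

text \<open>The ratio, up to the sign, that enters the left separate states.\<close>

definition rn where "rn n = bd (h + xi n) / bd (h - xi n)"

lemma A_bdry_formula:
 "\<Lambda> z = (-1) ^ N * (th1 (2 * z + 2 * h) / th1 (2 * z)) * bd z * (\<Prod>n\<in>{1..N}. th1 (z - xi n + h) * th1 (- z - xi n - h))"
proof -
have e: "- z - eta X - x + eta X / 2 = - z - x - eta X / 2" for x by (simp add: field_simps)
show ?thesis unfolding A_coef_def a_bulk_def d_bulk_def th prod.distrib
 by (simp add: e mult_ac)
qed

text \<open>Detailed balance between the two values of the coefficient \<open>A\<close> at one site.\<close>

lemma balance:
 assumes n: "n \<in> {1..N}"
 shows "kn n * bn n * (\<Prod>m\<in>{1..N} - {n}. ts (xs n (Suc 0)) (xs m 0) * ts (xs n (Suc 0)) (xs m (Suc 0)))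
  = - (an n * rn n) * (\<Prod>m\<in>{1..N} - {n}. ts (xs n 0) (xs m 0) * ts (xs n 0) (xs m (Suc 0)))"
proof -
define x where "x = xi n"
define c where "c m = th1 (x - xi m) * th1 (x + xi m)" for m
define u where "u m = - (th1 (x - xi m + 2 * h) * th1 (x + xi m + 2 * h))" for m
define v where "v m = - (th1 (x - xi m - 2 * h) * th1 (x + xi m - 2 * h))" for m
let ?I = "{1..N} - {n}" and ?s = "(-1) ^ N :: complex"
have ab: "bd (h - x) ~= 0"
 using an_nz[OF n] unfolding an_def A_bdry_formula x_def by auto
have nz: "th1 (2 * x + 2 * h) ~= 0" "th1 (2 * x - 2 * h) ~= 0" "th1 (2 * x + 4 * h) ~= 0" "th1 (2 * x - 4 * h) ~= 0"
 unfolding x_def by (rule xi_nz[OF n])+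
have b: "bn n = - ?s * th1 (2 * x + 4 * h) * bd (h + x) * th1 (2 * h) * (\<Prod>m\<in>?I. u m)"
proof -
 have "th1 (h + x - xi m + h) * th1 (- (h + x) - xi m - h) = u m" for m
 proof -
  have e: "h + x - xi m + h = x - xi m + 2 * h" "- (h + x) - xi m - h = - (x + xi m + 2 * h)" by simp_all
  show ?thesis unfolding e th1_minus u_def by simp
 qed
 hence "(\<Prod>m\<in>{1..N}. th1 (h + x - xi m + h) * th1 (- (h + x) - xi m - h)) = (\<Prod>m\<in>{1..N}. u m)" by simp
 also have "... = u n * (\<Prod>m\<in>?I. u m)" by (rule prod.remove) (use n in auto)
 also have "u n = - (th1 (2 * h) * th1 (2 * x + 2 * h))" unfolding u_def x_def by (simp add: alg)
 finally have p: "(\<Prod>m\<in>{1..N}. th1 (h + x - xi m + h) * th1 (- (h + x) - xi m - h)) = - (th1 (2 * h) * th1 (2 * x + 2 * h)) * (\<Prod>m\<in>?I. u m)" .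
 have e: "2 * (h + x) + 2 * h = 2 * x + 4 * h" "2 * (h + x) = 2 * x + 2 * h" by simp_all
 show ?thesis unfolding bn_def x_def[symmetric] A_bdry_formula p e using nz by (simp add: add.commute)
qed
have a: "an n = ?s * th1 (2 * x - 4 * h) * bd (h - x) * th1 (2 * h) * (\<Prod>m\<in>?I. v m)"
proof -
 have "th1 (h - x - xi m + h) * th1 (- (h - x) - xi m - h) = v m" for m
 proof -
  have e: "h - x - xi m + h = - (x + xi m - 2 * h)" "- (h - x) - xi m - h = x - xi m - 2 * h" by simp_all
  show ?thesis unfolding e th1_minus v_def by simp
 qed
 hence "(\<Prod>m\<in>{1..N}. th1 (h - x - xi m + h) * th1 (- (h - x) - xi m - h)) = (\<Prod>m\<in>{1..N}. v m)" by simp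
 also have "... = v n * (\<Prod>m\<in>?I. v m)" by (rule prod.remove) (use n in auto)
 also have "v n = th1 (2 * h) * th1 (2 * x - 2 * h)" using th1_minus[of "2 * h"] unfolding v_def x_def by (simp add: alg)
 finally have p: "(\<Prod>m\<in>{1..N}. th1 (h - x - xi m + h) * th1 (- (h - x) - xi m - h)) = th1 (2 * h) * th1 (2 * x - 2 * h) * (\<Prod>m\<in>?I. v m)" .
 have e: "2 * (h - x) + 2 * h = - (2 * x - 4 * h)" "2 * (h - x) = - (2 * x - 2 * h)" by simp_all
 have m: "th1 (- (2 * x - 4 * h)) / th1 (- (2 * x - 2 * h)) = th1 (2 * x - 4 * h) / th1 (2 * x - 2 * h)"
  unfolding th1_minus by simp
 show ?thesis unfolding an_def x_def[symmetric] A_bdry_formula p e(1) unfolding e(2) m using nz by simp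
qed
have t1: "ts (xs n (Suc 0)) (xs m 0) * ts (xs n (Suc 0)) (xs m (Suc 0)) = (- 1 * v m) * c m" for m
proof -
 have e: "x - h - (xi m + h) = x - xi m - 2 * h" "x - h + (xi m + h) = x + xi m"
  "x - h - (xi m - h) = x - xi m" "x - h + (xi m - h) = x + xi m - 2 * h" by simp_all
 show ?thesis unfolding xi_sh_01 ts_def x_def[symmetric] e v_def c_def by simp
qed
have t0: "ts (xs n 0) (xs m 0) * ts (xs n 0) (xs m (Suc 0)) = (- 1 * u m) * c m" for m
proof -
 have e: "x + h - (xi m + h) = x - xi m" "x + h + (xi m + h) = x + xi m + 2 * h"
  "x + h - (xi m - h) = x - xi m + 2 * h" "x + h + (xi m - h) = x + xi m" by simp_all
 show ?thesis unfolding xi_sh_01 ts_def x_def[symmetric] e u_def c_def by simp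
qed
have "kn n * bn n = - ?s * th1 (2 * x - 4 * h) * bd (h + x) * th1 (2 * h) * (\<Prod>m\<in>?I. u m)"
 unfolding b kn_def x_def[symmetric] using nz by simp
moreover have "an n * rn n = ?s * th1 (2 * x - 4 * h) * bd (h + x) * th1 (2 * h) * (\<Prod>m\<in>?I. v m)"
 unfolding a rn_def x_def[symmetric] using ab by simp
ultimately show ?thesis unfolding t1 t0 prod.distrib prod_constant by simp
qed

end

context sov
begin

text \<open>The weight of the label \<open>k\<close> in the pairing, and the value of a product state there.\<close>

definition mu where "mu k = (\<Prod>n\<in>{1..N}. (- rn n) ^ k n) * Vb k"
definition Pc where "Pc Q k = (\<Prod>n\<in>{1..N}. Q (xs n (k n)))" for Q :: "complex => complex"

lemma Vk_Vb_update:
 assumes n: "n \<in> {1..N}" and k: "k \<in> confs N" "k n = 0"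
 shows "\<exists>W W'. Vk k = W * (\<Prod>m\<in>{1..N} - {n}. ts (xs n 0) (xs m (k m)))
  \<and> Vk (flip n k) = W * (\<Prod>m\<in>{1..N} - {n}. ts (xs n (Suc 0)) (xs m (k m)))
  \<and> Vb k = W' * (\<Prod>m\<in>{1..N} - {n}. ts (xs n (Suc 0)) (xs m (1 - k m)))
  \<and> Vb (flip n k) = W' * (\<Prod>m\<in>{1..N} - {n}. ts (xs n 0) (xs m (1 - k m)))"
proof -
let ?A = "%m. xs m (1 - k m)"
obtain W where W: "!!z. Vand X N ((%m. xs m (k m))(n := z)) = W * (\<Prod>m\<in>{1..N} - {n}. ts z (xs m (k m)))"
 using Vand_update[OF n, of "%m. xs m (k m)"] by auto
obtain W' where W': "!!z. Vand X N (?A(n := z)) = W' * (\<Prod>m\<in>{1..N} - {n}. ts z (xs m (1 - k m)))"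
 using Vand_update[OF n, of "%m. xs m (1 - k m)"] by auto
have 1: "(%m. xs m (k m)) = (%m. xs m (k m))(n := xs n 0)" using k by auto
have 2: "(%m. xs m (flip n k m)) = (%m. xs m (k m))(n := xs n (Suc 0))" using k unfolding flip_def by auto
have 3: "?A = ?A(n := xs n (Suc 0))" using k by auto
have 4: "(%m. xs m (1 - flip n k m)) = ?A(n := xs n 0)" using k unfolding flip_def by auto
have "Vk k = W * (\<Prod>m\<in>{1..N} - {n}. ts (xs n 0) (xs m (k m)))" unfolding Vk_def by (subst 1) (rule W)
moreover have "Vk (flip n k) = W * (\<Prod>m\<in>{1..N} - {n}. ts (xs n (Suc 0)) (xs m (k m)))" unfolding Vk_def 2 by (rule W)
moreover have "Vb k = W' * (\<Prod>m\<in>{1..N} - {n}. ts (xs n (Suc 0)) (xs m (1 - k m)))" unfolding Vb_def by (subst 3) (rule W')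
moreover have "Vb (flip n k) = W' * (\<Prod>m\<in>{1..N} - {n}. ts (xs n 0) (xs m (1 - k m)))" unfolding Vb_def 4 by (rule W')
ultimately show ?thesis by blast
qed

lemma mu_step:
 assumes n: "n \<in> {1..N}" and k: "k \<in> confs N" "k n = 0"
 shows "an n * mu (flip n k) * Vk k = kn n * bn n * mu k * Vk (flip n k)"
proof -
let ?I = "{1..N} - {n}"
obtain W W' where W: "Vk k = W * (\<Prod>m\<in>?I. ts (xs n 0) (xs m (k m)))"
 "Vk (flip n k) = W * (\<Prod>m\<in>?I. ts (xs n (Suc 0)) (xs m (k m)))"
 "Vb k = W' * (\<Prod>m\<in>?I. ts (xs n (Suc 0)) (xs m (1 - k m)))"
 "Vb (flip n k) = W' * (\<Prod>m\<in>?I. ts (xs n 0) (xs m (1 - k m)))"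
 using Vk_Vb_update[OF assms] by blast
define w where "w = (\<Prod>m\<in>?I. (- rn m) ^ k m)"
have w0: "(\<Prod>m\<in>{1..N}. (- rn m) ^ k m) = w"
 unfolding w_def using n k(2) by (subst prod.remove[of _ n]) auto
have w1: "(\<Prod>m\<in>{1..N}. (- rn m) ^ flip n k m) = - rn n * w"
 unfolding w_def flip_def using n k(2) by (subst prod.remove[of _ n]) (auto intro!: prod.cong)
have both: "(\<Prod>m\<in>?I. ts z (xs m (1 - k m))) * (\<Prod>m\<in>?I. ts z (xs m (k m))) = (\<Prod>m\<in>?I. ts z (xs m 0) * ts z (xs m (Suc 0)))" for z
 unfolding prod.distrib[symmetric]
proof (rule prod.cong[OF refl])
 fix m assume "m \<in> ?I"
 hence "k m = 0 \<or> k m = Suc 0" using confs_cases[OF k(1)] by blast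
 thus "ts z (xs m (1 - k m)) * ts z (xs m (k m)) = ts z (xs m 0) * ts z (xs m (Suc 0))" by auto
qed
have "an n * mu (flip n k) * Vk k = w * W * W' * (- (an n * rn n) * ((\<Prod>m\<in>?I. ts (xs n 0) (xs m (1 - k m))) * (\<Prod>m\<in>?I. ts (xs n 0) (xs m (k m)))))"
 unfolding mu_def w1 W by (simp add: mult_ac)
also have "... = w * W * W' * (kn n * bn n * ((\<Prod>m\<in>?I. ts (xs n (Suc 0)) (xs m (1 - k m))) * (\<Prod>m\<in>?I. ts (xs n (Suc 0)) (xs m (k m)))))"
 unfolding both balance[OF n] ..
also have "... = kn n * bn n * mu k * Vk (flip n k)"
 unfolding mu_def w0 W by (simp add: mult_ac)
finally show ?thesis .
qed

lemma flip_flip: "k \<in> confs N ==> n \<in> {1..N} ==> flip n (flip n k) = k"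
 using confs_cases[of k n] unfolding flip_def by auto

lemma flip_at: "flip n k n = 1 - k n" unfolding flip_def by simp

lemma mu_balance:
 assumes n: "n \<in> {1..N}" and k: "k \<in> confs N"
 shows "Kc n (k n) * (mu (flip n k) / Vk (flip n k)) = Bc n (k n) * (mu k / Vk k)"
proof -
note V = Vk_nz[OF k] Vk_nz[OF flip_confs[OF k n]]
show ?thesis using confs_cases[OF k n]
proof
 assume 0: "k n = 0"
 show ?thesis using mu_step[OF n k 0] V kn_nz[OF n] unfolding 0 Kc_def Bc_def by (simp add: field_simps)
next
 assume 1: "k n = Suc 0"
 have "flip n k n = 0" unfolding flip_at 1 by simp
 from mu_step[OF n flip_confs[OF k n] this] show ?thesis
  using V unfolding 1 Kc_def Bc_def flip_flip[OF k n] by (simp add: field_simps)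
qed
qed

lemma sep_carrier [simp]: "sk Q \<in> HV" "sb P \<in> HV"
proof -
show "sk Q \<in> HV" unfolding sep_ket_def by (rule finsum_vec_closed) auto
show "sb P \<in> HV" unfolding sep_bra_def
 by (rule smult_carrier_vec[THEN iffD2], rule finsum_vec_closed) auto
qed

lemma br_sep_ket: "k \<in> confs N ==> br k \<bullet> sk Q = Pc Q k * (N0 / V0)"
proof -
assume k: "k \<in> confs N"
have "br k \<bullet> sk Q = (\<Sum>l\<in>confs N. br k \<bullet> ((Pc Q l * Vk l) \<cdot>\<^sub>v kt l))"
 unfolding sep_ket_def Pc_def Vk_def by (rule scalar_prod_finsum(2)[OF finite_confs]) auto
also have "... = (\<Sum>l\<in>confs N. if l = k then Pc Q k * Vk k * (N0 / (Vk k * V0)) else 0)"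
 by (intro sum.cong refl) (auto simp: scalar_prod_smult_distrib[OF br_kt_carrier] orthogonality k)
also have "... = Pc Q k * Vk k * (N0 / (Vk k * V0))" using k finite_confs by simp
finally show ?thesis using Vk_nz[OF k] by simp
qed

lemma sep_bra_scalar:
 "v \<in> HV ==> sb P \<bullet> v = 1 / N0 * (\<Sum>l\<in>confs N. mu l * Pc P l * (br l \<bullet> v))"
proof -
assume v: "v \<in> HV"
define f where "f l = ((\<Prod>n\<in>{1..len X}. (- (bd (eta X / 2 + xi n) / bd (eta X / 2 - xi n))) ^ l n
      * P (xs n (l n))) * Vand X (len X) (%n. xs n (1 - l n))) \<cdot>\<^sub>v br l" for l
have f: "f l = (mu l * Pc P l) \<cdot>\<^sub>v br l" for l
 unfolding f_def mu_def Pc_def Vb_def rn_def prod.distrib by (simp add: mult_ac)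
have fc: "f l \<in> HV" for l unfolding f by simp
have "sb P \<bullet> v = 1 / N0 * (finsum_vec TYPE(complex) dm f (confs N) \<bullet> v)"
 unfolding sep_bra_def f_def[symmetric] by (rule smult_scalar_prod_distrib[OF finsum_vec_closed v]) (use fc in auto)
also have "finsum_vec TYPE(complex) dm f (confs N) \<bullet> v = (\<Sum>l\<in>confs N. f l \<bullet> v)"
 by (rule scalar_prod_finsum(1)[OF finite_confs fc v])
also have "... = (\<Sum>l\<in>confs N. mu l * Pc P l * (br l \<bullet> v))"
 unfolding f by (intro sum.cong refl smult_scalar_prod_distrib[OF br_kt_carrier(1) v])
finally show ?thesis .
qed

lemma sep_bra_kt: "k \<in> confs N ==> sb P \<bullet> kt k = mu k / Vk k * Pc P k / V0"
proof -
assume k: "k \<in> confs N"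
have "(\<Sum>l\<in>confs N. mu l * Pc P l * (br l \<bullet> kt k)) = (\<Sum>l\<in>confs N. if l = k then mu k * Pc P k * (N0 / (Vk k * V0)) else 0)"
 by (intro sum.cong refl) (auto simp: orthogonality k)
also have "... = mu k * Pc P k * (N0 / (Vk k * V0))" using k finite_confs by simp
finally show ?thesis unfolding sep_bra_scalar[OF br_kt_carrier(2)] using N0 by simp
qed

text \<open>The pairing of two separate states, as a symmetric bilinear form.\<close>

theorem sep_pairing_formula:
 "sp P Q = (\<Sum>k\<in>confs N. mu k * Pc P k * Pc Q k) / V0"
proof -
have "(\<Sum>l\<in>confs N. mu l * Pc P l * (br l \<bullet> sk Q)) = (\<Sum>l\<in>confs N. mu l * Pc P l * Pc Q l) * (N0 / V0)"
 unfolding sum_distrib_right by (intro sum.cong refl) (simp add: br_sep_ket)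
thus ?thesis unfolding sep_pairing_def sep_bra_scalar[OF sep_carrier(1)] using N0 by simp
qed

corollary sep_pairing_commute: "sp P Q = sp Q P"
 unfolding sep_pairing_formula by (simp add: mult_ac)

lemma Pc_flip:
 assumes n: "n \<in> {1..N}"
 shows "Pc Q k = Q (xs n (k n)) * (\<Prod>m\<in>{1..N} - {n}. Q (xs m (k m)))"
  "Pc Q (flip n k) = Q (xs n (1 - k n)) * (\<Prod>m\<in>{1..N} - {n}. Q (xs m (k m)))"
 unfolding Pc_def using n by (subst prod.remove[of _ n], auto simp: flip_def)+

theorem eigenstates:
 assumes \<tau>: "even_theta (N + 3) \<tau>"
  and s: "!!r. r < 4 ==> \<tau> (h + hp r) = tr r"
  and x: "!!n j. n \<in> {1..N} ==> j \<le> 1 ==> \<tau> (xs n j) * Q (xs n j) = Bc n j * Q (xs n (1 - j))"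
 shows "T z *\<^sub>v sk Q = \<tau> z \<cdot>\<^sub>v sk Q"
  and "transpose_mat (T z) *\<^sub>v sb Q = \<tau> z \<cdot>\<^sub>v sb Q"
proof -
define v w where "v = sk Q" and "w = sb Q"
have v: "v \<in> HV" and w: "w \<in> HV" unfolding v_def w_def by simp_all
have P: "\<tau> (xs n (k n)) * Pc Q k = Bc n (k n) * Pc Q (flip n k)" if k: "k \<in> confs N" and n: "n \<in> {1..N}" for k n
proof -
 have j: "k n \<le> 1" using confs_cases[OF k n] by auto
 have "\<tau> (xs n (k n)) * Pc Q k = (\<tau> (xs n (k n)) * Q (xs n (k n))) * (\<Prod>m\<in>{1..N} - {n}. Q (xs m (k m)))"
  unfolding Pc_flip(1)[OF n, of Q k] by (simp only: mult.assoc)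
 also have "... = Bc n (k n) * Pc Q (flip n k)"
  unfolding x[OF n j] Pc_flip(2)[OF n, of Q k] by (simp only: mult.assoc)
 finally show ?thesis .
qed
show "T z *\<^sub>v sk Q = \<tau> z \<cdot>\<^sub>v sk Q" unfolding v_def[symmetric]
proof (rule vec_eqI_br)
 show "T z *\<^sub>v v \<in> HV" "\<tau> z \<cdot>\<^sub>v v \<in> HV" using v by auto
 fix k assume k: "k \<in> confs N"
 have bv: "br k' \<bullet> v = Pc Q k' * (N0 / V0)" if "k' \<in> confs N" for k' unfolding v_def by (rule br_sep_ket[OF that])
 have "br k \<bullet> (T z *\<^sub>v v) = (br k \<bullet> v) * \<tau> z"
 proof (rule node_interpolation[OF k sandwich_even[OF br_kt_carrier(1) v] even_theta_cmult[OF \<tau>]])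
  fix r :: nat assume r: "r < 4"
  show "br k \<bullet> (T (h + hp r) *\<^sub>v v) = (br k \<bullet> v) * \<tau> (h + hp r)"
   unfolding T_special_vec[OF r v] s[OF r] scalar_prod_smult_distrib[OF br_kt_carrier(1) v] by (rule mult.commute)
 next
  fix n assume n: "n \<in> {1..N}"
  have "Bc n (k n) * (Pc Q (flip n k) * (N0 / V0)) = (\<tau> (xs n (k n)) * Pc Q k) * (N0 / V0)"
   unfolding P[OF k n] by (simp only: mult.assoc)
  thus "br k \<bullet> (T (xs n (k n)) *\<^sub>v v) = (br k \<bullet> v) * \<tau> (xs n (k n))"
   unfolding br_T_node[OF k n v] bv[OF k] bv[OF flip_confs[OF k n]] by (simp add: mult_ac)
 qed
 thus "br k \<bullet> (T z *\<^sub>v v) = br k \<bullet> (\<tau> z \<cdot>\<^sub>v v)"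
  unfolding scalar_prod_smult_distrib[OF br_kt_carrier(1) v] by (simp add: mult.commute)
qed
show "transpose_mat (T z) *\<^sub>v sb Q = \<tau> z \<cdot>\<^sub>v sb Q" unfolding w_def[symmetric]
proof (rule covec_eqI_kt)
 show "transpose_mat (T z) *\<^sub>v w \<in> HV"
  by (rule mult_mat_vec_carrier[OF _ w]) simp
 show "\<tau> z \<cdot>\<^sub>v w \<in> HV" using w by simp
 fix k assume k: "k \<in> confs N"
 have wk: "w \<bullet> kt k' = mu k' / Vk k' * Pc Q k' / V0" if "k' \<in> confs N" for k' unfolding w_def by (rule sep_bra_kt[OF that])
 have "w \<bullet> (T z *\<^sub>v kt k) = (w \<bullet> kt k) * \<tau> z"
 proof (rule node_interpolation[OF k sandwich_even[OF w br_kt_carrier(2)] even_theta_cmult[OF \<tau>]])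
  fix r :: nat assume r: "r < 4"
  show "w \<bullet> (T (h + hp r) *\<^sub>v kt k) = (w \<bullet> kt k) * \<tau> (h + hp r)"
   unfolding T_special_vec[OF r br_kt_carrier(2)] s[OF r] scalar_prod_smult_distrib[OF w br_kt_carrier(2)] by (rule mult.commute)
 next
  fix n assume n: "n \<in> {1..N}"
  have "Kc n (k n) * (mu (flip n k) / Vk (flip n k) * Pc Q (flip n k) / V0)
    = (Kc n (k n) * (mu (flip n k) / Vk (flip n k))) * Pc Q (flip n k) / V0" by simp
  also have "... = mu k / Vk k * (Bc n (k n) * Pc Q (flip n k)) / V0"
   unfolding mu_balance[OF n k] by simp
  also have "... = (mu k / Vk k * Pc Q k / V0) * \<tau> (xs n (k n))"
   unfolding P[OF k n, symmetric] by simp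
  finally show "w \<bullet> (T (xs n (k n)) *\<^sub>v kt k) = (w \<bullet> kt k) * \<tau> (xs n (k n))"
   unfolding kt_T_node[OF k n] scalar_prod_smult_distrib[OF w br_kt_carrier(2)] wk[OF k] wk[OF flip_confs[OF k n]] .
 qed
 thus "(transpose_mat (T z) *\<^sub>v w) \<bullet> kt k = (\<tau> z \<cdot>\<^sub>v w) \<bullet> kt k"
  unfolding transpose_vec_mult_scalar[OF T_carrier br_kt_carrier(2) w] smult_scalar_prod_distrib[OF w br_kt_carrier(2)]
  by (simp add: mult.commute)
qed
qed

end

section \<open>The functional difference operator\<close>

context xyz
begin

text \<open>The coefficient \<open>A\<close> without its denominator.\<close>

definition An :: "complex => complex" where
 "An z = (-1) ^ N * th1 (2 * z + 2 * h) * bd z * (\<Prod>n\<in>{1..N}. th1 (z - xi n + h) * th1 (- z - xi n - h))"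

lemma A_An: "\<Lambda> z = An z / th1 (2 * z)" unfolding A_bdry_formula An_def by simp

lemma An_hol: "entire An"
 unfolding An_def[abs_def] a_bdry_def th divide_inverse by (intro holomorphic_intros)

lemma a_bdry_plus_pi: "bd (z + \<pi>) = bd z"
proof -
have e: "z + \<pi> - c - d = (z - c - d) + \<pi>" for c d :: complex by simp
have "theta X (z + \<pi> - c - d) / b = -1 * (theta X (z - c - d) / b)" for c d b :: complex
 unfolding th e theta1_plus_pi[OF im] by simp
thus ?thesis unfolding a_bdry_def by (simp only: prod.distrib) (simp add: UNIV_bool)
qed

lemma An_plus_pi: "An (z + \<pi>) = An z"
proof -
have e: "2 * (z + \<pi>) + 2 * h = (2 * z + 2 * h + \<pi>) + \<pi>"
 "z + \<pi> - c + h = (z - c + h) + \<pi>" for c by simp_all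
have m: "th1 (- (z + \<pi>) - c - h) = - th1 (- z - c - h)" for c
proof -
 have e: "(- (z + \<pi>) - c - h) + \<pi> = - z - c - h" by simp
 show ?thesis using theta1_plus_pi[OF im, of "- (z + \<pi>) - c - h"] unfolding e by simp
qed
show ?thesis unfolding An_def a_bdry_plus_pi e m theta1_plus_pi[OF im] by simp
qed

lemma qper_add: "qper (z + w) = qper z * exp (- 2 * \<i> * w)"
 by (rule qper_shift)

lemma a_bdry_plus_tau:
 "bd (z + pt) = qper z ^ 6 * exp (12 * \<i> * h) * exp (4 * \<i> * h * of_int (int N - 2 * int M - 1)) * bd z"
proof -
let ?A = "qper z * exp (2 * \<i> * h)"
have e: "z + pt - c - d = (z - c - d) + pt" for c d :: complex by simp
have q: "qper (z - c - d) = qper z * exp (2 * \<i> * c) * exp (2 * \<i> * d)" for c d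
proof -
 have "z - c - d = z + (- c + - d)" by simp
 thus ?thesis by (simp only: qper_add mult.assoc exp_add[symmetric]) (simp add: alg)
qed
have t: "theta X (z + pt - h - d) / b = (- ?A) * exp (2 * \<i> * d) * (theta X (z - h - d) / b)" for d b
 unfolding th e theta_plus_tau(1)[OF im, folded qper_def] q by simp
have s: "bp (%\<sigma> i. exp (2 * \<i> * (eb \<sigma> i))) = exp (4 * \<i> * h * of_int (int N - 2 * int M - 1))"
proof -
 have "bp (%\<sigma> i. exp (2 * \<i> * (eb \<sigma> i)))
   = exp (2 * \<i> * (\<Sum>\<sigma>\<in>UNIV. \<Sum>i\<in>{1..3}. eb \<sigma> i))"
  unfolding sum_distrib_left by (simp add: exp_sum)
 thus ?thesis unfolding constraint by (simp add: mult_ac)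
qed
have c: "(\<Prod>\<sigma>\<in>(UNIV::bool set). \<Prod>i\<in>{1..3::nat}. - ?A) = qper z ^ 6 * exp (12 * \<i> * h)"
proof -
 have "(\<Prod>\<sigma>\<in>(UNIV::bool set). \<Prod>i\<in>{1..3::nat}. - ?A) = (- ?A) ^ 6"
  by (simp add: UNIV_bool power_add[symmetric])
 also have "... = qper z ^ 6 * exp (2 * \<i> * h) ^ 6" by (simp add: power_mult_distrib)
 also have "exp (2 * \<i> * h) ^ 6 = exp (12 * \<i> * h)" unfolding exp_of_nat_mult[symmetric] by simp
 finally show ?thesis .
qed
show ?thesis unfolding a_bdry_def t prod.distrib s c by (simp only: mult_ac)
qed

text \<open>The quasi-period factor of \<open>th1 (2 * z)\<close>.\<close>

definition Th2 where "Th2 z = qper (2 * z) * qper (2 * z + pt)"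

lemma th1_double_tau: "th1 (2 * (z + pt)) = Th2 z * th1 (2 * z)"
proof -
have e: "2 * (z + pt) = (2 * z + pt) + pt" by simp
show ?thesis unfolding Th2_def e theta_plus_tau(1)[OF im, folded qper_def] by simp
qed

lemma An_plus_tau:
 "An (z + pt) = Th2 z * qper z ^ (2 * (N + 3)) * exp (- (8 * \<i> * h * of_nat M)) * An z"
proof -
let ?A = "- 2 * \<i> * (2 * h)"
let ?B = "- (4 * \<i> * h * of_nat N)"
have t: "th1 (z + pt) = - qper z * th1 z" for z by (rule theta_plus_tau(1)[OF im, folded qper_def])
have 1: "th1 (2 * (z + pt) + 2 * h) = Th2 z * exp (- 8 * \<i> * h) * th1 (2 * z + 2 * h)"
proof -
 have e: "2 * (z + pt) + 2 * h = (2 * z + 2 * h + pt) + pt" by simp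
 have e2: "2 * z + 2 * h + pt = (2 * z + pt) + 2 * h" by simp
 have q: "qper (2 * z + 2 * h) = qper (2 * z) * exp ?A"
  "qper (2 * z + 2 * h + pt) = qper (2 * z + pt) * exp ?A"
  unfolding e2 by (rule qper_add)+
 have q3: "th1 (2 * (z + pt) + 2 * h) = (qper (2 * z) * exp ?A) * (qper (2 * z + pt) * exp ?A) * th1 (2 * z + 2 * h)"
  unfolding e t q by simp
 have q4: "exp ?A * exp ?A = exp (- 8 * \<i> * h)"
  unfolding exp_add[symmetric] by (rule exp_cong) simp
 have "th1 (2 * (z + pt) + 2 * h) = (qper (2 * z) * qper (2 * z + pt)) * (exp ?A * exp ?A) * th1 (2 * z + 2 * h)"
  unfolding q3 by (simp only: mult_ac)
 thus ?thesis unfolding q4 Th2_def .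
qed
have 2: "th1 (z + pt - c + h) * th1 (- (z + pt) - c - h)
  = (qper z ^ 2 * exp (- 4 * \<i> * h)) * (th1 (z - c + h) * th1 (- z - c - h))" for c
proof -
 have e: "z + pt - c + h = (z - c + h) + pt"
  "- (z + pt) - c - h = - ((z + c + h) + pt)" "- z - c - h = - (z + c + h)" by simp_all
 have "qper (z - c + h) * qper (z + c + h) = qper ((z + h) - c) * qper ((z + h) + c)"
  by (simp add: alg)
 also have "... = (qper (z + h)) ^ 2" using qper_mult[of "z + h" c] by (simp add: mult.commute)
 also have "... = qper z ^ 2 * exp (- 4 * \<i> * h)"
 proof -
  have "exp (- 2 * \<i> * h) ^ 2 = exp (- 4 * \<i> * h)" unfolding exp_of_nat_mult[symmetric] by (rule exp_cong) simp
  thus ?thesis unfolding qper_add power_mult_distrib by simp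
 qed
 finally have q: "qper (z - c + h) * qper (z + c + h) = qper z ^ 2 * exp (- 4 * \<i> * h)" .
 show ?thesis unfolding e t th1_minus q[symmetric] by simp
qed
have p: "(\<Prod>n\<in>{1..N}. th1 (z + pt - xi n + h) * th1 (- (z + pt) - xi n - h))
  = qper z ^ (2 * N) * exp ?B * (\<Prod>n\<in>{1..N}. th1 (z - xi n + h) * th1 (- z - xi n - h))"
proof -
 have "exp (- 4 * \<i> * h) ^ N = exp ?B"
  unfolding exp_of_nat_mult[symmetric] by (rule exp_cong) simp
 thus ?thesis unfolding 2 by (simp add: prod.distrib power_mult_distrib power_mult[symmetric])
qed
have x: "exp (- 8 * \<i> * h) * (exp (12 * \<i> * h) * exp (4 * \<i> * h * of_int (int N - 2 * int M - 1))) * exp ?B = exp (- (8 * \<i> * h * of_nat M))"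
 unfolding exp_add[symmetric] by (rule exp_cong) (simp add: alg)
have pw: "qper z ^ (2 * (N + 3)) = qper z ^ 6 * qper z ^ (2 * N)" by (simp add: power_add[symmetric] alg)
show ?thesis unfolding An_def 1 p a_bdry_plus_tau pw x[symmetric] by (simp only: mult_ac)
qed

text \<open>One half of the difference operator; the other half is its image under \<open>z \<mapsto> -z\<close>.\<close>

definition L1 where "L1 W z = An z * W (z - 2 * h)" for W :: "complex => complex"

text \<open>The numerator \<open>L1 W z - L1 W (- z)\<close> is odd and quasi-periodic, so that it vanishes at the zeros of
 \<open>th1 (2 * z)\<close>; the quotient is entire.\<close>

theorem difference_operator:
 assumes W: "even_theta M W"
 obtains g where "even_theta (N + 3 + M) g"
  "!!z. g z * th1 (2 * z) = L1 W z - L1 W (- z)"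
proof -
let ?A = "8 * \<i> * h * of_nat M"
define D where "D z = L1 W z - L1 W (- z)" for z
note WD = even_thetaD[OF W]
have Wh: "entire (%z. W (u z))" if "entire u" for u
 using entire_compose[OF WD(1) that] .
have Dh: "entire D"
 unfolding D_def[abs_def] L1_def by (intro holomorphic_intros Wh entire_compose[OF An_hol])
define Cq where "Cq z = Th2 z * qper z ^ (2 * (N + 3 + M))" for z
have L1t: "L1 W (z + pt) = Cq z * L1 W z" for z
proof -
 have "W (z + pt - 2 * h) = qper (z - 2 * h) ^ (2 * M) * W (z - 2 * h)"
  using WD(4)[of "z - 2 * h"] by (simp add: alg)
 also have "qper (z - 2 * h) ^ (2 * M) = qper z ^ (2 * M) * exp ?A"
 proof -
  have "qper (z - 2 * h) = qper z * exp (4 * \<i> * h)" using qper_add[of z "- 2 * h"] by (simp add: mult_ac)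
  moreover have "exp (4 * \<i> * h) ^ (2 * M) = exp ?A"
   unfolding exp_of_nat_mult[symmetric] by (rule exp_cong) simp
  ultimately show ?thesis by (simp add: power_mult_distrib)
 qed
 finally have w: "W (z + pt - 2 * h) = qper z ^ (2 * M) * exp ?A * W (z - 2 * h)" .
 have "exp (- ?A) * exp ?A = 1" by (simp add: exp_minus)
 hence x: "exp (- ?A) * (exp ?A * y) = y" for y by (metis mult.assoc mult_1_left)
 have "L1 W (z + pt) = Th2 z * (qper z ^ (2 * (N + 3)) * qper z ^ (2 * M)) * (exp (- ?A) * (exp ?A * (An z * W (z - 2 * h))))"
  unfolding L1_def w An_plus_tau by (simp only: mult_ac)
 thus ?thesis unfolding x L1_def Cq_def by (simp add: power_add[symmetric] alg)
qed
have L1p: "L1 W (z + \<pi>) = L1 W z" for z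
 unfolding L1_def An_plus_pi using WD(3)[of "z - 2 * h"] by (simp add: alg)
have Dodd: "D (- z) = - D z" for z unfolding D_def by simp
have Dp: "D (z + \<pi>) = D z" for z
 unfolding D_def L1p using L1p[of "- (z + \<pi>)"] by simp
have Cq_inv: "Cq z * Cq (- (z + pt)) = 1" for z
proof -
 have q1: "qper a * qper b = 1" if "a + b = - \<pi> * \<omega>" for a b
 proof -
  have "- \<i> * \<pi> * \<omega> - 2 * \<i> * a + (- \<i> * \<pi> * \<omega> - 2 * \<i> * b) = - 2 * \<i> * \<pi> * \<omega> - 2 * \<i> * (a + b)"
   by (simp add: alg)
  also have "... = 0" unfolding that by simp
  finally show ?thesis unfolding qper_def exp_add[symmetric] by simp
 qed
 have "Cq z * Cq (- (z + pt)) = (qper (2 * z) * qper (2 * - (z + pt) + pt))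
   * (qper (2 * z + pt) * qper (2 * - (z + pt))) * (qper z * qper (- (z + pt))) ^ (2 * (N + 3 + M))"
  unfolding Cq_def Th2_def power_mult_distrib by (simp only: mult_ac)
 also have "... = 1" by (simp only: q1 add_ac) (simp add: q1 alg)
 finally show ?thesis .
qed
have Dt: "D (z + pt) = Cq z * D z" for z
proof -
 have "L1 W (- z) = Cq (- (z + pt)) * L1 W (- (z + pt))"
  using L1t[of "- (z + pt)"] by simp
 hence "L1 W (- (z + pt)) = Cq z * L1 W (- z)"
  using Cq_inv[of z] by (metis mult.assoc mult_1_left)
 thus ?thesis unfolding D_def L1t by (simp add: alg)
qed
define F where "F z = th1 (2 * z)" for z
have Fh: "entire F" unfolding F_def[abs_def] by (intro holomorphic_intros)
have Fd: "deriv F z ~= 0" if "F z = 0" for z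
proof -
 have "(th1 has_field_derivative deriv th1 (2 * z)) (at (2 * z))"
  using theta1_entire by (metis DERIV_deriv_iff_field_differentiable holomorphic_on_imp_differentiable_at open_UNIV UNIV_I)
 hence "(F has_field_derivative deriv th1 (2 * z) * 2) (at z)" unfolding F_def[abs_def]
  by (intro DERIV_chain2[of th1]) (auto intro!: derivative_eq_intros)
 hence "deriv F z = deriv th1 (2 * z) * 2" by (rule DERIV_imp_deriv)
 thus ?thesis using theta1_simple that unfolding F_def by simp
qed
have F0: "D z = 0" if Fz: "F z = 0" for z
proof -
 obtain r where r: "r < 4" "th1 (z + hp r) = 0" using theta1_double_zero[OF Fz[unfolded F_def]] by blast
 have sp: "D (hp r) = 0"
 proof -
  have z2: "x = 0" if "x = - x" for x :: complex
  proof -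
   have "x + x = 0" using that unfolding eq_neg_iff_add_eq_0 .
   thus ?thesis by simp
  qed
  show ?thesis using r(1)
  proof (cases r rule: r_cases)
   case 0
   thus ?thesis using Dodd[of 0] z2[of "D 0"] by (simp add: hp_def)
  next
   case 1
   have "D (\<pi> / 2) = D (- (\<pi> / 2) + \<pi>)" by (simp add: field_simps)
   hence "D (\<pi> / 2) = - D (\<pi> / 2)" unfolding Dp Dodd .
   from z2[OF this] show ?thesis using 1 by (simp add: hp_def)
  next
   case 2
   let ?s = "pt / 2"
   have c: "Cq (- ?s) = 1" unfolding Cq_def Th2_def qper_def by (simp add: exp_add[symmetric] alg)
   have "- ?s + pt = ?s" by (simp add: field_simps)
   hence "D ?s = - D ?s" using Dt[of "- ?s"] unfolding c Dodd by (simp add: field_simps)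
   from z2[OF this] show ?thesis using 2 by (simp add: hp_def)
  next
   case 3
   let ?s = "(\<pi> + pt) / 2"
   have q: "qper (- ?s) = -1"
   proof -
    have "qper (- ?s) = exp (\<i> * \<pi>)" unfolding qper_def by (rule exp_cong) (simp add: field_simps)
    thus ?thesis by simp
   qed
   have t: "Th2 (- ?s) = 1"
   proof -
    have "Th2 (- ?s) = exp (2 * (2 * (\<i> * \<pi>)))" unfolding Th2_def qper_def exp_add[symmetric]
     by (rule exp_cong) (simp add: field_simps)
    also have "... = exp (\<i> * \<pi>) ^ 4" unfolding exp_of_nat_mult[symmetric] by (rule exp_cong) simp
    finally show ?thesis by simp
   qed
   have c: "Cq (- ?s) = 1" unfolding Cq_def q t by simp
   have e': "(- ?s + pt) + \<pi> = ?s" by (simp add: field_simps)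
   have "D ?s = D (- ?s + pt)" using Dp[of "- ?s + pt"] unfolding e' .
   hence "D ?s = - D ?s" unfolding Dt c Dodd by simp
   from z2[OF this] show ?thesis using 3 by (simp add: hp_def)
  qed
 qed
 have zl: "z - hp r \<in> lat"
 proof -
  have "th1 (z - hp r + 2 * hp r) = 0" using r(2) by (simp add: alg)
  hence "th1 (z - hp r) = 0" using theta1_lat_iff[OF two_hp_lat[OF r(1)], of "z - hp r"] by (simp only:)
  thus ?thesis unfolding theta1_eq_0_iff .
 qed
 then obtain a b :: int where ab: "z - hp r = of_int a * \<pi> + of_int b * pt" unfolding lat_def by blast
 have Cq0: "Cq z ~= 0" for z unfolding Cq_def Th2_def by simp
 have "(D (w + \<pi>) = 0) = (D w = 0)" "(D (w + pt) = 0) = (D w = 0)" for w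
  unfolding Dp Dt using Cq0 by simp_all
 hence "(D (hp r + of_int a * \<pi> + of_int b * pt) = 0) = (D (hp r) = 0)"
  using int_periodic[of "%w. D w = 0" "\<pi>" "hp r" a] int_periodic[of "%w. D w = 0" "pt" "hp r + of_int a * \<pi>" b] by simp
 thus ?thesis using sp ab by (simp add: alg)
qed
obtain g where g: "entire g" "!!z. D z = g z * F z"
 using entire_divide[OF Dh Fh Fd F0] by blast
obtain z0 where z0: "th1 z0 ~= 0" using nz by (elim exE)
have w: "F (z0 / 2) ~= 0" unfolding F_def using z0 by simp
have cancel: "u z = v z" if "entire u" "entire v" "!!z. u z * F z = v z * F z" for u v z
proof (rule entire_eq_off_zeros[OF that(1,2) Fh _ w])
 fix z assume "F z ~= 0"
 thus "u z = v z" using that(3)[of z] by simp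
qed
have Fs: "F (- z) = - F z" "F (z + \<pi>) = F z" "F (z + pt) = Th2 z * F z" for z
proof -
 show "F (- z) = - F z" unfolding F_def using th1_minus[of "2 * z"] by simp
 have e: "2 * (z + \<pi>) = (2 * z + \<pi>) + \<pi>" by simp
 show "F (z + \<pi>) = F z" unfolding F_def e theta1_plus_pi[OF im] by simp
 show "F (z + pt) = Th2 z * F z" unfolding F_def by (rule th1_double_tau)
qed
have "even_theta (N + 3 + M) g"
proof (rule even_thetaI)
 show "entire g" by (rule g)
 have gc: "entire (%z. g (u z))" if "entire u" for u
  by (rule entire_compose[OF g(1) that])
 fix z
 show "g (- z) = g z"
 proof (rule cancel[of "%z. g (- z)" g])
  show "entire (%z. g (- z))" by (intro gc holomorphic_intros)
  show "g (- z) * F z = g z * F z" for z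
  proof -
   have "g (- z) * F z = - (g (- z) * F (- z))" unfolding Fs(1) by simp
   also have "... = - D (- z)" unfolding g(2) ..
   also have "... = D z" unfolding Dodd by (rule minus_minus)
   also have "... = g z * F z" by (rule g(2))
   finally show ?thesis .
  qed
 qed (rule g)
 show "g (z + \<pi>) = g z"
 proof (rule cancel[of "%z. g (z + \<pi>)" g])
  show "entire (%z. g (z + \<pi>))" by (intro gc holomorphic_intros)
  show "g (z + \<pi>) * F z = g z * F z" for z
   using Dp[of z] unfolding g(2) Fs(2) .
 qed (rule g)
 show "g (z + pt) = qper z ^ (2 * (N + 3 + M)) * g z"
 proof (rule cancel[of "%z. g (z + pt)" "%z. qper z ^ (2 * (N + 3 + M)) * g z"])
  show "entire (%z. g (z + pt))" by (intro gc holomorphic_intros)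
  show "entire (%z. qper z ^ (2 * (N + 3 + M)) * g z)"
   unfolding qper_def by (intro holomorphic_intros g)
  fix z
  have t0: "Th2 z ~= 0" unfolding Th2_def by simp
  have "Th2 z * (g (z + pt) * F z) = D (z + pt)" unfolding g(2) Fs(3) by (simp only: mult_ac)
  also have "... = Th2 z * (qper z ^ (2 * (N + 3 + M)) * g z * F z)" unfolding Dt Cq_def g(2)[of z] by (simp only: mult_ac)
  finally show "g (z + pt) * F z = qper z ^ (2 * (N + 3 + M)) * g z * F z" using t0 by simp
 qed
qed
moreover have "g z * th1 (2 * z) = L1 W z - L1 W (- z)" for z using g(2)[of z] unfolding D_def F_def by simp
ultimately show ?thesis by (rule that)
qed

lemma difference_operator_value:
 assumes W: "even_theta M W" and g: "!!z. g z * th1 (2 * z) = L1 W z - L1 W (- z)" and z: "th1 (2 * z) ~= 0"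
 shows "g z = \<Lambda> z * W (z - 2 * h) + \<Lambda> (- z) * W (z + 2 * h)"
proof -
have "W (- z - 2 * h) = W (z + 2 * h)" using even_thetaD(2)[OF W, of "z + 2 * h"] by simp
moreover have "th1 (2 * - z) = - th1 (2 * z)" using th1_minus[of "2 * z"] by simp
ultimately show ?thesis using g[of z] z unfolding L1_def A_An by (simp add: field_simps)
qed

end

section \<open>Linear relations between pairings\<close>

context sov
begin

text \<open>Value of the pairing form with \<open>Q\<close>, for a product over a set of points.\<close>

definition XJ :: "(complex => complex) => (nat => complex) => nat set => complex" where
 "XJ Q p I = (\<Sum>k\<in>confs N. mu k * (\<Prod>n\<in>{1..N}. Q (xs n (k n)) * (\<Prod>i\<in>I. ts (xs n (k n)) (p i))))"

lemma PR_xs_nz: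
 assumes n: "n \<in> {1..N}" and j: "j \<le> 1"
 shows "PR (xs n j) ~= 0"
 unfolding PR_def
proof
assume "(\<Prod>r<4. ts (xs n j) (h + hp r)) = 0"
then obtain r where r: "r < 4" "ts (xs n j) (h + hp r) = 0" by (subst (asm) prod_zero_iff) auto
have "Inl (n, j) \<in> NI" using n j unfolding NI_def by auto
from nodes_distinct(2)[OF this NI_I(3)[OF r(1)]] r(2) show False by (simp add: xi_special_hp)
qed

lemma flip_antisym_sum_zero:
 fixes t :: "(nat => nat) => complex"
 assumes n: "n \<in> {1..N}" and t: "!!k. k \<in> confs N ==> t (flip n k) = - t k"
 shows "(\<Sum>k\<in>confs N. t k) = 0"
proof -
let ?A = "\<Sum>k\<in>confs N. t k"
have "?A = (\<Sum>k\<in>confs N. t (flip n k))"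
 by (rule sum.reindex_bij_witness[of _ "flip n" "flip n"]) (simp_all add: flip_confs[OF _ n] flip_flip[OF _ n])
also have "... = - ?A" unfolding sum_negf[symmetric] by (rule sum.cong[OF refl t])
finally have "?A + ?A = 0" unfolding eq_neg_iff_add_eq_0 .
thus ?thesis by simp
qed

text \<open>The weights of the contribution of a site are symmetric under the exchange of its two shifted
 inhomogeneities.\<close>

lemma site_weight_flip:
 assumes n: "n \<in> {1..N}" and k: "k \<in> confs N"
 shows "mu (flip n k) * Bc n (1 - k n) / (PR (xs n (1 - k n)) * (\<Prod>m\<in>{1..N} - {n}. ts (xs n (1 - k n)) (xs m (k m))))
  = mu k * Bc n (k n) / (PR (xs n (k n)) * (\<Prod>m\<in>{1..N} - {n}. ts (xs n (k n)) (xs m (k m))))"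
proof -
have zero: "mu (flip n k) * Bc n 1 / (PR (xs n 1) * (\<Prod>m\<in>{1..N} - {n}. ts (xs n 1) (xs m (k m))))
 = mu k * Bc n 0 / (PR (xs n 0) * (\<Prod>m\<in>{1..N} - {n}. ts (xs n 0) (xs m (k m))))"
 if k: "k \<in> confs N" and 0: "k n = 0" for k
proof -
 let ?P0 = "\<Prod>m\<in>{1..N} - {n}. ts (xs n 0) (xs m (k m))" and ?P1 = "\<Prod>m\<in>{1..N} - {n}. ts (xs n (Suc 0)) (xs m (k m))"
 obtain W where W: "Vk k = W * ?P0" "Vk (flip n k) = W * ?P1" using Vk_Vb_update[OF n k 0] by blast
 have nz: "W * ?P0 ~= 0" "W * ?P1 ~= 0" using Vk_nz[OF k] Vk_nz[OF flip_confs[OF k n]] unfolding W by auto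
 have s: "an n * mu (flip n k) * (W * ?P0) = kn n * bn n * mu k * (W * ?P1)" using mu_step[OF n k 0] unfolding W .
 have pr: "PR (xs n (Suc 0)) = kn n * PR (xs n 0)" "PR (xs n 0) ~= 0" using kn_PR(1)[OF n] PR_xs_nz[OF n, of 0] by simp_all
 have W0: "W ~= 0" "?P0 ~= 0" "?P1 ~= 0" using nz by auto
 have "W * (an n * mu (flip n k) * ?P0) = W * (kn n * bn n * mu k * ?P1)" using s by (simp only: mult_ac)
 hence "an n * mu (flip n k) * ?P0 = kn n * bn n * mu k * ?P1" using W0(1) by simp
 thus ?thesis unfolding Bc_def One_nat_def pr(1) using W0 pr(2) kn_nz[OF n] by (simp add: field_simps)
qed
show ?thesis using confs_cases[OF k n]
proof
 assume 0: "k n = 0"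
 show ?thesis using zero[OF k 0] unfolding 0 by simp
next
 assume 1: "k n = Suc 0"
 have f0: "flip n k n = 0" unfolding flip_at 1 by simp
 have e: "(\<Prod>m\<in>{1..N} - {n}. ts z (xs m (flip n k m))) = (\<Prod>m\<in>{1..N} - {n}. ts z (xs m (k m)))" for z
  by (intro prod.cong refl) (auto simp: flip_def)
 show ?thesis using zero[OF flip_confs[OF k n] f0] unfolding 1 flip_flip[OF k n] e by simp
qed
qed

text \<open>The assumption \<open>fx\<close> at the shifted inhomogeneities is what \<open>Q \<partial>\<tau>\<^sub>Q/\<partial>q\<^sub>l\<close> satisfies, with \<open>W\<close>
 equal to \<open>\<partial>Q/\<partial>q\<^sub>l\<close>: its right-hand side is antisymmetric in the two points of a site.\<close>

lemma relation_generic: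
 fixes J :: "nat set"
 assumes f: "even_theta (N + 3 + M) f" and J: "finite J" "card J = Suc M"
  and fs: "!!r. r < 4 ==> f (h + hp r) = 0"
  and fx: "!!n j. n \<in> {1..N} ==> j \<le> 1 ==> Q (xs n j) * f (xs n j) = Bc n j * (Q (xs n j) * W (xs n (1 - j)) - Q (xs n (1 - j)) * W (xs n j))"
  and p2: "!!j. j \<in> J ==> th1 (2 * p j) ~= 0"
  and pn: "!!j i. j \<in> J ==> i \<in> NI ==> ts (p j) (nd i) ~= 0"
  and pp: "!!i j. i \<in> J ==> j \<in> J ==> i ~= j ==> ts (p i) (p j) ~= 0"
 shows "(\<Sum>j\<in>J. XJ Q p (J - {j}) * (f (p j) / (PR (p j) * (\<Prod>i\<in>J - {j}. ts (p j) (p i))))) = 0"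
proof -
let ?A = "%j. f (p j) / (PR (p j) * (\<Prod>i\<in>J - {j}. ts (p j) (p i)))"
let ?B = "%n k dn. f (xs n (k n)) / dn k (Inl (Inl (n, k n)))"
let ?C = "%k j. \<Prod>n\<in>{1..N}. Q (xs n (k n)) * (\<Prod>i\<in>J - {j}. ts (xs n (k n)) (p i))"
let ?D = "%n k. \<Prod>m\<in>{1..N} - {n}. ts (xs n (k n)) (xs m (k m))"
let ?E = "%Z dn. \<Sum>k\<in>confs N. \<Sum>j\<in>J. Z k * (f (p j) / dn k (Inr j))"
let ?F = "%n k. Inl (Inl (n, k n))"
let ?G = "%j k. \<Prod>n\<in>{1..N}. ts (p j) (xs n (k n))"
define x where "x = case_sum nd p"
define IK where "IK k = Inl ` nodes k \<union> Inr ` J" for k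
define dn where "dn k i = (\<Prod>l\<in>IK k - {i}. ts (x i) (x l))" for k i
have fin: "finite (IK k)" for k unfolding IK_def using nodes_finite J by auto
have xsn: "Inl (n, k n) \<in> NI" if "k \<in> confs N" "n \<in> {1..N}" for k n
 using nodes_NI[OF that(1)] that(2) unfolding nodes_def by blast
have flipts: "ts (nd i) (p j) ~= 0" if "j \<in> J" "i \<in> NI" for i j
 using pn[OF that] ts_minus[of "nd i" "p j"] by simp
define Zp where "Zp k n = (\<Prod>i\<in>J. ts (xs n (k n)) (p i))" for k n
define Z where "Z k = mu k * (\<Prod>n\<in>{1..N}. Q (xs n (k n)) * Zp k n)" for k
have IKP: "IK k = ((%n. (n, k n)) ` {1..N} <+> {..<4}) <+> J" for k
 unfolding IK_def nodes_def Plus_def image_Un image_image ..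
have card: "card (IK k) = Suc (Suc (N + 3 + M))" for k
 unfolding IKP by (simp add: card_Plus card_image inj_on_def J)
have IKprod: "(\<Prod>l\<in>IK k. g l) = (\<Prod>n\<in>{1..N}. g (?F n k)) * (\<Prod>r<4. g (Inl (Inr r))) * (\<Prod>j\<in>J. g (Inr j))" for g :: "_ => complex" and k
 unfolding IKP by (simp add: prod.Plus J prod.reindex inj_on_def)
have IKsum: "(\<Sum>l\<in>IK k. g l) = (\<Sum>n\<in>{1..N}. g (?F n k)) + (\<Sum>r<4. g (Inl (Inr r))) + (\<Sum>j\<in>J. g (Inr j))" for g :: "_ => complex" and k
 unfolding IKP by (simp add: sum.Plus J sum.reindex inj_on_def)
\<comment> \<open>The factor that \<open>dn\<close> omits is replaced by \<open>1\<close>, so that the product splits over the node types.\<close>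
have dnp: "dn k (Inr j) = PR (p j) * (?G j k) * (\<Prod>i\<in>J - {j}. ts (p j) (p i))" if j: "j \<in> J" for k j
proof -
 define g where "g l = (if l = Inr j then 1 else ts (x (Inr j)) (x l))" for l
 have "dn k (Inr j) = (\<Prod>l\<in>IK k. g l)"
  unfolding dn_def by (rule prod.mono_neutral_cong_left) (auto simp: fin g_def)
 also have "... = (?G j k) * PR (p j) * (\<Prod>i\<in>J. g (Inr i))"
  unfolding IKprod PR_def by (simp add: g_def x_def xi_special_hp)
 also have "(\<Prod>i\<in>J. g (Inr i)) = (\<Prod>i\<in>J - {j}. ts (p j) (p i))"
  by (rule prod.mono_neutral_cong_right) (auto simp: J g_def x_def)
 finally show ?thesis by (simp only: mult_ac)
qed
have dnn: "dn k (?F n k) = PR (xs n (k n)) * (?D n k) * Zp k n" if n: "n \<in> {1..N}" for k n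
proof -
 define g where "g l = (if l = Inl (Inl (n, k n)) then 1 else ts (x (?F n k)) (x l))" for l
 have "dn k (?F n k) = (\<Prod>l\<in>IK k. g l)"
  unfolding dn_def by (rule prod.mono_neutral_cong_left) (auto simp: fin g_def)
 also have "... = (\<Prod>m\<in>{1..N}. g (Inl (Inl (m, k m)))) * PR (xs n (k n)) * Zp k n"
  unfolding IKprod PR_def Zp_def by (simp add: g_def x_def xi_special_hp)
 also have "(\<Prod>m\<in>{1..N}. g (Inl (Inl (m, k m)))) = (?D n k)"
  by (rule prod.mono_neutral_cong_right) (auto simp: g_def x_def)
 finally show ?thesis by (simp only: mult_ac)
qed
have DD: "(\<Sum>n\<in>{1..N}. f (xs n (k n)) / dn k (?F n k)) + (\<Sum>j\<in>J. f (p j) / dn k (Inr j)) = 0" if k: "k \<in> confs N" for k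
proof -
 have x2: "th1 (2 * x i) ~= 0" if "i \<in> IK k" for i
  using that p2 nodes_distinct(1) nodes_NI[OF k] unfolding IK_def x_def by auto
 have xx: "ts (x i) (x l) ~= 0" if "i \<in> IK k" "l \<in> IK k" "i ~= l" for i l
 proof (cases i)
  case a: (Inl a)
  have aN: "a \<in> NI" using that(1) nodes_NI[OF k] unfolding IK_def a by auto
  show ?thesis
  proof (cases l)
   case b: (Inl b)
   have "b \<in> NI" using that(2) nodes_NI[OF k] unfolding IK_def b by auto
   from nodes_distinct(2)[OF aN this] that(3) show ?thesis unfolding x_def a b by simp
  next
   case b: (Inr b)
   have "b \<in> J" using that(2) unfolding IK_def b by auto
   from flipts[OF this aN] show ?thesis unfolding x_def a b by simp
  qed
 next
  case a: (Inr a)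
  have aJ: "a \<in> J" using that(1) unfolding IK_def a by auto
  show ?thesis
  proof (cases l)
   case b: (Inl b)
   have "b \<in> NI" using that(2) nodes_NI[OF k] unfolding IK_def b by auto
   from pn[OF aJ this] show ?thesis unfolding x_def a b by simp
  next
   case b: (Inr b)
   have "b \<in> J" using that(2) unfolding IK_def b by auto
   from pp[OF aJ this] that(3) show ?thesis unfolding x_def a b by simp
  qed
 qed
 have "(\<Sum>i\<in>IK k. f (x i) / dn k i) = 0"
  unfolding dn_def by (rule even_theta_divided_difference[OF f fin card x2 xx])
 thus ?thesis unfolding IKsum using fs by (simp add: x_def xi_special_hp)
qed
\<comment> \<open>The weight \<open>Z k\<close> clears the denominators that connect the sites with the points \<open>p\<close>.\<close>
have Zj: "Z k * (f (p j) / dn k (Inr j)) = (-1) ^ N * (mu k * (?C k j))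
  * (?A j)" if k: "k \<in> confs N" and j: "j \<in> J" for k j
proof -
 define Y where "Y = mu k * (?C k j)"
 define t where "t = (?G j k)"
 have t0: "t ~= 0" unfolding t_def using pn[OF j xsn[OF k]] by (auto simp: prod_zero_iff)
 have "Q (xs n (k n)) * Zp k n = (Q (xs n (k n)) * (\<Prod>i\<in>J - {j}. ts (xs n (k n)) (p i))) * (-1 * ts (p j) (xs n (k n)))" for n
  unfolding Zp_def prod.remove[OF J(1) j] using ts_minus[of "p j" "xs n (k n)"] by simp
 hence "Z k = Y * ((-1) ^ N * t)" unfolding Z_def Y_def t_def
  by (simp only: prod.distrib prod_constant) simp
 thus ?thesis unfolding dnp[OF j] Y_def[symmetric] t_def[symmetric] using t0 by simp
qed
have Zn: "(\<Sum>k\<in>confs N. Z k * (?B n k dn)) = 0" if n: "n \<in> {1..N}" for n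
proof (rule flip_antisym_sum_zero[OF n])
 fix k assume k: "k \<in> confs N"
 define R where "R k = (\<Prod>m\<in>{1..N} - {n}. Q (xs m (k m)) * Zp k m)" for k
 define wq where "wq k = mu k * Bc n (k n) / (PR (xs n (k n)) * (?D n k))" for k
 define a where "a k = Q (xs n (k n)) * W (xs n (1 - k n)) - Q (xs n (1 - k n)) * W (xs n (k n))" for k
 have t: "Z k * (?B n k dn) = wq k * R k * a k" if k: "k \<in> confs N" for k
 proof -
  have zp: "Zp k n ~= 0" unfolding Zp_def using flipts[OF _ xsn[OF k n]] J(1) by (auto simp: prod_zero_iff)
  have kn: "k n \<le> 1" using confs_cases[OF k n] by auto
  have "Z k = mu k * (Q (xs n (k n)) * Zp k n * R k)" unfolding Z_def R_def using n by (subst prod.remove[of _ n]) auto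
  hence "Z k * (?B n k dn)
    = mu k * R k * (Q (xs n (k n)) * f (xs n (k n))) / (PR (xs n (k n)) * (?D n k))"
   unfolding dnn[OF n] using zp by simp
  thus ?thesis unfolding fx[OF n kn] wq_def a_def by simp
 qed
 have "R (flip n k) = R k" unfolding R_def Zp_def by (intro prod.cong refl) (auto simp: flip_def)
 moreover have "wq (flip n k) = wq k"
 proof -
  have e: "(\<Prod>m\<in>{1..N} - {n}. ts z (xs m (flip n k m))) = (\<Prod>m\<in>{1..N} - {n}. ts z (xs m (k m)))" for z
   by (intro prod.cong refl) (auto simp: flip_def)
  show ?thesis unfolding wq_def e flip_at by (rule site_weight_flip[OF n k])
 qed
 moreover have "a (flip n k) = - a k"
 proof -
  have "1 - (1 - k n) = k n" using confs_cases[OF k n] by auto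
  thus ?thesis unfolding a_def flip_at by simp
 qed
 ultimately show "Z (flip n k) * (f (xs n (flip n k n)) / dn (flip n k) (Inl (Inl (n, flip n k n)))) = - (Z k * (?B n k dn))"
  unfolding t[OF k] t[OF flip_confs[OF k n]] by simp
qed
have "0 = (\<Sum>k\<in>confs N. Z k * ((\<Sum>n\<in>{1..N}. f (xs n (k n)) / dn k (?F n k)) + (\<Sum>j\<in>J. f (p j) / dn k (Inr j))))"
 by (rule sum.neutral[symmetric]) (use DD in simp)
also have "... = (\<Sum>k\<in>confs N. \<Sum>n\<in>{1..N}. Z k * (?B n k dn)) + (?E Z dn)"
 unfolding distrib_left sum.distrib sum_distrib_left ..
also have "(\<Sum>k\<in>confs N. \<Sum>n\<in>{1..N}. Z k * (?B n k dn)) = 0"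
 by (subst sum.swap, rule sum.neutral) (use Zn in blast)
also have "(?E Z dn)
  = (-1) ^ N * (\<Sum>j\<in>J. XJ Q p (J - {j}) * (?A j))"
proof -
 have "(?E Z dn)
   = (\<Sum>k\<in>confs N. \<Sum>j\<in>J. (-1) ^ N * ((mu k * (?C k j))
  * (?A j)))"
  by (intro sum.cong refl) (simp only: Zj mult.assoc)
 also have "... = (\<Sum>j\<in>J. (-1) ^ N * (XJ Q p (J - {j}) * (?A j)))"
  unfolding XJ_def by (subst sum.swap) (simp only: sum_distrib_left sum_distrib_right)
 finally show ?thesis unfolding sum_distrib_left .
qed
finally show ?thesis by simp
qed

end

section \<open>Bethe roots\<close>

text \<open>Linearity of the determinant in one row.\<close>

lemma det_row_linear:
 fixes C :: "nat => nat => complex"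
 assumes J: "finite J" and i: "i < m"
 shows "Determinant.det (Matrix.mat m m (%(a, b). if a = i then (\<Sum>j\<in>J. y j * r j b) else C a b))
  = (\<Sum>j\<in>J. y j * Determinant.det (Matrix.mat m m (%(a, b). if a = i then r j b else C a b)))"
proof -
let ?A = "%u p. \<Prod>a = 0..<m. Matrix.mat m m (%(a, b). if a = i then u b else C a b) $$ (a, p a)"
let ?B = "%p. \<Prod>a\<in>{0..<m} - {i}. C a (p a)"
let ?P = "{p. p permutes {0..<m}}"
have d: "Determinant.det (Matrix.mat m m (%(a, b). if a = i then u b else C a b))
  = (\<Sum>p\<in>?P. (signof p * (?B p)) * u (p i))" for u
proof -
 have "Determinant.det (Matrix.mat m m (%(a, b). if a = i then u b else C a b))
   = (\<Sum>p\<in>?P. signof p * (?A u p))"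
  by (rule det_def') simp
 also have "... = (\<Sum>p\<in>?P. (signof p * (?B p)) * u (p i))"
 proof (rule sum.cong[OF refl])
  fix p assume "p \<in> ?P"
  hence p: "p a < m" if "a < m" for a using that permutes_in_image[of p "{0..<m}" a] by auto
  have "(?A u p) = (\<Prod>a = 0..<m. if a = i then u (p a) else C a (p a))"
   by (rule prod.cong[OF refl]) (use p in simp)
  also have "... = u (p i) * (?B p)"
   using i by (subst prod.remove[of _ i]) (auto intro!: prod.cong)
  finally show "signof p * (?A u p)
    = (signof p * (?B p)) * u (p i)" by (simp only: mult_ac)
 qed
 finally show ?thesis .
qed
show ?thesis unfolding d sum_distrib_left
 by (subst sum.swap) (simp only: sum_distrib_left mult_ac)
qed

lemma det_equal_rows:
 fixes r :: "nat => nat => complex"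
 assumes "i < m" "j < m" "i ~= j" "!!b. b < m ==> r i b = r j b"
 shows "Determinant.det (Matrix.mat m m (%(a, b). r a b)) = 0"
 by (rule det_identical_rows[OF _ assms(3,1,2)]) (use assms in \<open>auto intro!: eq_vecI\<close>)

lemma det_holomorphic:
 assumes "!!a b. a < m ==> b < m ==> entire (%s. g s a b)"
 shows "entire (%s. Determinant.det (Matrix.mat m m (%(a, b). g s a b)))"
proof -
have "Determinant.det (Matrix.mat m m (%(a, b). g s a b)) = (\<Sum>p\<in>{p. p permutes {0..<m}}. signof p * (\<Prod>a = 0..<m. g s a (p a)))" for s
proof -
 have "Determinant.det (Matrix.mat m m (%(a, b). g s a b)) = (\<Sum>p\<in>{p. p permutes {0..<m}}. signof p * (\<Prod>a = 0..<m. Matrix.mat m m (%(a, b). g s a b) $$ (a, p a)))"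
  by (rule det_def') simp
 also have "... = (\<Sum>p\<in>{p. p permutes {0..<m}}. signof p * (\<Prod>a = 0..<m. g s a (p a)))"
 proof (intro sum.cong refl arg_cong2[of _ _ _ _ "(*)"] prod.cong)
  fix p a assume "p \<in> {p. p permutes {0..<m}}" "a \<in> {0..<m}"
  hence "a < m" "p a < m" using permutes_in_image[of p "{0..<m}" a] by auto
  thus "Matrix.mat m m (%(a, b). g s a b) $$ (a, p a) = g s a (p a)" by simp
 qed
 finally show ?thesis .
qed
moreover have "entire (%s. \<Sum>p\<in>{p. p permutes {0..<m}}. signof p * (\<Prod>a = 0..<m. g s a (p a)))"
proof (intro holomorphic_intros assms)
 fix p a assume "p \<in> {p. p permutes {0..<m}}" "a \<in> {0..<m}"
 thus "a < m" "p a < m" using permutes_in_image[of p "{0..<m}" a] by auto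
qed
ultimately show ?thesis by simp
qed

context xyz
begin

definition dth1 where "dth1 = deriv th1"

lemma dth1: "(th1 has_field_derivative dth1 z) (at z)"
 unfolding dth1_def using theta1_entire
 by (simp add: holomorphic_on_imp_differentiable_at DERIV_deriv_iff_field_differentiable)

lemma dth1_affine: "((%z. th1 (c * z + b)) has_field_derivative dth1 (c * z + b) * c) (at z)"
 by (rule DERIV_chain2[OF dth1]) (auto intro!: derivative_eq_intros)

lemma dth1_hol: "entire dth1"
 unfolding dth1_def by (rule holomorphic_deriv[OF theta1_entire]) simp

lemma dth1_minus: "dth1 (- z) = dth1 z"
proof -
have "((%z. th1 (- z)) has_field_derivative - dth1 (- z)) (at z)"
 using dth1_affine[of "-1" 0 z] by (simp add: add.commute)
moreover have "((%z. th1 (- z)) has_field_derivative - dth1 z) (at z)"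
 unfolding th1_minus by (intro DERIV_minus dth1)
ultimately show ?thesis using DERIV_unique by fastforce
qed

lemma dth1_plus_pi: "dth1 (z + \<pi>) = - dth1 z"
proof -
have "((%z. th1 (z + \<pi>)) has_field_derivative dth1 (z + \<pi>)) (at z)"
 using dth1_affine[of 1 "\<pi>" z] by (simp add: add.commute)
moreover have "((%z. th1 (z + \<pi>)) has_field_derivative - dth1 z) (at z)"
 unfolding theta1_plus_pi[OF im] by (intro DERIV_minus dth1)
ultimately show ?thesis by (rule DERIV_unique)
qed

lemma dth1_plus_tau: "dth1 (z + pt) = - (qper z * dth1 z) + 2 * \<i> * qper z * th1 z"
proof -
have q: "(qper has_field_derivative - 2 * \<i> * qper z) (at z)"
 unfolding qper_def[abs_def] by (auto intro!: derivative_eq_intros)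
have "((%z. th1 (z + pt)) has_field_derivative dth1 (z + pt)) (at z)"
 using dth1_affine[of 1 "pt" z] by (simp add: add.commute)
moreover have "((%z. th1 (z + pt)) has_field_derivative - (qper z * dth1 z) + 2 * \<i> * qper z * th1 z) (at z)"
proof -
 have "((%z. - (qper z * th1 z)) has_field_derivative - (- 2 * \<i> * qper z * th1 z + dth1 z * qper z)) (at z)"
  by (intro DERIV_minus DERIV_mult q dth1)
 moreover have "th1 (z + pt) = - (qper z * th1 z)" for z
  using theta_plus_tau(1)[OF im, of z, folded qper_def] by simp
 ultimately show ?thesis by (simp add: alg)
qed
ultimately show ?thesis by (rule DERIV_unique)
qed

text \<open>The derivative of \<open>ts z w\<close> in \<open>w\<close>.\<close>

definition dts where "dts z w = th1 (z - w) * dth1 (z + w) - dth1 (z - w) * th1 (z + w)"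

lemma dts: "((%w. ts z w) has_field_derivative dts z w) (at w)"
proof -
have "((%w. th1 (z - w)) has_field_derivative - dth1 (z - w)) (at w)"
 using dth1_affine[of "-1" z w] by (simp add: add.commute)
moreover have "((%w. th1 (z + w)) has_field_derivative dth1 (z + w)) (at w)"
 using dth1_affine[of 1 z w] by (simp add: add.commute)
ultimately have "((%w. th1 (z - w) * th1 (z + w)) has_field_derivative - dth1 (z - w) * th1 (z + w) + dth1 (z + w) * th1 (z - w)) (at w)"
 by (rule DERIV_mult)
thus ?thesis unfolding ts_def dts_def by (simp add: alg)
qed

lemma dts_even_theta: "even_theta 1 (%z. dts z w)"
proof (rule even_thetaI)
show "entire (%z. dts z w)"
 unfolding dts_def by (intro holomorphic_intros entire_compose[OF dth1_hol])
fix z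
have e: "- z - w = - (z + w)" "- z + w = - (z - w)" by simp_all
show "dts (- z) w = dts z w" unfolding dts_def e th1_minus dth1_minus by (simp add: mult.commute)
have e: "z + \<pi> - w = (z - w) + \<pi>" "z + \<pi> + w = (z + w) + \<pi>" by simp_all
show "dts (z + \<pi>) w = dts z w" unfolding dts_def e dth1_plus_pi theta1_plus_pi[OF im] by simp
have e: "z + pt - w = (z - w) + pt" "z + pt + w = (z + w) + pt" by simp_all
have t: "th1 (u + pt) = - (qper u * th1 u)" for u
 using theta_plus_tau(1)[OF im, of u, folded qper_def] by simp
have "dts (z + pt) w = (qper (z + w) * qper (z - w)) * dts z w"
 unfolding dts_def e dth1_plus_tau t by (simp add: alg)
thus "dts (z + pt) w = qper z ^ (2 * 1) * dts z w" unfolding qper_mult by simp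
qed

lemma Qf_ts: "Qf X M p z = (\<Prod>n\<in>{1..M}. ts z (p n))"
 unfolding Qf_def th ..

lemma Qf_even: "even_theta M (Qf X M p)"
 using even_theta_prod[of "{1..M}" "%n z. ts z (p n)"] ts_even_theta
 unfolding Qf_ts[abs_def] by simp

text \<open>The derivative of \<open>Q\<close> in one of its roots.\<close>

definition dQ where "dQ p l z = dts z (p l) * (\<Prod>n\<in>{1..M} - {l}. ts z (p n))"

lemma dQ_even:
 assumes "l \<in> {1..M}"
 shows "even_theta M (dQ p l)"
proof -
have "even_theta (1 + card ({1..M} - {l})) (%z. dts z (p l) * (\<Prod>n\<in>{1..M} - {l}. ts z (p n)))"
 by (intro even_theta_mult dts_even_theta even_theta_prod ts_even_theta) simp
moreover have c: "1 + card ({1..M} - {l}) = M" using assms by simp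
ultimately show ?thesis unfolding c dQ_def[abs_def] by (simp only:)
qed

lemma Qf_upd:
 assumes l: "l \<in> {1..M}"
 shows "Qf X M (p(l := x)) z = ts z x * (\<Prod>n\<in>{1..M} - {l}. ts z (p n))"
proof -
have "Qf X M (p(l := x)) z = ts z ((p(l := x)) l) * (\<Prod>n\<in>{1..M} - {l}. ts z ((p(l := x)) n))"
 unfolding Qf_ts by (rule prod.remove) (use l in auto)
also have "(\<Prod>n\<in>{1..M} - {l}. ts z ((p(l := x)) n)) = (\<Prod>n\<in>{1..M} - {l}. ts z (p n))" by (rule prod.cong) auto
finally show ?thesis by (simp only: fun_upd_same)
qed

lemma dQ: "l \<in> {1..M} ==> ((%x. Qf X M (p(l := x)) z) has_field_derivative dQ p l z) (at (p l))"
 unfolding Qf_upd dQ_def by (rule DERIV_cmult_right[OF dts])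

text \<open>The entire function \<open>A(z) W(z - \<eta>) + A(-z) W(z + \<eta>)\<close>.\<close>

definition gop where
 "gop W = (SOME g. even_theta (N + 3 + M) g \<and> (\<forall>z. g z * th1 (2 * z) = L1 W z - L1 W (- z)))"

lemma gop:
 assumes "even_theta M W"
 shows "even_theta (N + 3 + M) (gop W)" "gop W z * th1 (2 * z) = L1 W z - L1 W (- z)"
proof -
obtain g where "even_theta (N + 3 + M) g" "!!z. g z * th1 (2 * z) = L1 W z - L1 W (- z)"
 using difference_operator[OF assms] by blast
hence "\<exists>g. even_theta (N + 3 + M) g \<and> (\<forall>z. g z * th1 (2 * z) = L1 W z - L1 W (- z))" by blast
from someI_ex[OF this] show "even_theta (N + 3 + M) (gop W)" "gop W z * th1 (2 * z) = L1 W z - L1 W (- z)"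
 unfolding gop_def[symmetric] by blast+
qed

lemma gop_value:
 assumes "even_theta M W" "th1 (2 * z) ~= 0"
 shows "gop W z = \<Lambda> z * W (z - 2 * h) + \<Lambda> (- z) * W (z + 2 * h)"
 by (rule difference_operator_value[OF assms(1) gop(2)[OF assms(1)] assms(2)])

end

context sov
begin

lemma gop_special:
 assumes W: "even_theta M W" and r: "r < 4"
 shows "gop W (h + hp r) = tr r * W (h + hp r)"
proof -
have nz: "th1 (2 * (h + hp r)) ~= 0" using nodes_distinct(1)[OF NI_I(3)[OF r]] by (simp add: xi_special_hp)
have "An (- (h + hp r)) = 0"
proof -
 have e: "2 * - (h + hp r) + 2 * h = - (2 * hp r)" by simp
 have "th1 (2 * hp r) = 0" using two_hp_lat[OF r] theta1_eq_0_iff by blast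
 thus ?thesis unfolding An_def e th1_minus by simp
qed
hence "\<Lambda> (- (h + hp r)) = 0" unfolding A_An by simp
moreover have e: "h + hp r - 2 * h = hp r - h" by simp
ultimately have "gop W (h + hp r) = \<Lambda> (h + hp r) * W (hp r - h)" unfolding gop_value[OF W nz] e by simp
thus ?thesis unfolding even_theta_special[OF W r, of h] tr_def by (simp add: add.commute)
qed

lemma gop_site:
 assumes W: "even_theta M W" and n: "n \<in> {1..N}" and j: "j \<le> 1"
 shows "gop W (xs n j) = Bc n j * W (xs n (1 - j))"
proof -
have nz: "th1 (2 * xs n j) ~= 0"
proof -
 have "Inl (n, j) \<in> NI" using n j unfolding NI_def by auto
 from nodes_distinct(1)[OF this] show ?thesis by simp
qed
have t0: "th1 0 = 0" using th1_minus[of 0] by simp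
have "j = 0 \<or> j = Suc 0" using j by auto
thus ?thesis
proof
 assume 0: "j = 0"
 have "(\<Prod>m\<in>{1..N}. th1 (- (xi n + h) - xi m + h) * th1 (- (- (xi n + h)) - xi m - h)) = 0"
  by (rule prod_zero) (use n t0 in \<open>auto intro!: bexI[of _ n]\<close>)
 hence "\<Lambda> (- (xi n + h)) = 0" unfolding A_An An_def by simp
 moreover have e: "xi n + h - 2 * h = xi n - h" by simp
 ultimately show ?thesis using gop_value[OF W nz] unfolding 0 Bc_def bn_def by (simp add: xi_sh_01 e add.commute)
next
 assume 1: "j = Suc 0"
 have "(\<Prod>m\<in>{1..N}. th1 (xi n - h - xi m + h) * th1 (- (xi n - h) - xi m - h)) = 0"
  by (rule prod_zero) (use n t0 in \<open>auto intro!: bexI[of _ n]\<close>)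
 hence "\<Lambda> (xi n - h) = 0" unfolding A_An An_def by simp
 moreover have e: "xi n - h + 2 * h = xi n + h" "- (xi n - h) = h - xi n" by simp_all
 moreover have "gop W (xi n - h) = \<Lambda> (xi n - h) * W (xi n - h - 2 * h) + \<Lambda> (- (xi n - h)) * W (xi n - h + 2 * h)"
  using gop_value[OF W nz] unfolding 1 xi_sh_01 .
 ultimately have "gop W (xi n - h) = \<Lambda> (h - xi n) * W (xi n + h)" by (simp only:) simp
 thus ?thesis unfolding 1 xi_sh_01 Bc_def an_def by (simp add: xi_sh_01)
qed
qed

end

text \<open>An admissible solution of the Bethe equations.\<close>

locale bethe = sov +
 fixes q :: "nat => complex"
 assumes q2: "!!j. j \<in> {1..M} ==> 2 * q j \<notin> period_lattice X"
  and qq: "!!j k. j \<in> {1..M} ==> k \<in> {1..M} ==> j ~= k ==>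
      q j - q k \<notin> period_lattice X \<and> q j + q k \<notin> period_lattice X"
  and qn: "!!j. j \<in> {1..M} ==> theta_s X (2 * q j) (eta X) ~= 0"
  and bethe: "!!j. j \<in> {1..M} ==>
      A_coef X \<epsilon> (q j) * Qf X M q (q j - eta X) + A_coef X \<epsilon> (- q j) * Qf X M q (q j + eta X) = 0"
begin

abbreviation Q where "Q \<equiv> Qf X M q"

lemma q2': "j \<in> {1..M} ==> th1 (2 * q j) ~= 0"
 using q2[of j] unfolding th theta1_eq_0_iff .

lemma qq': "j \<in> {1..M} ==> k \<in> {1..M} ==> j ~= k ==> ts (q j) (q k) ~= 0"
 using qq[of j k] unfolding th ts_zero_iff by blast

lemma tau_exists: "\<exists>\<tau>. even_theta (N + 3) \<tau> \<and> (\<forall>z. gop Q z = \<tau> z * Q z)"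
proof -
have root: "gop Q (q j) = 0" if j: "j \<in> {1..M}" for j
proof -
 have e: "q j - 2 * h = q j - eta X" "q j + 2 * h = q j + eta X" by simp_all
 show ?thesis unfolding gop_value[OF Qf_even q2'[OF j]] e by (rule bethe[OF j])
qed
have "\<exists>\<tau>. even_theta (N + 3 + (M - n)) \<tau> \<and> (\<forall>z. gop Q z = \<tau> z * (\<Prod>i\<in>{1..n}. ts z (q i)))" if "n \<le> M" for n
 using that
proof (induction n)
 case 0
 show ?case using gop(1)[OF Qf_even] by auto
next
 case (Suc n)
 then obtain \<tau> where \<tau>: "even_theta (N + 3 + (M - n)) \<tau>" "!!z. gop Q z = \<tau> z * (\<Prod>i\<in>{1..n}. ts z (q i))" by auto
 have c: "N + 3 + (M - n) = Suc (N + 3 + (M - Suc n))" using Suc.prems by simp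
 have j: "Suc n \<in> {1..M}" using Suc.prems by simp
 have "(\<Prod>i\<in>{1..n}. ts (q (Suc n)) (q i)) ~= 0"
  using qq'[OF j] Suc.prems by (auto simp: prod_zero_iff)
 hence "\<tau> (q (Suc n)) = 0" using root[OF j] \<tau>(2)[of "q (Suc n)"] by simp
 from even_theta_divide[OF \<tau>(1)[unfolded c] this q2'[OF j]]
 obtain g where g: "even_theta (N + 3 + (M - Suc n)) g" "!!z. \<tau> z = g z * ts z (q (Suc n))" by blast
 have "gop Q z = g z * (\<Prod>i\<in>{1..Suc n}. ts z (q i))" for z
 proof -
  have "(\<Prod>i\<in>{1..Suc n}. ts z (q i)) = ts z (q (Suc n)) * (\<Prod>i\<in>{1..n}. ts z (q i))" by (simp add: mult.commute)
  thus ?thesis unfolding \<tau>(2) g(2) by simp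
 qed
 thus ?case using g(1) by blast
qed
from this[of M] show ?thesis unfolding Qf_ts by simp
qed

text \<open>The eigenvalue, extended to the zeros of \<open>Q\<close>.\<close>

definition tau where "tau = (SOME \<tau>. even_theta (N + 3) \<tau> \<and> (\<forall>z. gop Q z = \<tau> z * Q z))"

lemma tau_even: "even_theta (N + 3) tau" and tau_Q: "gop Q z = tau z * Q z"
 using someI_ex[OF tau_exists] unfolding tau_def[symmetric] by blast+

lemma tau_special: "r < 4 ==> tau (h + hp r) = tr r"
proof -
assume r: "r < 4"
have "Q (h + hp r) ~= 0"
proof
 assume "Q (h + hp r) = 0"
 then obtain j where j: "j \<in> {1..M}" "ts (h + hp r) (q j) = 0" unfolding Qf_ts by (subst (asm) prod_zero_iff) auto
 have "ts (2 * q j) (2 * h) = 0"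
 proof -
  have "PR (q j) = 0" unfolding PR_def using r j(2) ts_minus[of "q j" "h + hp r"] by (intro prod_zero) (auto intro!: bexI[of _ r])
  moreover obtain K where "K ~= 0" "!!z. PR z = K * (th1 (2 * z - 2 * h) * th1 (2 * z + 2 * h))" using PR_formula by blast
  ultimately show ?thesis unfolding ts_def by simp
 qed
 thus False using qn[OF j(1)] unfolding th by simp
qed
thus ?thesis using gop_special[OF Qf_even r, of q] unfolding tau_Q by simp
qed

lemma tau_site: "n \<in> {1..N} ==> j \<le> 1 ==> tau (xs n j) * Q (xs n j) = Bc n j * Q (xs n (1 - j))"
 using gop_site[OF Qf_even, of n j q] unfolding tau_Q .

lemmas tau_eigenstates = eigenstates[OF tau_even tau_special tau_site]

text \<open>The matrix entries \<open>Q(z) \<partial>\<tau>\<^sub>Q(z)/\<partial>q\<^sub>l\<close>, extended to all \<open>z\<close>.\<close>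

definition G where "G z l = gop (dQ q l) z - tau z * dQ q l z"

lemma G_even: "l \<in> {1..M} ==> even_theta (N + 3 + M) (%z. G z l)"
 unfolding G_def by (intro even_theta_diff even_theta_mult gop(1) dQ_even tau_even)

lemma G_special: "l \<in> {1..M} ==> r < 4 ==> G (h + hp r) l = 0"
 unfolding G_def by (simp add: gop_special[OF dQ_even] tau_special)

lemma G_site:
 assumes "l \<in> {1..M}" "n \<in> {1..N}" "j \<le> 1"
 shows "Q (xs n j) * G (xs n j) l = Bc n j * (Q (xs n j) * dQ q l (xs n (1 - j)) - Q (xs n (1 - j)) * dQ q l (xs n j))"
proof -
have "Q (xs n j) * G (xs n j) l = Bc n j * Q (xs n j) * dQ q l (xs n (1 - j)) - (tau (xs n j) * Q (xs n j)) * dQ q l (xs n j)"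
 unfolding G_def gop_site[OF dQ_even[OF assms(1)] assms(2,3)] by (simp add: alg)
thus ?thesis unfolding tau_site[OF assms(2,3)] by (simp add: alg)
qed

end

section \<open>Determinant formula\<close>

text \<open>Entire functions that do not vanish identically.\<close>

definition nzf :: "(complex => complex) => bool" where
 "nzf f \<longleftrightarrow> entire f \<and> (\<exists>z. f z ~= 0)"

lemma nzf_mult:
 assumes "nzf f" "nzf g" shows "nzf (%z. f z * g z)"
proof -
obtain a b where ab: "entire f" "entire g" "f a ~= 0" "g b ~= 0" using assms unfolding nzf_def by auto
have "\<not> (\<forall>z. f z * g z = 0)" using entire_mult_zero[OF ab(1,2) _ ab(4), of a] ab(3) by blast
thus ?thesis unfolding nzf_def using ab by (auto intro!: holomorphic_intros)
qed

lemma nzf_prod: "finite I ==> (!!i. i \<in> I ==> nzf (f i)) ==> nzf (%z. \<Prod>i\<in>I. f i z)"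
proof (induction I rule: finite_induct)
case empty
show ?case by (simp add: nzf_def)
next
case (insert i I)
show ?case unfolding prod.insert[OF insert.hyps] by (rule nzf_mult) (use insert in auto)
qed

context bethe
begin

lemma nzf_theta: "k ~= 0 ==> nzf (%s. th1 (a + k * s))"
 unfolding nzf_def using theta1_avoid[of k k a a]
 by (auto intro!: entire_compose[OF theta1_entire] holomorphic_intros)

lemma nzf_ts:
 assumes "k - l ~= 0" "k + l ~= 0"
 shows "nzf (%s. ts (a + k * s) (b + l * s))"
proof -
have e: "a + k * s - (b + l * s) = (a - b) + (k - l) * s" "a + k * s + (b + l * s) = (a + b) + (k + l) * s" for s
 by (simp_all add: alg)
show ?thesis unfolding ts_def e by (rule nzf_mult; rule nzf_theta; fact)
qed

text \<open>Up to a constant \<open>F p\<close> is the pairing of the separate states of \<open>Qf X M p\<close> and \<open>Q\<close>, and \<open>D p\<close> is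
 the determinant in the numerator; \<open>H p\<close> includes the prefactors of the determinant formula.\<close>

definition F where "F p = (\<Sum>k\<in>confs N. mu k * Pc (Qf X M p) k * Pc Q k)"
definition D where "D p = Determinant.det (Matrix.mat M M (%(i, j). G (p (Suc i)) (Suc j)))"
definition H where "H p = F p * Vand X M p * (\<Prod>j\<in>{1..M}. PR (p j))"

lemma F_XJ: "F p = XJ Q p {1..M}"
 unfolding F_def XJ_def Pc_def Qf_ts[of p] by (simp only: prod.distrib mult_ac)

lemma G_hol: "l \<in> {1..M} ==> entire (%z. G z l)"
 by (rule even_thetaD(1)[OF G_even])

lemma PR_hol: "entire PR"
 unfolding PR_def by (intro holomorphic_intros even_thetaD(1)[OF ts_even_theta])

lemma D_hol: "(!!j. (%s. g s j) holomorphic_on UNIV) ==> entire (%s. D (g s))"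
 unfolding D_def by (rule det_holomorphic) (auto intro!: entire_compose[OF G_hol])

lemma H_hol: "(!!j. (%s. g s j) holomorphic_on UNIV) ==> entire (%s. H (g s))"
 unfolding H_def F_XJ XJ_def Vand_def th ts_def
 by (intro holomorphic_intros entire_compose[OF PR_hol] entire_compose[OF theta1_entire]; assumption)

lemma D_cong: "(!!j. j \<in> {1..M} ==> p j = r j) ==> D p = D r"
 unfolding D_def by (intro arg_cong[of _ _ Determinant.det] cong_mat) auto

lemma H_cong:
 assumes "!!j. j \<in> {1..M} ==> p j = r j" shows "H p = H r"
proof -
have "F p = F r" unfolding F_XJ XJ_def using assms by (auto intro!: sum.cong prod.cong)
moreover have "Vand X M p = Vand X M r" unfolding Vand_def using assms by (auto intro!: prod.cong)
moreover have "(\<Prod>j\<in>{1..M}. PR (p j)) = (\<Prod>j\<in>{1..M}. PR (r j))" using assms by (auto intro!: prod.cong)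
ultimately show ?thesis unfolding H_def by simp
qed

text \<open>The point \<open>p 0\<close> is the one that replaces \<open>p i\<close>. The relation between the \<open>M + 1\<close> rows is inserted
 in row \<open>i\<close> of the determinant, where only the terms of \<open>0\<close> and \<open>i\<close> survive.\<close>

lemma exchange_generic:
 assumes i: "i \<in> {1..M}"
  and p2: "!!j. j \<in> {0..M} ==> th1 (2 * p j) ~= 0"
  and pn: "!!j i. j \<in> {0..M} ==> i \<in> NI ==> ts (p j) (nd i) ~= 0"
  and pp: "!!i j. i \<in> {0..M} ==> j \<in> {0..M} ==> i ~= j ==> ts (p i) (p j) ~= 0"
 shows "H p * D (p(i := p 0)) = H (p(i := p 0)) * D p"
proof -
define J where "J = {0..M}"
define c where "c j = PR (p j) * (\<Prod>m\<in>J - {j}. ts (p j) (p m))" for j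
define y where "y j = XJ Q p (J - {j}) / c j" for j
define I where "I = {1..M} - {i}"
define d where "d u = Determinant.det (Matrix.mat M M (%(a, b). if a = i - 1 then G u (Suc b) else G (p (Suc a)) (Suc b)))" for u
have i': "i - 1 < M" "Suc (i - 1) = i" using i by auto
have rel: "(\<Sum>j\<in>J. y j * G (p j) l) = 0" if l: "l \<in> {1..M}" for l
proof -
 have "(\<Sum>j\<in>J. XJ Q p (J - {j}) * (G (p j) l / (PR (p j) * (\<Prod>i\<in>J - {j}. ts (p j) (p i))))) = 0"
  by (rule relation_generic[OF G_even[OF l] _ _ G_special[OF l] G_site[OF l]]) (use p2 pn pp in \<open>auto simp: J_def\<close>)
 thus ?thesis unfolding y_def c_def by simp
qed
have "0 = (\<Sum>j\<in>J. y j * d (p j))"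
proof -
 have "(\<Sum>j\<in>J. y j * d (p j)) = Determinant.det (Matrix.mat M M (%(a, b). if a = i - 1 then (\<Sum>j\<in>J. y j * G (p j) (Suc b)) else G (p (Suc a)) (Suc b)))"
  unfolding d_def by (rule det_row_linear[OF _ i'(1), symmetric]) (simp add: J_def)
 also have "... = Determinant.det (Matrix.mat M M (%(a, b). if a = i - 1 then (\<Sum>j\<in>{}. y j * G (p j) (Suc b)) else G (p (Suc a)) (Suc b)))"
  by (intro arg_cong[of _ _ Determinant.det] cong_mat) (auto simp: rel)
 also have "... = 0" by (subst det_row_linear[OF _ i'(1)]) auto
 finally show ?thesis ..
qed
also have "... = (\<Sum>j\<in>{0, i}. y j * d (p j))"
proof (rule sum.mono_neutral_right)
 show "\<forall>j\<in>J - {0, i}. y j * d (p j) = 0"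
 proof
  fix j assume j: "j \<in> J - {0, i}"
  have "d (p j) = 0" unfolding d_def
   by (rule det_equal_rows[OF i'(1), of "j - 1"]) (use j i in \<open>auto simp: J_def\<close>)
  thus "y j * d (p j) = 0" by simp
 qed
qed (use i in \<open>auto simp: J_def\<close>)
also have "... = y 0 * d (p 0) + y i * d (p i)" using i by simp
also have "d (p i) = D p" unfolding d_def D_def using i'
 by (intro arg_cong[of _ _ Determinant.det] cong_mat) auto
also have "d (p 0) = D (p(i := p 0))" unfolding d_def D_def using i
 by (intro arg_cong[of _ _ Determinant.det] cong_mat) auto
finally have yy: "y 0 * D (p(i := p 0)) + y i * D p = 0" by simp
define W where "W z = (\<Prod>m\<in>I. ts z (p m))" for z
have "XJ Q p (J - {0}) = F p" unfolding F_XJ J_def by (intro arg_cong[of _ _ "XJ Q p"]) auto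
moreover have "XJ Q p (J - {i}) = F (p(i := p 0))"
proof -
 have e: "J - {i} = insert 0 I" "finite I" "0 \<notin> I" using i unfolding J_def I_def by auto
 have s: "(\<Prod>m\<in>{1..M}. ts z ((p(i := p 0)) m)) = ts z (p 0) * (\<Prod>m\<in>I. ts z (p m))" for z
  using Qf_upd[OF i, of p "p 0" z] unfolding Qf_ts I_def .
 show ?thesis unfolding F_XJ XJ_def e(1) prod.insert[OF e(2,3)] s ..
qed
moreover have "c 0 = PR (p 0) * (ts (p 0) (p i) * W (p 0))"
proof -
 have e: "J - {0} = insert i I" "finite I" "i \<notin> I" using i unfolding J_def I_def by auto
 show ?thesis unfolding c_def e(1) prod.insert[OF e(2,3)] W_def ..
qed
moreover have "c i = PR (p i) * (- ts (p 0) (p i) * W (p i))"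
proof -
 have e: "J - {i} = insert 0 I" "finite I" "0 \<notin> I" using i unfolding J_def I_def by auto
 show ?thesis unfolding c_def e(1) prod.insert[OF e(2,3)] W_def ts_minus[of "p i" "p 0"] ..
qed
ultimately have y: "y 0 = F p / (PR (p 0) * (ts (p 0) (p i) * W (p 0)))" "y i = F (p(i := p 0)) / (PR (p i) * (- ts (p 0) (p i) * W (p i)))"
 unfolding y_def by simp_all
have PRnz: "PR (p j) ~= 0" if "j \<in> J" for j
proof
 assume "PR (p j) = 0"
 then obtain r where r: "r < 4" "ts (p j) (h + hp r) = 0" unfolding PR_def by (subst (asm) prod_zero_iff) auto
 thus False using pn[OF _ NI_I(3)[OF r(1)]] that by (simp add: J_def xi_special_hp)
qed
have Wnz: "W (p j) ~= 0" if "j \<in> {0, i}" for j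
 unfolding W_def using pp that i by (auto simp: prod_zero_iff I_def)
have t0: "ts (p 0) (p i) ~= 0" using pp[of 0 i] i by simp
have J: "0 \<in> J" "i \<in> J" using i unfolding J_def by auto
have FD: "F p * PR (p i) * W (p i) * D (p(i := p 0)) = F (p(i := p 0)) * PR (p 0) * W (p 0) * D p"
 using yy t0 PRnz[OF J(1)] PRnz[OF J(2)] Wnz[of 0] Wnz[of i] unfolding y by (simp add: field_simps)
obtain C where C: "!!z. Vand X M (p(i := z)) = C * W z"
 using Vand_update[OF i, of p] unfolding W_def I_def by auto
have V: "Vand X M p = C * W (p i)" using C[of "p i"] by simp
have P: "(\<Prod>j\<in>{1..M}. PR ((p(i := z)) j)) = PR z * (\<Prod>j\<in>I. PR (p j))" for z
proof -
 have "(\<Prod>j\<in>{1..M}. PR ((p(i := z)) j)) = PR ((p(i := z)) i) * (\<Prod>j\<in>I. PR ((p(i := z)) j))"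
  unfolding I_def by (rule prod.remove) (use i in auto)
 also have "(\<Prod>j\<in>I. PR ((p(i := z)) j)) = (\<Prod>j\<in>I. PR (p j))" by (rule prod.cong) (auto simp: I_def)
 finally show ?thesis by (simp only: fun_upd_same)
qed
have P': "(\<Prod>j\<in>{1..M}. PR (p j)) = PR (p i) * (\<Prod>j\<in>I. PR (p j))" using P[of "p i"] by simp
have "H p * D (p(i := p 0)) = (C * (\<Prod>j\<in>I. PR (p j))) * (F p * PR (p i) * W (p i) * D (p(i := p 0)))"
 unfolding H_def V P' by (simp only: mult_ac)
also have "... = (C * (\<Prod>j\<in>I. PR (p j))) * (F (p(i := p 0)) * PR (p 0) * W (p 0) * D p)"
 unfolding FD ..
also have "... = H (p(i := p 0)) * D p" unfolding H_def C P by (simp only: mult_ac)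
finally show ?thesis .
qed

text \<open>All points are moved along lines of different slopes, which makes the generic position fail only on
 the zeros of an entire function.\<close>

lemma exchange:
 assumes i: "i \<in> {1..M}"
 shows "H p * D (p(i := w)) = H (p(i := w)) * D p"
proof -
let ?A = "%j r s. \<Prod>i\<in>{0..M} - {j}. ts (r s i) (r s j)"
define r where "r s j = (p(0 := w)) j + of_nat (Suc j) * s" for s :: complex and j :: nat
define E where "E s = H (r s) * D ((r s)(i := r s 0)) - H ((r s)(i := r s 0)) * D (r s)" for s
define B where "B s = (\<Prod>j\<in>{0..M}. th1 (2 * r s j) * ((\<Prod>i\<in>NI. ts (r s j) (nd i)) * (?A j r s)))" for s
have r: "entire (%s. r s j)" for j unfolding r_def by (intro holomorphic_intros)
have r': "entire (%s. ((r s)(i := r s 0)) j)" for j using r by (cases "j = i") simp_all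
have Eh: "entire E" unfolding E_def
 by (intro holomorphic_intros H_hol D_hol) (rule r r')+
have "finite NI" unfolding NI_def by simp
have "nzf B" unfolding B_def
proof (intro nzf_prod nzf_mult)
 fix j
 have e: "2 * r s j = 2 * (p(0 := w)) j + (2 * of_nat (Suc j)) * s" for s unfolding r_def by (simp add: alg)
 show "nzf (%s. th1 (2 * r s j))" unfolding e by (rule nzf_theta) (simp del: of_nat_Suc)
 fix i
 show "nzf (%s. ts (r s j) (nd i))"
  using nzf_ts[of "of_nat (Suc j)" 0 "(p(0 := w)) j" "nd i"] unfolding r_def by (simp del: of_nat_Suc)
next
 fix j i assume i: "i \<in> {0..M} - {j}"
 have "of_nat (Suc i) - of_nat (Suc j) ~= (0 :: complex)" using i by simp
 moreover have "of_nat (Suc i) + of_nat (Suc j) ~= (0 :: complex)" unfolding of_nat_add[symmetric] of_nat_eq_0_iff by simp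
 ultimately show "nzf (%s. ts (r s i) (r s j))" unfolding r_def by (rule nzf_ts)
qed (use \<open>finite NI\<close> in auto)
then obtain s0 where B: "entire B" "B s0 ~= 0" unfolding nzf_def by blast
have "E s * B s = 0" for s
proof (cases "B s = 0")
 case False
 have nz: "th1 (2 * r s j) * ((\<Prod>i\<in>NI. ts (r s j) (nd i)) * (?A j r s)) ~= 0" if "j \<in> {0..M}" for j
  using False that unfolding B_def by (subst (asm) prod_zero_iff) auto
 have "H (r s) * D ((r s)(i := r s 0)) = H ((r s)(i := r s 0)) * D (r s)"
 proof (rule exchange_generic[OF i])
  fix j assume j: "j \<in> {0..M}"
  show "th1 (2 * r s j) ~= 0" using nz[OF j] by auto
  have "(\<Prod>i\<in>NI. ts (r s j) (nd i)) ~= 0" "(?A j r s) ~= 0" using nz[OF j] by auto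
  hence "ts (r s j) (nd i) ~= 0" if "i \<in> NI" for i using that \<open>finite NI\<close> by (subst (asm) prod_zero_iff) auto
  thus "ts (r s j) (nd i) ~= 0" if "i \<in> NI" for i using that .
 next
  fix i j assume j: "i \<in> {0..M}" "j \<in> {0..M}" "i ~= j"
  have "(?A j r s) ~= 0" using nz[OF j(2)] by auto
  thus "ts (r s i) (r s j) ~= 0" using j by (subst (asm) prod_zero_iff) auto
 qed
 thus ?thesis unfolding E_def by simp
qed simp
from entire_mult_zero[OF Eh B(1) this B(2), of 0] have "E 0 = 0" .
moreover have "H (r 0) = H p" "D (r 0) = D p" by (rule H_cong D_cong; simp add: r_def)+
moreover have "H ((r 0)(i := r 0 0)) = H (p(i := w))" "D ((r 0)(i := r 0 0)) = D (p(i := w))" by (rule H_cong D_cong; simp add: r_def)+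
ultimately show ?thesis unfolding E_def by simp
qed

theorem determinant_formula:
 assumes Dq: "D q ~= 0"
 shows "H p * D q = H q * D p"
proof -
define mix where "mix t p j = (if j \<in> {1..t} then p j else q j)" for t :: nat and p :: "nat => complex" and j
have main: "H (mix t p) * D q = H q * D (mix t p)" if "t \<le> M" for t p
 using that
proof (induction t arbitrary: p)
 case 0
 have "mix 0 p = q" unfolding mix_def by auto
 thus ?case by simp
next
 case (Suc t)
 \<comment> \<open>\<open>D\<close> may vanish at the mixed points, so the first \<open>t\<close> points move along a line from the Bethe roots,
  where \<open>D\<close> does not vanish by assumption.\<close>
 define a where "a s = mix t (%j. q j + s * (p j - q j))" for s
 define b where "b s = (a s)(Suc t := p (Suc t))" for s
 have i: "Suc t \<in> {1..M}" using Suc.prems by simp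
 have ah: "entire (%s. a s j)" for j
  unfolding a_def mix_def by (cases "j \<in> {1..t}") (auto intro!: holomorphic_intros)
 have bh: "entire (%s. b s j)" for j
  unfolding b_def using ah by (cases "j = Suc t") simp_all
 have z: "(H (b s) * D q - H q * D (b s)) * D (a s) = 0" for s
 proof -
  have 1: "H (a s) * D q = H q * D (a s)" unfolding a_def by (rule Suc.IH) (use Suc.prems in simp)
  have 2: "H (a s) * D (b s) = H (b s) * D (a s)" unfolding b_def by (rule exchange[OF i])
  have "(H (b s) * D q - H q * D (b s)) * D (a s) = (H (b s) * D (a s)) * D q - (H q * D (a s)) * D (b s)"
   by (simp add: alg)
  thus ?thesis unfolding 1[symmetric] 2[symmetric] by (simp add: alg)
 qed
 have "a 0 = q" unfolding a_def mix_def by auto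
 hence a0: "D (a 0) ~= 0" using Dq by simp
 have "H (b 1) * D q - H q * D (b 1) = 0"
  by (rule entire_mult_zero[OF _ D_hol[OF ah] z a0]) (intro holomorphic_intros H_hol D_hol bh)+
 moreover have "b 1 = mix (Suc t) p" unfolding b_def a_def mix_def by (auto simp: fun_eq_iff)
 ultimately show ?case by simp
qed
have "H (mix M p) = H p" "D (mix M p) = D p" by (rule H_cong D_cong; simp add: mix_def)+
thus ?thesis using main[of M p] by simp
qed

end

section \<open>Matrix elements\<close>

context bethe
begin

text \<open>The logarithmic derivative of the theta function.\<close>

definition lg where "lg z = dth1 z / th1 z"

lemma dQ_log:
 assumes l: "l \<in> {1..M}" and z: "Q z ~= 0"
 shows "dQ q l z = Q z * (lg (z + q l) - lg (z - q l))"
proof -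
have e: "Q z = ts z (q l) * (\<Prod>n\<in>{1..M} - {l}. ts z (q n))" using Qf_upd[OF l, of q "q l" z] by simp
hence "th1 (z - q l) ~= 0" "th1 (z + q l) ~= 0" using z unfolding ts_def by auto
hence "dts z (q l) = ts z (q l) * (lg (z + q l) - lg (z - q l))"
 unfolding dts_def ts_def lg_def by (simp add: field_simps)
thus ?thesis unfolding dQ_def e by simp
qed

lemma t_fun_lg: "t_fun X z = lg (z - h) - lg (z + h)" and K_fun_lg: "K_fun X z = lg (z - 2 * h) - lg (z + 2 * h)"
 unfolding t_fun_def K_fun_def lg_def th dth1_def by simp_all

lemma K_fun_t_fun: "K_fun X z = t_fun X (z + eta X / 2) + t_fun X (z - eta X / 2)"
 unfolding t_fun_lg K_fun_lg by (simp add: alg)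

lemma tauQ_derivative:
 assumes l: "l \<in> {1..M}" and z: "th1 (2 * z) ~= 0" "Q z ~= 0"
 shows "((%x. tauQ X \<epsilon> M (q(l := x)) z) has_field_derivative G z l / Q z) (at (q l))"
proof -
have u: "q(l := q l) = q" by simp
have n: "((%x. \<Lambda> z * Qf X M (q(l := x)) (z - eta X) + \<Lambda> (- z) * Qf X M (q(l := x)) (z + eta X))
  has_field_derivative \<Lambda> z * dQ q l (z - eta X) + \<Lambda> (- z) * dQ q l (z + eta X)) (at (q l))"
 by (intro DERIV_add DERIV_cmult dQ l)
have v: "\<Lambda> z * Q (z - eta X) + \<Lambda> (- z) * Q (z + eta X) = tau z * Q z"
 unfolding tau_Q[symmetric] gop_value[OF Qf_even z(1)] by simp
have w: "\<Lambda> z * dQ q l (z - eta X) + \<Lambda> (- z) * dQ q l (z + eta X) = gop (dQ q l) z"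
 unfolding gop_value[OF dQ_even[OF l] z(1)] by simp
have "((%x. tauQ X \<epsilon> M (q(l := x)) z) has_field_derivative
  (gop (dQ q l) z * Q z - tau z * Q z * dQ q l z) / (Q z * Q z)) (at (q l))"
 using DERIV_divide[OF n dQ[OF l, of q z]] z(2) unfolding u v w tauQ_def by simp
moreover have "(gop (dQ q l) z * Q z - tau z * Q z * dQ q l z) / (Q z * Q z) = G z l / Q z"
 unfolding G_def using z(2) by (simp add: field_simps)
ultimately show ?thesis by simp
qed

lemma S_entry_G: "l \<in> {1..M} ==> th1 (2 * z) ~= 0 ==> Q z ~= 0 ==> S_entry X \<epsilon> M q z l = G z l"
 unfolding S_entry_def using DERIV_imp_deriv[OF tauQ_derivative[of l z]] by simp

lemma S_entry_explicit_G:
 assumes l: "l \<in> {1..M}" and z: "th1 (2 * z) ~= 0" "Q z ~= 0" "Q (z - eta X) ~= 0" "Q (z + eta X) ~= 0"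
 shows "S_entry_explicit X \<epsilon> M q z l = G z l"
proof -
define r where "r z = lg (z + q l) - lg (z - q l)" for z
have t: "t_fun X (z + q l - eta X / 2) - t_fun X (z - q l - eta X / 2) = r (z - eta X) - r z"
 "t_fun X (z + q l + eta X / 2) - t_fun X (z - q l + eta X / 2) = r z - r (z + eta X)"
 unfolding t_fun_lg r_def by (simp_all add: alg)
have d: "dQ q l (z - eta X) = Q (z - eta X) * r (z - eta X)" "dQ q l (z + eta X) = Q (z + eta X) * r (z + eta X)" "dQ q l z = Q z * r z"
 unfolding r_def by (intro dQ_log l z)+
have "gop (dQ q l) z = \<Lambda> z * dQ q l (z - eta X) + \<Lambda> (- z) * dQ q l (z + eta X)"
 unfolding gop_value[OF dQ_even[OF l] z(1)] by simp
moreover have "tau z * Q z = \<Lambda> z * Q (z - eta X) + \<Lambda> (- z) * Q (z + eta X)"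
 unfolding tau_Q[symmetric] gop_value[OF Qf_even z(1)] by simp
hence "tau z * dQ q l z = (\<Lambda> z * Q (z - eta X) + \<Lambda> (- z) * Q (z + eta X)) * r z" unfolding d by simp
ultimately show ?thesis unfolding S_entry_explicit_def t G_def d by (simp add: alg)
qed

lemma nzf_Q: "nzf Q"
 unfolding Qf_ts
proof (intro nzf_prod)
fix n show "nzf (%z. ts z (q n))" using nzf_ts[of 1 0 0 "q n"] by simp
qed simp

lemma S_entry_tendsto:
 assumes i: "i \<in> {1..M}" and l: "l \<in> {1..M}"
 shows "((%z. S_entry X \<epsilon> M q z l) \<longlongrightarrow> G (q i) l) (at (q i))"
proof (rule Lim_transform_eventually)
have "continuous_on UNIV (%z. G z l)" by (rule holomorphic_on_imp_continuous_on[OF G_hol[OF l]])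
thus "((%z. G z l) \<longlongrightarrow> G (q i) l) (at (q i))" by (simp add: continuous_on_def)
obtain b where b: "entire Q" "Q b ~= 0" using nzf_Q unfolding nzf_def by blast
have 1: "\<forall>\<^sub>F z in at (q i). Q z ~= 0 \<and> z \<in> UNIV" by (rule non_zero_neighbour_alt[of _ _ _ b]) (use b in auto)
have h2: "entire (%z. th1 (2 * z))" by (intro entire_compose[OF theta1_entire] holomorphic_intros)
have 2: "\<forall>\<^sub>F z in at (q i). th1 (2 * z) ~= 0 \<and> z \<in> UNIV"
 by (rule non_zero_neighbour_alt[of _ _ _ "q i"]) (use h2 q2'[OF i] in auto)
show "\<forall>\<^sub>F z in at (q i). G z l = S_entry X \<epsilon> M q z l"
 using 1 2 by eventually_elim (simp add: S_entry_G[OF l])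
qed

lemma SQQ_entry_G: "i \<in> {1..M} ==> l \<in> {1..M} ==> SQQ_entry X \<epsilon> M q i l = G (q i) l"
 unfolding SQQ_entry_def by (rule tendsto_Lim[OF _ S_entry_tendsto]) simp_all

lemma \<Lambda>_differentiable: "th1 (2 * z) ~= 0 ==> \<Lambda> field_differentiable at z"
proof -
assume z: "th1 (2 * z) ~= 0"
have "(%z. An z / th1 (2 * z)) field_differentiable at z"
 by (intro field_differentiable_divide z; rule holomorphic_on_imp_differentiable_at[of _ UNIV])
  (auto intro!: entire_compose[OF theta1_entire] holomorphic_intros An_hol)
thus ?thesis unfolding A_An[abs_def] .
qed

lemma tau_eigen:
 "T z *\<^sub>v sk Q = tau z \<cdot>\<^sub>v sk Q"
 "transpose_mat (T z) *\<^sub>v sb Q = tau z \<cdot>\<^sub>v sb Q"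
 by (rule eigenstates[of tau Q, OF tau_even tau_special tau_site]; assumption)+

text \<open>At a Bethe root the derivative of \<open>\<tau> Q = a + b\<close> only involves the derivative of \<open>Q\<close>, which is
 up to the sign its derivative in the root.\<close>

lemma SQQ_explicit_G:
 assumes i: "i \<in> {1..M}" and l: "l \<in> {1..M}" and nz: "\<Lambda> (- q i) * Q (q i + eta X) ~= 0"
 shows "SQQ_explicit X \<epsilon> M q i l = G (q i) l"
proof -
define a b where "a \<mu> = \<Lambda> \<mu> * Q (\<mu> - eta X)" and "b \<mu> = \<Lambda> (- \<mu>) * Q (\<mu> + eta X)" for \<mu>
define u where "u = b (q i)"
have u: "u ~= 0" "a (q i) = - u" using nz bethe[OF i] unfolding u_def a_def b_def by (simp_all add: eq_neg_iff_add_eq_0)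
have t2: "th1 (2 * q i) ~= 0" by (rule q2'[OF i])
have t2': "th1 (2 * - q i) ~= 0" using t2 th1_minus[of "2 * q i"] by simp
have Qh: "entire Q" by (rule even_thetaD(1)[OF Qf_even])
have Qd: "(%z. Q (z + c)) field_differentiable at z" for c z
 by (rule holomorphic_on_imp_differentiable_at[of _ UNIV]) (auto intro!: entire_compose[OF Qh] holomorphic_intros)
have "a field_differentiable at (q i)" unfolding a_def
 using field_differentiable_mult[OF \<Lambda>_differentiable[OF t2] Qd[of "- eta X"]] by simp
then obtain a' where a': "(a has_field_derivative a') (at (q i))" unfolding field_differentiable_def by blast
have "(%\<mu>. \<Lambda> (- \<mu>)) field_differentiable at (q i)"
 using field_differentiable_compose[of "%z. - z" "q i" \<Lambda>, OF field_differentiable_minus[OF field_differentiable_ident] \<Lambda>_differentiable[OF t2']]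
 unfolding o_def .
from field_differentiable_mult[OF this Qd[of "eta X"]] have "b field_differentiable at (q i)" unfolding b_def .
then obtain b' where b': "(b has_field_derivative b') (at (q i))" unfolding field_differentiable_def by blast
have f: "((%\<mu>. a \<mu> / b \<mu>) has_field_derivative (a' + b') / u) (at (q i))"
proof -
 have "((%\<mu>. a \<mu> / b \<mu>) has_field_derivative (a' * u + u * b') / (u * u)) (at (q i))"
  using DERIV_divide[OF a' b'] u unfolding u_def[symmetric] by simp
 moreover have "(a' * u + u * b') / (u * u) = (a' + b') / u" using u(1) by (simp add: field_simps)
 ultimately show ?thesis by (simp only:)
qed
have dQi: "tau (q i) * dQ q i (q i) = - (a' + b')"
proof -
 have t0: "th1 0 = 0" using th1_minus[of 0] by simp
 define Pi where "Pi z = (\<Prod>n\<in>{1..M} - {i}. ts z (q n))" for z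
 have Ph: "entire Pi" unfolding Pi_def by (intro holomorphic_intros even_thetaD(1)[OF ts_even_theta])
 then obtain P' where P': "(Pi has_field_derivative P') (at (q i))"
  using holomorphic_on_imp_differentiable_at[OF Ph, of "q i"] unfolding field_differentiable_def by auto
 have "((%z. th1 (z - q i) * th1 (z + q i)) has_field_derivative dth1 0 * th1 (2 * q i) + dth1 (2 * q i) * th1 0) (at (q i))"
  using DERIV_mult[OF dth1_affine[of 1 "- q i" "q i"] dth1_affine[of 1 "q i" "q i"]] by simp
 hence t': "((%z. ts z (q i)) has_field_derivative dth1 0 * th1 (2 * q i)) (at (q i))" unfolding ts_def t0 by simp
 have Qe: "Q z = ts z (q i) * Pi z" for z using Qf_upd[OF i, of q "q i" z] unfolding Pi_def by simp
 have "(Q has_field_derivative dth1 0 * th1 (2 * q i) * Pi (q i)) (at (q i))"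
  unfolding Qe[abs_def] using DERIV_mult[OF t' P'] by simp
 moreover have dq: "dQ q i (q i) = - (dth1 0 * th1 (2 * q i) * Pi (q i))"
  unfolding dQ_def dts_def Pi_def by (simp add: t0)
 ultimately have Q': "(Q has_field_derivative - dQ q i (q i)) (at (q i))" by simp
 obtain t' where t': "(tau has_field_derivative t') (at (q i))"
  using holomorphic_on_imp_differentiable_at[OF even_thetaD(1)[OF tau_even], of "q i"] unfolding field_differentiable_def by auto
 have Q0: "Q (q i) = 0" unfolding Qe by simp
 have 1: "((%z. tau z * Q z) has_field_derivative - (tau (q i) * dQ q i (q i))) (at (q i))"
  using DERIV_mult[OF t' Q'] unfolding Q0 by (simp add: mult.commute)
 have 2: "((%z. a z + b z) has_field_derivative a' + b') (at (q i))" by (rule DERIV_add[OF a' b'])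
 have h2: "continuous_on UNIV (%z. th1 (2 * z))"
  by (intro holomorphic_on_imp_continuous_on entire_compose[OF theta1_entire] holomorphic_intros)
 have op: "open {z. th1 (2 * z) ~= 0}" by (rule open_Collect_neq[OF h2 continuous_on_const])
 have "((%z. tau z * Q z) has_field_derivative a' + b') (at (q i))"
 proof (rule has_field_derivative_transform_within_open[OF 2 op])
  fix z assume "z \<in> {z. th1 (2 * z) ~= 0}"
  thus "a z + b z = tau z * Q z"
   using gop_value[OF Qf_even, of z q] unfolding tau_Q a_def b_def by simp
 qed (use t2 in simp)
 from DERIV_unique[OF 1 this] show ?thesis unfolding minus_equation_iff[of "tau (q i) * dQ q i (q i)"] by (rule sym)
qed
have Qnz: "Q (q i - eta X) ~= 0" "Q (q i + eta X) ~= 0" using u unfolding u_def a_def b_def by auto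
have "gop (dQ q l) (q i) = \<Lambda> (q i) * dQ q l (q i - eta X) + \<Lambda> (- q i) * dQ q l (q i + eta X)"
 unfolding gop_value[OF dQ_even[OF l] t2] by simp
also have "... = a (q i) * (lg (q i - eta X + q l) - lg (q i - eta X - q l)) + u * (lg (q i + eta X + q l) - lg (q i + eta X - q l))"
 unfolding dQ_log[OF l Qnz(1)] dQ_log[OF l Qnz(2)] a_def u_def b_def by simp
also have "... = u * (K_fun X (q i - q l) - K_fun X (q i + q l))"
 unfolding u(2) K_fun_lg by (simp add: alg)
finally have g: "gop (dQ q l) (q i) = u * (K_fun X (q i - q l) - K_fun X (q i + q l))" .
have d: "tau (q i) * dQ q l (q i) = (if i = l then - (a' + b') else 0)"
proof (cases "i = l")
 case True
 thus ?thesis using dQi by simp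
next
 case False
 have "(\<Prod>n\<in>{1..M} - {l}. ts (q i) (q n)) = 0" by (rule prod_zero) (use False i in \<open>auto intro!: bexI[of _ i]\<close>)
 thus ?thesis using False unfolding dQ_def by simp
qed
have ff: "a (q i) / b (q i) = -1" using u unfolding u_def[symmetric] by simp
have "SQQ_explicit X \<epsilon> M q i l = u * (- (if i = l then deriv (%\<mu>. a \<mu> / b \<mu>) (q i) / (a (q i) / b (q i)) else 0) + K_fun X (q i - q l) - K_fun X (q i + q l))"
 unfolding SQQ_explicit_def Let_def u_def a_def b_def ..
also have "... = G (q i) l"
 unfolding G_def g d ff DERIV_imp_deriv[OF f] using u(1) by (cases "i = l") (simp_all add: field_simps)
finally show ?thesis .
qed

section \<open>Ratio of pairings\<close>

lemma pairing_F: "sp (Qf X M p) Q = F p / V0"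
 unfolding sep_pairing_formula F_def ..

lemma pairing_continuous: "continuous_on UNIV (%p. sp (Qf X M p) Q)"
 unfolding pairing_F F_XJ XJ_def ts_def
 by (intro continuous_intros continuous_on_compose2[OF holomorphic_on_imp_continuous_on[OF theta1_entire]]
   continuous_on_product_coordinates) (simp_all add: V0_nz)

lemma det_ratio_pairing:
 assumes p: "p \<in> regular_points X M q" and nz: "sp Q Q ~= 0" and dq: "Determinant.det (SQQ_mat X \<epsilon> M q) ~= 0"
 shows "sp (Qf X M p) Q / sp Q Q = det_ratio X \<epsilon> M q p"
proof -
have p': "Vand X M p ~= 0" "!!i. i \<in> {1..M} ==> ts (2 * p i) (eta X) ~= 0"
 "!!i. i \<in> {1..M} ==> th1 (2 * p i) ~= 0" "!!i. i \<in> {1..M} ==> Q (p i) ~= 0"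
 using p unfolding regular_points_def th by auto
have Dq: "Determinant.det (SQQ_mat X \<epsilon> M q) = D q"
 unfolding SQQ_mat_def D_def by (intro arg_cong[of _ _ Determinant.det] cong_mat) (auto simp: SQQ_entry_G)
have Dp: "Determinant.det (S_mat X \<epsilon> M q p) = D p"
 unfolding S_mat_def D_def by (intro arg_cong[of _ _ Determinant.det] cong_mat) (auto simp: S_entry_G p')
obtain K where K: "K ~= 0" "!!z. PR z = K * (th1 (2 * z - 2 * h) * th1 (2 * z + 2 * h))" using PR_formula by blast
have pr: "(\<Prod>j\<in>{1..M}. PR (r j)) = K ^ M * (\<Prod>j\<in>{1..M}. ts (2 * r j) (eta X))" for r
 unfolding K(2) ts_def prod.distrib by simp
define a b where "a = (\<Prod>j\<in>{1..M}. ts (2 * p j) (eta X))" and "b = (\<Prod>j\<in>{1..M}. ts (2 * q j) (eta X))"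
have a: "a ~= 0" unfolding a_def using p'(2) by (auto simp: prod_zero_iff)
have "F p * Vand X M p * (K ^ M * a) * D q = F q * Vand X M q * (K ^ M * b) * D p"
 using determinant_formula[of p] dq unfolding Dq H_def pr a_def b_def by simp
hence "K ^ M * (F p * Vand X M p * a * D q) = K ^ M * (F q * Vand X M q * b * D p)" by (simp only: mult_ac)
hence e: "F p * Vand X M p * a * D q = F q * Vand X M q * b * D p" using K(1) by simp
have Fq: "F q ~= 0" using nz unfolding pairing_F by auto
have "sp (Qf X M p) Q / sp Q Q = F p / F q"
 unfolding pairing_F using V0_nz by simp
also have "... = Vand X M q / Vand X M p * (b / a) * (D p / D q)"
 using e Fq a p'(1) dq unfolding Dq by (simp add: field_simps)
also have "... = det_ratio X \<epsilon> M q p"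
 unfolding det_ratio_def Dq Dp th a_def b_def prod_dividef ..
finally show ?thesis .
qed

lemma det_ratio_tendsto:
 assumes nz: "sp Q Q ~= 0" and dq: "Determinant.det (SQQ_mat X \<epsilon> M q) ~= 0"
 shows "(det_ratio X \<epsilon> M q \<longlongrightarrow> sp (Qf X M p) Q / sp Q Q) (at p within regular_points X M q)"
proof (rule Lim_transform_eventually)
have "((%p. sp (Qf X M p) Q) \<longlongrightarrow> sp (Qf X M p) Q) (at p)"
 using pairing_continuous unfolding continuous_on_def by simp
hence "((%p. sp (Qf X M p) Q) \<longlongrightarrow> sp (Qf X M p) Q) (at p within regular_points X M q)"
 by (rule tendsto_within_subset) simp
thus "((%p. sp (Qf X M p) Q / sp Q Q) \<longlongrightarrow> sp (Qf X M p) Q / sp Q Q) (at p within regular_points X M q)"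
 by (intro tendsto_divide tendsto_const nz)
show "\<forall>\<^sub>F r in at p within regular_points X M q. sp (Qf X M r) Q / sp Q Q = det_ratio X \<epsilon> M q r"
 unfolding eventually_at_filter using det_ratio_pairing[OF _ nz dq] by (simp add: eventually_mono)
qed

lemma sep_nonzero:
 assumes "sp P W ~= 0"
 shows "sk W ~= 0\<^sub>v dm" "sb P ~= 0\<^sub>v dm"
proof -
have c: "sk W \<in> HV" "sb P \<in> HV" by simp_all
show "sk W ~= 0\<^sub>v dm" "sb P ~= 0\<^sub>v dm"
 using assms c unfolding sep_pairing_def by auto
qed

lemma transfer_T:
 assumes "theta X (2 * z - eta X) ~= 0" "theta X (2 * z + eta X) ~= 0"
 shows "transfer X z = T z"
 by (rule transfer_eq_TM[OF refl bdry_nz assms])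

end

theorem theorem4p1:
  fixes X :: xyz_chain and \<epsilon> :: signs
    and S R :: "complex vec" and \<N>\<^sub>0 :: complex
    and M :: nat and q :: "nat \<Rightarrow> complex"
  assumes "Im (omega X) > 0"
    and eta_generic: "\<And>n :: int. n \<noteq> 0 \<Longrightarrow> of_int n * eta X \<notin> period_lattice X"
    and "points_distinct X"
    and "\<And>\<sigma> i. i \<in> {1..3} \<Longrightarrow> theta X (bdry X \<sigma> i) \<noteq> 0"
    and "\<And>n. n \<in> {1..len X} \<Longrightarrow> A_coef X \<epsilon> (eta X / 2 - inh X n) \<noteq> 0"
    and "\<not> ((\<forall>z. \<exists>c. K_plus X z = c \<cdot>\<^sub>m 1\<^sub>m 2) \<and> (\<forall>z. \<exists>c. K_minus X z = c \<cdot>\<^sub>m 1\<^sub>m 2))"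
    and sov_covector: "S \<in> carrier_vec (2 ^ len X)" "is_covector_basis X \<epsilon> S"
    and sov_vector: "\<N>\<^sub>0 \<noteq> 0" "is_ref_vector X \<epsilon> S \<N>\<^sub>0 R"
    and signs: "\<And>\<sigma> i. i \<in> {1..3} \<Longrightarrow> \<epsilon> \<sigma> i \<in> {1, -1}" "(\<Prod>\<sigma>\<in>UNIV. \<Prod>i\<in>{1..3}. \<epsilon> \<sigma> i) = 1"
    and boundary_constraint:
      "(\<Sum>\<sigma>\<in>UNIV. \<Sum>i\<in>{1..3}. of_int (\<epsilon> \<sigma> i) * bdry X \<sigma> i)
         = of_int (int (len X) - 2 * int M - 1) * eta X"
    and "\<And>j. j \<in> {1..M} \<Longrightarrow> 2 * q j \<notin> period_lattice X"
    and "\<And>j k. j \<in> {1..M} \<Longrightarrow> k \<in> {1..M} \<Longrightarrow> j \<noteq> k \<Longrightarrow>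
           q j - q k \<notin> period_lattice X \<and> q j + q k \<notin> period_lattice X"
    and nontrivial_roots: "\<And>j. j \<in> {1..M} \<Longrightarrow> theta_s X (2 * q j) (eta X) \<noteq> 0"
    and bethe: "\<And>j. j \<in> {1..M} \<Longrightarrow>
           A_coef X \<epsilon> (q j) * Qf X M q (q j - eta X) + A_coef X \<epsilon> (- q j) * Qf X M q (q j + eta X) = 0"
  shows
    "(\<exists>\<tau>. \<tau> holomorphic_on UNIV \<and>
       (\<forall>z. theta X (2 * z) \<noteq> 0 \<longrightarrow>
          \<tau> z * Qf X M q z
            = A_coef X \<epsilon> z * Qf X M q (z - eta X) + A_coef X \<epsilon> (- z) * Qf X M q (z + eta X)) \<and>
       (\<forall>z. theta X (2 * z - eta X) \<noteq> 0 \<and> theta X (2 * z + eta X) \<noteq> 0 \<longrightarrow>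
          transfer X z *\<^sub>v sep_ket X \<epsilon> R (Qf X M q) = \<tau> z \<cdot>\<^sub>v sep_ket X \<epsilon> R (Qf X M q) \<and>
          transpose_mat (transfer X z) *\<^sub>v sep_bra X \<epsilon> S \<N>\<^sub>0 (Qf X M q)
            = \<tau> z \<cdot>\<^sub>v sep_bra X \<epsilon> S \<N>\<^sub>0 (Qf X M q)))
     \<and>
     (\<forall>z. \<forall>j\<in>{1..M}. theta X (2 * z) \<noteq> 0 \<and> Qf X M q z \<noteq> 0 \<longrightarrow>
        (\<lambda>x. tauQ X \<epsilon> M (q(j := x)) z) field_differentiable at (q j) \<and>
        (Qf X M q (z - eta X) \<noteq> 0 \<and> Qf X M q (z + eta X) \<noteq> 0 \<longrightarrow>
           S_entry X \<epsilon> M q z j = S_entry_explicit X \<epsilon> M q z j))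
     \<and>
     (\<forall>i\<in>{1..M}. \<forall>j\<in>{1..M}.
        ((\<lambda>z. S_entry X \<epsilon> M q z j) \<longlongrightarrow> SQQ_entry X \<epsilon> M q i j) (at (q i)) \<and>
        (A_coef X \<epsilon> (- q i) * Qf X M q (q i + eta X) \<noteq> 0 \<longrightarrow>
           SQQ_entry X \<epsilon> M q i j = SQQ_explicit X \<epsilon> M q i j))
     \<and>
     (\<forall>z. theta X (z - eta X) \<noteq> 0 \<and> theta X z \<noteq> 0 \<and> theta X (z + eta X) \<noteq> 0 \<longrightarrow>
        K_fun X z = t_fun X (z + eta X / 2) + t_fun X (z - eta X / 2))
     \<and>
     (sep_pairing X \<epsilon> S \<N>\<^sub>0 R (Qf X M q) (Qf X M q) \<noteq> 0 \<longrightarrow>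
        sep_ket X \<epsilon> R (Qf X M q) \<noteq> 0\<^sub>v (2 ^ len X) \<and>
        sep_bra X \<epsilon> S \<N>\<^sub>0 (Qf X M q) \<noteq> 0\<^sub>v (2 ^ len X) \<and>
        (\<forall>p. sep_pairing X \<epsilon> S \<N>\<^sub>0 R (Qf X M p) (Qf X M q)
                / sep_pairing X \<epsilon> S \<N>\<^sub>0 R (Qf X M q) (Qf X M q)
              = sep_pairing X \<epsilon> S \<N>\<^sub>0 R (Qf X M q) (Qf X M p)
                / sep_pairing X \<epsilon> S \<N>\<^sub>0 R (Qf X M q) (Qf X M q)) \<and>
        (Determinant.det (SQQ_mat X \<epsilon> M q) \<noteq> 0 \<longrightarrow>
          (\<forall>p\<in>regular_points X M q.
             sep_pairing X \<epsilon> S \<N>\<^sub>0 R (Qf X M p) (Qf X M q)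
               / sep_pairing X \<epsilon> S \<N>\<^sub>0 R (Qf X M q) (Qf X M q)
             = det_ratio X \<epsilon> M q p) \<and>
          (\<forall>p. (det_ratio X \<epsilon> M q \<longlongrightarrow>
                  sep_pairing X \<epsilon> S \<N>\<^sub>0 R (Qf X M p) (Qf X M q)
                    / sep_pairing X \<epsilon> S \<N>\<^sub>0 R (Qf X M q) (Qf X M q))
                (at p within regular_points X M q))))"
proof -
interpret bethe X \<epsilon> M S R \<N>\<^sub>0 q
 by unfold_locales fact+
have TQ: "tau z * Qf X M q z = A_coef X \<epsilon> z * Qf X M q (z - eta X) + A_coef X \<epsilon> (- z) * Qf X M q (z + eta X)"
 if "theta X (2 * z) ~= 0" for z
 using gop_value[OF Qf_even, of z q] that unfolding tau_Q th by simp
show ?thesis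
proof (intro conjI, goal_cases)
 case 1
 show ?case by (intro exI[of _ tau] conjI allI impI)
  (auto simp: TQ transfer_T tau_eigen even_thetaD(1)[OF tau_even])
next
 case 2
 show ?case unfolding th field_differentiable_def
  by (intro allI ballI impI conjI exI) (auto simp: S_entry_G S_entry_explicit_G intro: tauQ_derivative)
next
 case 3
 show ?case using S_entry_tendsto SQQ_explicit_G by (simp add: SQQ_entry_G)
next
 case 4
 show ?case by (intro allI impI K_fun_t_fun)
next
 case 5
 show ?case by (intro impI conjI allI ballI sep_nonzero det_ratio_pairing det_ratio_tendsto
    arg_cong2[of _ _ _ _ "(/)"] sep_pairing_commute refl)
qed
qed

end
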